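(* For each $n$ let $\theta=\theta^{(n)}\in\mathbb{R}^n$ have positive entries, and let $A$ be the adjacency matrix of a network generated under the null hypothesis: $A$ is symmetric with zero diagonal and its entries $A_{ij}$, $i<j$, are independent Bernoulli variables with $\mathbb{P}(A_{ij}=1)=\theta_i\theta_j$. Suppose that, as $n\to\infty$, $\|\theta\|\to\infty$, $\theta_{\max}\to0$, and $(\|\theta\|^2/\|\theta\|_1)\sqrt{\log(\|\theta\|_1)}\to0$. Let $T_n$ be the Signed Triangle (SgnT) statistic. Then, as $n\to\infty$, $$\mathbb{E}[T_n]=o(\|\theta\|^3),\qquad \mathrm{Var}(T_n)\sim6\|\theta\|^6,$$ and $$\frac{T_n-\mathbb{E}[T_n]}{\sqrt{\mathrm{Var}(T_n)}}\longrightarrow N(0,1)\quad\text{in law}.$$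
   Context: $\|\theta\|_q$ is the $\ell^q$-norm, $\|\theta\|=\|\theta\|_2$, $\theta_{\max}=\max_i\theta_i$. $a_n\sim b_n$ means $a_n/b_n\to1$. With $V={\bf 1}_n'A{\bf 1}_n$ and $\hat\eta=V^{-1/2}A{\bf 1}_n$ (with $\hat\eta=0$ if $V=0$), the SgnT statistic is $$T_n=\sum_{i_1,i_2,i_3(dist)}(A_{i_1i_2}-\hat\eta_{i_1}\hat\eta_{i_2})(A_{i_2i_3}-\hat\eta_{i_2}\hat\eta_{i_3})(A_{i_3i_1}-\hat\eta_{i_3}\hat\eta_{i_1}),$$ the sum being over all triples of pairwise distinct indices in $\{1,\ldots,n\}$. *)

theory Defs
  imports "HOL-Probability.Probability" "HOL-Library.Landau_Symbols"
begin

text \<open>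
  Nodes are indexed by \<open>0, \<dots>, n - 1\<close>. A random \<open>n \<times> n\<close> matrix on a sample space \<open>M\<close> is a
  function \<open>A\<close> of the outcome; only the entries \<open>A \<omega> i j\<close> with \<open>i, j < n\<close> are relevant.
\<close>

definition null_network ::
  "'a measure \<Rightarrow> nat \<Rightarrow> (nat \<Rightarrow> real) \<Rightarrow> ('a \<Rightarrow> nat \<Rightarrow> nat \<Rightarrow> real) \<Rightarrow> bool" where
  "null_network M n \<theta> A \<longleftrightarrow>
     prob_space M \<and>
     (\<forall>\<omega>\<in>space M. \<forall>i<n. A \<omega> i i = 0) \<and>
     (\<forall>\<omega>\<in>space M. \<forall>i<n. \<forall>j<n. A \<omega> i j = A \<omega> j i) \<and>
     (\<forall>\<omega>\<in>space M. \<forall>i<n. \<forall>j<n. A \<omega> i j \<in> {0, 1}) \<and>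
     (\<forall>j<n. \<forall>i<j. measure M {\<omega> \<in> space M. A \<omega> i j = 1} = \<theta> i * \<theta> j) \<and>
     prob_space.indep_vars M (\<lambda>_. borel) (\<lambda>(i, j) \<omega>. A \<omega> i j) {(i, j). i < j \<and> j < n}"

definition total_degree :: "nat \<Rightarrow> (nat \<Rightarrow> nat \<Rightarrow> real) \<Rightarrow> real" where
  "total_degree n A = (\<Sum>i<n. \<Sum>j<n. A i j)"

definition eta_hat :: "nat \<Rightarrow> (nat \<Rightarrow> nat \<Rightarrow> real) \<Rightarrow> nat \<Rightarrow> real" where
  "eta_hat n A i =
     (if total_degree n A = 0 then 0
      else total_degree n A powr (- 1 / 2) * (\<Sum>j<n. A i j))"

definition sgnT :: "nat \<Rightarrow> (nat \<Rightarrow> nat \<Rightarrow> real) \<Rightarrow> real" where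
  "sgnT n A =
     (\<Sum>(i, j, k) \<in> {(i, j, k). i < n \<and> j < n \<and> k < n \<and> i \<noteq> j \<and> j \<noteq> k \<and> k \<noteq> i}.
        (A i j - eta_hat n A i * eta_hat n A j) *
        (A j k - eta_hat n A j * eta_hat n A k) *
        (A k i - eta_hat n A k * eta_hat n A i))"

end

theory Submission
  imports Defs "HOL-Real_Asymp.Real_Asymp"
begin

text \<open>
  Write \<open>w i j = A i j - \<theta> i * \<theta> j\<close> for \<open>i \<noteq> j\<close> and \<open>w i i = 0\<close>, let \<open>s\<close> be the Euclidean norm of
  \<open>\<theta>\<close>, and let \<open>U\<close> be the sum of \<open>w i j * w j k * w k i\<close> over distinct \<open>i, j, k\<close>: the signed triangle
  statistic \<open>T\<close> with the estimated means replaced by the true ones. The three claims follow from two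
  estimates in which the number of nodes is fixed. There the network is a random set of edges, so
  that every expectation is a finite sum over sets of edges.

  The first estimate (\<open>nrm_T_minus_U\<close>) says that \<open>T - U\<close> is at most a constant times \<open>s\<^sup>2\<close> in
  \<open>L\<^sup>2\<close>. As \<open>U\<close> has mean zero and standard deviation about \<open>sqrt 6 * s ^ 3\<close>, the mean of \<open>T\<close> is then
  negligible, and \<open>T\<close> and \<open>U\<close> have the same variance and the same limit law to first order. With the
  total degree \<open>V\<close> and the degrees \<open>d\<close>, the entries of the residual matrix are \<open>w i j + D i j / V\<close> where
  \<open>D i j = V * \<theta> i * \<theta> j - d i * d j\<close>, so \<open>T - U\<close> is a combination of three cyclic sums in \<open>w\<close> and \<open>D\<close>.
  The range of the matrix \<open>D\<close> lies in the span of \<open>\<theta>\<close> and of the vector \<open>x\<close> of degree deviations.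
  The cyclic sums therefore reduce to a few scalars and to sums over copies of small graphs, to which the
  following two tools apply.

    \<^item> Products of the \<open>w i j\<close> over different sets of edges are orthogonal. Hence a sum over the copies
    of a fixed small graph has an \<open>L\<^sup>2\<close> norm that is a product over the vertices of that graph
    (\<open>nrm_graph_le\<close>).

    \<^item> Linear statistics have exponential tails (\<open>linear_tail\<close>). Let \<open>q ^ 16\<close> be the sum of \<open>\<theta>\<close>. Up to
    probability \<open>exp (- q)\<close> times a power of \<open>q\<close>, all degrees and the total degree stay within a factor
    \<open>q\<close> of their typical deviations (\<open>bad_prob\<close>). On that event all factors but one of each
    product are bounded deterministically, and orthogonality bounds the remaining one. The wasted powers of
    \<open>q\<close> do no harm, because the terms in which they occur have a factor of about \<open>q ^ 8\<close> to spare. Off the event a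
    polynomial bound on \<open>T - U\<close> suffices.

  The second estimate (\<open>char_U\<close>) compares the characteristic function of \<open>U\<close> with a Gaussian one. The
  polynomial \<open>U\<close> is affine in each edge: it is \<open>6 * w i j * h i j\<close> plus a term without that edge, where
  \<open>h i j\<close> is the weighted number of two-step paths from \<open>i\<close> to \<open>j\<close>. This gives the Stein identity
  \<open>E (U * exp (\<i> y U)) = \<i> y E (\<Gamma> * exp (\<i> y U))\<close> up to third moments of \<open>h\<close>, where \<open>\<Gamma>\<close> is the sum of
  \<open>6 * (w i j * h i j)\<^sup>2\<close>. Since no \<open>\<theta> i\<close> is large, \<open>\<Gamma>\<close> concentrates at \<open>6 * s ^ 6\<close> (\<open>nrm_\<Gamma>\<close>), and the
  characteristic function nearly solves the differential equation of the Gaussian one. The Levy continuity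
  theorem then yields the limit law.
\<close>

section \<open>Functions of independent Bernoulli variables\<close>

text \<open>
  A random subset of \<open>E\<close> contains each \<open>e\<close> independently with probability \<open>p e\<close>. Random
  variables are functions on \<open>Pow E\<close>, so that no measurability or integrability enters.
\<close>
locale bernoulli_product =
  fixes E :: "'e set" and p :: "'e \<Rightarrow> real"
  assumes finite_E [simp]: "finite E"
    and p_bounds: "\<And>e. e \<in> E \<Longrightarrow> 0 \<le> p e \<and> p e \<le> 1"
begin

definition weight :: "'e set \<Rightarrow> real" where
  "weight S = (\<Prod>e\<in>S. p e) * (\<Prod>e\<in>E - S. 1 - p e)"

definition expect :: "('e set \<Rightarrow> 'b::real_vector) \<Rightarrow> 'b" where
  "expect f = (\<Sum>S\<in>Pow E. weight S *\<^sub>R f S)"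

definition W :: "'e \<Rightarrow> 'e set \<Rightarrow> real" where
  "W e S = of_bool (e \<in> S) - p e"

text \<open>
  The \<open>L\<^sup>2\<close> norm of a random variable; \<^const>\<open>L2_set\<close> supplies the inequalities of Minkowski and
  Cauchy--Schwarz.
\<close>
definition nrm :: "('e set \<Rightarrow> real) \<Rightarrow> real" where
  "nrm f = L2_set (\<lambda>S. sqrt (weight S) * f S) (Pow E)"

lemma weight_nonneg: "S \<subseteq> E \<Longrightarrow> 0 \<le> weight S"
  unfolding weight_def using p_bounds by (intro mult_nonneg_nonneg prod_nonneg) auto

lemma sum_weight: "(\<Sum>S\<in>Pow E. weight S) = 1"
  using prod_add[OF finite_E, of p "\<lambda>e. 1 - p e"] by (simp add: weight_def)

lemma expect_cong: "(\<And>S. S \<subseteq> E \<Longrightarrow> f S = g S) \<Longrightarrow> expect f = expect g"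
  unfolding expect_def by (intro sum.cong) auto

lemma expect_const [simp]: "expect (\<lambda>S. c) = c"
  unfolding expect_def scaleR_sum_left[symmetric] sum_weight by simp

lemma expect_add: "expect (\<lambda>S. f S + g S) = expect f + expect g"
  by (simp add: expect_def scaleR_add_right sum.distrib)

lemma expect_diff: "expect (\<lambda>S. f S - g S) = expect f - expect g"
  by (simp add: expect_def scaleR_diff_right sum_subtractf)

lemma expect_scaleR: "expect (\<lambda>S. c *\<^sub>R f S) = c *\<^sub>R expect f"
  by (simp add: expect_def scaleR_sum_right mult.commute)

lemma expect_cmult: "expect (\<lambda>S. c * f S) = c * expect f" for c :: "'b::real_algebra"
  by (simp add: expect_def sum_distrib_left)

lemma expect_sum: "expect (\<lambda>S. \<Sum>i\<in>I. f i S) = (\<Sum>i\<in>I. expect (f i))"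
  unfolding expect_def scaleR_sum_right by (rule sum.swap)

lemma expect_mono: "(\<And>S. S \<subseteq> E \<Longrightarrow> f S \<le> g S) \<Longrightarrow> expect f \<le> expect g" for f g :: "_ \<Rightarrow> real"
  unfolding expect_def by (intro sum_mono) (auto intro!: mult_left_mono weight_nonneg)

lemma expect_nonneg: "(\<And>S. S \<subseteq> E \<Longrightarrow> 0 \<le> f S) \<Longrightarrow> 0 \<le> expect f" for f :: "_ \<Rightarrow> real"
  using expect_mono[of "\<lambda>_. 0" f] by simp

lemma norm_expect_le: "norm (expect f) \<le> expect (\<lambda>S. norm (f S))" for f :: "_ \<Rightarrow> 'b::real_normed_vector"
  unfolding expect_def
  by (rule sum_norm_le) (simp add: weight_nonneg)

text \<open>
  Conditioning on all coordinates except \<open>e\<close>. Everything about independence is derived from this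
  identity.
\<close>
lemma expect_resample:
  fixes f :: "'e set \<Rightarrow> 'b::real_vector"
  assumes e: "e \<in> E"
  shows "expect f = expect (\<lambda>S. p e *\<^sub>R f (insert e S) + (1 - p e) *\<^sub>R f (S - {e}))"
proof -
  let ?P = "Pow (E - {e})"
  have disj: "?P \<inter> insert e ` ?P = {}" by auto
  have Pow: "Pow E = ?P \<union> insert e ` ?P"
    using Pow_insert[of e "E - {e}"] by (simp only: insert_Diff[OF e])
  have inj: "inj_on (insert e) ?P" by (auto simp: inj_on_def)
  have weight_insert: "weight (insert e S) = p e * ((\<Prod>e\<in>S. p e) * (\<Prod>e\<in>E - {e} - S. 1 - p e))" if "S \<in> ?P" for S
  proof -
    have "finite S" "e \<notin> S" using that finite_subset[OF _ finite_E, of S] by auto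
    moreover have "E - insert e S = E - {e} - S" by auto
    ultimately show ?thesis by (simp add: weight_def)
  qed
  have weight_keep: "weight S = (1 - p e) * ((\<Prod>e\<in>S. p e) * (\<Prod>e\<in>E - {e} - S. 1 - p e))" if "S \<in> ?P" for S
  proof -
    have "E - S = insert e (E - {e} - S)" using that e by auto
    then have "(\<Prod>e\<in>E - S. 1 - p e) = (1 - p e) * (\<Prod>e\<in>E - {e} - S. 1 - p e)"
      by (simp add: prod.insert)
    then show ?thesis by (simp add: weight_def)
  qed
  have split: "expect g = (\<Sum>S\<in>?P. weight S *\<^sub>R g S + weight (insert e S) *\<^sub>R g (insert e S))" for g :: "'e set \<Rightarrow> 'b"
    unfolding expect_def Pow
    by (subst sum.union_disjoint[OF _ _ disj]) (simp_all add: sum.reindex[OF inj] sum.distrib)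
  show ?thesis
    unfolding split
  proof (rule sum.cong[OF refl], goal_cases)
    case (1 S)
    then have [simp]: "S - {e} = S" "insert e S - {e} = S" by auto
    show ?case
      unfolding weight_insert[OF 1] weight_keep[OF 1]
      by (simp add: scaleR_add_right algebra_simps flip: scaleR_add_left)
  qed
qed

lemma expect_factor:
  fixes h :: "'e set \<Rightarrow> 'b::real_vector"
  assumes "e \<in> E" "\<And>S. S \<subseteq> E \<Longrightarrow> h (insert e S) = h S" "\<And>S. S \<subseteq> E \<Longrightarrow> h (S - {e}) = h S"
  shows "expect (\<lambda>S. g (e \<in> S) *\<^sub>R h S) = (p e * g True + (1 - p e) * g False) *\<^sub>R expect h"
  by (subst expect_resample[OF assms(1)], subst expect_scaleR[symmetric], rule expect_cong)
     (simp add: assms algebra_simps)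

lemma expect_prod:
  assumes "F \<subseteq> E"
  shows "expect (\<lambda>S. \<Prod>e\<in>F. g e (e \<in> S)) = (\<Prod>e\<in>F. p e * g e True + (1 - p e) * g e False)"
proof -
  have "finite F" using assms finite_E finite_subset by blast
  then show ?thesis using assms
  proof (induction F)
    case empty
    then show ?case by simp
  next
    case (insert e F)
    have "expect (\<lambda>S. \<Prod>e\<in>insert e F. g e (e \<in> S)) = expect (\<lambda>S. g e (e \<in> S) *\<^sub>R (\<Prod>e\<in>F. g e (e \<in> S)))"
      using insert by simp
    also have "\<dots> = (p e * g e True + (1 - p e) * g e False) *\<^sub>R expect (\<lambda>S. \<Prod>e\<in>F. g e (e \<in> S))"
      using insert by (intro expect_factor prod.cong refl) (auto intro!: arg_cong[where f = "g _"])
    finally show ?case using insert by simp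
  qed
qed

lemma nrm_sq: "(nrm f)\<^sup>2 = expect (\<lambda>S. (f S)\<^sup>2)"
  unfolding nrm_def L2_set_def expect_def
  by (subst real_sqrt_pow2) (auto intro!: sum_nonneg sum.cong simp: weight_nonneg power_mult_distrib)

lemma nrm_nonneg [simp]: "0 \<le> nrm f"
  by (simp add: nrm_def)

lemma nrm_eq: "nrm f = sqrt (expect (\<lambda>S. (f S)\<^sup>2))"
  by (simp flip: nrm_sq)

lemma nrm_cong: "(\<And>S. S \<subseteq> E \<Longrightarrow> f S = g S) \<Longrightarrow> nrm f = nrm g"
  unfolding nrm_eq by (subst expect_cong[of "\<lambda>S. (f S)\<^sup>2" "\<lambda>S. (g S)\<^sup>2"]) auto

lemma nrm_mono: "(\<And>S. S \<subseteq> E \<Longrightarrow> \<bar>f S\<bar> \<le> \<bar>g S\<bar>) \<Longrightarrow> nrm f \<le> nrm g"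
  unfolding nrm_eq by (intro real_sqrt_le_mono expect_mono) (auto simp: abs_le_square_iff)

lemma nrm_add: "nrm (\<lambda>S. f S + g S) \<le> nrm f + nrm g"
  unfolding nrm_def by (simp add: distrib_left L2_set_triangle_ineq)

lemma nrm_scale: "nrm (\<lambda>S. c * f S) = \<bar>c\<bar> * nrm f"
  unfolding nrm_eq by (simp add: power_mult_distrib expect_cmult real_sqrt_mult)

lemma nrm_const [simp]: "nrm (\<lambda>S. c) = \<bar>c\<bar>"
  by (simp add: nrm_eq)

lemma nrm_diff: "nrm (\<lambda>S. f S - g S) \<le> nrm f + nrm g"
  using nrm_add[of f "\<lambda>S. -1 * g S"] nrm_scale[of "-1" g] by simp

lemma nrm_le_add:
  assumes "\<And>S. S \<subseteq> E \<Longrightarrow> \<bar>f S\<bar> \<le> \<bar>g S\<bar> + \<bar>h S\<bar>"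
  shows "nrm f \<le> nrm g + nrm h"
proof -
  have "nrm f \<le> nrm (\<lambda>S. \<bar>g S\<bar> + \<bar>h S\<bar>)"
    by (intro nrm_mono) (simp add: assms)
  also have "\<dots> \<le> nrm (\<lambda>S. \<bar>g S\<bar>) + nrm (\<lambda>S. \<bar>h S\<bar>)" by (rule nrm_add)
  also have "\<dots> = nrm g + nrm h" by (simp add: nrm_eq)
  finally show ?thesis .
qed

lemma expect_mult_le: "expect (\<lambda>S. \<bar>f S\<bar> * \<bar>g S\<bar>) \<le> nrm f * nrm g"
proof -
  have "expect (\<lambda>S. \<bar>f S\<bar> * \<bar>g S\<bar>) = (\<Sum>S\<in>Pow E. \<bar>sqrt (weight S) * f S\<bar> * \<bar>sqrt (weight S) * g S\<bar>)"
    unfolding expect_def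
  proof (intro sum.cong refl)
    fix S assume "S \<in> Pow E"
    then have "\<bar>sqrt (weight S) * f S\<bar> * \<bar>sqrt (weight S) * g S\<bar> = (sqrt (weight S) * sqrt (weight S)) * (\<bar>f S\<bar> * \<bar>g S\<bar>)"
      by (simp only: abs_mult) (simp add: weight_nonneg)
    then show "weight S *\<^sub>R (\<bar>f S\<bar> * \<bar>g S\<bar>) = \<bar>sqrt (weight S) * f S\<bar> * \<bar>sqrt (weight S) * g S\<bar>"
      using \<open>S \<in> Pow E\<close> by (simp add: weight_nonneg)
  qed
  then show ?thesis unfolding nrm_def by (simp add: L2_set_mult_ineq)
qed

lemma expect_abs_le_nrm: "expect (\<lambda>S. \<bar>f S\<bar>) \<le> nrm f"
  using expect_mult_le[of f "\<lambda>_. 1"] by simp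

lemma abs_expect_le_nrm: "\<bar>expect f\<bar> \<le> nrm f"
  using norm_expect_le[of f] expect_abs_le_nrm[of f] by simp

definition \<sigma> :: "'e \<Rightarrow> real" where "\<sigma> e = p e * (1 - p e)"

lemma \<sigma>_bounds: "e \<in> E \<Longrightarrow> 0 \<le> \<sigma> e \<and> \<sigma> e \<le> p e"
  using p_bounds[of e] by (simp add: \<sigma>_def mult_left_le)

lemma W_le_1: "e \<in> E \<Longrightarrow> \<bar>W e S\<bar> \<le> 1"
  using p_bounds[of e] by (auto simp: W_def)

lemma W_square: "(W e S)\<^sup>2 = \<sigma> e + (1 - 2 * p e) * W e S"
  by (cases "e \<in> S") (simp_all add: W_def \<sigma>_def power2_eq_square algebra_simps)

text \<open>
  An element of exactly one of \<open>F\<close> and \<open>G\<close> contributes the factor \<open>E (W e) = 0\<close>.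
\<close>
lemma expect_W_prod:
  assumes "F \<subseteq> E" "G \<subseteq> E"
  shows "expect (\<lambda>S. (\<Prod>e\<in>F. W e S) * (\<Prod>e\<in>G. W e S)) = (if F = G then \<Prod>e\<in>F. \<sigma> e else 0)"
proof -
  have fin: "finite F" "finite G" using assms finite_E finite_subset by blast+
  define g where "g e b = (if e \<in> F then of_bool b - p e else 1) * (if e \<in> G then of_bool b - p e else 1)" for e b
  have "(\<Prod>e\<in>F. W e S) * (\<Prod>e\<in>G. W e S) = (\<Prod>e\<in>F \<union> G. g e (e \<in> S))" for S
  proof -
    have "(\<Prod>e\<in>F. W e S) = (\<Prod>e\<in>F \<union> G. if e \<in> F then W e S else 1)"
      by (rule prod.mono_neutral_cong_left) (use fin in auto)
    moreover have "(\<Prod>e\<in>G. W e S) = (\<Prod>e\<in>F \<union> G. if e \<in> G then W e S else 1)"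
      by (rule prod.mono_neutral_cong_left) (use fin in auto)
    moreover have "(\<Prod>e\<in>F \<union> G. g e (e \<in> S)) =
        (\<Prod>e\<in>F \<union> G. if e \<in> F then W e S else 1) * (\<Prod>e\<in>F \<union> G. if e \<in> G then W e S else 1)"
      unfolding g_def W_def prod.distrib ..
    ultimately show ?thesis by simp
  qed
  then have "expect (\<lambda>S. (\<Prod>e\<in>F. W e S) * (\<Prod>e\<in>G. W e S)) = expect (\<lambda>S. \<Prod>e\<in>F \<union> G. g e (e \<in> S))"
    by simp
  also have "\<dots> = (\<Prod>e\<in>F \<union> G. p e * g e True + (1 - p e) * g e False)"
    by (rule expect_prod) (use assms in auto)
  also have "\<dots> = (if F = G then \<Prod>e\<in>F. \<sigma> e else 0)"
  proof (cases "F = G")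
    case True
    have "(\<Prod>e\<in>F \<union> G. p e * g e True + (1 - p e) * g e False) = (\<Prod>e\<in>F. \<sigma> e)"
      using True by (intro prod.cong) (simp_all add: g_def \<sigma>_def algebra_simps)
    then show ?thesis using True by simp
  next
    case False
    then obtain e where e: "e \<in> F \<union> G" "e \<in> F \<longleftrightarrow> e \<notin> G" by blast
    then have "p e * g e True + (1 - p e) * g e False = 0"
      by (cases "e \<in> F") (simp_all add: g_def algebra_simps)
    then have "(\<Prod>e\<in>F \<union> G. p e * g e True + (1 - p e) * g e False) = 0"
      using e(1) fin by (intro prod_zero) auto
    then show ?thesis using False by simp
  qed
  finally show ?thesis .
qed

text \<open>
  By orthogonality only pairs of indices with the same set of variables contribute to the
  square. The inequality \<open>2 * c * c' \<le> c\<^sup>2 + c'\<^sup>2\<close> charges such a pair to its two members, and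
  each index is in at most \<open>K\<close> pairs on either side.
\<close>
lemma nrm_multilinear_le:
  assumes fin: "finite I" and sub: "\<And>\<tau>. \<tau> \<in> I \<Longrightarrow> F \<tau> \<subseteq> E"
    and fibre: "\<And>\<tau>. \<tau> \<in> I \<Longrightarrow> real (card {\<tau>' \<in> I. F \<tau>' = F \<tau>}) \<le> K"
  shows "(nrm (\<lambda>S. \<Sum>\<tau>\<in>I. c \<tau> * (\<Prod>e\<in>F \<tau>. W e S)))\<^sup>2 \<le> K * (\<Sum>\<tau>\<in>I. (c \<tau>)\<^sup>2 * (\<Prod>e\<in>F \<tau>. p e))"
proof -
  define P where "P \<tau> = (\<Prod>e\<in>F \<tau>. \<sigma> e)" for \<tau>
  have P0: "0 \<le> P \<tau>" if "\<tau> \<in> I" for \<tau>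
    unfolding P_def using sub[OF that] \<sigma>_bounds by (intro prod_nonneg) auto
  have Pp: "P \<tau> \<le> (\<Prod>e\<in>F \<tau>. p e)" if "\<tau> \<in> I" for \<tau>
    unfolding P_def using sub[OF that] \<sigma>_bounds by (intro prod_mono) auto
  have "(nrm (\<lambda>S. \<Sum>\<tau>\<in>I. c \<tau> * (\<Prod>e\<in>F \<tau>. W e S)))\<^sup>2
      = (\<Sum>\<tau>\<in>I. \<Sum>\<tau>'\<in>I. c \<tau> * c \<tau>' * expect (\<lambda>S. (\<Prod>e\<in>F \<tau>. W e S) * (\<Prod>e\<in>F \<tau>'. W e S)))"
    unfolding nrm_sq
    by (simp add: power2_eq_square sum_product expect_sum mult_ac flip: expect_cmult)
  also have "\<dots> = (\<Sum>\<tau>\<in>I. \<Sum>\<tau>'\<in>I. of_bool (F \<tau>' = F \<tau>) * (c \<tau> * c \<tau>' * P \<tau>))"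
    by (intro sum.cong refl) (auto simp: expect_W_prod sub P_def)
  also have "\<dots> \<le> (\<Sum>\<tau>\<in>I. \<Sum>\<tau>'\<in>I. of_bool (F \<tau>' = F \<tau>) * ((c \<tau>)\<^sup>2 * P \<tau> / 2) + of_bool (F \<tau>' = F \<tau>) * ((c \<tau>')\<^sup>2 * P \<tau>' / 2))"
  proof (intro sum_mono, goal_cases)
    case (1 \<tau> \<tau>')
    have "c \<tau> * c \<tau>' \<le> ((c \<tau>)\<^sup>2 + (c \<tau>')\<^sup>2) / 2" using sum_squares_bound[of "c \<tau>" "c \<tau>'"] by simp
    from mult_right_mono[OF this P0[OF 1(1)]] show ?case
      by (auto simp: P_def algebra_simps add_divide_distrib)
  qed
  also have "\<dots> = (\<Sum>\<tau>\<in>I. \<Sum>\<tau>'\<in>I. of_bool (F \<tau>' = F \<tau>) * ((c \<tau>)\<^sup>2 * P \<tau> / 2))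
       + (\<Sum>\<tau>\<in>I. \<Sum>\<tau>'\<in>I. of_bool (F \<tau>' = F \<tau>) * ((c \<tau>')\<^sup>2 * P \<tau>' / 2))"
    by (simp add: sum.distrib)
  also have "(\<Sum>\<tau>\<in>I. \<Sum>\<tau>'\<in>I. of_bool (F \<tau>' = F \<tau>) * ((c \<tau>')\<^sup>2 * P \<tau>' / 2))
       = (\<Sum>\<tau>\<in>I. \<Sum>\<tau>'\<in>I. of_bool (F \<tau>' = F \<tau>) * ((c \<tau>)\<^sup>2 * P \<tau> / 2))"
    by (subst sum.swap) (simp add: eq_commute)
  also have "(\<Sum>\<tau>\<in>I. \<Sum>\<tau>'\<in>I. of_bool (F \<tau>' = F \<tau>) * ((c \<tau>)\<^sup>2 * P \<tau> / 2)) + \<dots>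
      = (\<Sum>\<tau>\<in>I. real (card {\<tau>' \<in> I. F \<tau>' = F \<tau>}) * ((c \<tau>)\<^sup>2 * P \<tau>))"
  proof -
    have "(\<Sum>\<tau>'\<in>I. of_bool (F \<tau>' = F \<tau>)) = real (card {\<tau>' \<in> I. F \<tau>' = F \<tau>})" for \<tau>
      using fin by (simp add: of_bool_def sum.If_cases Int_def)
    then show ?thesis
      by (simp only: sum.distrib[symmetric] sum_distrib_right[symmetric])
        (simp add: sum_distrib_right[symmetric] sum_distrib_left[symmetric] mult_ac)
  qed
  also have "\<dots> \<le> (\<Sum>\<tau>\<in>I. K * ((c \<tau>)\<^sup>2 * (\<Prod>e\<in>F \<tau>. p e)))"
  proof (intro sum_mono mult_mono fibre)
    fix \<tau> assume "\<tau> \<in> I"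
    then show "0 \<le> K" using fibre[of \<tau>] by (meson of_nat_0_le_iff order_trans)
  qed (auto intro!: mult_left_mono Pp P0 mult_nonneg_nonneg)
  also have "\<dots> = K * (\<Sum>\<tau>\<in>I. (c \<tau>)\<^sup>2 * (\<Prod>e\<in>F \<tau>. p e))"
    by (simp add: sum_distrib_left)
  finally show ?thesis .
qed

lemma exp_le_quadratic:
  fixes x :: real assumes "\<bar>x\<bar> \<le> 1" shows "exp x \<le> 1 + x + x\<^sup>2"
proof (cases "0 \<le> x")
  case True then show ?thesis using assms exp_bound[of x] by simp
next
  case False
  define y where "y = - x"
  have y: "0 \<le> y" "y \<le> 1" using False assms by (auto simp: y_def)
  have "1 \<le> (1 - y + y\<^sup>2) * (1 + y)"
    using y by (simp add: algebra_simps power2_eq_square)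
  also have "\<dots> \<le> (1 - y + y\<^sup>2) * exp y"
    using y by (intro mult_left_mono exp_ge_add_one_self) (auto simp: power2_eq_square)
  finally show ?thesis by (simp add: y_def exp_minus field_simps)
qed

text \<open>
  Independence factorises the moment generating function, and \<open>exp x \<le> 1 + x + x\<^sup>2\<close> is applied
  to every factor.
\<close>
lemma expect_exp_linear_le:
  assumes c: "\<And>e. e \<in> E \<Longrightarrow> \<bar>c e\<bar> \<le> 1"
  shows "expect (\<lambda>S. exp (\<Sum>e\<in>E. c e * W e S)) \<le> exp (\<Sum>e\<in>E. (c e)\<^sup>2 * p e)"
proof -
  define g where "g e b = exp (c e * (of_bool b - p e))" for e b
  have "expect (\<lambda>S. exp (\<Sum>e\<in>E. c e * W e S)) = expect (\<lambda>S. \<Prod>e\<in>E. g e (e \<in> S))"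
    by (simp add: exp_sum g_def W_def)
  also have "\<dots> = (\<Prod>e\<in>E. p e * g e True + (1 - p e) * g e False)"
    by (rule expect_prod) simp
  also have "\<dots> \<le> (\<Prod>e\<in>E. exp ((c e)\<^sup>2 * p e))"
  proof (intro prod_mono conjI)
    fix e assume e: "e \<in> E"
    note p = p_bounds[OF e]
    then show "0 \<le> p e * g e True + (1 - p e) * g e False" by (simp add: g_def)
    have small: "\<bar>c e * (of_bool b - p e)\<bar> \<le> 1" for b
      using c[OF e] p by (cases b) (auto simp: abs_mult intro!: mult_le_one)
    have g_le: "g e b \<le> 1 + c e * (of_bool b - p e) + (c e * (of_bool b - p e))\<^sup>2" for b
      unfolding g_def by (rule exp_le_quadratic[OF small])
    have "p e * g e True + (1 - p e) * g e False
      \<le> p e * (1 + c e * (1 - p e) + (c e * (1 - p e))\<^sup>2) + (1 - p e) * (1 + c e * (0 - p e) + (c e * (0 - p e))\<^sup>2)"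
      using p g_le[of True] g_le[of False] by (intro add_mono mult_left_mono) simp_all
    also have "\<dots> = 1 + (c e)\<^sup>2 * (p e * (1 - p e))"
      by (simp add: power2_eq_square algebra_simps)
    also have "\<dots> \<le> 1 + (c e)\<^sup>2 * p e"
      using p by (intro add_left_mono mult_left_mono) (auto simp: mult_left_le)
    also have "\<dots> \<le> exp ((c e)\<^sup>2 * p e)" by (rule exp_ge_add_one_self)
    finally show "p e * g e True + (1 - p e) * g e False \<le> exp ((c e)\<^sup>2 * p e)" .
  qed
  also have "\<dots> = exp (\<Sum>e\<in>E. (c e)\<^sup>2 * p e)" by (simp add: exp_sum)
  finally show ?thesis .
qed

text \<open>
  The exponential Chebyshev inequality with \<open>2 * (cosh - 1)\<close> in place of \<open>exp\<close>. This function is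
  of second order at zero, which keeps the factor \<open>v / B\<^sup>2\<close>: for the degree of a node with small
  \<open>\<theta> i\<close> it makes the tail proportional to \<open>\<theta> i\<close>, and a union bound over all nodes stays
  summable.
\<close>
lemma linear_tail:
  assumes B: "0 < B" and c: "\<And>e. e \<in> E \<Longrightarrow> \<bar>c e\<bar> \<le> B"
    and v: "(\<Sum>e\<in>E. (c e)\<^sup>2 * p e) \<le> v" "v \<le> B\<^sup>2" and q: "1 \<le> q"
  shows "expect (\<lambda>S. of_bool (q * B < \<bar>\<Sum>e\<in>E. c e * W e S\<bar>)) \<le> 4 * (v / B\<^sup>2) / (exp q - 2)"
proof -
  define X where "X S = (\<Sum>e\<in>E. c e * W e S)" for S
  define z where "z = v / B\<^sup>2"
  have z: "z \<le> 1" using v B by (simp add: z_def)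
  have z0: "0 \<le> z"
    unfolding z_def by (intro divide_nonneg_nonneg order_trans[OF _ v(1)] sum_nonneg) (auto simp: p_bounds)
  have eq: "2 < exp q"
  proof -
    have "2 < exp (1::real)" using exp_lower_Taylor_quadratic[of 1] by simp
    also have "\<dots> \<le> exp q" using q by simp
    finally show ?thesis .
  qed
  have mgf: "expect (\<lambda>S. exp (a * (X S / B))) \<le> exp z" if "\<bar>a\<bar> = 1" for a
  proof -
    have "expect (\<lambda>S. exp (a * (X S / B))) = expect (\<lambda>S. exp (\<Sum>e\<in>E. (a * c e / B) * W e S))"
      by (simp add: X_def sum_divide_distrib sum_distrib_left mult.assoc)
    also have "\<dots> \<le> exp (\<Sum>e\<in>E. (a * c e / B)\<^sup>2 * p e)"
      by (rule expect_exp_linear_le) (use c B that in \<open>auto simp: abs_mult\<close>)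
    also have "(\<Sum>e\<in>E. (a * c e / B)\<^sup>2 * p e) = (\<Sum>e\<in>E. (c e)\<^sup>2 * p e) / B\<^sup>2"
      using that by (auto simp: sum_divide_distrib power_mult_distrib power_divide power2_eq_1_iff abs_if split: if_splits)
    also have "exp \<dots> \<le> exp z" using v B by (simp add: z_def divide_right_mono)
    finally show ?thesis .
  qed
  have "expect (\<lambda>S. of_bool (q * B < \<bar>X S\<bar>)) * (exp q - 2)
      = expect (\<lambda>S. of_bool (q * B < \<bar>X S\<bar>) * (exp q - 2))"
    by (simp only: expect_cmult mult.commute[of _ "exp q - 2"])
  also have "\<dots> \<le> expect (\<lambda>S. exp (1 * (X S / B)) + exp ((-1) * (X S / B)) - 2)"
  proof (rule expect_mono)
    fix S
    have pos: "0 \<le> exp y + exp (- y) - 2" for y :: real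
      using cosh_real_ge_1[of y] by (simp add: cosh_def)
    show "of_bool (q * B < \<bar>X S\<bar>) * (exp q - 2) \<le> exp (1 * (X S / B)) + exp ((-1) * (X S / B)) - 2"
    proof (cases "q * B < \<bar>X S\<bar>")
      case True
      then have "q \<le> \<bar>X S / B\<bar>" using B by (simp add: field_simps)
      then have "exp q \<le> exp \<bar>X S / B\<bar>" by simp
      also have "\<dots> \<le> exp (X S / B) + exp (- (X S / B))" by (auto simp: abs_if)
      finally show ?thesis using True by simp
    next
      case False
      then show ?thesis using pos[of "X S / B"] by simp
    qed
  qed
  also have "\<dots> \<le> 2 * (exp z - 1)"
    using mgf[of 1] mgf[of "-1"] by (simp add: expect_add expect_diff)
  also have "\<dots> \<le> 4 * z"
  proof -
    have "exp z \<le> 1 + z + z\<^sup>2" using z z0 by (intro exp_bound) auto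
    also have "z\<^sup>2 \<le> z" using z z0 by (simp add: power2_eq_square mult_left_le)
    finally show ?thesis by simp
  qed
  finally show ?thesis using eq unfolding X_def z_def by (subst pos_le_divide_eq) auto
qed

end

section \<open>Sums over the copies of a small graph\<close>

text \<open>
  Sums over distinct nodes are written with indicator factors. These two rules would turn the
  indicators into restricted index sets and destroy the common shape of the sums.
\<close>
declare sum_of_bool_mult_eq [simp del] sum_mult_of_bool_eq [simp del]

locale null_model =
  fixes n :: nat and \<theta> :: "nat \<Rightarrow> real"
  assumes \<theta>_pos: "\<And>i. i < n \<Longrightarrow> 0 < \<theta> i" and \<theta>_le_1: "\<And>i. i < n \<Longrightarrow> \<theta> i \<le> 1"
begin

definition edges :: "(nat \<times> nat) set" where
  "edges = {(i, j). i < j \<and> j < n}"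

lemma finite_edges: "finite edges"
  by (rule finite_subset[of _ "{..<n} \<times> {..<n}"]) (auto simp: edges_def)

sublocale bernoulli_product edges "\<lambda>(i, j). \<theta> i * \<theta> j"
proof
  show "finite edges" by (rule finite_edges)
  fix e assume "e \<in> edges"
  then obtain i j where "e = (i, j)" "i < n" "j < n" by (auto simp: edges_def)
  then show "0 \<le> (case e of (i, j) \<Rightarrow> \<theta> i * \<theta> j) \<and> (case e of (i, j) \<Rightarrow> \<theta> i * \<theta> j) \<le> 1"
    using \<theta>_pos[of i] \<theta>_pos[of j] \<theta>_le_1[of i] \<theta>_le_1[of j] by (simp add: mult_le_one)
qed

definition edge :: "nat \<Rightarrow> nat \<Rightarrow> nat \<times> nat" where
  "edge i j = (min i j, max i j)"

definition w :: "nat \<Rightarrow> nat \<Rightarrow> (nat \<times> nat) set \<Rightarrow> real" where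
  "w i j S = (if i = j then 0 else W (edge i j) S)"

definition power_sum :: "nat \<Rightarrow> real" where
  "power_sum r = (\<Sum>i<n. \<theta> i ^ r)"

definition tuples :: "nat \<Rightarrow> nat list set" where
  "tuples q = {xs. set xs \<subseteq> {..<n} \<and> length xs = q}"

definition pattern_degree :: "(nat \<times> nat) list \<Rightarrow> nat \<Rightarrow> nat" where
  "pattern_degree es k = length (filter (\<lambda>(a, b). a = k \<or> b = k) es)"

lemma edge_eq_iff: "edge i j = edge k l \<longleftrightarrow> {i, j} = {k, l}"
  by (auto simp: edge_def doubleton_eq_iff min_def max_def split: if_splits)

lemma edge_in: "i < n \<Longrightarrow> j < n \<Longrightarrow> i \<noteq> j \<Longrightarrow> edge i j \<in> edges"
  by (auto simp: edge_def edges_def)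

lemma w_sym: "w i j = w j i"
  by (auto simp: w_def edge_def min.commute max.commute fun_eq_iff)

lemma w_diag [simp]: "w i i S = 0"
  by (simp add: w_def)

lemma p_edge: "(case edge i j of (i, j) \<Rightarrow> \<theta> i * \<theta> j) = \<theta> i * \<theta> j"
  by (simp add: edge_def min_def max_def mult.commute)

lemma power_sum_nonneg [simp]: "0 \<le> power_sum r"
  unfolding power_sum_def using \<theta>_pos by (intro sum_nonneg) (simp add: less_imp_le)

lemma finite_tuples [simp]: "finite (tuples q)"
  unfolding tuples_def by (rule finite_lists_length_eq) simp

lemma tuples_0 [simp]: "tuples 0 = {[]}"
  by (auto simp: tuples_def)

lemma sum_tuples_Suc: "(\<Sum>xs\<in>tuples (Suc q). f xs) = (\<Sum>i<n. \<Sum>xs\<in>tuples q. f (i # xs))"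
proof -
  have "tuples (Suc q) = (\<lambda>(i, xs). i # xs) ` ({..<n} \<times> tuples q)"
    by (auto simp: tuples_def length_Suc_conv image_iff)
  moreover have "inj_on (\<lambda>(i, xs). i # xs) ({..<n} \<times> tuples q)" by (auto simp: inj_on_def)
  ultimately show ?thesis
    by (simp add: sum.reindex sum.cartesian_product case_prod_unfold)
qed

lemma sum_tuples_prod:
  "(\<Sum>xs\<in>tuples q. \<Prod>k<q. f k (xs ! k)) = (\<Prod>k<q. \<Sum>i<n. f k i)" for f :: "nat \<Rightarrow> nat \<Rightarrow> real"
proof (induction q arbitrary: f)
  case 0
  then show ?case by simp
next
  case (Suc q)
  have "(\<Sum>xs\<in>tuples (Suc q). \<Prod>k<Suc q. f k (xs ! k)) =
      (\<Sum>i<n. f 0 i * (\<Sum>xs\<in>tuples q. \<Prod>k<q. f (Suc k) (xs ! k)))"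
    unfolding sum_tuples_Suc by (simp add: prod.lessThan_Suc_shift sum_distrib_left del: prod.lessThan_Suc)
  also have "\<dots> = (\<Sum>i<n. f 0 i) * (\<Prod>k<q. \<Sum>i<n. f (Suc k) i)"
    using Suc.IH[of "\<lambda>k. f (Suc k)"] by (simp add: sum_distrib_right)
  finally show ?case by (simp only: prod.lessThan_Suc_shift o_def)
qed

lemma prod_edges_weight:
  fixes x :: "nat \<Rightarrow> real"
  assumes "\<And>a b. (a, b) \<in> set es \<Longrightarrow> a < b \<and> b < q"
  shows "(\<Prod>(a, b)\<leftarrow>es. x a * x b) = (\<Prod>k<q. x k ^ pattern_degree es k)"
  using assms
proof (induction es)
  case Nil
  then show ?case by (simp add: pattern_degree_def)
next
  case (Cons e es)
  obtain a b where e: "e = (a, b)" by force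
  have ab: "a < b" "b < q" using Cons.prems[of a b] e by auto
  have "(\<Prod>k<q. x k ^ pattern_degree (e # es) k) = (\<Prod>k<q. (if k = a then x a else 1) * (if k = b then x b else 1) * x k ^ pattern_degree es k)"
    using ab by (intro prod.cong refl) (auto simp: pattern_degree_def e)
  also have "\<dots> = x a * x b * (\<Prod>k<q. x k ^ pattern_degree es k)"
    using ab by (simp add: prod.distrib)
  moreover have "(\<Prod>(a, b)\<leftarrow>es. x a * x b) = (\<Prod>k<q. x k ^ pattern_degree es k)"
    using Cons.prems by (intro Cons.IH) auto
  ultimately show ?case by (simp add: e)
qed

text \<open>
  The list \<open>es\<close> is a graph on the vertices \<open>0, \<dots>, q - 1\<close> without isolated vertices, and \<open>xs\<close>
  places its vertices at distinct nodes. The set of edges of a placed copy determines its set of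
  nodes, hence the placement up to \<open>q ^ q\<close> choices, and \<open>nrm_multilinear_le\<close> applies. In the
  resulting sum of squares the coefficient contributes \<open>\<theta> ^ (2 * r k)\<close> and the edge
  probabilities contribute \<open>\<theta> ^ pattern_degree es k\<close> at the vertex \<open>k\<close>, so that the sum
  factorises over the vertices.
\<close>
lemma nrm_graph_le:
  assumes es: "\<And>a b. (a, b) \<in> set es \<Longrightarrow> a < b \<and> b < q" "distinct es"
    and cover: "\<And>k. k < q \<Longrightarrow> \<exists>a b. (a, b) \<in> set es \<and> (k = a \<or> k = b)"
    and c: "\<And>xs. xs \<in> tuples q \<Longrightarrow> distinct xs \<Longrightarrow> \<bar>c xs\<bar> \<le> K * (\<Prod>k<q. \<theta> (xs ! k) ^ r k)"
    and K: "0 \<le> K"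
  shows "nrm (\<lambda>S. \<Sum>xs\<in>tuples q. of_bool (distinct xs) * (c xs * (\<Prod>(a, b)\<leftarrow>es. w (xs ! a) (xs ! b) S)))
    \<le> sqrt (real q ^ q) * (K * (\<Prod>k<q. sqrt (power_sum (2 * r k + pattern_degree es k))))"
proof -
  define I where "I = {xs \<in> tuples q. distinct xs}"
  define F where "F xs = (\<lambda>(a, b). edge (xs ! a) (xs ! b)) ` set es" for xs
  have fin: "finite I" by (simp add: I_def)
  have len: "length xs = q" "set xs \<subseteq> {..<n}" "distinct xs" if "xs \<in> I" for xs
    using that by (auto simp: I_def tuples_def)
  have nth: "xs ! k < n" if "xs \<in> I" "k < q" for xs k
    using len[OF that(1)] that(2) nth_mem by blast
  have inj: "inj_on (\<lambda>(a, b). edge (xs ! a) (xs ! b)) (set es)" if xs: "xs \<in> I" for xs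
  proof (rule inj_onI, clarify)
    fix a b c d
    assume ab: "(a, b) \<in> set es" "(c, d) \<in> set es" "edge (xs ! a) (xs ! b) = edge (xs ! c) (xs ! d)"
    have "a < b" "b < q" "c < d" "d < q" using es(1)[OF ab(1)] es(1)[OF ab(2)] by auto
    moreover have "{xs ! a, xs ! b} = {xs ! c, xs ! d}" using ab(3) by (simp add: edge_eq_iff)
    ultimately show "a = c \<and> b = d"
      using len[OF xs] nth_eq_iff_index_eq[of xs] by (auto simp: doubleton_eq_iff)
  qed
  have distinct_nth: "xs ! a \<noteq> xs ! b" if "xs \<in> I" "(a, b) \<in> set es" for xs a b
    using es(1)[OF that(2)] len[OF that(1)] by (simp add: nth_eq_iff_index_eq)
  have sub: "F xs \<subseteq> edges" if "xs \<in> I" for xs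
  proof -
    have "edge (xs ! a) (xs ! b) \<in> edges" if "(a, b) \<in> set es" for a b
      using es(1)[OF that] distinct_nth[OF \<open>xs \<in> I\<close> that] nth[OF \<open>xs \<in> I\<close>] by (intro edge_in) auto
    then have "e \<in> edges" if "e \<in> F xs" for e
      using that by (auto simp: F_def)
    then show ?thesis by (rule subsetI)
  qed
  (* every vertex lies on an edge, so the nodes can be read off from the edges *)
  have vertices: "set xs = (\<Union>e\<in>F xs. {fst e, snd e})" if xs: "xs \<in> I" for xs
  proof -
    have edge_ends: "{fst (edge a b), snd (edge a b)} = {a, b}" for a b :: nat
      by (auto simp: edge_def min_def max_def)
    have "(\<Union>e\<in>F xs. {fst e, snd e}) = (\<Union>(a, b)\<in>set es. {xs ! a, xs ! b})"
      unfolding F_def by (simp add: case_prod_unfold edge_ends)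
    also have "\<dots> = set xs"
    proof (intro equalityI subsetI)
      fix i assume "i \<in> (\<Union>(a, b)\<in>set es. {xs ! a, xs ! b})"
      then obtain a b where ab: "(a, b) \<in> set es" "i = xs ! a \<or> i = xs ! b" by auto
      then show "i \<in> set xs" using es(1)[OF ab(1)] len(1)[OF xs] by auto
    next
      fix i assume "i \<in> set xs"
      then obtain k where k: "k < q" "i = xs ! k" using len(1)[OF xs] by (auto simp: in_set_conv_nth)
      obtain a b where "(a, b) \<in> set es" "k = a \<or> k = b" using cover[OF k(1)] by blast
      then show "i \<in> (\<Union>(a, b)\<in>set es. {xs ! a, xs ! b})" using k(2) by force
    qed
    finally show ?thesis ..
  qed
  (* placements with the same edges have the same node set, so they are among the tuples over
     that set *)
  have fibre: "real (card {ys \<in> I. F ys = F xs}) \<le> real q ^ q" if xs: "xs \<in> I" for xs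
  proof -
    have "set ys = set xs" if "ys \<in> I" "F ys = F xs" for ys
      using vertices[OF xs] vertices[OF that(1)] that(2) by simp
    then have "{ys \<in> I. F ys = F xs} \<subseteq> {ys. set ys \<subseteq> set xs \<and> length ys = q}"
      using len(1) by blast
    then have "card {ys \<in> I. F ys = F xs} \<le> card {ys. set ys \<subseteq> set xs \<and> length ys = q}"
      by (intro card_mono finite_lists_length_eq) auto
    also have "\<dots> = q ^ q"
      using len[OF xs] by (simp add: card_lists_length_eq distinct_card)
    finally show ?thesis by (metis of_nat_le_iff of_nat_power)
  qed
  have prodW: "(\<Prod>(a, b)\<leftarrow>es. w (xs ! a) (xs ! b) S) = (\<Prod>e\<in>F xs. W e S)" if xs: "xs \<in> I" for xs S
    unfolding F_def prod.reindex[OF inj[OF xs]] prod.distinct_set_conv_list[OF es(2), symmetric]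
    by (intro prod.cong refl) (auto simp: w_def distinct_nth[OF xs])
  have prodp: "(\<Prod>e\<in>F xs. case e of (i, j) \<Rightarrow> \<theta> i * \<theta> j) = (\<Prod>k<q. \<theta> (xs ! k) ^ pattern_degree es k)" if xs: "xs \<in> I" for xs
  proof -
    have "(\<Prod>e\<in>F xs. case e of (i, j) \<Rightarrow> \<theta> i * \<theta> j) = (\<Prod>(a, b)\<leftarrow>es. \<theta> (xs ! a) * \<theta> (xs ! b))"
      unfolding F_def prod.reindex[OF inj[OF xs]] prod.distinct_set_conv_list[OF es(2), symmetric]
      by (intro prod.cong refl) (auto simp: p_edge)
    also have "\<dots> = (\<Prod>k<q. \<theta> (xs ! k) ^ pattern_degree es k)"
      using es(1) by (rule prod_edges_weight)
    finally show ?thesis .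
  qed
  have sums: "(\<Sum>xs\<in>tuples q. of_bool (distinct xs) * (c xs * (\<Prod>(a, b)\<leftarrow>es. w (xs ! a) (xs ! b) S)))
      = (\<Sum>xs\<in>I. c xs * (\<Prod>e\<in>F xs. W e S))" for S
  proof -
    have "(\<Sum>xs\<in>tuples q. of_bool (distinct xs) * (c xs * (\<Prod>(a, b)\<leftarrow>es. w (xs ! a) (xs ! b) S)))
       = (\<Sum>xs\<in>I. of_bool (distinct xs) * (c xs * (\<Prod>(a, b)\<leftarrow>es. w (xs ! a) (xs ! b) S)))"
      unfolding I_def by (rule sum.mono_neutral_right) auto
    also have "\<dots> = (\<Sum>xs\<in>I. c xs * (\<Prod>e\<in>F xs. W e S))"
      by (intro sum.cong refl) (simp add: prodW, simp add: I_def)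
    finally show ?thesis .
  qed
  have "(nrm (\<lambda>S. \<Sum>xs\<in>I. c xs * (\<Prod>e\<in>F xs. W e S)))\<^sup>2
      \<le> real q ^ q * (\<Sum>xs\<in>I. (c xs)\<^sup>2 * (\<Prod>e\<in>F xs. case e of (i, j) \<Rightarrow> \<theta> i * \<theta> j))"
    by (rule nrm_multilinear_le[OF fin sub fibre])
  also have "\<dots> \<le> real q ^ q * (\<Sum>xs\<in>tuples q. K\<^sup>2 * (\<Prod>k<q. \<theta> (xs ! k) ^ (2 * r k + pattern_degree es k)))"
  proof (intro mult_left_mono order_trans[OF sum_mono sum_mono2])
    fix xs assume xs: "xs \<in> I"
    have th: "0 \<le> \<theta> (xs ! k) ^ r'" if "k < q" for k r' using nth[OF xs that] \<theta>_pos by (simp add: less_imp_le)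
    have "\<bar>c xs\<bar>\<^sup>2 \<le> (K * (\<Prod>k<q. \<theta> (xs ! k) ^ r k))\<^sup>2"
      using xs by (intro power_mono c) (auto simp: I_def)
    then have "(c xs)\<^sup>2 \<le> K\<^sup>2 * (\<Prod>k<q. \<theta> (xs ! k) ^ (2 * r k))"
      by (simp add: power_mult_distrib prod_power_distrib power_mult[symmetric] mult.commute)
    then have "(c xs)\<^sup>2 * (\<Prod>k<q. \<theta> (xs ! k) ^ pattern_degree es k)
        \<le> K\<^sup>2 * (\<Prod>k<q. \<theta> (xs ! k) ^ (2 * r k)) * (\<Prod>k<q. \<theta> (xs ! k) ^ pattern_degree es k)"
      by (rule mult_right_mono) (auto intro!: prod_nonneg th)
    then show "(c xs)\<^sup>2 * (\<Prod>e\<in>F xs. case e of (i, j) \<Rightarrow> \<theta> i * \<theta> j)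
        \<le> K\<^sup>2 * (\<Prod>k<q. \<theta> (xs ! k) ^ (2 * r k + pattern_degree es k))"
      by (simp add: prodp[OF xs] power_add prod.distrib mult.assoc)
  next
    fix xs assume "xs \<in> tuples q - I"
    then have "xs ! k < n" if "k < q" for k
      using that unfolding tuples_def by (metis (mono_tags, lifting) DiffD1 lessThan_iff mem_Collect_eq nth_mem subsetD)
    then show "0 \<le> K\<^sup>2 * (\<Prod>k<q. \<theta> (xs ! k) ^ (2 * r k + pattern_degree es k))"
      by (auto intro!: mult_nonneg_nonneg prod_nonneg simp: less_imp_le[OF \<theta>_pos])
  qed (auto simp: I_def)
  also have "\<dots> = real q ^ q * K\<^sup>2 * (\<Prod>k<q. power_sum (2 * r k + pattern_degree es k))"
    using sum_tuples_prod[of "\<lambda>k i. \<theta> i ^ (2 * r k + pattern_degree es k)" q] by (simp add: power_sum_def flip: sum_distrib_left)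
  finally have "nrm (\<lambda>S. \<Sum>xs\<in>I. c xs * (\<Prod>e\<in>F xs. W e S)) \<le> sqrt (real q ^ q * K\<^sup>2 * (\<Prod>k<q. power_sum (2 * r k + pattern_degree es k)))"
    by (rule real_le_rsqrt)
  also have "\<dots> = sqrt (real q ^ q) * (K * (\<Prod>k<q. sqrt (power_sum (2 * r k + pattern_degree es k))))"
  proof -
    have "sqrt (\<Prod>k<q. power_sum (2 * r k + pattern_degree es k)) = (\<Prod>k<q. sqrt (power_sum (2 * r k + pattern_degree es k)))"
      by (induction q) (simp_all add: real_sqrt_mult)
    then show ?thesis using K by (simp add: real_sqrt_mult)
  qed
  finally show ?thesis unfolding sums .
qed

text \<open>
  The factor that a vertex contributes to the bound \<open>nrm_graph_le\<close>.
\<close>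
definition rp :: "nat \<Rightarrow> real" where "rp r = sqrt (power_sum r)"

lemma rp_nonneg [simp]: "0 \<le> rp r"
  by (simp add: rp_def)

lemma sqrt_power_self_le: "sqrt (real 2 ^ 2) = 2" "sqrt (real 3 ^ 3) \<le> 6" "sqrt (real 4 ^ 4) = 16" "sqrt (real 5 ^ 5) \<le> 56"
  by (auto intro: real_le_lsqrt real_sqrt_unique simp: real_le_lsqrt)

text \<open>
  The general bound is unfolded into nested sums for two to five vertices, with \<open>sqrt (q ^ q)\<close>
  rounded up.
\<close>
lemma nrm_graph2:
  assumes "\<And>i j. i < n \<Longrightarrow> j < n \<Longrightarrow> i \<noteq> j \<Longrightarrow> \<bar>c i j\<bar> \<le> K * (\<theta> i ^ a * \<theta> j ^ b)" "0 \<le> K"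
  shows "nrm (\<lambda>S. \<Sum>i<n. \<Sum>j<n. c i j * w i j S) \<le> 2 * (K * (rp (2 * a + 1) * rp (2 * b + 1)))"
proof -
  have "nrm (\<lambda>S. \<Sum>xs\<in>tuples 2. of_bool (distinct xs) * (c (xs ! 0) (xs ! 1) * (\<Prod>(a, b)\<leftarrow>[(0, 1)]. w (xs ! a) (xs ! b) S)))
    \<le> sqrt (real 2 ^ 2) * (K * (\<Prod>k<2. sqrt (power_sum (2 * ([a, b] ! k) + pattern_degree [(0, 1)] k))))"
    by (rule nrm_graph_le) (use assms in \<open>auto simp: tuples_def numeral_2_eq_2 length_Suc_conv less_Suc_eq mult.assoc\<close>)
  moreover have "(\<Sum>xs\<in>tuples 2. of_bool (distinct xs) * (c (xs ! 0) (xs ! 1) * (\<Prod>(a, b)\<leftarrow>[(0, 1)]. w (xs ! a) (xs ! b) S)))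
      = (\<Sum>i<n. \<Sum>j<n. c i j * w i j S)" for S
    by (auto simp: numeral_2_eq_2 sum_tuples_Suc intro!: sum.cong)
  ultimately show ?thesis by (simp add: numeral_2_eq_2 pattern_degree_def rp_def)
qed

lemma nrm_graph3:
  assumes es: "\<forall>(a, b)\<in>set es. a < b \<and> b < 3" "distinct es" "\<forall>k<3. 0 < pattern_degree es k"
    and c: "\<And>i j k. i < n \<Longrightarrow> j < n \<Longrightarrow> k < n \<Longrightarrow> distinct [i, j, k] \<Longrightarrow> \<bar>c i j k\<bar> \<le> K * (\<theta> i ^ r0 * \<theta> j ^ r1 * \<theta> k ^ r2)"
    and K: "0 \<le> K"
  shows "nrm (\<lambda>S. \<Sum>i<n. \<Sum>j<n. \<Sum>k<n. of_bool (distinct [i, j, k]) * (c i j k * (\<Prod>(a, b)\<leftarrow>es. w ([i, j, k] ! a) ([i, j, k] ! b) S)))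
    \<le> 6 * (K * (rp (2 * r0 + pattern_degree es 0) * rp (2 * r1 + pattern_degree es 1) * rp (2 * r2 + pattern_degree es 2)))"
proof -
  have "nrm (\<lambda>S. \<Sum>xs\<in>tuples 3. of_bool (distinct xs) * (c (xs ! 0) (xs ! 1) (xs ! 2) * (\<Prod>(a, b)\<leftarrow>es. w (xs ! a) (xs ! b) S)))
    \<le> sqrt (real 3 ^ 3) * (K * (\<Prod>k<3. sqrt (power_sum (2 * ([r0, r1, r2] ! k) + pattern_degree es k))))"
  proof (rule nrm_graph_le)
    show "\<exists>a b. (a, b) \<in> set es \<and> (k = a \<or> k = b)" if "k < 3" for k
      using es(3) that by (fastforce simp: pattern_degree_def filter_empty_conv)
    fix xs assume "xs \<in> tuples 3" "distinct xs"
    then obtain i j k where "xs = [i, j, k]" "i < n" "j < n" "k < n"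
      by (auto simp: tuples_def numeral_3_eq_3 length_Suc_conv)
    then show "\<bar>c (xs ! 0) (xs ! 1) (xs ! 2)\<bar> \<le> K * (\<Prod>k<3. \<theta> (xs ! k) ^ ([r0, r1, r2] ! k))"
      using c[of i j k] \<open>distinct xs\<close> by (simp add: numeral_3_eq_3 numeral_2_eq_2 mult.assoc)
  qed (use es K in auto)
  also have "\<dots> \<le> 6 * (K * (\<Prod>k<3. sqrt (power_sum (2 * ([r0, r1, r2] ! k) + pattern_degree es k))))"
    using K by (intro mult_right_mono sqrt_power_self_le) (auto intro!: mult_nonneg_nonneg prod_nonneg)
  finally show ?thesis
    by (simp add: numeral_3_eq_3 numeral_2_eq_2 sum_tuples_Suc rp_def mult.assoc)
qed

lemma nrm_graph4:
  assumes es: "\<forall>(a, b)\<in>set es. a < b \<and> b < 4" "distinct es" "\<forall>k<4. 0 < pattern_degree es k"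
    and c: "\<And>i j k l. i < n \<Longrightarrow> j < n \<Longrightarrow> k < n \<Longrightarrow> l < n \<Longrightarrow> distinct [i, j, k, l] \<Longrightarrow>
       \<bar>c i j k l\<bar> \<le> K * (\<theta> i ^ r0 * \<theta> j ^ r1 * \<theta> k ^ r2 * \<theta> l ^ r3)"
    and K: "0 \<le> K"
  shows "nrm (\<lambda>S. \<Sum>i<n. \<Sum>j<n. \<Sum>k<n. \<Sum>l<n. of_bool (distinct [i, j, k, l]) * (c i j k l * (\<Prod>(a, b)\<leftarrow>es. w ([i, j, k, l] ! a) ([i, j, k, l] ! b) S)))
    \<le> 16 * (K * (rp (2 * r0 + pattern_degree es 0) * rp (2 * r1 + pattern_degree es 1) * rp (2 * r2 + pattern_degree es 2) * rp (2 * r3 + pattern_degree es 3)))"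
proof -
  have "nrm (\<lambda>S. \<Sum>xs\<in>tuples 4. of_bool (distinct xs) * (c (xs ! 0) (xs ! 1) (xs ! 2) (xs ! 3) * (\<Prod>(a, b)\<leftarrow>es. w (xs ! a) (xs ! b) S)))
    \<le> sqrt (real 4 ^ 4) * (K * (\<Prod>k<4. sqrt (power_sum (2 * ([r0, r1, r2, r3] ! k) + pattern_degree es k))))"
  proof (rule nrm_graph_le)
    show "\<exists>a b. (a, b) \<in> set es \<and> (k = a \<or> k = b)" if "k < 4" for k
      using es(3) that by (fastforce simp: pattern_degree_def filter_empty_conv)
    fix xs assume "xs \<in> tuples 4" "distinct xs"
    then obtain i j k l where "xs = [i, j, k, l]" "i < n" "j < n" "k < n" "l < n"
      by (auto simp: tuples_def eval_nat_numeral length_Suc_conv)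
    then show "\<bar>c (xs ! 0) (xs ! 1) (xs ! 2) (xs ! 3)\<bar> \<le> K * (\<Prod>k<4. \<theta> (xs ! k) ^ ([r0, r1, r2, r3] ! k))"
      using c[of i j k l] \<open>distinct xs\<close> by (simp add: eval_nat_numeral mult.assoc)
  qed (use es K in auto)
  then show ?thesis
    unfolding sqrt_power_self_le
    by (simp add: eval_nat_numeral sum_tuples_Suc rp_def mult.assoc)
qed

lemma nrm_graph5:
  assumes es: "\<forall>(a, b)\<in>set es. a < b \<and> b < 5" "distinct es" "\<forall>k<5. 0 < pattern_degree es k"
    and c: "\<And>i j k l m. i < n \<Longrightarrow> j < n \<Longrightarrow> k < n \<Longrightarrow> l < n \<Longrightarrow> m < n \<Longrightarrow> distinct [i, j, k, l, m] \<Longrightarrow>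
       \<bar>c i j k l m\<bar> \<le> K"
    and K: "0 \<le> K"
  shows "nrm (\<lambda>S. \<Sum>i<n. \<Sum>j<n. \<Sum>k<n. \<Sum>l<n. \<Sum>m<n. of_bool (distinct [i, j, k, l, m]) * (c i j k l m * (\<Prod>(a, b)\<leftarrow>es. w ([i, j, k, l, m] ! a) ([i, j, k, l, m] ! b) S)))
    \<le> 56 * (K * (rp (pattern_degree es 0) * rp (pattern_degree es 1) * rp (pattern_degree es 2) * rp (pattern_degree es 3) * rp (pattern_degree es 4)))"
proof -
  have "nrm (\<lambda>S. \<Sum>xs\<in>tuples 5. of_bool (distinct xs) * (c (xs ! 0) (xs ! 1) (xs ! 2) (xs ! 3) (xs ! 4) * (\<Prod>(a, b)\<leftarrow>es. w (xs ! a) (xs ! b) S)))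
    \<le> sqrt (real 5 ^ 5) * (K * (\<Prod>k<5. sqrt (power_sum (2 * 0 + pattern_degree es k))))"
  proof (rule nrm_graph_le)
    show "\<exists>a b. (a, b) \<in> set es \<and> (k = a \<or> k = b)" if "k < 5" for k
      using es(3) that by (fastforce simp: pattern_degree_def filter_empty_conv)
    fix xs assume "xs \<in> tuples 5" "distinct xs"
    then obtain i j k l m where "xs = [i, j, k, l, m]" "i < n" "j < n" "k < n" "l < n" "m < n"
      by (auto simp: tuples_def eval_nat_numeral length_Suc_conv)
    then show "\<bar>c (xs ! 0) (xs ! 1) (xs ! 2) (xs ! 3) (xs ! 4)\<bar> \<le> K * (\<Prod>k<5. \<theta> (xs ! k) ^ 0)"
      using c[of i j k l m] \<open>distinct xs\<close> by (simp add: eval_nat_numeral mult.assoc)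
  qed (use es K in auto)
  also have "\<dots> \<le> 56 * (K * (\<Prod>k<5. sqrt (power_sum (2 * 0 + pattern_degree es k))))"
    using K by (intro mult_right_mono sqrt_power_self_le) (auto intro!: mult_nonneg_nonneg prod_nonneg)
  finally show ?thesis
    by (simp add: eval_nat_numeral sum_tuples_Suc rp_def mult.assoc)
qed

end

section \<open>Sums over distinct nodes\<close>

context null_model
begin

definition sum2 :: "(nat \<Rightarrow> nat \<Rightarrow> real) \<Rightarrow> real" where
  "sum2 f = (\<Sum>i<n. \<Sum>j<n. of_bool (distinct [i, j]) * f i j)"
definition sum3 :: "(nat \<Rightarrow> nat \<Rightarrow> nat \<Rightarrow> real) \<Rightarrow> real" where
  "sum3 f = (\<Sum>i<n. \<Sum>j<n. \<Sum>k<n. of_bool (distinct [i, j, k]) * f i j k)"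
definition sum4 :: "(nat \<Rightarrow> nat \<Rightarrow> nat \<Rightarrow> nat \<Rightarrow> real) \<Rightarrow> real" where
  "sum4 f = (\<Sum>i<n. \<Sum>j<n. \<Sum>k<n. \<Sum>l<n. of_bool (distinct [i, j, k, l]) * f i j k l)"
definition sum5 :: "(nat \<Rightarrow> nat \<Rightarrow> nat \<Rightarrow> nat \<Rightarrow> nat \<Rightarrow> real) \<Rightarrow> real" where
  "sum5 f = (\<Sum>i<n. \<Sum>j<n. \<Sum>k<n. \<Sum>l<n. \<Sum>m<n. of_bool (distinct [i, j, k, l, m]) * f i j k l m)"

lemma sum3_sum2: "sum3 f = sum2 (\<lambda>i j. \<Sum>k<n. of_bool (distinct [i, j, k]) * f i j k)"
  unfolding sum3_def sum2_def sum_distrib_left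
  by (intro sum.cong refl) auto

lemma sum4_sum3: "sum4 f = sum3 (\<lambda>i j k. \<Sum>l<n. of_bool (distinct [i, j, k, l]) * f i j k l)"
  unfolding sum3_def sum4_def sum_distrib_left
  by (intro sum.cong refl) auto

lemma sum5_sum3: "sum5 f = sum3 (\<lambda>i j k. \<Sum>l<n. \<Sum>m<n. of_bool (distinct [i, j, k, l, m]) * f i j k l m)"
  unfolding sum3_def sum5_def sum_distrib_left
  by (intro sum.cong refl) auto

lemma sum4_sum2: "sum4 f = sum2 (\<lambda>i j. \<Sum>k<n. \<Sum>l<n. of_bool (distinct [i, j, k, l]) * f i j k l)"
  unfolding sum2_def sum4_def sum_distrib_left
  by (intro sum.cong refl) auto

lemma sum2_cong: "(\<And>i j. i < n \<Longrightarrow> j < n \<Longrightarrow> i \<noteq> j \<Longrightarrow> f i j = g i j) \<Longrightarrow> sum2 f = sum2 g"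
  unfolding sum2_def by (intro sum.cong refl) auto
lemma sum3_cong: "(\<And>i j k. i < n \<Longrightarrow> j < n \<Longrightarrow> k < n \<Longrightarrow> distinct [i, j, k] \<Longrightarrow> f i j k = g i j k) \<Longrightarrow> sum3 f = sum3 g"
  unfolding sum3_def by (intro sum.cong refl) auto

lemma sum2_add: "sum2 (\<lambda>i j. f i j + g i j) = sum2 f + sum2 g"
  by (simp add: sum2_def distrib_left sum.distrib)
lemma sum2_diff: "sum2 (\<lambda>i j. f i j - g i j) = sum2 f - sum2 g"
  by (simp add: sum2_def right_diff_distrib sum_subtractf)
lemma sum3_add: "sum3 (\<lambda>i j k. f i j k + g i j k) = sum3 f + sum3 g"
  by (simp add: sum3_def distrib_left sum.distrib)
lemma sum3_diff: "sum3 (\<lambda>i j k. f i j k - g i j k) = sum3 f - sum3 g"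
  by (simp add: sum3_def right_diff_distrib sum_subtractf)

lemma sum2_swap: "sum2 f = sum2 (\<lambda>i j. f j i)"
  unfolding sum2_def by (subst sum.swap) (simp add: eq_commute)

lemma sum3_rev: "sum3 f = sum3 (\<lambda>i j k. f k j i)"
proof -
  have "sum3 f = (\<Sum>j<n. \<Sum>i<n. \<Sum>k<n. of_bool (distinct [i, j, k]) * f i j k)"
    unfolding sum3_def by (rule sum.swap)
  also have "\<dots> = (\<Sum>j<n. \<Sum>k<n. \<Sum>i<n. of_bool (distinct [i, j, k]) * f i j k)"
    by (intro sum.cong refl sum.swap)
  also have "\<dots> = (\<Sum>k<n. \<Sum>j<n. \<Sum>i<n. of_bool (distinct [i, j, k]) * f i j k)"
    by (rule sum.swap)
  also have "\<dots> = sum3 (\<lambda>i j k. f k j i)"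
    unfolding sum3_def by (intro sum.cong refl) auto
  finally show ?thesis .
qed

text \<open>
  A node that is absent from the factor \<open>g\<close> can be summed out; the result is a sum over a
  smaller graph with a summed coefficient.
\<close>
lemma sum3_collapse_first:
  "sum3 (\<lambda>i j k. f i j k * g j k) = sum2 (\<lambda>j k. (\<Sum>i<n. of_bool (distinct [i, j, k]) * f i j k) * g j k)"
proof -
  have "sum3 (\<lambda>i j k. f i j k * g j k) = (\<Sum>j<n. \<Sum>i<n. \<Sum>k<n. of_bool (distinct [i, j, k]) * (f i j k * g j k))"
    unfolding sum3_def by (rule sum.swap)
  also have "\<dots> = (\<Sum>j<n. \<Sum>k<n. \<Sum>i<n. of_bool (distinct [i, j, k]) * (f i j k * g j k))"
    by (intro sum.cong refl sum.swap)
  also have "\<dots> = sum2 (\<lambda>j k. (\<Sum>i<n. of_bool (distinct [i, j, k]) * f i j k) * g j k)"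
    unfolding sum2_def sum_distrib_left sum_distrib_right by (intro sum.cong refl) auto
  finally show ?thesis .
qed

lemma sum3_collapse_mid:
  "sum3 (\<lambda>i j k. f i j k * g i k) = sum2 (\<lambda>i k. (\<Sum>j<n. of_bool (distinct [i, j, k]) * f i j k) * g i k)"
proof -
  have "sum3 (\<lambda>i j k. f i j k * g i k) = (\<Sum>i<n. \<Sum>k<n. \<Sum>j<n. of_bool (distinct [i, j, k]) * (f i j k * g i k))"
    unfolding sum3_def by (intro sum.cong refl sum.swap)
  also have "\<dots> = sum2 (\<lambda>i k. (\<Sum>j<n. of_bool (distinct [i, j, k]) * f i j k) * g i k)"
    unfolding sum2_def sum_distrib_left sum_distrib_right by (intro sum.cong refl) auto
  finally show ?thesis .
qed

lemma sum4_collapse_first: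
  "sum4 (\<lambda>i j k l. f i j k l * g j k l) = sum3 (\<lambda>j k l. (\<Sum>i<n. of_bool (distinct [i, j, k, l]) * f i j k l) * g j k l)"
proof -
  have "sum4 (\<lambda>i j k l. f i j k l * g j k l) = (\<Sum>j<n. \<Sum>i<n. \<Sum>k<n. \<Sum>l<n. of_bool (distinct [i, j, k, l]) * (f i j k l * g j k l))"
    unfolding sum4_def by (rule sum.swap)
  also have "\<dots> = (\<Sum>j<n. \<Sum>k<n. \<Sum>i<n. \<Sum>l<n. of_bool (distinct [i, j, k, l]) * (f i j k l * g j k l))"
    by (intro sum.cong refl sum.swap)
  also have "\<dots> = (\<Sum>j<n. \<Sum>k<n. \<Sum>l<n. \<Sum>i<n. of_bool (distinct [i, j, k, l]) * (f i j k l * g j k l))"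
    by (intro sum.cong refl sum.swap)
  also have "\<dots> = sum3 (\<lambda>j k l. (\<Sum>i<n. of_bool (distinct [i, j, k, l]) * f i j k l) * g j k l)"
    unfolding sum3_def sum_distrib_left sum_distrib_right by (intro sum.cong refl) auto
  finally show ?thesis .
qed

lemma sum_sum_factor: "(\<Sum>i<n. \<Sum>j<n. k * (f i * g j)) = k * ((\<Sum>i<n. f i) * (\<Sum>j<n. g j))" for k and f g :: "nat \<Rightarrow> real"
  unfolding sum_product by (simp only: sum_distrib_left)

text \<open>
  In a product of two sums over a fresh node the two nodes either coincide or are distinct.
\<close>
lemma sum_pair_split3:
  "(\<Sum>l<n. of_bool (distinct [i, j, k, l]) * f l) * (\<Sum>m<n. of_bool (distinct [i, j, k, m]) * g m)
   = (\<Sum>l<n. of_bool (distinct [i, j, k, l]) * (f l * g l))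
   + (\<Sum>l<n. \<Sum>m<n. of_bool (distinct [i, j, k, l, m]) * (f l * g m :: real))"
proof -
  have "(\<Sum>m<n. of_bool (distinct [i, j, k, l]) * f l * (of_bool (distinct [i, j, k, m]) * g m)) =
    (\<Sum>m<n. (if m = l then of_bool (distinct [i, j, k, l]) * (f l * g l) else 0)
        + of_bool (distinct [i, j, k, l, m]) * (f l * g m))" if "l < n" for l
    by (intro sum.cong refl) auto
  then show ?thesis by (simp add: sum_product sum.distrib)
qed

lemma sum_pair_split2:
  "(\<Sum>l<n. of_bool (distinct [i, j, l]) * f l) * (\<Sum>m<n. of_bool (distinct [i, j, m]) * g m)
   = (\<Sum>l<n. of_bool (distinct [i, j, l]) * (f l * g l))
   + (\<Sum>l<n. \<Sum>m<n. of_bool (distinct [i, j, l, m]) * (f l * g m :: real))"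
proof -
  have "(\<Sum>m<n. of_bool (distinct [i, j, l]) * f l * (of_bool (distinct [i, j, m]) * g m)) =
    (\<Sum>m<n. (if m = l then of_bool (distinct [i, j, l]) * (f l * g l) else 0)
        + of_bool (distinct [i, j, l, m]) * (f l * g m))" if "l < n" for l
    by (intro sum.cong refl) auto
  then show ?thesis by (simp add: sum_product sum.distrib)
qed

text \<open>
  By \<open>w_square\<close>, the variance of an edge and the linear coefficient in
  \<open>(w i j)\<^sup>2 = sg i j + kp i j * w i j\<close>. This relation reduces every polynomial in the edges to
  a multilinear one.
\<close>
definition sg :: "nat \<Rightarrow> nat \<Rightarrow> real" where "sg i j = \<theta> i * \<theta> j * (1 - \<theta> i * \<theta> j)"
definition kp :: "nat \<Rightarrow> nat \<Rightarrow> real" where "kp i j = 1 - 2 * (\<theta> i * \<theta> j)"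

lemma \<theta>_nonneg: "i < n \<Longrightarrow> 0 \<le> \<theta> i"
  using \<theta>_pos by (simp add: less_imp_le)

lemma p_le_1: "i < n \<Longrightarrow> j < n \<Longrightarrow> \<theta> i * \<theta> j \<le> 1"
  using \<theta>_pos \<theta>_le_1 by (simp add: less_imp_le mult_le_one)

lemma sg_bounds: "i < n \<Longrightarrow> j < n \<Longrightarrow> 0 \<le> sg i j \<and> sg i j \<le> \<theta> i * \<theta> j"
  using p_le_1[of i j] \<theta>_nonneg[of i] \<theta>_nonneg[of j] by (simp add: sg_def mult_left_le)

lemma kp_le: "i < n \<Longrightarrow> j < n \<Longrightarrow> \<bar>kp i j\<bar> \<le> 1"
  using p_le_1[of i j] \<theta>_nonneg[of i] \<theta>_nonneg[of j] mult_nonneg_nonneg[of "\<theta> i" "\<theta> j"]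
  by (simp add: kp_def abs_le_iff)

lemma w_square: "i \<noteq> j \<Longrightarrow> (w i j S)\<^sup>2 = sg i j + kp i j * w i j S"
  unfolding w_def using W_square[of "edge i j" S] p_edge[of i j]
  by (simp add: \<sigma>_def sg_def kp_def)

lemma w_le_1: "i < n \<Longrightarrow> j < n \<Longrightarrow> \<bar>w i j S\<bar> \<le> 1"
  using W_le_1[OF edge_in, of i j S] by (simp add: w_def)

lemma nrm_add_le: "nrm f \<le> a \<Longrightarrow> nrm g \<le> b \<Longrightarrow> nrm (\<lambda>S. f S + g S) \<le> a + b"
  using nrm_add[of f g] by linarith
lemma nrm_diff_le: "nrm f \<le> a \<Longrightarrow> nrm g \<le> b \<Longrightarrow> nrm (\<lambda>S. f S - g S) \<le> a + b"
  using nrm_diff[of f g] by linarith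
lemma nrm_scale_le: "nrm f \<le> a \<Longrightarrow> nrm (\<lambda>S. c * f S) \<le> \<bar>c\<bar> * a"
  using nrm_scale[of c f] by (simp add: mult_left_mono)

text \<open>
  The norms of the sums over copies of small graphs that occur below. The letters of a term are
  its vertices in order; the suffixes \<open>first\<close> and \<open>last\<close> say where the additional edge of a path
  or the pendant edge of a triangle (a paw) is attached.
\<close>
lemma edge2:
  assumes "\<And>i j. i < n \<Longrightarrow> j < n \<Longrightarrow> i \<noteq> j \<Longrightarrow> \<bar>c i j\<bar> \<le> K * (\<theta> i ^ a * \<theta> j ^ b)" "0 \<le> K"
  shows "nrm (\<lambda>S. sum2 (\<lambda>i j. c i j * w i j S)) \<le> 2 * (K * (rp (2 * a + 1) * rp (2 * b + 1)))"
proof -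
  have "sum2 (\<lambda>i j. c i j * w i j S) = (\<Sum>i<n. \<Sum>j<n. c i j * w i j S)" for S
    unfolding sum2_def by (intro sum.cong refl) auto
  then show ?thesis using nrm_graph2[OF assms] by simp
qed

context
  fixes c :: "nat \<Rightarrow> nat \<Rightarrow> nat \<Rightarrow> real" and K r0 r1 r2
  assumes c: "\<And>i j k. i < n \<Longrightarrow> j < n \<Longrightarrow> k < n \<Longrightarrow> distinct [i, j, k] \<Longrightarrow> \<bar>c i j k\<bar> \<le> K * (\<theta> i ^ r0 * \<theta> j ^ r1 * \<theta> k ^ r2)"
    and K: "0 \<le> K"
begin

lemma path3: "nrm (\<lambda>S. sum3 (\<lambda>i j k. c i j k * (w i j S * w j k S)))
    \<le> 6 * (K * (rp (2 * r0 + 1) * rp (2 * r1 + 2) * rp (2 * r2 + 1)))"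
  using nrm_graph3[OF _ _ _ c K, of "[(0, 1), (1, 2)]"]
  by (simp add: sum3_def pattern_degree_def less_Suc_eq numeral_3_eq_3 numeral_2_eq_2)

lemma path3_first: "nrm (\<lambda>S. sum3 (\<lambda>i j k. c i j k * (w i j S * w i k S)))
    \<le> 6 * (K * (rp (2 * r0 + 2) * rp (2 * r1 + 1) * rp (2 * r2 + 1)))"
  using nrm_graph3[OF _ _ _ c K, of "[(0, 1), (0, 2)]"]
  by (simp add: sum3_def pattern_degree_def less_Suc_eq numeral_3_eq_3 numeral_2_eq_2)

lemma path3_last: "nrm (\<lambda>S. sum3 (\<lambda>i j k. c i j k * (w j k S * w i k S)))
    \<le> 6 * (K * (rp (2 * r0 + 1) * rp (2 * r1 + 1) * rp (2 * r2 + 2)))"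
  using nrm_graph3[OF _ _ _ c K, of "[(1, 2), (0, 2)]"]
  by (simp add: sum3_def pattern_degree_def less_Suc_eq numeral_3_eq_3 numeral_2_eq_2)

lemma triangle: "nrm (\<lambda>S. sum3 (\<lambda>i j k. c i j k * (w i j S * (w j k S * w i k S))))
    \<le> 6 * (K * (rp (2 * r0 + 2) * rp (2 * r1 + 2) * rp (2 * r2 + 2)))"
  using nrm_graph3[OF _ _ _ c K, of "[(0, 1), (1, 2), (0, 2)]"]
  by (simp add: sum3_def pattern_degree_def less_Suc_eq numeral_3_eq_3 numeral_2_eq_2)

end

context
  fixes c :: "nat \<Rightarrow> nat \<Rightarrow> nat \<Rightarrow> nat \<Rightarrow> real" and K r0 r1 r2 r3
  assumes c: "\<And>i j k l. i < n \<Longrightarrow> j < n \<Longrightarrow> k < n \<Longrightarrow> l < n \<Longrightarrow> distinct [i, j, k, l] \<Longrightarrow>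
      \<bar>c i j k l\<bar> \<le> K * (\<theta> i ^ r0 * \<theta> j ^ r1 * \<theta> k ^ r2 * \<theta> l ^ r3)"
    and K: "0 \<le> K"
begin

lemma path4_first: "nrm (\<lambda>S. sum4 (\<lambda>i j k l. c i j k l * (w i j S * (w j k S * w i l S))))
    \<le> 16 * (K * (rp (2 * r0 + 2) * rp (2 * r1 + 2) * rp (2 * r2 + 1) * rp (2 * r3 + 1)))"
  using nrm_graph4[OF _ _ _ c K, of "[(0, 1), (1, 2), (0, 3)]"]
  by (simp add: sum4_def pattern_degree_def less_Suc_eq numeral_3_eq_3 numeral_2_eq_2 eval_nat_numeral)

lemma path4_both: "nrm (\<lambda>S. sum4 (\<lambda>i j k l. c i j k l * (w i j S * (w i k S * w j l S))))
    \<le> 16 * (K * (rp (2 * r0 + 2) * rp (2 * r1 + 2) * rp (2 * r2 + 1) * rp (2 * r3 + 1)))"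
  using nrm_graph4[OF _ _ _ c K, of "[(0, 1), (0, 2), (1, 3)]"]
  by (simp add: sum4_def pattern_degree_def less_Suc_eq numeral_3_eq_3 numeral_2_eq_2 eval_nat_numeral)

lemma path4_last: "nrm (\<lambda>S. sum4 (\<lambda>i j k l. c i j k l * (w i j S * (w j k S * w k l S))))
    \<le> 16 * (K * (rp (2 * r0 + 1) * rp (2 * r1 + 2) * rp (2 * r2 + 2) * rp (2 * r3 + 1)))"
  using nrm_graph4[OF _ _ _ c K, of "[(0, 1), (1, 2), (2, 3)]"]
  by (simp add: sum4_def pattern_degree_def less_Suc_eq numeral_3_eq_3 numeral_2_eq_2 eval_nat_numeral)

lemma paw_first: "nrm (\<lambda>S. sum4 (\<lambda>i j k l. c i j k l * (w i j S * (w j k S * (w i k S * w i l S)))))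
    \<le> 16 * (K * (rp (2 * r0 + 3) * rp (2 * r1 + 2) * rp (2 * r2 + 2) * rp (2 * r3 + 1)))"
  using nrm_graph4[OF _ _ _ c K, of "[(0, 1), (1, 2), (0, 2), (0, 3)]"]
  by (simp add: sum4_def pattern_degree_def less_Suc_eq numeral_3_eq_3 numeral_2_eq_2 eval_nat_numeral)

lemma paw_last: "nrm (\<lambda>S. sum4 (\<lambda>i j k l. c i j k l * (w i j S * (w j k S * (w i k S * w k l S)))))
    \<le> 16 * (K * (rp (2 * r0 + 2) * rp (2 * r1 + 2) * rp (2 * r2 + 3) * rp (2 * r3 + 1)))"
  using nrm_graph4[OF _ _ _ c K, of "[(0, 1), (1, 2), (0, 2), (2, 3)]"]
  by (simp add: sum4_def pattern_degree_def less_Suc_eq numeral_3_eq_3 numeral_2_eq_2 eval_nat_numeral)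

lemma cycle4: "nrm (\<lambda>S. sum4 (\<lambda>i j k l. c i j k l * (w i j S * (w j k S * (w i l S * w k l S)))))
    \<le> 16 * (K * (rp (2 * r0 + 2) * rp (2 * r1 + 2) * rp (2 * r2 + 2) * rp (2 * r3 + 2)))"
  using nrm_graph4[OF _ _ _ c K, of "[(0, 1), (1, 2), (0, 3), (2, 3)]"]
  by (simp add: sum4_def pattern_degree_def less_Suc_eq numeral_3_eq_3 numeral_2_eq_2 eval_nat_numeral)

end

lemma path5: "nrm (\<lambda>S. sum5 (\<lambda>i j k l m. w i j S * (w j k S * (w i l S * w k m S))))
    \<le> 56 * (rp 2 * rp 2 * rp 2 * rp 1 * rp 1)"
  using nrm_graph5[of "[(0, 1), (1, 2), (0, 3), (2, 4)]" "\<lambda>_ _ _ _ _. 1" 1]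
  by (simp add: sum5_def pattern_degree_def less_Suc_eq numeral_3_eq_3 numeral_2_eq_2 eval_nat_numeral)

definition row_sum :: "nat \<Rightarrow> (nat \<times> nat) set \<Rightarrow> real" where "row_sum i S = (\<Sum>j<n. w i j S)"

text \<open>
  The neighbours of \<open>i\<close> that already occur in the surrounding term are separated, so that the
  remaining sum runs over a fresh node.
\<close>
lemma row_sum_split2:
  assumes "j < n" "i \<noteq> j"
  shows "row_sum i S = w i j S + (\<Sum>l<n. of_bool (distinct [i, j, l]) * w i l S)"
proof -
  have "row_sum i S = (\<Sum>l<n. (if l = j then w i j S else 0) + of_bool (distinct [i, j, l]) * w i l S)"
    unfolding row_sum_def using assms by (intro sum.cong refl) (auto simp: w_def)
  then show ?thesis using assms by (simp add: sum.distrib)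
qed

lemma row_sum_split3:
  assumes "j < n" "k < n" "distinct [i, j, k]"
  shows "row_sum i S = w i j S + w i k S + (\<Sum>l<n. of_bool (distinct [i, j, k, l]) * w i l S)"
proof -
  have "row_sum i S = (\<Sum>l<n. (if l = j then w i j S else 0) + (if l = k then w i k S else 0) + of_bool (distinct [i, j, k, l]) * w i l S)"
    unfolding row_sum_def using assms by (intro sum.cong refl) (auto simp: w_def)
  then show ?thesis using assms by (simp add: sum.distrib)
qed

end

section \<open>Orders of magnitude in two scales\<close>

text \<open>
  All orders of magnitude are monomials in \<open>q\<close> and \<open>s\<close>. Since the sum of \<open>\<theta>\<close> is \<open>q ^ 16\<close>, its
  square root and its square are \<open>q ^ 8\<close> and \<open>q ^ 32\<close>, while the factor lost to large deviations
  is just \<open>q\<close>.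
\<close>
locale large_model = null_model +
  fixes q s :: real
  assumes q_ge: "100 \<le> q" and power_sum_1: "power_sum 1 = q ^ 16"
    and s_ge_1: "1 \<le> s" and s_sq: "s\<^sup>2 = power_sum 2"
begin

text \<open>
  The exponents in the bound \<open>rp r \<le> q ^ q_exponent r * s ^ s_exponent r\<close>.
\<close>
definition q_exponent :: "nat \<Rightarrow> nat" where "q_exponent r = (if r = 1 then 8 else 0)"
definition s_exponent :: "nat \<Rightarrow> nat" where "s_exponent r = (if r = 1 then 0 else 1)"

lemma q_pos [simp]: "0 < q" "0 \<le> q" "1 \<le> q" and s_pos [simp]: "0 < s" "0 \<le> s" "1 \<le> s"
  using q_ge s_ge_1 by auto

lemma power_sum_antimono: "r \<le> r' \<Longrightarrow> power_sum r' \<le> power_sum r"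
  unfolding power_sum_def using \<theta>_nonneg \<theta>_le_1 by (intro sum_mono power_decreasing) auto

lemma s_le: "s \<le> q ^ 8"
proof -
  have "s\<^sup>2 \<le> (q ^ 8)\<^sup>2" using power_sum_antimono[of 1 2] s_sq power_sum_1 by (simp flip: power_mult)
  then show ?thesis by (rule power2_le_imp_le) simp
qed

lemma rp_le: "1 \<le> r \<Longrightarrow> rp r \<le> q ^ q_exponent r * s ^ s_exponent r"
proof (cases "r = 1")
  case True
  have "sqrt (q ^ 16) = q ^ 8" by (rule real_sqrt_unique) (simp_all flip: power_mult)
  then show ?thesis using True power_sum_1 by (simp add: rp_def q_exponent_def s_exponent_def)
next
  case False
  assume "1 \<le> r"
  then have "power_sum r \<le> s\<^sup>2" using power_sum_antimono[of 2 r] False s_sq by simp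
  then have "rp r \<le> s" unfolding rp_def by (intro real_le_lsqrt) auto
  then show ?thesis using False by (simp add: q_exponent_def s_exponent_def)
qed

text \<open>
  Since \<open>s \<le> q ^ 8\<close>, a surplus power of \<open>s\<close> can be traded for \<open>q ^ 8\<close>. Comparing error terms
  thus becomes a comparison of numerals.
\<close>
lemma monomial_mono:
  assumes "a + 8 * (b - d) \<le> c"
  shows "q ^ a * s ^ b \<le> q ^ c * s ^ d"
proof -
  have "s ^ b \<le> s ^ (d + (b - d))" by (intro power_increasing) auto
  also have "\<dots> \<le> s ^ d * (q ^ 8) ^ (b - d)"
    unfolding power_add by (intro mult_left_mono power_mono s_le) auto
  finally have "q ^ a * s ^ b \<le> q ^ a * (s ^ d * (q ^ 8) ^ (b - d))" by (rule mult_left_mono) simp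
  also have "\<dots> = q ^ (a + 8 * (b - d)) * s ^ d" by (simp add: power_add power_mult)
  also have "\<dots> \<le> q ^ c * s ^ d" using assms by (intro mult_right_mono power_increasing) auto
  finally show ?thesis .
qed

lemma rp_prod2:
  assumes "1 \<le> a" "1 \<le> b" "0 \<le> M" "\<kappa> + (q_exponent a + q_exponent b) + 8 * ((s_exponent a + s_exponent b) - d) \<le> e"
  shows "M * q ^ \<kappa> * (rp a * rp b) \<le> M * (q ^ e * s ^ d)"
proof -
  have "rp a * rp b \<le> (q ^ q_exponent a * s ^ s_exponent a) * (q ^ q_exponent b * s ^ s_exponent b)"
    by (intro mult_mono rp_le assms mult_nonneg_nonneg) auto
  then have "M * q ^ \<kappa> * (rp a * rp b) \<le> M * q ^ \<kappa> * \<dots>"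
    using assms by (intro mult_left_mono) auto
  also have "\<dots> = M * (q ^ (\<kappa> + (q_exponent a + q_exponent b)) * s ^ (s_exponent a + s_exponent b))" by (simp add: power_add)
  also have "\<dots> \<le> M * (q ^ e * s ^ d)" using assms by (intro mult_left_mono monomial_mono) auto
  finally show ?thesis .
qed

lemma rp_prod3:
  assumes "1 \<le> a" "1 \<le> b" "1 \<le> c" "0 \<le> M" "\<kappa> + (q_exponent a + q_exponent b + q_exponent c) + 8 * ((s_exponent a + s_exponent b + s_exponent c) - d) \<le> e"
  shows "M * q ^ \<kappa> * (rp a * rp b * rp c) \<le> M * (q ^ e * s ^ d)"
proof -
  have "rp a * rp b * rp c \<le> (q ^ q_exponent a * s ^ s_exponent a) * (q ^ q_exponent b * s ^ s_exponent b) * (q ^ q_exponent c * s ^ s_exponent c)"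
    by (intro mult_mono rp_le assms mult_nonneg_nonneg) auto
  then have "M * q ^ \<kappa> * (rp a * rp b * rp c) \<le> M * q ^ \<kappa> * \<dots>"
    using assms by (intro mult_left_mono) auto
  also have "\<dots> = M * (q ^ (\<kappa> + (q_exponent a + q_exponent b + q_exponent c)) * s ^ (s_exponent a + s_exponent b + s_exponent c))" by (simp add: power_add)
  also have "\<dots> \<le> M * (q ^ e * s ^ d)" using assms by (intro mult_left_mono monomial_mono) auto
  finally show ?thesis .
qed

lemma rp_prod4:
  assumes "1 \<le> a" "1 \<le> b" "1 \<le> c" "1 \<le> c'" "0 \<le> M"
    "\<kappa> + (q_exponent a + q_exponent b + q_exponent c + q_exponent c') + 8 * ((s_exponent a + s_exponent b + s_exponent c + s_exponent c') - d) \<le> e"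
  shows "M * q ^ \<kappa> * (rp a * rp b * rp c * rp c') \<le> M * (q ^ e * s ^ d)"
proof -
  have "rp a * rp b * rp c * rp c' \<le> (q ^ q_exponent a * s ^ s_exponent a) * (q ^ q_exponent b * s ^ s_exponent b) * (q ^ q_exponent c * s ^ s_exponent c) * (q ^ q_exponent c' * s ^ s_exponent c')"
    by (intro mult_mono rp_le assms mult_nonneg_nonneg) auto
  then have "M * q ^ \<kappa> * (rp a * rp b * rp c * rp c') \<le> M * q ^ \<kappa> * \<dots>"
    using assms by (intro mult_left_mono) auto
  also have "\<dots> = M * (q ^ (\<kappa> + (q_exponent a + q_exponent b + q_exponent c + q_exponent c')) * s ^ (s_exponent a + s_exponent b + s_exponent c + s_exponent c'))" by (simp add: power_add)
  also have "\<dots> \<le> M * (q ^ e * s ^ d)" using assms by (intro mult_left_mono monomial_mono) auto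
  finally show ?thesis .
qed

lemmas exponent_defs = q_exponent_def s_exponent_def

context
  fixes c :: "nat \<Rightarrow> nat \<Rightarrow> real" and M :: real and \<kappa> r0 r1 d e :: nat
  assumes c: "\<And>i j. i < n \<Longrightarrow> j < n \<Longrightarrow> i \<noteq> j \<Longrightarrow> \<bar>c i j\<bar> \<le> M * q ^ \<kappa> * (\<theta> i ^ r0 * \<theta> j ^ r1)"
    and M: "0 \<le> M"
begin
text \<open>
  This and the next lemmas restate the norm bounds with a premise on exponents that the
  simplifier decides.
\<close>
lemma edge2_q:
  assumes "\<kappa> + (q_exponent (2 * r0 + 1) + q_exponent (2 * r1 + 1)) + 8 * (s_exponent (2 * r0 + 1) + s_exponent (2 * r1 + 1) - d) \<le> e"
  shows "nrm (\<lambda>S. sum2 (\<lambda>i j. c i j * w i j S)) \<le> 2 * (M * (q ^ e * s ^ d))"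
  by (rule order_trans[OF edge2[OF c]], assumption+, simp add: M, rule mult_left_mono[OF rp_prod2[OF _ _ M assms]], auto)
end

context
  fixes c :: "nat \<Rightarrow> nat \<Rightarrow> nat \<Rightarrow> real" and M :: real and \<kappa> r0 r1 r2 d e :: nat
  assumes c: "\<And>i j k. i < n \<Longrightarrow> j < n \<Longrightarrow> k < n \<Longrightarrow> distinct [i, j, k] \<Longrightarrow>
      \<bar>c i j k\<bar> \<le> M * q ^ \<kappa> * (\<theta> i ^ r0 * \<theta> j ^ r1 * \<theta> k ^ r2)"
    and M: "0 \<le> M"
begin
lemma path3_q:
  assumes "\<kappa> + (q_exponent (2 * r0 + 1) + q_exponent (2 * r1 + 2) + q_exponent (2 * r2 + 1)) + 8 * (s_exponent (2 * r0 + 1) + s_exponent (2 * r1 + 2) + s_exponent (2 * r2 + 1) - d) \<le> e"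
  shows "nrm (\<lambda>S. sum3 (\<lambda>i j k. c i j k * (w i j S * w j k S))) \<le> 6 * (M * (q ^ e * s ^ d))"
  by (rule order_trans[OF path3[OF c]], assumption+, simp add: M, rule mult_left_mono[OF rp_prod3[OF _ _ _ M assms]], auto)
lemma path3_first_q:
  assumes "\<kappa> + (q_exponent (2 * r0 + 2) + q_exponent (2 * r1 + 1) + q_exponent (2 * r2 + 1)) + 8 * (s_exponent (2 * r0 + 2) + s_exponent (2 * r1 + 1) + s_exponent (2 * r2 + 1) - d) \<le> e"
  shows "nrm (\<lambda>S. sum3 (\<lambda>i j k. c i j k * (w i j S * w i k S))) \<le> 6 * (M * (q ^ e * s ^ d))"
  by (rule order_trans[OF path3_first[OF c]], assumption+, simp add: M, rule mult_left_mono[OF rp_prod3[OF _ _ _ M assms]], auto)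
lemma path3_last_q:
  assumes "\<kappa> + (q_exponent (2 * r0 + 1) + q_exponent (2 * r1 + 1) + q_exponent (2 * r2 + 2)) + 8 * (s_exponent (2 * r0 + 1) + s_exponent (2 * r1 + 1) + s_exponent (2 * r2 + 2) - d) \<le> e"
  shows "nrm (\<lambda>S. sum3 (\<lambda>i j k. c i j k * (w j k S * w i k S))) \<le> 6 * (M * (q ^ e * s ^ d))"
  by (rule order_trans[OF path3_last[OF c]], assumption+, simp add: M, rule mult_left_mono[OF rp_prod3[OF _ _ _ M assms]], auto)
lemma triangle_q:
  assumes "\<kappa> + (q_exponent (2 * r0 + 2) + q_exponent (2 * r1 + 2) + q_exponent (2 * r2 + 2)) + 8 * (s_exponent (2 * r0 + 2) + s_exponent (2 * r1 + 2) + s_exponent (2 * r2 + 2) - d) \<le> e"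
  shows "nrm (\<lambda>S. sum3 (\<lambda>i j k. c i j k * (w i j S * (w j k S * w i k S)))) \<le> 6 * (M * (q ^ e * s ^ d))"
  by (rule order_trans[OF triangle[OF c]], assumption+, simp add: M, rule mult_left_mono[OF rp_prod3[OF _ _ _ M assms]], auto)
end

context
  fixes c :: "nat \<Rightarrow> nat \<Rightarrow> nat \<Rightarrow> nat \<Rightarrow> real" and M :: real and d e :: nat
  assumes c: "\<And>i j k l. i < n \<Longrightarrow> j < n \<Longrightarrow> k < n \<Longrightarrow> l < n \<Longrightarrow> distinct [i, j, k, l] \<Longrightarrow> \<bar>c i j k l\<bar> \<le> M"
    and M: "0 \<le> M"
begin
lemma path4_first_q:
  assumes "16 + 8 * (2 - d) \<le> e"
  shows "nrm (\<lambda>S. sum4 (\<lambda>i j k l. c i j k l * (w i j S * (w j k S * w i l S)))) \<le> 16 * (M * (q ^ e * s ^ d))"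
  by (rule order_trans[OF path4_first[of c M 0 0 0 0]], use c in simp, use M in simp, use rp_prod4[of 2 2 1 1 M 0 d e] assms M in \<open>simp add: exponent_defs eval_nat_numeral\<close>)
lemma path4_both_q:
  assumes "16 + 8 * (2 - d) \<le> e"
  shows "nrm (\<lambda>S. sum4 (\<lambda>i j k l. c i j k l * (w i j S * (w i k S * w j l S)))) \<le> 16 * (M * (q ^ e * s ^ d))"
  by (rule order_trans[OF path4_both[of c M 0 0 0 0]], use c in simp, use M in simp, use rp_prod4[of 2 2 1 1 M 0 d e] assms M in \<open>simp add: exponent_defs eval_nat_numeral\<close>)
lemma path4_last_q:
  assumes "16 + 8 * (2 - d) \<le> e"
  shows "nrm (\<lambda>S. sum4 (\<lambda>i j k l. c i j k l * (w i j S * (w j k S * w k l S)))) \<le> 16 * (M * (q ^ e * s ^ d))"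
  by (rule order_trans[OF path4_last[of c M 0 0 0 0]], use c in simp, use M in simp, use rp_prod4[of 1 2 2 1 M 0 d e] assms M in \<open>simp add: exponent_defs eval_nat_numeral\<close>)
lemma paw_first_q:
  assumes "8 + 8 * (3 - d) \<le> e"
  shows "nrm (\<lambda>S. sum4 (\<lambda>i j k l. c i j k l * (w i j S * (w j k S * (w i k S * w i l S))))) \<le> 16 * (M * (q ^ e * s ^ d))"
  by (rule order_trans[OF paw_first[of c M 0 0 0 0]], use c in simp, use M in simp, use rp_prod4[of 3 2 2 1 M 0 d e] assms M in \<open>simp add: exponent_defs eval_nat_numeral\<close>)
lemma paw_last_q:
  assumes "8 + 8 * (3 - d) \<le> e"
  shows "nrm (\<lambda>S. sum4 (\<lambda>i j k l. c i j k l * (w i j S * (w j k S * (w i k S * w k l S))))) \<le> 16 * (M * (q ^ e * s ^ d))"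
  by (rule order_trans[OF paw_last[of c M 0 0 0 0]], use c in simp, use M in simp, use rp_prod4[of 2 2 3 1 M 0 d e] assms M in \<open>simp add: exponent_defs eval_nat_numeral\<close>)
lemma cycle4_q:
  assumes "8 * (4 - d) \<le> e"
  shows "nrm (\<lambda>S. sum4 (\<lambda>i j k l. c i j k l * (w i j S * (w j k S * (w i l S * w k l S))))) \<le> 16 * (M * (q ^ e * s ^ d))"
  by (rule order_trans[OF cycle4[of c M 0 0 0 0]], use c in simp, use M in simp, use rp_prod4[of 2 2 2 2 M 0 d e] assms M in \<open>simp add: exponent_defs eval_nat_numeral\<close>)
end

lemma path5_q: "nrm (\<lambda>S. sum5 (\<lambda>i j k l m. w i j S * (w j k S * (w i l S * w k m S)))) \<le> 56 * (q ^ 24 * s ^ 2)"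
proof -
  have "rp 2 * rp 2 * rp 2 * rp 1 * rp 1 = rp 1 * (rp 2 * rp 2 * rp 2 * rp 1)" by simp
  also have "\<dots> \<le> q ^ 8 * (q ^ 8 * s ^ 3)"
  proof (rule mult_mono)
    show "rp 1 \<le> q ^ 8" using rp_le[of 1] by (simp add: exponent_defs)
    show "rp 2 * rp 2 * rp 2 * rp 1 \<le> q ^ 8 * s ^ 3"
      using rp_prod4[of 2 2 2 1 1 0 3 8] by (simp add: exponent_defs)
  qed auto
  also have "\<dots> = q ^ 16 * s ^ 3" by (simp flip: power_add)
  also have "\<dots> \<le> q ^ 24 * s ^ 2" by (rule monomial_mono) simp
  finally show ?thesis using path5 by linarith
qed

text \<open>
  By \<open>node_degree_x\<close> below, the deviation of the degree of \<open>i\<close> from \<open>q ^ 16 * \<theta> i\<close>. The square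
  compensates for the missing diagonal entry.
\<close>
definition x :: "nat \<Rightarrow> (nat \<times> nat) set \<Rightarrow> real" where "x i S = row_sum i S - (\<theta> i)\<^sup>2"

lemma \<theta>_pow_le_1: "i < n \<Longrightarrow> \<theta> i ^ r \<le> 1"
  using \<theta>_nonneg \<theta>_le_1 by (simp add: power_le_one)

lemma \<theta>_pow_nonneg: "i < n \<Longrightarrow> 0 \<le> \<theta> i ^ r"
  using \<theta>_nonneg by simp

lemma sum_\<theta>_bool_le:
  assumes f: "\<And>i. i < n \<Longrightarrow> \<bar>f i\<bar> \<le> c * \<theta> i" and c: "0 \<le> c"
  shows "\<bar>\<Sum>i<n. of_bool (P i) * f i\<bar> \<le> c * q ^ 16"
proof -
  have "\<bar>\<Sum>i<n. of_bool (P i) * f i\<bar> \<le> (\<Sum>i<n. c * \<theta> i)"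
    using f c \<theta>_nonneg by (intro order_trans[OF sum_abs] sum_mono) (auto simp: abs_mult)
  also have "\<dots> = c * q ^ 16" using power_sum_1 by (simp add: power_sum_def flip: sum_distrib_left)
  finally show ?thesis .
qed

definition A1 :: "(nat \<times> nat) set \<Rightarrow> real" where
  "A1 S = sum3 (\<lambda>i j k. \<theta> i * \<theta> k * (w i j S * w j k S))"
definition A2 :: "(nat \<times> nat) set \<Rightarrow> real" where
  "A2 S = sum3 (\<lambda>i j k. \<theta> k * x i S * (w i j S * w j k S))"

lemma nrm_A1: "nrm A1 \<le> 6 * (q ^ 0 * s ^ 3)"
  unfolding A1_def by (rule path3_q[of _ 1 0 1 0 1, unfolded mult_1]) (auto simp: exponent_defs \<theta>_nonneg)

lemma A2_term: "th * (a + c + y - t) * (a * b) = (th * g) * b + (th * k) * (a * b) + th * (a * (b * c)) - (t * th) * (a * b) + th * (a * b) * y"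
  if "a\<^sup>2 = g + k * a" for th a b c y t g k :: real
  using that by algebra

text \<open>
  The deviation \<open>x i\<close> contains the edges \<open>w i j\<close> and \<open>w i k\<close>. Once they are separated, squares
  are removed by \<open>w_square\<close> and multilinear sums remain.
\<close>
lemma A2_expand:
  "A2 S =
     sum2 (\<lambda>j k. (\<Sum>i<n. of_bool (distinct [i, j, k]) * (\<theta> k * sg i j)) * w j k S)
   + sum3 (\<lambda>i j k. (\<theta> k * kp i j) * (w i j S * w j k S))
   + sum3 (\<lambda>i j k. \<theta> k * (w i j S * (w j k S * w i k S)))
   - sum3 (\<lambda>i j k. ((\<theta> i)\<^sup>2 * \<theta> k) * (w i j S * w j k S))
   + sum4 (\<lambda>i j k l. \<theta> k * (w i j S * (w j k S * w i l S)))"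
proof -
  have "A2 S =
    sum3 (\<lambda>i j k. (\<theta> k * sg i j) * w j k S + (\<theta> k * kp i j) * (w i j S * w j k S)
       + \<theta> k * (w i j S * (w j k S * w i k S)) - ((\<theta> i)\<^sup>2 * \<theta> k) * (w i j S * w j k S)
       + (\<Sum>l<n. of_bool (distinct [i, j, k, l]) * (\<theta> k * (w i j S * (w j k S * w i l S)))))"
    unfolding A2_def
  proof (rule sum3_cong, goal_cases)
    case (1 i j k)
    have "w i j S ^ 2 = sg i j + kp i j * w i j S" using 1 by (intro w_square) auto
    from A2_term[OF this, of "\<theta> k" "w i k S" "\<Sum>l<n. of_bool (distinct [i, j, k, l]) * w i l S" "(\<theta> i)\<^sup>2" "w j k S"]
    show ?case unfolding x_def row_sum_split3[OF 1(2-4)] by (simp add: sum_distrib_left mult_ac)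
  qed
  then show ?thesis
    by (simp only: sum3_add sum3_diff sum3_collapse_first sum4_sum3)
qed

lemma nrm_A2: "nrm A2 \<le> 36 * (q ^ 16 * s ^ 2)"
proof -
  have 1: "nrm (\<lambda>S. sum2 (\<lambda>j k. (\<Sum>i<n. of_bool (distinct [i, j, k]) * (\<theta> k * sg i j)) * w j k S)) \<le> 2 * (1 * (q ^ 16 * s ^ 2))"
  proof (rule edge2_q[of _ 1 16 1 1])
    fix j k assume "j < n" "k < n"
    then have "\<bar>\<theta> k * sg i j\<bar> \<le> (\<theta> k * \<theta> j) * \<theta> i" if "i < n" for i
      using sg_bounds[OF that \<open>j < n\<close>] \<theta>_nonneg[OF \<open>k < n\<close>] mult_left_mono[of "sg i j" "\<theta> i * \<theta> j" "\<theta> k"]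
      by (simp add: abs_mult mult_ac)
    from sum_\<theta>_bool_le[OF this, of "\<lambda>i. distinct [i, j, k]"]
    show "\<bar>\<Sum>i<n. of_bool (distinct [i, j, k]) * (\<theta> k * sg i j)\<bar> \<le> 1 * q ^ 16 * (\<theta> j ^ 1 * \<theta> k ^ 1)"
      using \<theta>_nonneg[of k] \<theta>_nonneg[of j] \<open>j < n\<close> \<open>k < n\<close> by (simp add: mult_ac)
  qed (auto simp: exponent_defs)
  have 2: "nrm (\<lambda>S. sum3 (\<lambda>i j k. (\<theta> k * kp i j) * (w i j S * w j k S))) \<le> 6 * (1 * (q ^ 16 * s ^ 2))"
    by (rule path3_q[of _ 1 0 0 0 1]) (auto simp: exponent_defs abs_mult \<theta>_nonneg kp_le mult_left_le)
  have 3: "nrm (\<lambda>S. sum3 (\<lambda>i j k. \<theta> k * (w i j S * (w j k S * w i k S)))) \<le> 6 * (1 * (q ^ 16 * s ^ 2))"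
    by (rule triangle_q[of _ 1 0 0 0 1]) (auto simp: exponent_defs \<theta>_nonneg)
  have 4: "nrm (\<lambda>S. sum3 (\<lambda>i j k. ((\<theta> i)\<^sup>2 * \<theta> k) * (w i j S * w j k S))) \<le> 6 * (1 * (q ^ 16 * s ^ 2))"
    by (rule path3_q[of _ 1 0 2 0 1]) (auto simp: exponent_defs \<theta>_nonneg)
  have 5: "nrm (\<lambda>S. sum4 (\<lambda>i j k l. \<theta> k * (w i j S * (w j k S * w i l S)))) \<le> 16 * (1 * (q ^ 16 * s ^ 2))"
    by (rule path4_first_q) (auto simp: exponent_defs \<theta>_nonneg \<theta>_le_1)
  show ?thesis
    unfolding A2_expand using nrm_add_le[OF nrm_diff_le[OF nrm_add_le[OF nrm_add_le[OF 1 2] 3] 4] 5]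
    by linarith
qed

end

section \<open>Multilinear expansions of the remainder\<close>

context large_model
begin

lemma sum2_swapped:
  assumes "\<And>i j. i < n \<Longrightarrow> j < n \<Longrightarrow> i \<noteq> j \<Longrightarrow> g i j = f j i"
  shows "sum2 g = sum2 f"
  by (subst sum2_swap, rule sum2_cong) (use assms in auto)

definition A32 :: "(nat \<times> nat) set \<Rightarrow> real" where
  "A32 S = sum3 (\<lambda>i j k. (w i j S)\<^sup>2 * w j k S * (w i k S + (\<Sum>l<n. of_bool (distinct [i, j, k, l]) * w k l S) - (\<theta> k)\<^sup>2))"

definition A34 :: "(nat \<times> nat) set \<Rightarrow> real" where
  "A34 S = sum3 (\<lambda>i j k. w i j S * w j k S * (w i k S + (\<Sum>l<n. of_bool (distinct [i, j, k, l]) * w i l S) - (\<theta> i)\<^sup>2)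
      * (w i k S + (\<Sum>l<n. of_bool (distinct [i, j, k, l]) * w k l S) - (\<theta> k)\<^sup>2))"

text \<open>
  Each of \<open>x i\<close> and \<open>x k\<close> is the adjacent edge of the path plus a rest. The term in which both
  edges are squared has a large mean; it is kept, and bounded pointwise later. The mixed terms
  agree by reversal of the path.
\<close>
lemma A3_expand:
  "sum3 (\<lambda>i j k. x i S * x k S * (w i j S * w j k S)) = sum3 (\<lambda>i j k. (w i j S)\<^sup>2 * (w j k S)\<^sup>2) + 2 * A32 S + A34 S"
proof -
  let ?Y = "\<lambda>i j k. \<Sum>l<n. of_bool (distinct [i, j, k, l]) * w i l S"
  let ?Z = "\<lambda>i j k. \<Sum>l<n. of_bool (distinct [i, j, k, l]) * w k l S"
  have alg: "(a + c + y - t) * (b + c + z - u) * (a * b) = a\<^sup>2 * b\<^sup>2 + a\<^sup>2 * b * (c + z - u) + b\<^sup>2 * a * (c + y - t)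
      + a * b * (c + y - t) * (c + z - u)" for a b c t u y z :: real
    by algebra
  have "sum3 (\<lambda>i j k. x i S * x k S * (w i j S * w j k S)) =
      sum3 (\<lambda>i j k. (w i j S)\<^sup>2 * (w j k S)\<^sup>2
         + (w i j S)\<^sup>2 * w j k S * (w i k S + ?Z i j k - (\<theta> k)\<^sup>2)
         + (w j k S)\<^sup>2 * w i j S * (w i k S + ?Y i j k - (\<theta> i)\<^sup>2)
         + w i j S * w j k S * (w i k S + ?Y i j k - (\<theta> i)\<^sup>2) * (w i k S + ?Z i j k - (\<theta> k)\<^sup>2))"
  proof (rule sum3_cong, goal_cases)
    case (1 i j k)
    have "row_sum k S = w k j S + w k i S + (\<Sum>l<n. of_bool (distinct [k, j, i, l]) * w k l S)"
      using 1 by (intro row_sum_split3) auto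
    also have "(\<Sum>l<n. of_bool (distinct [k, j, i, l]) * w k l S) = ?Z i j k"
      by (intro sum.cong refl) auto
    finally have k: "row_sum k S = w j k S + w i k S + ?Z i j k" by (simp add: w_sym[of k])
    show ?case unfolding x_def row_sum_split3[OF 1(2-4)] k by (rule alg)
  qed
  also have "\<dots> = sum3 (\<lambda>i j k. (w i j S)\<^sup>2 * (w j k S)\<^sup>2) + A32 S
     + sum3 (\<lambda>i j k. (w j k S)\<^sup>2 * w i j S * (w i k S + ?Y i j k - (\<theta> i)\<^sup>2)) + A34 S"
    by (simp only: sum3_add A32_def A34_def)
  also have "sum3 (\<lambda>i j k. (w j k S)\<^sup>2 * w i j S * (w i k S + ?Y i j k - (\<theta> i)\<^sup>2)) = A32 S"
    unfolding A32_def
  proof (subst sum3_rev, rule sum3_cong, goal_cases)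
    case (1 i j k)
    have "(\<Sum>l<n. of_bool (distinct [k, j, i, l]) * w k l S) = ?Z i j k"
      by (intro sum.cong refl) auto
    then show ?case by (simp add: w_sym[of k] w_sym[of j i])
  qed
  finally show ?thesis by simp
qed

lemma A32_expand:
  "A32 S =
     sum3 (\<lambda>i j k. sg i j * (w j k S * w i k S))
   + sum3 (\<lambda>j k l. (\<Sum>i<n. of_bool (distinct [i, j, k, l]) * sg i j) * (w j k S * w k l S))
   - sum2 (\<lambda>j k. (\<Sum>i<n. of_bool (distinct [i, j, k]) * (sg i j * (\<theta> k)\<^sup>2)) * w j k S)
   + sum3 (\<lambda>i j k. kp i j * (w i j S * (w j k S * w i k S)))
   + sum4 (\<lambda>i j k l. kp i j * (w i j S * (w j k S * w k l S)))
   - sum3 (\<lambda>i j k. (kp i j * (\<theta> k)\<^sup>2) * (w i j S * w j k S))"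
proof -
  let ?Z = "\<lambda>i j k. \<Sum>l<n. of_bool (distinct [i, j, k, l]) * w k l S"
  have alg: "a\<^sup>2 * b * (c + z - u) = g * (b * c) + g * b * z - (g * u) * b + k * (a * (b * c)) + k * (a * b) * z - (k * u) * (a * b)"
    if "a\<^sup>2 = g + k * a" for a b c u z g k :: real
    using that by algebra
  have "A32 S = sum3 (\<lambda>i j k. sg i j * (w j k S * w i k S) + (\<Sum>l<n. of_bool (distinct [i, j, k, l]) * (sg i j * (w j k S * w k l S)))
       - (sg i j * (\<theta> k)\<^sup>2) * w j k S + kp i j * (w i j S * (w j k S * w i k S))
       + (\<Sum>l<n. of_bool (distinct [i, j, k, l]) * (kp i j * (w i j S * (w j k S * w k l S))))
       - (kp i j * (\<theta> k)\<^sup>2) * (w i j S * w j k S))"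
    unfolding A32_def
  proof (rule sum3_cong, goal_cases)
    case (1 i j k)
    have "w i j S ^ 2 = sg i j + kp i j * w i j S" using 1 by (intro w_square) auto
    from alg[OF this, of "w j k S" "w i k S" "?Z i j k" "(\<theta> k)\<^sup>2"]
    show ?case by (simp add: sum_distrib_left mult_ac)
  qed
  then show ?thesis
    by (simp only: sum3_add sum3_diff sum3_collapse_first sum4_sum3[symmetric] sum4_collapse_first)
qed

lemma abs_kp_mult_le: "i < n \<Longrightarrow> j < n \<Longrightarrow> 0 \<le> a \<Longrightarrow> \<bar>kp i j\<bar> * a \<le> a"
  using kp_le[of i j] by (simp add: mult_left_le_one_le)

lemma nrm_A32: "nrm A32 \<le> 42 * (q ^ 32 * s ^ 2)"
proof -
  have 1: "nrm (\<lambda>S. sum3 (\<lambda>i j k. sg i j * (w j k S * w i k S))) \<le> 6 * (1 * (q ^ 32 * s ^ 2))"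
    by (rule path3_last_q[of _ 1 0 1 1 0]) (use sg_bounds in \<open>auto simp: exponent_defs\<close>)
  have 2: "nrm (\<lambda>S. sum3 (\<lambda>j k l. (\<Sum>i<n. of_bool (distinct [i, j, k, l]) * sg i j) * (w j k S * w k l S))) \<le> 6 * (1 * (q ^ 32 * s ^ 2))"
  proof (rule path3_q[of _ 1 16 1 0 0])
    fix j k l assume "j < n" "k < n" "l < n"
    then have "\<bar>sg i j\<bar> \<le> \<theta> j * \<theta> i" if "i < n" for i
      using sg_bounds[OF that \<open>j < n\<close>] by (simp add: mult_ac)
    from sum_\<theta>_bool_le[OF this, of "\<lambda>i. distinct [i, j, k, l]"]
    show "\<bar>\<Sum>i<n. of_bool (distinct [i, j, k, l]) * sg i j\<bar> \<le> 1 * q ^ 16 * (\<theta> j ^ 1 * \<theta> k ^ 0 * \<theta> l ^ 0)"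
      using \<theta>_nonneg[OF \<open>j < n\<close>] by (simp add: mult_ac)
  qed (auto simp: exponent_defs)
  have 3: "nrm (\<lambda>S. sum2 (\<lambda>j k. (\<Sum>i<n. of_bool (distinct [i, j, k]) * (sg i j * (\<theta> k)\<^sup>2)) * w j k S)) \<le> 2 * (1 * (q ^ 32 * s ^ 2))"
  proof (rule edge2_q[of _ 1 16 1 2])
    fix j k assume jk: "j < n" "k < n"
    then have "\<bar>sg i j * (\<theta> k)\<^sup>2\<bar> \<le> (\<theta> j * (\<theta> k)\<^sup>2) * \<theta> i" if "i < n" for i
      using sg_bounds[OF that \<open>j < n\<close>] mult_right_mono[of "sg i j" "\<theta> i * \<theta> j" "(\<theta> k)\<^sup>2"] by (simp add: abs_mult mult_ac)
    from sum_\<theta>_bool_le[OF this, of "\<lambda>i. distinct [i, j, k]"]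
    show "\<bar>\<Sum>i<n. of_bool (distinct [i, j, k]) * (sg i j * (\<theta> k)\<^sup>2)\<bar> \<le> 1 * q ^ 16 * (\<theta> j ^ 1 * \<theta> k ^ 2)"
      using \<theta>_nonneg[OF \<open>j < n\<close>] by (simp add: mult_ac)
  qed (auto simp: exponent_defs)
  have 4: "nrm (\<lambda>S. sum3 (\<lambda>i j k. kp i j * (w i j S * (w j k S * w i k S)))) \<le> 6 * (1 * (q ^ 32 * s ^ 2))"
    by (rule triangle_q[of _ 1 0 0 0 0]) (auto simp: exponent_defs kp_le)
  have 5: "nrm (\<lambda>S. sum4 (\<lambda>i j k l. kp i j * (w i j S * (w j k S * w k l S)))) \<le> 16 * (1 * (q ^ 32 * s ^ 2))"
    by (rule path4_last_q) (auto simp: kp_le)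
  have 6: "nrm (\<lambda>S. sum3 (\<lambda>i j k. (kp i j * (\<theta> k)\<^sup>2) * (w i j S * w j k S))) \<le> 6 * (1 * (q ^ 32 * s ^ 2))"
    by (rule path3_q[of _ 1 0 0 0 2]) (auto simp: exponent_defs abs_mult abs_kp_mult_le)
  show ?thesis
    unfolding A32_expand
    using nrm_diff_le[OF nrm_add_le[OF nrm_add_le[OF nrm_diff_le[OF nrm_add_le[OF 1 2] 3] 4] 5] 6]
    by linarith
qed

lemma A34_expand:
  "A34 S =
     sum3 (\<lambda>i j k. sg i k * (w i j S * w j k S))
   + sum3 (\<lambda>i j k. (kp i k - (\<theta> i)\<^sup>2 - (\<theta> k)\<^sup>2) * (w i j S * (w j k S * w i k S)))
   + sum4 (\<lambda>i j k l. 1 * (w i j S * (w j k S * (w i k S * w i l S))))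
   + sum4 (\<lambda>i j k l. 1 * (w i j S * (w j k S * (w i k S * w k l S))))
   + sum4 (\<lambda>i j k l. 1 * (w i j S * (w j k S * (w i l S * w k l S))))
   + sum5 (\<lambda>i j k l m. w i j S * (w j k S * (w i l S * w k m S)))
   - sum4 (\<lambda>i j k l. (\<theta> k)\<^sup>2 * (w i j S * (w j k S * w i l S)))
   - sum4 (\<lambda>i j k l. (\<theta> i)\<^sup>2 * (w i j S * (w j k S * w k l S)))
   + sum3 (\<lambda>i j k. ((\<theta> i)\<^sup>2 * (\<theta> k)\<^sup>2) * (w i j S * w j k S))"
proof -
  let ?Y = "\<lambda>i j k. \<Sum>l<n. of_bool (distinct [i, j, k, l]) * w i l S"
  let ?Z = "\<lambda>i j k. \<Sum>l<n. of_bool (distinct [i, j, k, l]) * w k l S"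
  have alg: "a * b * (c + y - t) * (c + z - u) = g * (a * b) + (k - t - u) * (a * (b * c)) + a * b * c * y + a * b * c * z
      + a * b * (y * z) - u * (a * b) * y - t * (a * b) * z + (t * u) * (a * b)"
    if "c\<^sup>2 = g + k * c" for a b c t u y z g k :: real
    using that by algebra
  have "A34 S = sum3 (\<lambda>i j k. sg i k * (w i j S * w j k S)
       + (kp i k - (\<theta> i)\<^sup>2 - (\<theta> k)\<^sup>2) * (w i j S * (w j k S * w i k S))
       + (\<Sum>l<n. of_bool (distinct [i, j, k, l]) * (1 * (w i j S * (w j k S * (w i k S * w i l S)))))
       + (\<Sum>l<n. of_bool (distinct [i, j, k, l]) * (1 * (w i j S * (w j k S * (w i k S * w k l S)))))
       + (\<Sum>l<n. of_bool (distinct [i, j, k, l]) * (1 * (w i j S * (w j k S * (w i l S * w k l S)))))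
       + (\<Sum>l<n. \<Sum>m<n. of_bool (distinct [i, j, k, l, m]) * (w i j S * (w j k S * (w i l S * w k m S))))
       - (\<Sum>l<n. of_bool (distinct [i, j, k, l]) * ((\<theta> k)\<^sup>2 * (w i j S * (w j k S * w i l S))))
       - (\<Sum>l<n. of_bool (distinct [i, j, k, l]) * ((\<theta> i)\<^sup>2 * (w i j S * (w j k S * w k l S))))
       + ((\<theta> i)\<^sup>2 * (\<theta> k)\<^sup>2) * (w i j S * w j k S))"
    unfolding A34_def
  proof (rule sum3_cong, goal_cases)
    case (1 i j k)
    have "w i k S ^ 2 = sg i k + kp i k * w i k S" using 1 by (intro w_square) auto
    from alg[OF this, of "w i j S" "w j k S" "?Y i j k" "(\<theta> i)\<^sup>2" "?Z i j k" "(\<theta> k)\<^sup>2"]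
    show ?case unfolding sum_pair_split3 by (simp add: sum_distrib_left distrib_left mult_ac)
  qed
  then show ?thesis
    by (simp only: sum3_add sum3_diff sum4_sum3[symmetric] sum5_sum3[symmetric])
qed

lemma nrm_A34: "nrm A34 \<le> 200 * (q ^ 32 * s ^ 2)"
proof -
  have 1: "nrm (\<lambda>S. sum3 (\<lambda>i j k. sg i k * (w i j S * w j k S))) \<le> 6 * (1 * (q ^ 32 * s ^ 2))"
    by (rule path3_q[of _ 1 0 1 0 1]) (use sg_bounds in \<open>auto simp: exponent_defs\<close>)
  have 2: "nrm (\<lambda>S. sum3 (\<lambda>i j k. (kp i k - (\<theta> i)\<^sup>2 - (\<theta> k)\<^sup>2) * (w i j S * (w j k S * w i k S)))) \<le> 6 * (3 * (q ^ 32 * s ^ 2))"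
  proof (rule triangle_q[of _ 3 0 0 0 0])
    fix i j k assume "i < n" "k < n"
    then show "\<bar>kp i k - (\<theta> i)\<^sup>2 - (\<theta> k)\<^sup>2\<bar> \<le> 3 * q ^ 0 * (\<theta> i ^ 0 * \<theta> j ^ 0 * \<theta> k ^ 0)"
      using kp_le[of i k] \<theta>_pow_le_1[of i 2] \<theta>_pow_le_1[of k 2] zero_le_power2[of "\<theta> i"] zero_le_power2[of "\<theta> k"]
      unfolding abs_le_iff by (simp, linarith)
  qed (auto simp: exponent_defs)
  have 3: "nrm (\<lambda>S. sum4 (\<lambda>i j k l. 1 * (w i j S * (w j k S * (w i k S * w i l S))))) \<le> 16 * (1 * (q ^ 32 * s ^ 2))"
    by (rule paw_first_q) auto
  have 4: "nrm (\<lambda>S. sum4 (\<lambda>i j k l. 1 * (w i j S * (w j k S * (w i k S * w k l S))))) \<le> 16 * (1 * (q ^ 32 * s ^ 2))"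
    by (rule paw_last_q) auto
  have 5: "nrm (\<lambda>S. sum4 (\<lambda>i j k l. 1 * (w i j S * (w j k S * (w i l S * w k l S))))) \<le> 16 * (1 * (q ^ 32 * s ^ 2))"
    by (rule cycle4_q) auto
  have 6: "nrm (\<lambda>S. sum5 (\<lambda>i j k l m. w i j S * (w j k S * (w i l S * w k m S)))) \<le> 56 * (q ^ 32 * s ^ 2)"
    using path5_q monomial_mono[of 24 2 2 32] by simp
  have 7: "nrm (\<lambda>S. sum4 (\<lambda>i j k l. (\<theta> k)\<^sup>2 * (w i j S * (w j k S * w i l S)))) \<le> 16 * (1 * (q ^ 32 * s ^ 2))"
    by (rule path4_first_q) (auto simp: \<theta>_pow_le_1)
  have 8: "nrm (\<lambda>S. sum4 (\<lambda>i j k l. (\<theta> i)\<^sup>2 * (w i j S * (w j k S * w k l S)))) \<le> 16 * (1 * (q ^ 32 * s ^ 2))"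
    by (rule path4_last_q) (auto simp: \<theta>_pow_le_1)
  have 9: "nrm (\<lambda>S. sum3 (\<lambda>i j k. ((\<theta> i)\<^sup>2 * (\<theta> k)\<^sup>2) * (w i j S * w j k S))) \<le> 6 * (1 * (q ^ 32 * s ^ 2))"
    by (rule path3_q[of _ 1 0 2 0 2]) (auto simp: exponent_defs)
  have 0: "0 \<le> q ^ 32 * s ^ 2" by simp
  show ?thesis
    unfolding A34_expand
    using 0 nrm_add_le[OF nrm_diff_le[OF nrm_diff_le[OF nrm_add_le[OF nrm_add_le[OF nrm_add_le[OF nrm_add_le[OF nrm_add_le[OF 1 2] 3] 4] 5] 6] 7] 8] 9]
    by linarith
qed

text \<open>
  The quantities \<open>F\<close>, \<open>F2\<close>, \<open>F3\<close> and \<open>F5\<close> are what is left of sums that are quadratic in the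
  degree deviations or the edges, after a part with a good pointwise bound has been split off;
  they are small in \<open>L\<^sup>2\<close>.
\<close>
definition F :: "(nat \<times> nat) set \<Rightarrow> real" where "F S = sum3 (\<lambda>i j k. 1 * (w i j S * w j k S))"

lemma nrm_F: "nrm F \<le> 6 * (q ^ 16 * s ^ 1)"
  unfolding F_def by (rule path3_q[of _ 1 0 0 0 0, unfolded mult_1]) (auto simp: exponent_defs)

definition F2 :: "(nat \<times> nat) set \<Rightarrow> real" where
  "F2 S = sum3 (\<lambda>i j l. \<theta> i * (w i j S * w j l S)) - sum2 (\<lambda>i j. (\<theta> i * (\<theta> j)\<^sup>2) * w i j S)"

lemma nrm_F2: "nrm F2 \<le> 8 * (q ^ 8 * s ^ 2)"
proof -
  have 1: "nrm (\<lambda>S. sum3 (\<lambda>i j l. \<theta> i * (w i j S * w j l S))) \<le> 6 * (1 * (q ^ 8 * s ^ 2))"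
    by (rule path3_q[of _ 1 0 1 0 0]) (auto simp: exponent_defs \<theta>_nonneg)
  have 2: "nrm (\<lambda>S. sum2 (\<lambda>i j. (\<theta> i * (\<theta> j)\<^sup>2) * w i j S)) \<le> 2 * (1 * (q ^ 8 * s ^ 2))"
    by (rule edge2_q[of _ 1 0 1 2]) (auto simp: exponent_defs \<theta>_nonneg)
  show ?thesis unfolding F2_def using nrm_diff_le[OF 1 2] by linarith
qed

text \<open>
  The edge \<open>w i j\<close> occurs in \<open>x j\<close>, which produces the sum of squares; the rest \<open>F2\<close> is small in
  \<open>L\<^sup>2\<close>.
\<close>
lemma B2_expand:
  "sum2 (\<lambda>i j. \<theta> i * x j S * w i j S) = sum2 (\<lambda>i j. \<theta> i * (w i j S)\<^sup>2) + F2 S"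
proof -
  have "sum2 (\<lambda>i j. \<theta> i * x j S * w i j S) = sum2 (\<lambda>i j. \<theta> i * (w i j S)\<^sup>2
     + (\<Sum>l<n. of_bool (distinct [i, j, l]) * (\<theta> i * (w i j S * w j l S))) - (\<theta> i * (\<theta> j)\<^sup>2) * w i j S)"
  proof (rule sum2_cong, goal_cases)
    case (1 i j)
    have "row_sum j S = w j i S + (\<Sum>l<n. of_bool (distinct [j, i, l]) * w j l S)"
      using 1 by (intro row_sum_split2) auto
    also have "(\<Sum>l<n. of_bool (distinct [j, i, l]) * w j l S) = (\<Sum>l<n. of_bool (distinct [i, j, l]) * w j l S)"
      by (intro sum.cong refl) auto
    finally show ?case
      by (simp add: x_def w_sym[of j i] algebra_simps power2_eq_square sum_distrib_left)
  qed
  then show ?thesis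
    by (simp only: sum2_add sum2_diff sum3_sum2[symmetric] F2_def)
qed

definition B32 :: "(nat \<times> nat) set \<Rightarrow> real" where
  "B32 S = sum2 (\<lambda>i j. (w i j S)\<^sup>2 * ((\<Sum>l<n. of_bool (distinct [i, j, l]) * w i l S) - (\<theta> i)\<^sup>2))"

definition B34 :: "(nat \<times> nat) set \<Rightarrow> real" where
  "B34 S = sum2 (\<lambda>i j. w i j S * ((\<Sum>l<n. of_bool (distinct [i, j, l]) * w i l S) - (\<theta> i)\<^sup>2)
      * ((\<Sum>l<n. of_bool (distinct [i, j, l]) * w j l S) - (\<theta> j)\<^sup>2))"

definition F3 :: "(nat \<times> nat) set \<Rightarrow> real" where "F3 S = 2 * B32 S + B34 S"

text \<open>
  The analogous separation of \<open>w i j\<close> from both deviations produces the sum of cubes.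
\<close>
lemma B3_expand:
  "sum2 (\<lambda>i j. x i S * x j S * w i j S) = sum2 (\<lambda>i j. (w i j S) ^ 3) + F3 S"
proof -
  let ?Y = "\<lambda>i j. \<Sum>l<n. of_bool (distinct [i, j, l]) * w i l S"
  let ?Z = "\<lambda>i j. \<Sum>l<n. of_bool (distinct [i, j, l]) * w j l S"
  have alg: "(a + y - t) * (a + z - u) * a = a ^ 3 + a\<^sup>2 * (y - t) + a\<^sup>2 * (z - u) + a * (y - t) * (z - u)" for a t u y z :: real
    by algebra
  have ZY: "(\<Sum>l<n. of_bool (distinct [j, i, l]) * w j l S) = ?Z i j" for i j
    by (intro sum.cong refl) auto
  have "sum2 (\<lambda>i j. x i S * x j S * w i j S) = sum2 (\<lambda>i j. (w i j S) ^ 3 + (w i j S)\<^sup>2 * (?Y i j - (\<theta> i)\<^sup>2)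
     + (w i j S)\<^sup>2 * (?Z i j - (\<theta> j)\<^sup>2) + w i j S * (?Y i j - (\<theta> i)\<^sup>2) * (?Z i j - (\<theta> j)\<^sup>2))"
  proof (rule sum2_cong, goal_cases)
    case (1 i j)
    have "row_sum j S = w j i S + (\<Sum>l<n. of_bool (distinct [j, i, l]) * w j l S)"
      using 1 by (intro row_sum_split2) auto
    then have j: "row_sum j S = w i j S + ?Z i j" unfolding ZY by (simp add: w_sym[of j i])
    show ?case unfolding x_def row_sum_split2[OF 1(2,3)] j by (rule alg)
  qed
  also have "\<dots> = sum2 (\<lambda>i j. (w i j S) ^ 3) + B32 S + sum2 (\<lambda>i j. (w i j S)\<^sup>2 * (?Z i j - (\<theta> j)\<^sup>2)) + B34 S"
    by (simp only: sum2_add B32_def B34_def)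
  also have "sum2 (\<lambda>i j. (w i j S)\<^sup>2 * (?Z i j - (\<theta> j)\<^sup>2)) = B32 S"
    unfolding B32_def
  proof (rule sum2_swapped, goal_cases)
    case (1 i j)
    show ?case unfolding ZY w_sym[of j i] ..
  qed
  finally show ?thesis by (simp add: F3_def)
qed

lemma B32_expand:
  "B32 S = sum2 (\<lambda>i l. (\<Sum>j<n. of_bool (distinct [i, j, l]) * sg i j) * w i l S)
    - sum2 (\<lambda>i j. sg i j * (\<theta> i)\<^sup>2)
    + sum3 (\<lambda>i j l. kp i j * (w i j S * w i l S))
    - sum2 (\<lambda>i j. (kp i j * (\<theta> i)\<^sup>2) * w i j S)"
proof -
  let ?Y = "\<lambda>i j. \<Sum>l<n. of_bool (distinct [i, j, l]) * w i l S"
  have alg: "a\<^sup>2 * (y - t) = g * y - g * t + k * a * y - (k * t) * a" if "a\<^sup>2 = g + k * a" for a t y g k :: real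
    using that by algebra
  have "B32 S = sum2 (\<lambda>i j. (\<Sum>l<n. of_bool (distinct [i, j, l]) * (sg i j * w i l S)) - sg i j * (\<theta> i)\<^sup>2
      + (\<Sum>l<n. of_bool (distinct [i, j, l]) * (kp i j * (w i j S * w i l S))) - (kp i j * (\<theta> i)\<^sup>2) * w i j S)"
    unfolding B32_def
  proof (rule sum2_cong, goal_cases)
    case (1 i j)
    have "w i j S ^ 2 = sg i j + kp i j * w i j S" using 1 by (intro w_square) auto
    from alg[OF this, of "?Y i j" "(\<theta> i)\<^sup>2"]
    show ?case by (simp add: sum_distrib_left mult_ac)
  qed
  then show ?thesis
    by (simp only: sum2_add sum2_diff sum3_sum2[symmetric] sum3_collapse_mid)
qed

lemma B34_expand:
  "B34 S = sum3 (\<lambda>i j l. 1 * (w i j S * (w j l S * w i l S)))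
    + sum4 (\<lambda>i j l m. 1 * (w i j S * (w i l S * w j m S)))
    - sum3 (\<lambda>i j l. (\<theta> j)\<^sup>2 * (w i j S * w i l S))
    - sum3 (\<lambda>i j l. (\<theta> i)\<^sup>2 * (w i j S * w j l S))
    + sum2 (\<lambda>i j. ((\<theta> i)\<^sup>2 * (\<theta> j)\<^sup>2) * w i j S)"
proof -
  let ?Y = "\<lambda>i j. \<Sum>l<n. of_bool (distinct [i, j, l]) * w i l S"
  let ?Z = "\<lambda>i j. \<Sum>l<n. of_bool (distinct [i, j, l]) * w j l S"
  have alg: "a * (y - t) * (z - u) = a * (y * z) - u * a * y - t * a * z + (t * u) * a" for a t u y z :: real
    by algebra
  have "B34 S = sum2 (\<lambda>i j. (\<Sum>l<n. of_bool (distinct [i, j, l]) * (1 * (w i j S * (w j l S * w i l S))))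
    + (\<Sum>l<n. \<Sum>m<n. of_bool (distinct [i, j, l, m]) * (1 * (w i j S * (w i l S * w j m S))))
    - (\<Sum>l<n. of_bool (distinct [i, j, l]) * ((\<theta> j)\<^sup>2 * (w i j S * w i l S)))
    - (\<Sum>l<n. of_bool (distinct [i, j, l]) * ((\<theta> i)\<^sup>2 * (w i j S * w j l S)))
    + ((\<theta> i)\<^sup>2 * (\<theta> j)\<^sup>2) * w i j S)"
    unfolding B34_def
  proof (rule sum2_cong, goal_cases)
    case (1 i j)
    show ?case unfolding alg sum_pair_split2 by (simp add: sum_distrib_left distrib_left mult_ac)
  qed
  then show ?thesis
    by (simp only: sum2_add sum2_diff sum3_sum2[symmetric] sum4_sum2[symmetric])
qed

lemma sum2_const_le:
  assumes "\<And>i j. i < n \<Longrightarrow> j < n \<Longrightarrow> \<bar>f i j\<bar> \<le> \<theta> i ^ a * \<theta> j ^ b"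
  shows "\<bar>sum2 f\<bar> \<le> power_sum a * power_sum b"
proof -
  have "\<bar>sum2 f\<bar> \<le> (\<Sum>i<n. \<Sum>j<n. \<theta> i ^ a * \<theta> j ^ b)"
    unfolding sum2_def
    by (intro order_trans[OF sum_abs] sum_mono) (use assms \<theta>_nonneg in \<open>auto simp: abs_mult\<close>)
  then show ?thesis by (simp add: power_sum_def sum_product)
qed

lemma power_sum_le_s: "2 \<le> r \<Longrightarrow> power_sum r \<le> s\<^sup>2"
  using power_sum_antimono[of 2 r] s_sq by simp

lemma nrm_F3: "nrm F3 \<le> 58 * (q ^ 24 * s ^ 1)"
proof -
  have 1: "nrm (\<lambda>S. sum2 (\<lambda>i l. (\<Sum>j<n. of_bool (distinct [i, j, l]) * sg i j) * w i l S)) \<le> 2 * (1 * (q ^ 24 * s ^ 1))"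
  proof (rule edge2_q[of _ 1 16 1 0])
    fix i l assume "i < n" "l < n"
    then have "\<bar>sg i j\<bar> \<le> \<theta> i * \<theta> j" if "j < n" for j
      using sg_bounds[OF \<open>i < n\<close> that] by simp
    from sum_\<theta>_bool_le[OF this, of "\<lambda>j. distinct [i, j, l]"]
    show "\<bar>\<Sum>j<n. of_bool (distinct [i, j, l]) * sg i j\<bar> \<le> 1 * q ^ 16 * (\<theta> i ^ 1 * \<theta> l ^ 0)"
      using \<theta>_nonneg[OF \<open>i < n\<close>] by (simp add: mult_ac)
  qed (auto simp: exponent_defs)
  have 2: "nrm (\<lambda>S. sum2 (\<lambda>i j. sg i j * (\<theta> i)\<^sup>2)) \<le> q ^ 24 * s ^ 1"
  proof -
    have "\<bar>sum2 (\<lambda>i j. sg i j * (\<theta> i)\<^sup>2)\<bar> \<le> power_sum 3 * power_sum 1"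
    proof (rule sum2_const_le)
      fix i j assume "i < n" "j < n"
      from sg_bounds[OF this] show "\<bar>sg i j * (\<theta> i)\<^sup>2\<bar> \<le> \<theta> i ^ 3 * \<theta> j ^ 1"
        using mult_right_mono[of "sg i j" "\<theta> i * \<theta> j" "(\<theta> i)\<^sup>2"]
        by (simp add: abs_mult power2_eq_square power3_eq_cube mult_ac)
    qed
    also have "\<dots> \<le> s\<^sup>2 * q ^ 16" unfolding power_sum_1 using power_sum_le_s[of 3] by (intro mult_right_mono) auto
    also have "\<dots> = q ^ 16 * s ^ 2" by simp
    also have "\<dots> \<le> q ^ 24 * s ^ 1" by (rule monomial_mono) simp
    finally show ?thesis by simp
  qed
  have 3: "nrm (\<lambda>S. sum3 (\<lambda>i j l. kp i j * (w i j S * w i l S))) \<le> 6 * (1 * (q ^ 24 * s ^ 1))"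
    by (rule path3_first_q[of _ 1 0 0 0 0]) (auto simp: exponent_defs kp_le)
  have 4: "nrm (\<lambda>S. sum2 (\<lambda>i j. (kp i j * (\<theta> i)\<^sup>2) * w i j S)) \<le> 2 * (1 * (q ^ 24 * s ^ 1))"
    by (rule edge2_q[of _ 1 0 2 0]) (auto simp: exponent_defs abs_mult abs_kp_mult_le)
  have B32: "nrm B32 \<le> 11 * (q ^ 24 * s ^ 1)"
    unfolding B32_expand using nrm_diff_le[OF nrm_add_le[OF nrm_diff_le[OF 1 2] 3] 4] by linarith
  have 5: "nrm (\<lambda>S. sum3 (\<lambda>i j l. 1 * (w i j S * (w j l S * w i l S)))) \<le> 6 * (1 * (q ^ 24 * s ^ 1))"
    by (rule triangle_q[of _ 1 0 0 0 0]) (auto simp: exponent_defs)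
  have 6: "nrm (\<lambda>S. sum4 (\<lambda>i j l m. 1 * (w i j S * (w i l S * w j m S)))) \<le> 16 * (1 * (q ^ 24 * s ^ 1))"
    by (rule path4_both_q) auto
  have 7: "nrm (\<lambda>S. sum3 (\<lambda>i j l. (\<theta> j)\<^sup>2 * (w i j S * w i l S))) \<le> 6 * (1 * (q ^ 24 * s ^ 1))"
    by (rule path3_first_q[of _ 1 0 0 0 0]) (auto simp: exponent_defs \<theta>_pow_le_1)
  have 8: "nrm (\<lambda>S. sum3 (\<lambda>i j l. (\<theta> i)\<^sup>2 * (w i j S * w j l S))) \<le> 6 * (1 * (q ^ 24 * s ^ 1))"
    by (rule path3_q[of _ 1 0 0 0 0]) (auto simp: exponent_defs \<theta>_pow_le_1)
  have 9: "nrm (\<lambda>S. sum2 (\<lambda>i j. ((\<theta> i)\<^sup>2 * (\<theta> j)\<^sup>2) * w i j S)) \<le> 2 * (1 * (q ^ 24 * s ^ 1))"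
    by (rule edge2_q[of _ 1 0 2 2]) (auto simp: exponent_defs)
  have B34: "nrm B34 \<le> 36 * (q ^ 24 * s ^ 1)"
    unfolding B34_expand using nrm_add_le[OF nrm_diff_le[OF nrm_diff_le[OF nrm_add_le[OF 5 6] 7] 8] 9] by linarith
  have "nrm (\<lambda>S. 2 * B32 S) \<le> 2 * (11 * (q ^ 24 * s ^ 1))"
    using nrm_scale_le[OF B32, of 2] unfolding abs_numeral .
  from nrm_add_le[OF this B34] show ?thesis unfolding F3_def by linarith
qed

end

section \<open>The remainder as a function of the degree deviations\<close>

context null_model
begin

definition adj :: "(nat \<times> nat) set \<Rightarrow> nat \<Rightarrow> nat \<Rightarrow> real" where
  "adj S i j = of_bool (i \<noteq> j \<and> edge i j \<in> S)"

definition T :: "(nat \<times> nat) set \<Rightarrow> real" where "T S = sgnT n (adj S)"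

definition U :: "(nat \<times> nat) set \<Rightarrow> real" where
  "U S = sum3 (\<lambda>i j k. w i j S * w j k S * w k i S)"

definition node_degree :: "nat \<Rightarrow> (nat \<times> nat) set \<Rightarrow> real" where "node_degree i S = (\<Sum>j<n. adj S i j)"
definition V :: "(nat \<times> nat) set \<Rightarrow> real" where "V S = (\<Sum>i<n. node_degree i S)"

lemma adj_w: "i \<noteq> j \<Longrightarrow> adj S i j = w i j S + \<theta> i * \<theta> j"
  using p_edge[of i j] by (simp add: adj_def w_def W_def)

lemma adj_diag [simp]: "adj S i i = 0" by (simp add: adj_def)

lemma node_degree_nonneg: "0 \<le> node_degree i S" and V_nonneg: "0 \<le> V S"
  by (auto simp: node_degree_def V_def adj_def intro!: sum_nonneg)

lemma node_degree_eq:
  assumes "i < n" shows "node_degree i S = row_sum i S + \<theta> i * (power_sum 1 - \<theta> i)"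
proof -
  have "node_degree i S = (\<Sum>j<n. w i j S + \<theta> i * \<theta> j - (if j = i then (\<theta> i)\<^sup>2 else 0))"
    unfolding node_degree_def by (intro sum.cong refl) (auto simp: adj_w power2_eq_square)
  then show ?thesis
    using assms by (simp add: sum.distrib sum_subtractf row_sum_def power_sum_def sum_distrib_left power2_eq_square algebra_simps)
qed

lemma sum3_rot: "sum3 f = sum3 (\<lambda>i j k. f j k i)"
proof -
  have "sum3 (\<lambda>i j k. f j k i) = (\<Sum>i<n. \<Sum>j<n. \<Sum>k<n. of_bool (distinct [j, k, i]) * f j k i)"
    unfolding sum3_def by (intro sum.cong refl) auto
  also have "\<dots> = (\<Sum>j<n. \<Sum>i<n. \<Sum>k<n. of_bool (distinct [j, k, i]) * f j k i)" by (rule sum.swap)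
  also have "\<dots> = (\<Sum>j<n. \<Sum>k<n. \<Sum>i<n. of_bool (distinct [j, k, i]) * f j k i)" by (intro sum.cong refl sum.swap)
  finally show ?thesis by (simp add: sum3_def)
qed

lemma sum3_cmult: "sum3 (\<lambda>i j k. c * f i j k) = c * sum3 f"
  by (simp add: sum3_def sum_distrib_left mult_ac)
lemma sum2_cmult: "sum2 (\<lambda>i j. c * f i j) = c * sum2 f"
  by (simp add: sum2_def sum_distrib_left mult_ac)

lemma sgnT_sum3:
  "sgnT n B = sum3 (\<lambda>i j k. (B i j - eta_hat n B i * eta_hat n B j) * (B j k - eta_hat n B j * eta_hat n B k)
     * (B k i - eta_hat n B k * eta_hat n B i))" (is "_ = sum3 ?f")
proof -
  have "sum3 ?f = (\<Sum>(i, j, k)\<in>{..<n} \<times> {..<n} \<times> {..<n}. of_bool (distinct [i, j, k]) * ?f i j k)"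
    unfolding sum3_def by (simp add: sum.cartesian_product)
  also have "\<dots> = (\<Sum>(i, j, k) \<in> {(i, j, k). i < n \<and> j < n \<and> k < n \<and> i \<noteq> j \<and> j \<noteq> k \<and> k \<noteq> i}. ?f i j k)"
    by (rule sum.mono_neutral_cong_right) auto
  finally show ?thesis by (simp add: sgnT_def)
qed

text \<open>
  The total degree times the error in the estimated mean of the entry \<open>i, j\<close>.
\<close>
definition D :: "nat \<Rightarrow> nat \<Rightarrow> (nat \<times> nat) set \<Rightarrow> real" where
  "D i j S = V S * (\<theta> i * \<theta> j) - node_degree i S * node_degree j S"

lemma eta_hat_mult:
  assumes "0 < V S"
  shows "eta_hat n (adj S) i * eta_hat n (adj S) j = node_degree i S * node_degree j S / V S"
proof -
  have "V S powr (- 1 / 2) * V S powr (- 1 / 2) = V S powr (- 1)"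
    by (simp flip: powr_add)
  also have "\<dots> = 1 / V S" using assms by (simp add: powr_minus divide_inverse)
  finally have "V S powr (- 1 / 2) * V S powr (- 1 / 2) = 1 / V S" .
  moreover have "total_degree n (adj S) = V S" by (simp add: total_degree_def V_def node_degree_def)
  ultimately show ?thesis
    using assms by (simp add: eta_hat_def flip: node_degree_def) (metis (no_types, opaque_lifting) mult.assoc mult.left_commute mult_1 times_divide_eq_left)
qed

text \<open>
  The residual entries are \<open>w i j + D i j / V\<close>. Expanding the cyclic product gives eight sums,
  of which those with equally many factors \<open>D\<close> agree by rotation.
\<close>
lemma T_minus_U:
  assumes V: "0 < V S"
  shows "T S - U S = 3 * (1 / V S) * sum3 (\<lambda>i j k. w i j S * w j k S * D k i S)
     + 3 * (1 / V S)\<^sup>2 * sum3 (\<lambda>i j k. w i j S * D j k S * D k i S)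
     + (1 / V S) ^ 3 * sum3 (\<lambda>i j k. D i j S * D j k S * D k i S)"
proof -
  define a where "a = 1 / V S"
  have entry: "adj S i j - eta_hat n (adj S) i * eta_hat n (adj S) j = w i j S + a * D i j S" if "i \<noteq> j" for i j
    using V that by (simp add: eta_hat_mult adj_w D_def a_def field_simps)
  have alg: "(u + a * x) * (v + a * y) * (z + a * t) = u * v * z + a * (u * v * t) + a * (v * z * x) + a * (z * u * y)
     + a\<^sup>2 * (u * y * t) + a\<^sup>2 * (v * t * x) + a\<^sup>2 * (z * x * y) + a ^ 3 * (x * y * t)" for u v z x y t :: real
    by algebra
  have "T S = sum3 (\<lambda>i j k. (w i j S + a * D i j S) * (w j k S + a * D j k S) * (w k i S + a * D k i S))"
    unfolding T_def sgnT_sum3 by (intro sum3_cong) (auto simp: entry)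
  also have "\<dots> = U S + a * sum3 (\<lambda>i j k. w i j S * w j k S * D k i S)
      + a * sum3 (\<lambda>i j k. w j k S * w k i S * D i j S)
      + a * sum3 (\<lambda>i j k. w k i S * w i j S * D j k S)
      + a\<^sup>2 * sum3 (\<lambda>i j k. w i j S * D j k S * D k i S)
      + a\<^sup>2 * sum3 (\<lambda>i j k. w j k S * D k i S * D i j S)
      + a\<^sup>2 * sum3 (\<lambda>i j k. w k i S * D i j S * D j k S)
      + a ^ 3 * sum3 (\<lambda>i j k. D i j S * D j k S * D k i S)"
    unfolding alg sum3_add sum3_cmult U_def ..
  also have "sum3 (\<lambda>i j k. w j k S * w k i S * D i j S) = sum3 (\<lambda>i j k. w i j S * w j k S * D k i S)"
    by (subst (2) sum3_rot) simp
  also have "sum3 (\<lambda>i j k. w k i S * w i j S * D j k S) = sum3 (\<lambda>i j k. w i j S * w j k S * D k i S)"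
    by (subst sum3_rot) simp
  also have "sum3 (\<lambda>i j k. w j k S * D k i S * D i j S) = sum3 (\<lambda>i j k. w i j S * D j k S * D k i S)"
    by (subst (2) sum3_rot) simp
  also have "sum3 (\<lambda>i j k. w k i S * D i j S * D j k S) = sum3 (\<lambda>i j k. w i j S * D j k S * D k i S)"
    by (subst sum3_rot) simp
  finally show ?thesis by (simp add: a_def)
qed

lemma sum2_full: "sum2 f = (\<Sum>i<n. \<Sum>j<n. f i j) - (\<Sum>i<n. f i i)"
proof -
  have "sum2 f = (\<Sum>i<n. \<Sum>j<n. f i j - (if j = i then f i i else 0))"
    unfolding sum2_def by (intro sum.cong refl) auto
  then show ?thesis by (simp add: sum_subtractf)
qed

lemma sum2_edges: "sum2 f = (\<Sum>(a, b)\<in>edges. f a b + f b a)"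
proof -
  have U: "{(i, j). i < n \<and> j < n \<and> i \<noteq> j} = edges \<union> prod.swap ` edges" by (auto simp: edges_def image_iff)
  have disj: "edges \<inter> prod.swap ` edges = {}" by (auto simp: edges_def)
  have inj: "inj_on prod.swap edges" by (auto simp: inj_on_def)
  have "sum2 f = (\<Sum>(i, j)\<in>{..<n} \<times> {..<n}. of_bool (distinct [i, j]) * f i j)"
    unfolding sum2_def by (simp add: sum.cartesian_product)
  also have "\<dots> = (\<Sum>(i, j)\<in>{(i, j). i < n \<and> j < n \<and> i \<noteq> j}. f i j)"
    by (rule sum.mono_neutral_cong_right) auto
  also have "\<dots> = (\<Sum>(a, b)\<in>edges. f a b) + (\<Sum>(a, b)\<in>edges. f b a)"
    unfolding U using disj finite_edges by (simp add: sum.union_disjoint sum.reindex[OF inj] case_prod_unfold)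
  finally show ?thesis by (simp add: sum.distrib case_prod_unfold)
qed

lemma sum3_third:
  "sum3 (\<lambda>i j k. f i j * g i j k) = sum2 (\<lambda>i j. f i j * ((\<Sum>k<n. g i j k) - g i j i - g i j j))"
proof -
  have "(\<Sum>k<n. of_bool (distinct [i, j, k]) * g i j k) = (\<Sum>k<n. g i j k) - g i j i - g i j j"
    if "i < n" "j < n" "i \<noteq> j" for i j
  proof -
    have "(\<Sum>k<n. of_bool (distinct [i, j, k]) * g i j k) = (\<Sum>k<n. g i j k - (if k = i then g i j i else 0) - (if k = j then g i j j else 0))"
      using that by (intro sum.cong refl) auto
    then show ?thesis using that by (simp add: sum_subtractf)
  qed
  moreover have "sum3 (\<lambda>i j k. f i j * g i j k) = sum2 (\<lambda>i j. f i j * (\<Sum>k<n. of_bool (distinct [i, j, k]) * g i j k))"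
    unfolding sum3_sum2 by (simp add: sum_distrib_left mult_ac)
  ultimately show ?thesis by (simp cong: sum2_cong)
qed

lemma D_sym: "D i j S = D j i S"
  by (simp add: D_def mult_ac)

end

context large_model
begin

text \<open>
  The coefficients in the cyclic sums depend on the degree deviations only through three
  numbers: the total \<open>v\<close>, the inner product \<open>\<beta>\<close> with \<open>\<theta>\<close>, and the squared length \<open>\<gamma>\<close>.
\<close>
definition v :: "(nat \<times> nat) set \<Rightarrow> real" where "v S = (\<Sum>i<n. x i S)"
definition \<beta> :: "(nat \<times> nat) set \<Rightarrow> real" where "\<beta> S = (\<Sum>i<n. \<theta> i * x i S)"
definition \<gamma> :: "(nat \<times> nat) set \<Rightarrow> real" where "\<gamma> S = (\<Sum>i<n. (x i S)\<^sup>2)"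

lemma node_degree_x: "i < n \<Longrightarrow> node_degree i S = q ^ 16 * \<theta> i + x i S"
  unfolding node_degree_eq power_sum_1 x_def by (simp add: algebra_simps power2_eq_square)

lemma V_eq: "V S = q ^ 32 + v S"
proof -
  have "V S = q ^ 16 * power_sum 1 + v S"
    by (simp add: V_def node_degree_x v_def sum.distrib power_sum_def sum_distrib_left)
  then show ?thesis by (simp only: power_sum_1) (simp flip: power_add)
qed

lemma D_eq:
  assumes "i < n" "j < n"
  shows "D i j S = v S * (\<theta> i * \<theta> j) - q ^ 16 * (x i S * \<theta> j) - q ^ 16 * (\<theta> i * x j S) - x i S * x j S"
  unfolding D_def node_degree_x[OF assms(1)] node_degree_x[OF assms(2)] V_eq by (simp add: algebra_simps flip: power_add)

lemma Q1_eq: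
  "sum3 (\<lambda>i j k. w i j S * w j k S * D k i S) =
     v S * sum3 (\<lambda>i j k. \<theta> i * \<theta> k * (w i j S * w j k S))
   - 2 * q ^ 16 * sum3 (\<lambda>i j k. \<theta> k * x i S * (w i j S * w j k S))
   - sum3 (\<lambda>i j k. x i S * x k S * (w i j S * w j k S))"
proof -
  have "sum3 (\<lambda>i j k. w i j S * w j k S * D k i S) =
    sum3 (\<lambda>i j k. v S * (\<theta> i * \<theta> k * (w i j S * w j k S)) - q ^ 16 * (\<theta> i * x k S * (w i j S * w j k S))
      - q ^ 16 * (\<theta> k * x i S * (w i j S * w j k S)) - x i S * x k S * (w i j S * w j k S))"
    by (intro sum3_cong) (simp add: D_eq algebra_simps)
  also have "\<dots> = v S * sum3 (\<lambda>i j k. \<theta> i * \<theta> k * (w i j S * w j k S))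
     - q ^ 16 * sum3 (\<lambda>i j k. \<theta> i * x k S * (w i j S * w j k S))
     - q ^ 16 * sum3 (\<lambda>i j k. \<theta> k * x i S * (w i j S * w j k S))
     - sum3 (\<lambda>i j k. x i S * x k S * (w i j S * w j k S))"
    by (simp only: sum3_diff sum3_cmult)
  also have "sum3 (\<lambda>i j k. \<theta> i * x k S * (w i j S * w j k S)) = sum3 (\<lambda>i j k. \<theta> k * x i S * (w i j S * w j k S))"
  proof (subst sum3_rev, rule sum3_cong)
    fix i j k
    show "\<theta> k * x i S * (w k j S * w j i S) = \<theta> k * x i S * (w i j S * w j k S)"
      by (simp add: w_sym[of k j] w_sym[of j i])
  qed
  finally show ?thesis by simp
qed

text \<open>
  The square of the matrix \<open>D\<close>, written in the span of \<open>\<theta>\<close> and \<open>x\<close>.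
\<close>
lemma sum_D_D:
  assumes "i < n" "j < n"
  shows "(\<Sum>k<n. D j k S * D k i S) =
     (s\<^sup>2 * (v S)\<^sup>2 - 2 * q ^ 16 * (v S * \<beta> S) + q ^ 32 * \<gamma> S) * (\<theta> i * \<theta> j)
   + (q ^ 32 * \<beta> S + q ^ 16 * \<gamma> S - q ^ 16 * (s\<^sup>2 * v S) - v S * \<beta> S) * (\<theta> i * x j S + x i S * \<theta> j)
   + (q ^ 32 * s\<^sup>2 + 2 * q ^ 16 * \<beta> S + \<gamma> S) * (x i S * x j S)"
proof -
  (* in row \<open>i\<close>, the coefficients of \<open>\<theta>\<close> and of \<open>x\<close> *)
  define P R where "P i = v S * \<theta> i - q ^ 16 * x i S" and "R i = - (q ^ 16 * \<theta> i) - x i S" for i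
  have "(\<Sum>k<n. D j k S * D k i S) = (\<Sum>k<n. P j * P i * \<theta> k ^ 2 + (P j * R i + R j * P i) * (\<theta> k * x k S) + R j * R i * (x k S)\<^sup>2)"
  proof (intro sum.cong refl)
    fix k assume "k \<in> {..<n}"
    then have "D j k S = P j * \<theta> k + R j * x k S" "D k i S = P i * \<theta> k + R i * x k S"
      using assms by (auto simp: D_eq P_def R_def algebra_simps)
    then show "D j k S * D k i S = P j * P i * \<theta> k ^ 2 + (P j * R i + R j * P i) * (\<theta> k * x k S) + R j * R i * (x k S)\<^sup>2"
      by (simp add: algebra_simps power2_eq_square)
  qed
  also have "\<dots> = P j * P i * s\<^sup>2 + (P j * R i + R j * P i) * \<beta> S + R j * R i * \<gamma> S"
    by (simp add: sum.distrib \<beta>_def \<gamma>_def s_sq power_sum_def flip: sum_distrib_left)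
  finally show ?thesis unfolding P_def R_def by algebra
qed

definition B1 :: "(nat \<times> nat) set \<Rightarrow> real" where "B1 S = sum2 (\<lambda>i j. \<theta> i * \<theta> j * w i j S)"
definition B2 :: "(nat \<times> nat) set \<Rightarrow> real" where "B2 S = sum2 (\<lambda>i j. \<theta> i * x j S * w i j S)"
definition B3 :: "(nat \<times> nat) set \<Rightarrow> real" where "B3 S = sum2 (\<lambda>i j. x i S * x j S * w i j S)"

lemma Q2_eq:
  "sum3 (\<lambda>i j k. w i j S * D j k S * D k i S) =
     (s\<^sup>2 * (v S)\<^sup>2 - 2 * q ^ 16 * (v S * \<beta> S) + q ^ 32 * \<gamma> S) * B1 S
   + 2 * ((q ^ 32 * \<beta> S + q ^ 16 * \<gamma> S - q ^ 16 * (s\<^sup>2 * v S) - v S * \<beta> S) * B2 S)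
   + (q ^ 32 * s\<^sup>2 + 2 * q ^ 16 * \<beta> S + \<gamma> S) * B3 S
   - 2 * sum2 (\<lambda>i j. w i j S * D j j S * D i j S)"
proof -
  let ?c1 = "s\<^sup>2 * (v S)\<^sup>2 - 2 * q ^ 16 * (v S * \<beta> S) + q ^ 32 * \<gamma> S"
  let ?c2 = "q ^ 32 * \<beta> S + q ^ 16 * \<gamma> S - q ^ 16 * (s\<^sup>2 * v S) - v S * \<beta> S"
  let ?c3 = "q ^ 32 * s\<^sup>2 + 2 * q ^ 16 * \<beta> S + \<gamma> S"
  have "sum3 (\<lambda>i j k. w i j S * D j k S * D k i S) = sum3 (\<lambda>i j k. w i j S * (D j k S * D k i S))"
    by (simp add: mult.assoc)
  also have "\<dots> = sum2 (\<lambda>i j. ?c1 * (\<theta> i * \<theta> j * w i j S) + ?c2 * (\<theta> i * x j S * w i j S)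
      + ?c2 * (x i S * \<theta> j * w i j S) + ?c3 * (x i S * x j S * w i j S)
      - w i j S * D i i S * D i j S - w i j S * D j j S * D i j S)"
    unfolding sum3_third
  proof (rule sum2_cong)
    fix i j assume ij: "i < n" "j < n"
    show "w i j S * ((\<Sum>k<n. D j k S * D k i S) - D j i S * D i i S - D j j S * D j i S) =
      ?c1 * (\<theta> i * \<theta> j * w i j S) + ?c2 * (\<theta> i * x j S * w i j S)
      + ?c2 * (x i S * \<theta> j * w i j S) + ?c3 * (x i S * x j S * w i j S)
      - w i j S * D i i S * D i j S - w i j S * D j j S * D i j S"
      unfolding sum_D_D[OF ij] D_sym[of j i] by algebra
  qed
  also have "\<dots> = ?c1 * B1 S + ?c2 * B2 S + ?c2 * sum2 (\<lambda>i j. x i S * \<theta> j * w i j S) + ?c3 * B3 S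
      - sum2 (\<lambda>i j. w i j S * D i i S * D i j S) - sum2 (\<lambda>i j. w i j S * D j j S * D i j S)"
    by (simp only: sum2_add sum2_diff sum2_cmult B1_def B2_def B3_def)
  also have "sum2 (\<lambda>i j. w i j S * D i i S * D i j S) = sum2 (\<lambda>i j. w i j S * D j j S * D i j S)"
    by (rule sum2_swapped) (simp add: w_sym[of j i for i j] D_sym[of j i for i j])
  also have "sum2 (\<lambda>i j. x i S * \<theta> j * w i j S) = B2 S"
    unfolding B2_def by (rule sum2_swapped) (simp add: w_sym[of j i for i j])
  finally show ?thesis by (simp add: algebra_simps)
qed

text \<open>
  A matrix of rank at most two with trace \<open>t\<close> and second elementary symmetric function \<open>e\<close> of
  its eigenvalues has cubic trace \<open>t ^ 3 - 3 * t * e\<close>. For \<open>D\<close> these are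
  \<open>t = s\<^sup>2 * v - 2 * q ^ 16 * \<beta> - \<gamma>\<close> and \<open>e = - V * (s\<^sup>2 * \<gamma> - \<beta>\<^sup>2)\<close>. The two sums at the end
  remove coinciding indices.
\<close>
lemma Q3_eq:
  "sum3 (\<lambda>i j k. D i j S * D j k S * D k i S) =
     (s\<^sup>2 * v S - 2 * q ^ 16 * \<beta> S - \<gamma> S) ^ 3
   + 3 * (s\<^sup>2 * v S - 2 * q ^ 16 * \<beta> S - \<gamma> S) * V S * (s\<^sup>2 * \<gamma> S - (\<beta> S)\<^sup>2)
   - 3 * (\<Sum>i<n. \<Sum>j<n. (D i j S)\<^sup>2 * D j j S) + 2 * (\<Sum>i<n. (D i i S) ^ 3)"
proof -
  let ?c1 = "s\<^sup>2 * (v S)\<^sup>2 - 2 * q ^ 16 * (v S * \<beta> S) + q ^ 32 * \<gamma> S"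
  let ?c2 = "q ^ 32 * \<beta> S + q ^ 16 * \<gamma> S - q ^ 16 * (s\<^sup>2 * v S) - v S * \<beta> S"
  let ?c3 = "q ^ 32 * s\<^sup>2 + 2 * q ^ 16 * \<beta> S + \<gamma> S"
  have moments: "(\<Sum>i<n. \<theta> i ^ 2 * x i S ^ 0) = s\<^sup>2" "(\<Sum>i<n. \<theta> i ^ 1 * x i S ^ 1) = \<beta> S" "(\<Sum>i<n. \<theta> i ^ 0 * x i S ^ 2) = \<gamma> S"
    by (simp_all add: s_sq power_sum_def \<beta>_def \<gamma>_def)
  have "sum3 (\<lambda>i j k. D i j S * D j k S * D k i S) = sum3 (\<lambda>i j k. D i j S * (D j k S * D k i S))"
    by (simp add: mult.assoc)
  also have "\<dots> = (\<Sum>i<n. \<Sum>j<n. D i j S * (\<Sum>k<n. D j k S * D k i S) - (D i j S)\<^sup>2 * D i i S - (D i j S)\<^sup>2 * D j j S)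
       - (\<Sum>i<n. D i i S * (\<Sum>k<n. D i k S * D k i S) - 2 * (D i i S) ^ 3)"
    unfolding sum3_third sum2_full
  proof (intro arg_cong2[where f = "(-)"] sum.cong refl)
    show "D i j S * ((\<Sum>k<n. D j k S * D k i S) - D j i S * D i i S - D j j S * D j i S)
      = D i j S * (\<Sum>k<n. D j k S * D k i S) - (D i j S)\<^sup>2 * D i i S - (D i j S)\<^sup>2 * D j j S" for i j
      unfolding D_sym[of j i] by algebra
    show "D i i S * ((\<Sum>k<n. D i k S * D k i S) - D i i S * D i i S - D i i S * D i i S)
      = D i i S * (\<Sum>k<n. D i k S * D k i S) - 2 * (D i i S) ^ 3" for i
      by algebra
  qed
  also have "\<dots> = (\<Sum>i<n. \<Sum>j<n. D i j S * (\<Sum>k<n. D j k S * D k i S))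
      - (\<Sum>i<n. \<Sum>j<n. (D i j S)\<^sup>2 * D i i S) - (\<Sum>i<n. \<Sum>j<n. (D i j S)\<^sup>2 * D j j S)
      - (\<Sum>i<n. D i i S * (\<Sum>k<n. D i k S * D k i S)) + 2 * (\<Sum>i<n. (D i i S) ^ 3)"
    by (simp add: sum_subtractf sum_distrib_left)
  also have "(\<Sum>i<n. D i i S * (\<Sum>k<n. D i k S * D k i S)) = (\<Sum>i<n. \<Sum>j<n. (D i j S)\<^sup>2 * D i i S)"
    unfolding sum_distrib_left by (intro sum.cong refl) (simp add: D_sym[of j i for i j] power2_eq_square mult_ac)
  also have "(\<Sum>i<n. \<Sum>j<n. (D i j S)\<^sup>2 * D i i S) = (\<Sum>i<n. \<Sum>j<n. (D i j S)\<^sup>2 * D j j S)"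
    by (subst sum.swap) (simp add: D_sym[of j i for i j])
  also have "(\<Sum>i<n. \<Sum>j<n. D i j S * (\<Sum>k<n. D j k S * D k i S)) =
     (\<Sum>i<n. \<Sum>j<n. (v S * ?c1) * (\<theta> i ^ 2 * x i S ^ 0 * (\<theta> j ^ 2 * x j S ^ 0))
       + (v S * ?c2 - q ^ 16 * ?c1) * (\<theta> i ^ 2 * x i S ^ 0 * (\<theta> j ^ 1 * x j S ^ 1))
       + (v S * ?c2 - q ^ 16 * ?c1) * (\<theta> i ^ 1 * x i S ^ 1 * (\<theta> j ^ 2 * x j S ^ 0))
       + (v S * ?c3 - 2 * q ^ 16 * ?c2 - ?c1) * (\<theta> i ^ 1 * x i S ^ 1 * (\<theta> j ^ 1 * x j S ^ 1))
       + (- (q ^ 16) * ?c2) * (\<theta> i ^ 0 * x i S ^ 2 * (\<theta> j ^ 2 * x j S ^ 0))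
       + (- (q ^ 16) * ?c2) * (\<theta> i ^ 2 * x i S ^ 0 * (\<theta> j ^ 0 * x j S ^ 2))
       + (- (q ^ 16) * ?c3 - ?c2) * (\<theta> i ^ 0 * x i S ^ 2 * (\<theta> j ^ 1 * x j S ^ 1))
       + (- (q ^ 16) * ?c3 - ?c2) * (\<theta> i ^ 1 * x i S ^ 1 * (\<theta> j ^ 0 * x j S ^ 2))
       + (- ?c3) * (\<theta> i ^ 0 * x i S ^ 2 * (\<theta> j ^ 0 * x j S ^ 2)))"
  proof (intro sum.cong refl)
    fix i j assume "i \<in> {..<n}" "j \<in> {..<n}"
    then have ij: "i < n" "j < n" by auto
    define c1 c2 c3 where "c1 = ?c1" and "c2 = ?c2" and "c3 = ?c3"
    show "D i j S * (\<Sum>k<n. D j k S * D k i S) =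
       (v S * ?c1) * (\<theta> i ^ 2 * x i S ^ 0 * (\<theta> j ^ 2 * x j S ^ 0))
       + (v S * ?c2 - q ^ 16 * ?c1) * (\<theta> i ^ 2 * x i S ^ 0 * (\<theta> j ^ 1 * x j S ^ 1))
       + (v S * ?c2 - q ^ 16 * ?c1) * (\<theta> i ^ 1 * x i S ^ 1 * (\<theta> j ^ 2 * x j S ^ 0))
       + (v S * ?c3 - 2 * q ^ 16 * ?c2 - ?c1) * (\<theta> i ^ 1 * x i S ^ 1 * (\<theta> j ^ 1 * x j S ^ 1))
       + (- (q ^ 16) * ?c2) * (\<theta> i ^ 0 * x i S ^ 2 * (\<theta> j ^ 2 * x j S ^ 0))
       + (- (q ^ 16) * ?c2) * (\<theta> i ^ 2 * x i S ^ 0 * (\<theta> j ^ 0 * x j S ^ 2))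
       + (- (q ^ 16) * ?c3 - ?c2) * (\<theta> i ^ 0 * x i S ^ 2 * (\<theta> j ^ 1 * x j S ^ 1))
       + (- (q ^ 16) * ?c3 - ?c2) * (\<theta> i ^ 1 * x i S ^ 1 * (\<theta> j ^ 0 * x j S ^ 2))
       + (- ?c3) * (\<theta> i ^ 0 * x i S ^ 2 * (\<theta> j ^ 0 * x j S ^ 2))"
      unfolding sum_D_D[OF ij] D_eq[OF ij] c1_def[symmetric] c2_def[symmetric] c3_def[symmetric] by (simp, algebra)
  qed
  also have "\<dots> = v S * ?c1 * (s\<^sup>2 * s\<^sup>2) + 2 * (v S * ?c2 - q ^ 16 * ?c1) * (s\<^sup>2 * \<beta> S)
       + (v S * ?c3 - 2 * q ^ 16 * ?c2 - ?c1) * (\<beta> S * \<beta> S)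
       - 2 * q ^ 16 * ?c2 * (\<gamma> S * s\<^sup>2) + 2 * (- (q ^ 16) * ?c3 - ?c2) * (\<gamma> S * \<beta> S) - ?c3 * (\<gamma> S * \<gamma> S)"
    unfolding sum.distrib sum_sum_factor moments by algebra
  also have "\<dots> = (s\<^sup>2 * v S - 2 * q ^ 16 * \<beta> S - \<gamma> S) ^ 3
   + 3 * (s\<^sup>2 * v S - 2 * q ^ 16 * \<beta> S - \<gamma> S) * V S * (s\<^sup>2 * \<gamma> S - (\<beta> S)\<^sup>2)"
    unfolding V_eq by algebra
  finally show ?thesis by simp
qed

end

section \<open>Bounds on the event of typical degrees\<close>

context large_model
begin

text \<open>
  The summand \<open>q ^ 8 * sqrt (\<theta> i)\<close> bounds the standard deviation of the degree of \<open>i\<close>. The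
  summand one covers nodes whose expected degree is below one, where the degree is not
  sub-Gaussian at its standard deviation.
\<close>
definition \<rho> :: "nat \<Rightarrow> real" where "\<rho> i = 1 + q ^ 8 * sqrt (\<theta> i)"

definition good :: "(nat \<times> nat) set \<Rightarrow> bool" where
  "good S \<longleftrightarrow> \<bar>sum2 (\<lambda>i j. 1 * w i j S)\<bar> \<le> q * (2 * q ^ 16)
     \<and> \<bar>sum2 (\<lambda>i j. \<theta> i * w i j S)\<bar> \<le> q * (2 * (q ^ 8 * s))
     \<and> \<bar>B1 S\<bar> \<le> q * (2 * s ^ 2)
     \<and> (\<forall>i<n. \<bar>row_sum i S\<bar> \<le> q * \<rho> i)"

definition row_sq :: "nat \<Rightarrow> (nat \<times> nat) set \<Rightarrow> real" where "row_sq i S = (\<Sum>j<n. (w i j S)\<^sup>2)"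

lemma sum2_w: "sum2 (\<lambda>i j. c i * w i j S) = (\<Sum>i<n. c i * row_sum i S)"
  unfolding sum2_full by (simp add: row_sum_def sum_distrib_left)

lemma v_eq: "v S = sum2 (\<lambda>i j. 1 * w i j S) - s\<^sup>2"
  unfolding sum2_w by (simp add: v_def x_def sum_subtractf s_sq power_sum_def)

lemma \<beta>_eq: "\<beta> S = sum2 (\<lambda>i j. \<theta> i * w i j S) - power_sum 3"
  unfolding sum2_w by (simp add: \<beta>_def x_def right_diff_distrib sum_subtractf power_sum_def power2_eq_square power3_eq_cube mult_ac)

lemma monomial_const: "q ^ a * s ^ b \<le> q ^ c" if "a + 8 * b \<le> c"
  using monomial_mono[of a b 0 c] that by simp

lemma s2_le: "s\<^sup>2 \<le> q ^ 16" "s\<^sup>2 \<le> q ^ 8 * s"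
  using monomial_const[of 0 2 16] monomial_mono[of 0 2 1 8] by simp_all

lemma q_pow_mono: "a \<le> b \<Longrightarrow> q ^ a \<le> q ^ b"
  by (rule power_increasing) auto

lemma q_pow_ge_1 [simp]: "1 \<le> q ^ a"
  by (rule one_le_power) simp

lemma q_pow_ge: "a < b \<Longrightarrow> 100 * q ^ a \<le> q ^ b"
proof -
  assume "a < b"
  have "100 * q ^ a \<le> q ^ Suc a" using q_ge by simp
  also have "\<dots> \<le> q ^ b" using \<open>a < b\<close> by (intro q_pow_mono) simp
  finally show ?thesis .
qed

lemma row_sum_abs_le:
  assumes "i < n" shows "\<bar>row_sum i S\<bar> \<le> node_degree i S + q ^ 16 * \<theta> i"
proof -
  have "0 \<le> node_degree i S" by (rule node_degree_nonneg)
  moreover have "node_degree i S = row_sum i S + q ^ 16 * \<theta> i - (\<theta> i)\<^sup>2"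
    unfolding node_degree_eq[OF assms] power_sum_1 by (simp add: algebra_simps power2_eq_square)
  moreover have "(\<theta> i)\<^sup>2 \<le> q ^ 16 * \<theta> i"
    using \<theta>_le_1[OF assms] q_pow_ge_1[of 16] \<theta>_nonneg[OF assms] unfolding power2_eq_square
    by (intro mult_right_mono) (auto intro: order_trans)
  moreover have "0 \<le> (\<theta> i)\<^sup>2" by simp
  ultimately show ?thesis unfolding abs_le_iff by linarith
qed

text \<open>
  As entries are zero or one, a sum of squares of centred entries is controlled by the degree
  itself.
\<close>
lemma row_sq_le_node_degree:
  assumes "i < n" shows "row_sq i S \<le> node_degree i S + q ^ 16 * \<theta> i"
proof -
  have "(w i j S)\<^sup>2 \<le> adj S i j + \<theta> i * \<theta> j" if "j < n" for j
  proof (cases "i = j")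
    case True
    then show ?thesis using \<theta>_nonneg[OF assms] by simp
  next
    case False
    have "w i j S = adj S i j - \<theta> i * \<theta> j" using adj_w[OF False] by simp
    moreover have "0 \<le> \<theta> i * \<theta> j" "\<theta> i * \<theta> j \<le> 1" using \<theta>_nonneg p_le_1 assms that by auto
    moreover have "adj S i j = 0 \<or> adj S i j = 1" by (simp add: adj_def of_bool_def)
    moreover have "(a - p)\<^sup>2 \<le> a + p" if "a = 0 \<or> a = 1" "0 \<le> p" "p \<le> 1" for a p :: real
      using that mult_left_le[of p p] by (auto simp: power2_eq_square algebra_simps)
    ultimately show ?thesis by simp
  qed
  then have "row_sq i S \<le> (\<Sum>j<n. adj S i j + \<theta> i * \<theta> j)" unfolding row_sq_def by (intro sum_mono) auto
  also have "\<dots> = node_degree i S + \<theta> i * power_sum 1"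
    by (simp add: sum.distrib node_degree_def power_sum_def sum_distrib_left)
  finally show ?thesis by (simp only: power_sum_1 mult.commute)
qed

lemma row_sq_nonneg: "0 \<le> row_sq i S" by (simp add: row_sq_def sum_nonneg)

lemma row_sq_le:
  assumes "i < n" shows "row_sq i S \<le> \<bar>row_sum i S\<bar> + 2 * (q ^ 16 * \<theta> i)"
proof -
  have "node_degree i S = row_sum i S + q ^ 16 * \<theta> i - (\<theta> i)\<^sup>2"
    unfolding node_degree_eq[OF assms] power_sum_1 by (simp add: algebra_simps power2_eq_square)
  then show ?thesis using row_sq_le_node_degree[OF assms, of S] zero_le_power2[of "\<theta> i"] by linarith
qed

lemma sum_c_row_sum_sq:
  "(\<Sum>j<n. c j * (row_sum j S)\<^sup>2) = (\<Sum>j<n. c j * row_sq j S) + sum3 (\<lambda>i j k. c j * (w i j S * w j k S))"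
proof -
  have "c j * (row_sum j S)\<^sup>2 = (\<Sum>i<n. \<Sum>k<n. c j * (w i j S * w j k S))" for j
  proof -
    have "(row_sum j S)\<^sup>2 = (\<Sum>i<n. w i j S) * (\<Sum>k<n. w j k S)"
      unfolding row_sum_def power2_eq_square by (intro arg_cong2[where f = "(*)"] sum.cong refl fun_cong[OF w_sym])
    then show ?thesis unfolding sum_product by (simp only: sum_distrib_left)
  qed
  then have "(\<Sum>j<n. c j * (row_sum j S)\<^sup>2) = (\<Sum>j<n. \<Sum>i<n. \<Sum>k<n. c j * (w i j S * w j k S))" by simp
  also have "\<dots> = (\<Sum>j<n. \<Sum>i<n. \<Sum>k<n. (if k = i then c j * (w j i S)\<^sup>2 else 0) + of_bool (distinct [i, j, k]) * (c j * (w i j S * w j k S)))"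
    by (intro sum.cong refl) (auto simp: power2_eq_square w_sym)
  also have "\<dots> = (\<Sum>j<n. c j * row_sq j S) + (\<Sum>j<n. \<Sum>i<n. \<Sum>k<n. of_bool (distinct [i, j, k]) * (c j * (w i j S * w j k S)))"
    by (simp add: sum.distrib row_sq_def sum_distrib_left)
  also have "(\<Sum>j<n. \<Sum>i<n. \<Sum>k<n. of_bool (distinct [i, j, k]) * (c j * (w i j S * w j k S))) = sum3 (\<lambda>i j k. c j * (w i j S * w j k S))"
    unfolding sum3_def by (rule sum.swap)
  finally show ?thesis .
qed

lemma sum_row_sum_sq: "(\<Sum>j<n. (row_sum j S)\<^sup>2) = (\<Sum>i<n. row_sq i S) + F S"
  using sum_c_row_sum_sq[of "\<lambda>_. 1"] by (simp add: F_def)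

lemma \<rho>_ge_1: "i < n \<Longrightarrow> 1 \<le> \<rho> i" and \<rho>_le: "i < n \<Longrightarrow> \<rho> i \<le> 2 * q ^ 8"
  and \<rho>_sq_le: "i < n \<Longrightarrow> (\<rho> i)\<^sup>2 \<le> 2 * (1 + q ^ 16 * \<theta> i)"
proof -
  assume i: "i < n"
  let ?y = "q ^ 8 * sqrt (\<theta> i)"
  have y: "0 \<le> ?y" using \<theta>_nonneg[OF i] by simp
  then show "1 \<le> \<rho> i" by (simp add: \<rho>_def)
  have "sqrt (\<theta> i) \<le> 1" using \<theta>_le_1[OF i] by simp
  then have "?y \<le> q ^ 8" by (simp add: mult_left_le)
  then show "\<rho> i \<le> 2 * q ^ 8" using q_pow_ge_1[of 8] unfolding \<rho>_def by linarith
  have "?y\<^sup>2 = q ^ 16 * \<theta> i" using \<theta>_nonneg[OF i] by (simp add: power_mult_distrib flip: power_mult)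
  moreover have "2 * ?y \<le> 1 + ?y\<^sup>2" using zero_le_power2[of "?y - 1"] by (simp add: power2_diff)
  ultimately show "(\<rho> i)\<^sup>2 \<le> 2 * (1 + q ^ 16 * \<theta> i)"
    unfolding \<rho>_def by (simp add: power2_sum mult.commute)
qed

definition D_sq_sum :: "(nat \<times> nat) set \<Rightarrow> real" where "D_sq_sum S = (\<Sum>i<n. \<Sum>j<n. (D i j S)\<^sup>2)"
text \<open>
  This sum arises when the inequality \<open>2 * a * b \<le> a\<^sup>2 + b\<^sup>2\<close> is applied to the terms with
  coinciding indices, see \<open>sum2_wDD_le\<close>.
\<close>
definition X :: "(nat \<times> nat) set \<Rightarrow> real" where "X S = (\<Sum>j<n. row_sq j S * (D j j S)\<^sup>2)"

lemma D_sq_sum_le: "D_sq_sum S \<le> 4 * (s ^ 4 * (v S)\<^sup>2 + 2 * (q ^ 32 * s\<^sup>2 * \<gamma> S) + (\<gamma> S)\<^sup>2)"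
proof -
  have four: "(a - b - c - d)\<^sup>2 \<le> 4 * (a\<^sup>2 + b\<^sup>2 + c\<^sup>2 + d\<^sup>2)" for a b c d :: real
  proof -
    have "4 * (a\<^sup>2 + b\<^sup>2 + c\<^sup>2 + d\<^sup>2) - (a - b - c - d)\<^sup>2 =
      (a + b)\<^sup>2 + (a + c)\<^sup>2 + (a + d)\<^sup>2 + (b - c)\<^sup>2 + (b - d)\<^sup>2 + (c - d)\<^sup>2" by algebra
    then show ?thesis by (smt (verit) zero_le_power2)
  qed
  have "D_sq_sum S \<le> (\<Sum>i<n. \<Sum>j<n. 4 * ((v S * (\<theta> i * \<theta> j))\<^sup>2 + (q ^ 16 * (x i S * \<theta> j))\<^sup>2 + (q ^ 16 * (\<theta> i * x j S))\<^sup>2 + (x i S * x j S)\<^sup>2))"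
    unfolding D_sq_sum_def
  proof (intro sum_mono)
    fix i j assume "i \<in> {..<n}" "j \<in> {..<n}"
    then show "(D i j S)\<^sup>2 \<le> 4 * ((v S * (\<theta> i * \<theta> j))\<^sup>2 + (q ^ 16 * (x i S * \<theta> j))\<^sup>2 + (q ^ 16 * (\<theta> i * x j S))\<^sup>2 + (x i S * x j S)\<^sup>2)"
      using four[of "v S * (\<theta> i * \<theta> j)"] by (simp only: D_eq lessThan_iff)
  qed
  also have "\<dots> = (\<Sum>i<n. \<Sum>j<n. 4 * (v S)\<^sup>2 * ((\<theta> i)\<^sup>2 * (\<theta> j)\<^sup>2) + 4 * q ^ 32 * ((x i S)\<^sup>2 * (\<theta> j)\<^sup>2)
      + 4 * q ^ 32 * ((\<theta> i)\<^sup>2 * (x j S)\<^sup>2) + 4 * ((x i S)\<^sup>2 * (x j S)\<^sup>2))"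
    by (intro sum.cong refl) algebra
  also have "\<dots> = 4 * (v S)\<^sup>2 * (s\<^sup>2 * s\<^sup>2) + 4 * q ^ 32 * (\<gamma> S * s\<^sup>2) + 4 * q ^ 32 * (s\<^sup>2 * \<gamma> S) + 4 * (\<gamma> S * \<gamma> S)"
    unfolding sum.distrib sum_sum_factor s_sq power_sum_def \<gamma>_def ..
  also have "\<dots> = 4 * (s ^ 4 * (v S)\<^sup>2 + 2 * (q ^ 32 * s\<^sup>2 * \<gamma> S) + (\<gamma> S)\<^sup>2)" by algebra
  finally show ?thesis .
qed

lemma \<beta>_sq_le: "(\<beta> S)\<^sup>2 \<le> s\<^sup>2 * \<gamma> S"
proof -
  have "(\<beta> S)\<^sup>2 \<le> (\<Sum>i<n. (\<theta> i)\<^sup>2) * (\<Sum>i<n. (x i S)\<^sup>2)"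
    unfolding \<beta>_def by (rule Cauchy_Schwarz_ineq_sum)
  then show ?thesis by (simp add: s_sq power_sum_def \<gamma>_def)
qed

lemma \<gamma>_nonneg: "0 \<le> \<gamma> S" by (simp add: \<gamma>_def sum_nonneg)

lemma sum2_wDD_le: "\<bar>2 * sum2 (\<lambda>i j. w i j S * D j j S * D i j S)\<bar> \<le> X S + D_sq_sum S"
proof -
  have "\<bar>2 * sum2 (\<lambda>i j. w i j S * D j j S * D i j S)\<bar> = \<bar>\<Sum>i<n. \<Sum>j<n. 2 * (w i j S * D j j S * D i j S)\<bar>"
    unfolding sum2_full by (simp add: sum_distrib_left)
  also have "\<dots> \<le> (\<Sum>i<n. \<Sum>j<n. (w i j S)\<^sup>2 * (D j j S)\<^sup>2 + (D i j S)\<^sup>2)"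
  proof (intro order_trans[OF sum_abs] sum_mono)
    fix i j
    have "2 * (\<bar>w i j S * D j j S\<bar> * \<bar>D i j S\<bar>) \<le> \<bar>w i j S * D j j S\<bar>\<^sup>2 + \<bar>D i j S\<bar>\<^sup>2"
      using sum_squares_bound[of "\<bar>w i j S * D j j S\<bar>" "\<bar>D i j S\<bar>"] by simp
    then show "\<bar>2 * (w i j S * D j j S * D i j S)\<bar> \<le> (w i j S)\<^sup>2 * (D j j S)\<^sup>2 + (D i j S)\<^sup>2"
      by (simp add: abs_mult power_mult_distrib)
  qed
  also have "\<dots> = (\<Sum>j<n. \<Sum>i<n. (w j i S)\<^sup>2 * (D j j S)\<^sup>2) + D_sq_sum S"
    unfolding sum.distrib D_sq_sum_def by (subst sum.swap) (simp add: w_sym)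
  also have "\<dots> = X S + D_sq_sum S"
    by (simp add: X_def row_sq_def sum_distrib_right)
  finally show ?thesis .
qed

context
  fixes S assumes good: "good S"
begin

lemma v_le: "\<bar>v S\<bar> \<le> 3 * q ^ 17"
proof -
  have "q * (2 * q ^ 16) = 2 * q ^ 17" by algebra
  then have "\<bar>sum2 (\<lambda>i j. 1 * w i j S)\<bar> \<le> 2 * q ^ 17" using good by (simp add: good_def)
  moreover have "q ^ 16 \<le> q ^ 17" by (rule q_pow_mono) simp
  ultimately show ?thesis unfolding v_eq using s2_le(1) zero_le_power2[of s] unfolding abs_le_iff by linarith
qed

lemma \<beta>_le: "\<bar>\<beta> S\<bar> \<le> 3 * (q ^ 9 * s)"
proof -
  have "q * (2 * (q ^ 8 * s)) = 2 * (q ^ 9 * s)" by algebra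
  then have "\<bar>sum2 (\<lambda>i j. \<theta> i * w i j S)\<bar> \<le> 2 * (q ^ 9 * s)" using good unfolding good_def by metis
  moreover have "q ^ 8 * s \<le> q ^ 9 * s" by (intro mult_right_mono q_pow_mono) auto
  ultimately show ?thesis unfolding \<beta>_eq using s2_le(2) power_sum_le_s[of 3] power_sum_nonneg[of 3] unfolding abs_le_iff by linarith
qed

lemma B1_le: "\<bar>B1 S\<bar> \<le> 2 * (q * s\<^sup>2)"
  using good by (simp add: good_def mult_ac)

lemma row_sum_le: "i < n \<Longrightarrow> \<bar>row_sum i S\<bar> \<le> q * \<rho> i"
  using good by (simp add: good_def)

lemma x_le:
  assumes "i < n" shows "\<bar>x i S\<bar> \<le> 2 * (q * \<rho> i)"
proof -
  have "(\<theta> i)\<^sup>2 \<le> 1" using \<theta>_pow_le_1[OF assms] .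
  moreover have "1 * 1 \<le> q * \<rho> i" using \<rho>_ge_1[OF assms] by (intro mult_mono) auto
  ultimately show ?thesis using row_sum_le[OF assms] zero_le_power2[of "\<theta> i"] unfolding x_def abs_le_iff by linarith
qed

lemma V_bounds: "q ^ 32 / 2 \<le> V S" "V S \<le> 2 * q ^ 32"
  using v_le q_pow_ge[of 17 32] unfolding V_eq abs_le_iff by auto

lemma sum_row_sq_le: "(\<Sum>i<n. row_sq i S) \<le> 3 * q ^ 32"
proof -
  have "(\<Sum>i<n. row_sq i S) \<le> (\<Sum>i<n. node_degree i S + q ^ 16 * \<theta> i)"
    by (intro sum_mono row_sq_le_node_degree) auto
  also have "\<dots> = V S + q ^ 16 * power_sum 1"
    by (simp add: sum.distrib V_def power_sum_def sum_distrib_left)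
  also have "q ^ 16 * power_sum 1 = q ^ 32" unfolding power_sum_1 by (simp flip: power_add)
  finally show ?thesis using V_bounds by linarith
qed

text \<open>
  For a node of large expected degree the bound by \<open>\<rho>\<close> is proportional to \<open>\<theta> i\<close>. For the other
  nodes it is a multiple of \<open>q\<close>, and it is used for one factor only; the other factor is
  controlled by the degree of the node, and the degrees sum to \<open>V\<close>.
\<close>
lemma sum_row_sum_sq_le: "(\<Sum>i<n. (row_sum i S)\<^sup>2) \<le> 5 * q ^ 34"
proof -
  (* the two cases are \<open>\<rho> i \<le> 2\<close> and \<open>\<rho> i \<le> 2 * q ^ 8 * sqrt (\<theta> i)\<close> *)
  have one: "(row_sum i S)\<^sup>2 \<le> 2 * q * (node_degree i S + q ^ 16 * \<theta> i) + 4 * q\<^sup>2 * (q ^ 16 * \<theta> i)" if i: "i < n" for i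
  proof (cases "q ^ 8 * sqrt (\<theta> i) \<le> 1")
    case True
    have "q * \<rho> i \<le> 2 * q" using True mult_left_mono[of "\<rho> i" 2 q] by (simp add: \<rho>_def)
    then have "\<bar>row_sum i S\<bar> * \<bar>row_sum i S\<bar> \<le> 2 * q * (node_degree i S + q ^ 16 * \<theta> i)"
      by (intro mult_mono[OF order_trans[OF row_sum_le[OF i]] row_sum_abs_le[OF i]]) auto
    moreover have "0 \<le> 4 * q\<^sup>2 * (q ^ 16 * \<theta> i)" using \<theta>_nonneg[OF i] by simp
    ultimately show ?thesis unfolding abs_mult_self_eq power2_eq_square[of "row_sum i S"] by linarith
  next
    case False
    have "\<bar>row_sum i S\<bar>\<^sup>2 \<le> (q * (2 * (q ^ 8 * sqrt (\<theta> i))))\<^sup>2"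
      using False by (intro power_mono order_trans[OF row_sum_le[OF i]] mult_left_mono) (auto simp: \<rho>_def mult.commute)
    also have "\<dots> = 4 * q\<^sup>2 * (q ^ 16 * \<theta> i)"
      using \<theta>_nonneg[OF i] by (simp add: power_mult_distrib flip: power_mult)
    finally show ?thesis using node_degree_nonneg[of i S] \<theta>_nonneg[OF i] by (simp add: add_increasing)
  qed
  have "(\<Sum>i<n. (row_sum i S)\<^sup>2) \<le> (\<Sum>i<n. 2 * q * (node_degree i S + q ^ 16 * \<theta> i) + 4 * q\<^sup>2 * (q ^ 16 * \<theta> i))"
    using one by (intro sum_mono) auto
  also have "\<dots> = 2 * q * (V S + q ^ 16 * power_sum 1) + 4 * q\<^sup>2 * (q ^ 16 * power_sum 1)"
    by (simp add: sum.distrib V_def power_sum_def sum_distrib_left distrib_left)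
  also have "q ^ 16 * power_sum 1 = q ^ 32" unfolding power_sum_1 by (simp flip: power_add)
  also have "2 * q * (V S + q ^ 32) + 4 * q\<^sup>2 * q ^ 32 \<le> 2 * q * (2 * q ^ 32 + q ^ 32) + 4 * q\<^sup>2 * q ^ 32"
    using V_bounds by (intro add_right_mono mult_left_mono) auto
  also have "\<dots> = 6 * q ^ 33 + 4 * q ^ 34" by algebra
  also have "\<dots> \<le> 5 * q ^ 34"
  proof -
    have "100 * q ^ 33 \<le> q ^ 34" by (rule q_pow_ge) simp
    then show ?thesis using q_pow_ge_1[of 33] by linarith
  qed
  finally show ?thesis .
qed

lemma F_le: "\<bar>F S\<bar> \<le> 5 * q ^ 34"
proof -
  have "0 \<le> (\<Sum>i<n. (row_sum i S)\<^sup>2)" "0 \<le> (\<Sum>i<n. row_sq i S)" by (auto intro!: sum_nonneg row_sq_nonneg)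
  then show ?thesis
    using sum_row_sum_sq[of S] sum_row_sum_sq_le sum_row_sq_le q_pow_ge[of 32 34] unfolding abs_le_iff by simp
qed

lemma \<gamma>_row_sum: "\<gamma> S \<le> 2 * (\<Sum>i<n. (row_sum i S)\<^sup>2) + 2 * q ^ 16"
proof -
  have "(x i S)\<^sup>2 \<le> 2 * (row_sum i S)\<^sup>2 + 2 * \<theta> i ^ 4" for i
    using zero_le_power2[of "row_sum i S + (\<theta> i)\<^sup>2"] by (simp add: x_def power2_diff power2_sum flip: power_mult)
  then have "\<gamma> S \<le> (\<Sum>i<n. 2 * (row_sum i S)\<^sup>2 + 2 * \<theta> i ^ 4)" unfolding \<gamma>_def by (rule sum_mono)
  also have "\<dots> = 2 * (\<Sum>i<n. (row_sum i S)\<^sup>2) + 2 * power_sum 4" by (simp add: sum.distrib power_sum_def sum_distrib_left)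
  also have "\<dots> \<le> 2 * (\<Sum>i<n. (row_sum i S)\<^sup>2) + 2 * q ^ 16" using power_sum_le_s[of 4] s2_le(1) by simp
  finally show ?thesis .
qed

lemma \<gamma>_le: "\<gamma> S \<le> 11 * q ^ 34"
proof -
  have "100 * q ^ 16 \<le> q ^ 34" by (rule q_pow_ge) simp
  then show ?thesis using \<gamma>_row_sum sum_row_sum_sq_le q_pow_ge_1[of 16] by linarith
qed

text \<open>
  Sharper than \<open>\<gamma>_le\<close> by a factor \<open>q\<^sup>2\<close>, apart from the multiple of \<open>F\<close>, which is small in
  \<open>L\<^sup>2\<close>. In a product of several such quantities this form is used for one of them and the crude
  form for the others.
\<close>
lemma \<gamma>_le_F: "\<gamma> S \<le> 8 * q ^ 32 + 2 * \<bar>F S\<bar>"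
proof -
  have "100 * q ^ 16 \<le> q ^ 32" by (rule q_pow_ge) simp
  then show ?thesis using \<gamma>_row_sum sum_row_sum_sq[of S] sum_row_sq_le q_pow_ge_1[of 16] by linarith
qed

lemma F_sq_le: "(F S)\<^sup>2 \<le> 5 * q ^ 34 * \<bar>F S\<bar>"
  using mult_right_mono[OF F_le abs_ge_zero[of "F S"]] by (simp add: power2_eq_square flip: abs_mult)

lemma \<gamma>_sq_le: "(\<gamma> S)\<^sup>2 \<le> 128 * q ^ 64 + 40 * q ^ 34 * \<bar>F S\<bar>"
proof -
  have "(\<gamma> S)\<^sup>2 \<le> (8 * q ^ 32 + 2 * \<bar>F S\<bar>)\<^sup>2" using \<gamma>_le_F \<gamma>_nonneg by (intro power_mono) auto
  also have "\<dots> \<le> 2 * ((8 * q ^ 32)\<^sup>2 + (2 * \<bar>F S\<bar>)\<^sup>2)"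
    using sum_squares_bound[of "8 * q ^ 32" "2 * \<bar>F S\<bar>"] by (simp add: power2_sum)
  also have "\<dots> = 128 * q ^ 64 + 8 * (F S)\<^sup>2" by (simp add: power_mult_distrib flip: power_mult)
  finally show ?thesis using F_sq_le by linarith
qed

lemma \<gamma>_cube_le: "(\<gamma> S) ^ 3 \<le> 2048 * q ^ 96 + 1600 * q ^ 68 * \<bar>F S\<bar>"
proof -
  have "(\<gamma> S) ^ 3 = (\<gamma> S)\<^sup>2 * \<gamma> S" by algebra
  also have "\<dots> \<le> (128 * q ^ 64 + 40 * q ^ 34 * \<bar>F S\<bar>) * (8 * q ^ 32 + 2 * \<bar>F S\<bar>)"
    using \<gamma>_nonneg by (intro mult_mono \<gamma>_sq_le \<gamma>_le_F) auto
  also have "\<dots> = 1024 * q ^ 96 + (256 * q ^ 64 + 320 * q ^ 66) * \<bar>F S\<bar> + 80 * q ^ 34 * (\<bar>F S\<bar> * \<bar>F S\<bar>)" by algebra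
  also have "\<dots> \<le> 1024 * q ^ 96 + (256 * q ^ 64 + 320 * q ^ 66) * \<bar>F S\<bar> + 80 * q ^ 34 * (5 * q ^ 34 * \<bar>F S\<bar>)"
    using F_sq_le by (intro add_left_mono mult_left_mono) (auto simp: power2_eq_square)
  also have "1024 * q ^ 96 + (256 * q ^ 64 + 320 * q ^ 66) * \<bar>F S\<bar> + 80 * q ^ 34 * (5 * q ^ 34 * \<bar>F S\<bar>)
     = 1024 * q ^ 96 + (256 * q ^ 64 + 320 * q ^ 66 + 400 * q ^ 68) * \<bar>F S\<bar>" by algebra
  also have "\<dots> \<le> 2048 * q ^ 96 + 1600 * q ^ 68 * \<bar>F S\<bar>"
  proof (intro add_mono mult_right_mono)
    have "q ^ 64 \<le> q ^ 68" "q ^ 66 \<le> q ^ 68" by (auto intro!: q_pow_mono)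
    then show "256 * q ^ 64 + 320 * q ^ 66 + 400 * q ^ 68 \<le> 1600 * q ^ 68"
      using q_pow_ge_1[of 68] by linarith
  qed auto
  finally show ?thesis .
qed

lemma D_sq_sum_le_F: "D_sq_sum S \<le> 700 * (q ^ 64 * s\<^sup>2) + 200 * (q ^ 34 * s\<^sup>2) * \<bar>F S\<bar>"
proof -
  have "\<bar>v S\<bar>\<^sup>2 \<le> (3 * q ^ 17)\<^sup>2" by (intro power_mono v_le) auto
  then have "s ^ 4 * (v S)\<^sup>2 \<le> s ^ 4 * (9 * q ^ 34)"
    by (intro mult_left_mono) (auto simp: power_mult_distrib simp flip: power_mult)
  also have "\<dots> \<le> 9 * (q ^ 64 * s\<^sup>2)" using monomial_mono[of 34 4 2 64] by (simp add: mult_ac)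
  finally have 1: "s ^ 4 * (v S)\<^sup>2 \<le> 9 * (q ^ 64 * s\<^sup>2)" .
  have "q ^ 32 * s\<^sup>2 * \<gamma> S \<le> q ^ 32 * s\<^sup>2 * (8 * q ^ 32 + 2 * \<bar>F S\<bar>)"
    by (intro mult_left_mono \<gamma>_le_F) auto
  also have "\<dots> = 8 * (q ^ 64 * s\<^sup>2) + 2 * (q ^ 32 * s\<^sup>2) * \<bar>F S\<bar>" by algebra
  finally have 2: "q ^ 32 * s\<^sup>2 * \<gamma> S \<le> 8 * (q ^ 64 * s\<^sup>2) + 2 * (q ^ 32 * s\<^sup>2) * \<bar>F S\<bar>" .
  have 3: "q ^ 32 * s\<^sup>2 * \<bar>F S\<bar> \<le> q ^ 34 * s\<^sup>2 * \<bar>F S\<bar>"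
    by (intro mult_right_mono q_pow_mono) auto
  have 4: "q ^ 34 * \<bar>F S\<bar> \<le> q ^ 34 * s\<^sup>2 * \<bar>F S\<bar>"
    using monomial_mono[of 34 0 2 34] by (intro mult_right_mono) auto
  have 5: "q ^ 64 \<le> q ^ 64 * s\<^sup>2" using monomial_mono[of 64 0 2 64] by simp
  define M N where "M = q ^ 64 * s\<^sup>2" and "N = q ^ 34 * s\<^sup>2 * \<bar>F S\<bar>"
  have pos: "0 \<le> M" "0 \<le> N" by (auto simp: M_def N_def)
  have 6: "q ^ 32 * s\<^sup>2 * \<gamma> S \<le> 8 * M + 2 * N" using 2 3 by (simp add: M_def N_def)
  have 7: "(\<gamma> S)\<^sup>2 \<le> 128 * M + 40 * N" using \<gamma>_sq_le 4 5 by (simp add: M_def N_def)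
  have "D_sq_sum S \<le> 4 * (9 * M + 2 * (8 * M + 2 * N) + (128 * M + 40 * N))"
    using 1 6 7 by (intro order_trans[OF D_sq_sum_le] mult_left_mono add_mono) (auto simp: M_def)
  also have "\<dots> = 612 * M + 176 * N" by (simp add: algebra_simps)
  also have "\<dots> \<le> 700 * M + 200 * N" using pos by (intro add_mono mult_right_mono) auto
  finally have "D_sq_sum S \<le> 700 * M + 200 * N" .
  then show ?thesis by (simp add: M_def N_def)
qed

lemma D_sq_sum_le_const: "D_sq_sum S \<le> 700 * (q ^ 68 * s\<^sup>2)"
proof -
  have "\<bar>v S\<bar>\<^sup>2 \<le> (3 * q ^ 17)\<^sup>2" by (intro power_mono v_le) auto
  then have "s ^ 4 * (v S)\<^sup>2 \<le> s ^ 4 * (9 * q ^ 34)"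
    by (intro mult_left_mono) (auto simp: power_mult_distrib simp flip: power_mult)
  also have "\<dots> \<le> 9 * (q ^ 68 * s\<^sup>2)" using monomial_mono[of 34 4 2 68] by (simp add: mult_ac)
  finally have 1: "s ^ 4 * (v S)\<^sup>2 \<le> 9 * (q ^ 68 * s\<^sup>2)" .
  have "q ^ 32 * s\<^sup>2 * \<gamma> S \<le> q ^ 32 * s\<^sup>2 * (11 * q ^ 34)"
    by (intro mult_left_mono \<gamma>_le) auto
  also have "\<dots> = 11 * (q ^ 66 * s\<^sup>2)" by algebra
  also have "\<dots> \<le> 11 * (q ^ 68 * s\<^sup>2)" using monomial_mono[of 66 2 2 68] by simp
  finally have 2: "q ^ 32 * s\<^sup>2 * \<gamma> S \<le> 11 * (q ^ 68 * s\<^sup>2)" .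
  have "(\<gamma> S)\<^sup>2 \<le> (11 * q ^ 34)\<^sup>2" by (intro power_mono \<gamma>_le \<gamma>_nonneg)
  also have "\<dots> = 121 * q ^ 68" by (simp add: power_mult_distrib flip: power_mult)
  also have "\<dots> \<le> 121 * (q ^ 68 * s\<^sup>2)" using monomial_mono[of 68 0 2 68] by simp
  finally have 3: "(\<gamma> S)\<^sup>2 \<le> 121 * (q ^ 68 * s\<^sup>2)" .
  define M where "M = q ^ 68 * s\<^sup>2"
  have "D_sq_sum S \<le> 4 * (9 * M + 2 * (11 * M) + 121 * M)"
    using 1 2 3 by (intro order_trans[OF D_sq_sum_le] mult_left_mono add_mono) (auto simp: M_def)
  also have "\<dots> = 608 * M" by (simp add: algebra_simps)
  also have "\<dots> \<le> 700 * M" by (intro mult_right_mono) (auto simp: M_def)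
  finally have "D_sq_sum S \<le> 700 * M" .
  then show ?thesis by (simp add: M_def)
qed

lemma x_le_const: "i < n \<Longrightarrow> \<bar>x i S\<bar> \<le> 4 * q ^ 9"
proof -
  assume i: "i < n"
  have "2 * (q * \<rho> i) \<le> 2 * (q * (2 * q ^ 8))" by (intro mult_left_mono \<rho>_le i) auto
  also have "\<dots> = 4 * q ^ 9" by algebra
  finally show ?thesis using x_le[OF i] by linarith
qed

lemma Dii_le:
  assumes i: "i < n" shows "\<bar>D i i S\<bar> \<le> 27 * q ^ 25"
proof -
  have th: "\<bar>\<theta> i\<bar> \<le> 1" using \<theta>_nonneg[OF i] \<theta>_le_1[OF i] by simp
  have 1: "\<bar>v S * (\<theta> i * \<theta> i)\<bar> \<le> 3 * q ^ 17 * (1 * 1)"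
    unfolding abs_mult by (intro mult_mono v_le th) auto
  have 2: "\<bar>q ^ 16 * (x i S * \<theta> i)\<bar> \<le> q ^ 16 * (4 * q ^ 9 * 1)"
    unfolding abs_mult by (intro mult_mono x_le_const[OF i] th) auto
  have 3: "\<bar>x i S * x i S\<bar> \<le> 4 * q ^ 9 * (4 * q ^ 9)"
    unfolding abs_mult by (intro mult_mono x_le_const[OF i]) auto
  have 4: "q ^ 16 * (4 * q ^ 9 * 1) = 4 * q ^ 25" "4 * q ^ 9 * (4 * q ^ 9) = 16 * q ^ 18" by algebra+
  have 5: "D i i S = v S * (\<theta> i * \<theta> i) - 2 * (q ^ 16 * (x i S * \<theta> i)) - x i S * x i S"
    by (simp add: D_eq[OF i i] algebra_simps)
  show ?thesis using 1 2 3 q_pow_mono[of 17 25] q_pow_mono[of 18 25] unfolding 4 5 by linarith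
qed

end

end

section \<open>The cyclic sums on the event of typical degrees\<close>

context large_model
begin

definition F5 :: "(nat \<times> nat) set \<Rightarrow> real" where
  "F5 S = sum3 (\<lambda>i j k. \<theta> j ^ 3 * (w i j S * w j k S))"

lemma nrm_F5: "nrm F5 \<le> 6 * (q ^ 16 * s ^ 1)"
  unfolding F5_def by (rule path3_q[of _ 1 0 0 3 0, unfolded mult_1]) (auto simp: exponent_defs \<theta>_nonneg)

lemma nrm_B1: "nrm B1 \<le> 2 * (q ^ 0 * s ^ 2)"
  unfolding B1_def by (rule edge2_q[of _ 1 0 1 1, unfolded mult_1]) (auto simp: exponent_defs \<theta>_nonneg)

lemma nrm_v: "nrm v \<le> 3 * (q ^ 16 * s ^ 0)"
proof -
  have 1: "nrm (\<lambda>S. sum2 (\<lambda>i j. 1 * w i j S)) \<le> 2 * (1 * (q ^ 16 * s ^ 0))"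
    by (rule edge2_q[of _ 1 0 0 0]) (auto simp: exponent_defs)
  have 2: "nrm (\<lambda>S. s\<^sup>2) \<le> q ^ 16" using s2_le(1) by simp
  have "nrm v = nrm (\<lambda>S. sum2 (\<lambda>i j. 1 * w i j S) - s\<^sup>2)" by (rule nrm_cong) (rule v_eq)
  then show ?thesis using nrm_diff_le[OF 1 2] by simp
qed

lemma nrm_\<beta>: "nrm \<beta> \<le> 3 * (q ^ 8 * s ^ 1)"
proof -
  have 1: "nrm (\<lambda>S. sum2 (\<lambda>i j. \<theta> i * w i j S)) \<le> 2 * (1 * (q ^ 8 * s ^ 1))"
    by (rule edge2_q[of _ 1 0 1 0]) (auto simp: exponent_defs \<theta>_nonneg)
  have 2: "nrm (\<lambda>S. power_sum 3) \<le> q ^ 8 * s" using s2_le(2) power_sum_le_s[of 3] by simp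
  have "nrm \<beta> = nrm (\<lambda>S. sum2 (\<lambda>i j. \<theta> i * w i j S) - power_sum 3)" by (rule nrm_cong) (rule \<beta>_eq)
  then show ?thesis using nrm_diff_le[OF 1 2] by (simp add: mult.commute)
qed

lemma lin2_le:
  assumes "good S"
  shows "0 \<le> sum2 (\<lambda>i j. \<theta> i * (w i j S)\<^sup>2)" "sum2 (\<lambda>i j. \<theta> i * (w i j S)\<^sup>2) \<le> 5 * (q ^ 16 * s\<^sup>2)"
proof -
  have eq: "sum2 (\<lambda>i j. \<theta> i * (w i j S)\<^sup>2) = (\<Sum>i<n. \<theta> i * row_sq i S)"
    unfolding sum2_full by (simp add: row_sq_def sum_distrib_left)
  show "0 \<le> sum2 (\<lambda>i j. \<theta> i * (w i j S)\<^sup>2)"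
    unfolding eq by (intro sum_nonneg mult_nonneg_nonneg row_sq_nonneg \<theta>_nonneg) auto
  have "(\<Sum>i<n. \<theta> i * row_sq i S) \<le> (\<Sum>i<n. \<theta> i * (node_degree i S + q ^ 16 * \<theta> i))"
    by (intro sum_mono mult_left_mono row_sq_le_node_degree \<theta>_nonneg) auto
  also have "\<dots> = (\<Sum>i<n. 2 * q ^ 16 * (\<theta> i)\<^sup>2 + \<theta> i * x i S)"
    by (intro sum.cong refl) (simp add: node_degree_x algebra_simps power2_eq_square)
  also have "\<dots> = 2 * q ^ 16 * s\<^sup>2 + \<beta> S"
    by (simp add: sum.distrib \<beta>_def s_sq power_sum_def sum_distrib_left)
  also have "\<dots> \<le> 2 * (q ^ 16 * s\<^sup>2) + 3 * (q ^ 16 * s\<^sup>2)"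
  proof -
    have "q ^ 9 * s ^ 1 \<le> q ^ 16 * s ^ 2" by (rule monomial_mono) simp
    then show ?thesis using \<beta>_le[OF assms] unfolding abs_le_iff mult.assoc power_one_right by linarith
  qed
  finally show "sum2 (\<lambda>i j. \<theta> i * (w i j S)\<^sup>2) \<le> 5 * (q ^ 16 * s\<^sup>2)" unfolding eq by linarith
qed

lemma lin3_le:
  assumes "good S"
  shows "\<bar>sum2 (\<lambda>i j. (w i j S) ^ 3)\<bar> \<le> 3 * q ^ 32"
proof -
  have "\<bar>sum2 (\<lambda>i j. (w i j S) ^ 3)\<bar> \<le> (\<Sum>i<n. \<Sum>j<n. (w i j S)\<^sup>2)"
    unfolding sum2_def
  proof (intro order_trans[OF sum_abs] sum_mono)
    fix i j assume "i \<in> {..<n}" "j \<in> {..<n}"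
    then have "(w i j S)\<^sup>2 * \<bar>w i j S\<bar> \<le> (w i j S)\<^sup>2"
      using w_le_1[of i j S] by (intro mult_left_le) auto
    then show "\<bar>of_bool (distinct [i, j]) * w i j S ^ 3\<bar> \<le> (w i j S)\<^sup>2"
      by (auto simp: abs_mult power3_eq_cube power2_eq_square)
  qed
  then show ?thesis using sum_row_sq_le[OF assms] by (simp add: row_sq_def)
qed

lemma abs_mult_le: "\<bar>a\<bar> \<le> A \<Longrightarrow> \<bar>b\<bar> \<le> B \<Longrightarrow> \<bar>a * b\<bar> \<le> A * B" for a b A B :: real
  unfolding abs_mult by (intro mult_mono) auto

text \<open>
  A bound of the kind used for all cyclic sums: each summand is a deterministic monomial times
  one random variable whose \<open>L\<^sup>2\<close> norm is known, and the constant is of order \<open>V * s\<^sup>2\<close>, which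
  is the final order after division by \<open>V\<close>.
\<close>
lemma Q1_le:
  assumes g: "good S"
  shows "\<bar>sum3 (\<lambda>i j k. w i j S * w j k S * D k i S)\<bar> \<le>
     3 * (q ^ 17 * s ^ 0) * \<bar>A1 S\<bar> + 2 * (q ^ 16 * s ^ 0) * \<bar>A2 S\<bar> + 2 * (q ^ 0 * s ^ 0) * \<bar>A32 S\<bar> + 1 * (q ^ 0 * s ^ 0) * \<bar>A34 S\<bar>
      + 2 * (q ^ 0 * s ^ 0) * \<bar>F S\<bar> + 14 * (q ^ 32 * s ^ 2)"
proof -
  let ?P = "sum3 (\<lambda>i j k. (w i j S)\<^sup>2 * (w j k S)\<^sup>2)"
  have "?P \<le> (\<Sum>j<n. (row_sq j S)\<^sup>2)"
  proof -
    have "?P \<le> (\<Sum>i<n. \<Sum>j<n. \<Sum>k<n. (w i j S)\<^sup>2 * (w j k S)\<^sup>2)"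
      unfolding sum3_def by (intro sum_mono) auto
    also have "\<dots> = (\<Sum>j<n. \<Sum>i<n. \<Sum>k<n. (w j i S)\<^sup>2 * (w j k S)\<^sup>2)"
      by (subst sum.swap) (intro sum.cong refl, simp add: w_sym)
    finally show ?thesis by (simp add: row_sq_def power2_eq_square[of "\<Sum>k<n. _ k"] sum_product)
  qed
  also have "\<dots> \<le> (\<Sum>j<n. 2 * (row_sum j S)\<^sup>2 + 8 * q ^ 32 * (\<theta> j)\<^sup>2)"
  proof (intro sum_mono)
    fix j assume "j \<in> {..<n}"
    then have "(row_sq j S)\<^sup>2 \<le> (\<bar>row_sum j S\<bar> + 2 * (q ^ 16 * \<theta> j))\<^sup>2"
      by (intro power_mono row_sq_le row_sq_nonneg) auto
    also have "\<dots> \<le> 2 * (\<bar>row_sum j S\<bar>\<^sup>2 + (2 * (q ^ 16 * \<theta> j))\<^sup>2)"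
      using sum_squares_bound[of "\<bar>row_sum j S\<bar>" "2 * (q ^ 16 * \<theta> j)"] by (simp add: power2_sum)
    also have "\<dots> = 2 * (row_sum j S)\<^sup>2 + 8 * q ^ 32 * (\<theta> j)\<^sup>2"
      by (simp add: power_mult_distrib flip: power_mult)
    finally show "(row_sq j S)\<^sup>2 \<le> 2 * (row_sum j S)\<^sup>2 + 8 * q ^ 32 * (\<theta> j)\<^sup>2" .
  qed
  also have "\<dots> = 2 * (\<Sum>j<n. (row_sum j S)\<^sup>2) + 8 * q ^ 32 * s\<^sup>2"
    by (simp add: sum.distrib sum_distrib_left s_sq power_sum_def)
  also have "\<dots> \<le> 2 * (3 * q ^ 32 + \<bar>F S\<bar>) + 8 * q ^ 32 * s\<^sup>2"
    unfolding sum_row_sum_sq using sum_row_sq_le[OF g] by (intro add_right_mono mult_left_mono add_mono) auto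
  finally have P: "?P \<le> 2 * (3 * q ^ 32 + \<bar>F S\<bar>) + 8 * q ^ 32 * s\<^sup>2" .
  have P0: "0 \<le> ?P" unfolding sum3_def by (intro sum_nonneg) auto
  have 1: "\<bar>v S * A1 S\<bar> \<le> 3 * q ^ 17 * \<bar>A1 S\<bar>" by (intro abs_mult_le v_le g) auto
  have 2: "\<bar>2 * q ^ 16 * A2 S\<bar> = 2 * q ^ 16 * \<bar>A2 S\<bar>" by (simp add: abs_mult)
  have 3: "q ^ 32 \<le> q ^ 32 * s\<^sup>2" using monomial_mono[of 32 0 2 32] by simp
  have 4: "8 * q ^ 32 * s\<^sup>2 = 8 * (q ^ 32 * s\<^sup>2)" by simp
  have eq: "sum3 (\<lambda>i j k. w i j S * w j k S * D k i S) = v S * A1 S - 2 * q ^ 16 * A2 S - (?P + 2 * A32 S + A34 S)"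
    unfolding Q1_eq A3_expand A1_def A2_def ..
  have "\<bar>a - b - (c + 2 * d + e)\<bar> \<le> \<bar>a\<bar> + \<bar>b\<bar> + c + 2 * \<bar>d\<bar> + \<bar>e\<bar>" if "0 \<le> c" for a b c d e :: real
    using that by linarith
  from this[OF P0, of "v S * A1 S" "2 * q ^ 16 * A2 S" "A32 S" "A34 S"]
  show ?thesis unfolding eq using 1 P 3 unfolding 2 4 by simp
qed

text \<open>
  The three products in \<open>Q2_eq\<close> are treated separately. Each is expanded such that at most one
  random factor is left besides deterministic bounds.
\<close>
lemma c1_le:
  assumes g: "good S"
  shows "\<bar>(s\<^sup>2 * (v S)\<^sup>2 - 2 * q ^ 16 * (v S * \<beta> S) + q ^ 32 * \<gamma> S) * B1 S\<bar> \<le>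
    35 * (q ^ 64 * s ^ 0) * \<bar>B1 S\<bar> + 4 * (q ^ 33 * s ^ 2) * \<bar>F S\<bar>"
proof -
  have "\<bar>v S\<bar>\<^sup>2 \<le> (3 * q ^ 17)\<^sup>2" by (intro power_mono v_le g) auto
  then have "s\<^sup>2 * (v S)\<^sup>2 \<le> s\<^sup>2 * (9 * q ^ 34)"
    by (intro mult_left_mono) (auto simp: power_mult_distrib simp flip: power_mult)
  then have 1: "\<bar>s\<^sup>2 * (v S)\<^sup>2\<bar> \<le> 9 * q ^ 64" using monomial_const[of 34 2 64] by (simp add: mult_ac)
  have "\<bar>v S * \<beta> S\<bar> \<le> 3 * q ^ 17 * (3 * (q ^ 9 * s))" by (intro abs_mult_le v_le \<beta>_le g)
  from abs_mult_le[OF order_refl this]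
  have "\<bar>2 * q ^ 16 * (v S * \<beta> S)\<bar> \<le> \<bar>2 * q ^ 16\<bar> * (3 * q ^ 17 * (3 * (q ^ 9 * s)))" .
  also have "\<bar>2 * q ^ 16\<bar> = 2 * q ^ 16" by simp
  also have "2 * q ^ 16 * (3 * q ^ 17 * (3 * (q ^ 9 * s))) = 18 * (q ^ 42 * s ^ 1)" by algebra
  also have "\<dots> \<le> 18 * q ^ 64" using monomial_const[of 42 1 64] by simp
  finally have 2: "\<bar>2 * q ^ 16 * (v S * \<beta> S)\<bar> \<le> 18 * q ^ 64" .
  have 3: "\<bar>s\<^sup>2 * (v S)\<^sup>2 - 2 * q ^ 16 * (v S * \<beta> S)\<bar> \<le> 27 * q ^ 64" using 1 2 by linarith
  have 4: "\<bar>(s\<^sup>2 * (v S)\<^sup>2 - 2 * q ^ 16 * (v S * \<beta> S)) * B1 S\<bar> \<le> 27 * q ^ 64 * \<bar>B1 S\<bar>"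
    by (intro abs_mult_le 3) auto
  have "\<bar>q ^ 32 * \<gamma> S * B1 S\<bar> \<le> q ^ 32 * (8 * q ^ 32 + 2 * \<bar>F S\<bar>) * \<bar>B1 S\<bar>"
    using \<gamma>_nonneg[of S] by (intro abs_mult_le) (auto simp: abs_mult intro!: \<gamma>_le_F g mult_left_mono)
  also have "\<dots> = 8 * q ^ 64 * \<bar>B1 S\<bar> + 2 * q ^ 32 * \<bar>F S\<bar> * \<bar>B1 S\<bar>" by algebra
  also have "\<dots> \<le> 8 * q ^ 64 * \<bar>B1 S\<bar> + 2 * q ^ 32 * \<bar>F S\<bar> * (2 * (q * s\<^sup>2))"
    by (intro add_left_mono mult_left_mono B1_le g) auto
  also have "\<dots> = 8 * q ^ 64 * \<bar>B1 S\<bar> + 4 * (q ^ 33 * s ^ 2) * \<bar>F S\<bar>" by algebra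
  finally have 5: "\<bar>q ^ 32 * \<gamma> S * B1 S\<bar> \<le> 8 * q ^ 64 * \<bar>B1 S\<bar> + 4 * (q ^ 33 * s ^ 2) * \<bar>F S\<bar>" .
  have "\<bar>(a + b) * c\<bar> \<le> \<bar>a * c\<bar> + \<bar>b * c\<bar>" for a b c :: real by (simp add: distrib_right)
  from order_trans[OF this add_mono[OF 4 5]] show ?thesis unfolding power_0 mult_1_right by linarith
qed

lemma c2_le:
  assumes g: "good S"
  shows "\<bar>(q ^ 32 * \<beta> S + q ^ 16 * \<gamma> S - q ^ 16 * (s\<^sup>2 * v S) - v S * \<beta> S) * B2 S\<bar> \<le>
    5 * (q ^ 48 * s ^ 2) * \<bar>\<beta> S\<bar> + 10 * (q ^ 32 * s ^ 2) * \<bar>F S\<bar> + 5 * (q ^ 32 * s ^ 4) * \<bar>v S\<bar>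
     + 26 * (q ^ 50 * s ^ 0) * \<bar>F2 S\<bar> + 85 * (q ^ 64 * s ^ 2)"
proof -
  let ?c = "q ^ 32 * \<beta> S + q ^ 16 * \<gamma> S - q ^ 16 * (s\<^sup>2 * v S) - v S * \<beta> S"
  let ?l = "sum2 (\<lambda>i j. \<theta> i * (w i j S)\<^sup>2)"
  have vb: "\<bar>v S * \<beta> S\<bar> \<le> 9 * (q ^ 26 * s)"
    using abs_mult_le[OF v_le[OF g] \<beta>_le[OF g]] by (simp flip: power_add)
  have tri: "\<bar>a + b - c - d\<bar> \<le> \<bar>a\<bar> + \<bar>b\<bar> + \<bar>c\<bar> + \<bar>d\<bar>" for a b c d :: real by linarith
  have c: "\<bar>?c\<bar> \<le> q ^ 32 * \<bar>\<beta> S\<bar> + q ^ 16 * \<gamma> S + q ^ 16 * (s\<^sup>2 * \<bar>v S\<bar>) + 9 * (q ^ 26 * s)"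
    using tri[of "q ^ 32 * \<beta> S" "q ^ 16 * \<gamma> S" "q ^ 16 * (s\<^sup>2 * v S)" "v S * \<beta> S"] vb \<gamma>_nonneg[of S]
    by (simp add: abs_mult)
  also have "\<dots> \<le> q ^ 32 * \<bar>\<beta> S\<bar> + q ^ 16 * (8 * q ^ 32 + 2 * \<bar>F S\<bar>) + q ^ 16 * (s\<^sup>2 * \<bar>v S\<bar>) + 9 * (q ^ 26 * s)"
    by (intro add_mono mult_left_mono \<gamma>_le_F g) auto
  finally have c1: "\<bar>?c\<bar> \<le> q ^ 32 * \<bar>\<beta> S\<bar> + q ^ 16 * (8 * q ^ 32 + 2 * \<bar>F S\<bar>) + q ^ 16 * (s\<^sup>2 * \<bar>v S\<bar>) + 9 * (q ^ 26 * s)" .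
  have "\<bar>?c * ?l\<bar> \<le> (q ^ 32 * \<bar>\<beta> S\<bar> + q ^ 16 * (8 * q ^ 32 + 2 * \<bar>F S\<bar>) + q ^ 16 * (s\<^sup>2 * \<bar>v S\<bar>) + 9 * (q ^ 26 * s)) * (5 * (q ^ 16 * s\<^sup>2))"
    using lin2_le[OF g] by (intro abs_mult_le c1) auto
  also have "\<dots> = 5 * (q ^ 48 * s ^ 2) * \<bar>\<beta> S\<bar> + 10 * (q ^ 32 * s ^ 2) * \<bar>F S\<bar> + 5 * (q ^ 32 * s ^ 4) * \<bar>v S\<bar> + (40 * (q ^ 64 * s ^ 2) + 45 * (q ^ 42 * s ^ 3))"
    by algebra
  also have "\<dots> \<le> 5 * (q ^ 48 * s ^ 2) * \<bar>\<beta> S\<bar> + 10 * (q ^ 32 * s ^ 2) * \<bar>F S\<bar> + 5 * (q ^ 32 * s ^ 4) * \<bar>v S\<bar> + 85 * (q ^ 64 * s ^ 2)"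
  proof (intro add_left_mono)
    have "q ^ 42 * s ^ 3 \<le> q ^ 64 * s ^ 2" by (rule monomial_mono) simp
    then show "40 * (q ^ 64 * s ^ 2) + 45 * (q ^ 42 * s ^ 3) \<le> 85 * (q ^ 64 * s ^ 2)" by linarith
  qed
  finally have 1: "\<bar>?c * ?l\<bar> \<le> 5 * (q ^ 48 * s ^ 2) * \<bar>\<beta> S\<bar> + 10 * (q ^ 32 * s ^ 2) * \<bar>F S\<bar> + 5 * (q ^ 32 * s ^ 4) * \<bar>v S\<bar> + 85 * (q ^ 64 * s ^ 2)" .
  have "\<bar>?c\<bar> \<le> q ^ 32 * (3 * (q ^ 9 * s)) + q ^ 16 * (11 * q ^ 34) + q ^ 16 * (s\<^sup>2 * (3 * q ^ 17)) + 9 * (q ^ 26 * s)"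
    using \<gamma>_le[OF g] by (intro order_trans[OF c] add_mono mult_left_mono \<beta>_le v_le g) auto
  also have "\<dots> = 3 * (q ^ 41 * s ^ 1) + 11 * q ^ 50 + 3 * (q ^ 33 * s ^ 2) + 9 * (q ^ 26 * s ^ 1)" by algebra
  also have "\<dots> \<le> 3 * q ^ 50 + 11 * q ^ 50 + 3 * q ^ 50 + 9 * q ^ 50"
    by (intro add_mono mult_left_mono monomial_const) auto
  finally have "\<bar>?c\<bar> \<le> 26 * q ^ 50" by simp
  then have 2: "\<bar>?c * F2 S\<bar> \<le> 26 * (q ^ 50 * s ^ 0) * \<bar>F2 S\<bar>" by (intro abs_mult_le) auto
  have "\<bar>a * (b + d)\<bar> \<le> \<bar>a * b\<bar> + \<bar>a * d\<bar>" for a b d :: real by (simp add: distrib_left)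
  from order_trans[OF this add_mono[OF 1 2]] show ?thesis unfolding B2_def B2_expand by linarith
qed

lemma c3_le:
  assumes g: "good S"
  shows "\<bar>(q ^ 32 * s\<^sup>2 + 2 * q ^ 16 * \<beta> S + \<gamma> S) * B3 S\<bar> \<le>
     6 * (q ^ 32 * s ^ 0) * \<bar>F S\<bar> + 1 * (q ^ 32 * s ^ 2) * \<bar>F3 S\<bar> + 17 * (q ^ 34 * s ^ 0) * \<bar>F3 S\<bar> + 45 * (q ^ 64 * s ^ 2)"
proof -
  let ?c = "q ^ 32 * s\<^sup>2 + 2 * q ^ 16 * \<beta> S + \<gamma> S"
  let ?l = "sum2 (\<lambda>i j. (w i j S) ^ 3)"
  have "\<bar>2 * q ^ 16 * \<beta> S\<bar> \<le> 2 * q ^ 16 * (3 * (q ^ 9 * s))" by (intro abs_mult_le \<beta>_le g) auto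
  also have "\<dots> = 6 * (q ^ 25 * s ^ 1)" by algebra
  finally have b: "\<bar>2 * q ^ 16 * \<beta> S\<bar> \<le> 6 * (q ^ 25 * s ^ 1)" .
  have c: "\<bar>?c\<bar> \<le> q ^ 32 * s\<^sup>2 + 6 * (q ^ 25 * s ^ 1) + \<gamma> S"
  proof -
    have "\<bar>a + b + c\<bar> \<le> a + \<bar>b\<bar> + c" if "0 \<le> a" "0 \<le> c" for a b c :: real using that by linarith
    from this[of "q ^ 32 * s\<^sup>2" "\<gamma> S" "2 * q ^ 16 * \<beta> S"] b \<gamma>_nonneg[of S] show ?thesis by simp
  qed
  have "\<bar>?c * ?l\<bar> \<le> (q ^ 32 * s\<^sup>2 + 6 * (q ^ 25 * s ^ 1) + (8 * q ^ 32 + 2 * \<bar>F S\<bar>)) * (3 * q ^ 32)"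
    using \<gamma>_le_F[OF g] by (intro abs_mult_le lin3_le g order_trans[OF c]) auto
  also have "\<dots> = 6 * (q ^ 32 * s ^ 0) * \<bar>F S\<bar> + (3 * (q ^ 64 * s ^ 2) + 18 * (q ^ 57 * s ^ 1) + 24 * (q ^ 64 * s ^ 0))"
    by algebra
  also have "\<dots> \<le> 6 * (q ^ 32 * s ^ 0) * \<bar>F S\<bar> + (3 * (q ^ 64 * s ^ 2) + 18 * (q ^ 64 * s ^ 2) + 24 * (q ^ 64 * s ^ 2))"
    by (intro add_mono mult_left_mono monomial_mono) auto
  finally have 1: "\<bar>?c * ?l\<bar> \<le> 6 * (q ^ 32 * s ^ 0) * \<bar>F S\<bar> + 45 * (q ^ 64 * s ^ 2)" by linarith
  have "\<bar>?c\<bar> \<le> q ^ 32 * s\<^sup>2 + 6 * q ^ 34 + 11 * q ^ 34"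
    using \<gamma>_le[OF g] monomial_const[of 25 1 34] by (intro order_trans[OF c] add_mono) auto
  then have "\<bar>?c * F3 S\<bar> \<le> (q ^ 32 * s\<^sup>2 + 6 * q ^ 34 + 11 * q ^ 34) * \<bar>F3 S\<bar>" by (intro abs_mult_le) auto
  also have "\<dots> = 1 * (q ^ 32 * s ^ 2) * \<bar>F3 S\<bar> + 17 * (q ^ 34 * s ^ 0) * \<bar>F3 S\<bar>" by algebra
  finally have 2: "\<bar>?c * F3 S\<bar> \<le> 1 * (q ^ 32 * s ^ 2) * \<bar>F3 S\<bar> + 17 * (q ^ 34 * s ^ 0) * \<bar>F3 S\<bar>" .
  have "\<bar>a * (b + d)\<bar> \<le> \<bar>a * b\<bar> + \<bar>a * d\<bar>" for a b d :: real by (simp add: distrib_left)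
  from order_trans[OF this add_mono[OF 1 2]] show ?thesis unfolding B3_def B3_expand by linarith
qed

lemma Y_le:
  assumes g: "good S"
  shows "(\<Sum>j<n. \<theta> j ^ 3 * (x j S)\<^sup>2) \<le> 10 * (q ^ 16 * s\<^sup>2) + 2 * \<bar>F5 S\<bar>"
proof -
  have "(x i S)\<^sup>2 \<le> 2 * (row_sum i S)\<^sup>2 + 2 * \<theta> i ^ 4" for i
    using zero_le_power2[of "row_sum i S + (\<theta> i)\<^sup>2"] by (simp add: x_def power2_diff power2_sum flip: power_mult)
  then have "(\<Sum>j<n. \<theta> j ^ 3 * (x j S)\<^sup>2) \<le> (\<Sum>j<n. \<theta> j ^ 3 * (2 * (row_sum j S)\<^sup>2 + 2 * \<theta> j ^ 4))"
    by (intro sum_mono mult_left_mono \<theta>_pow_nonneg) auto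
  also have "\<dots> = 2 * (\<Sum>j<n. \<theta> j ^ 3 * (row_sum j S)\<^sup>2) + 2 * power_sum 7"
    by (simp add: distrib_left sum.distrib sum_distrib_left power_sum_def mult_ac flip: power_add)
  also have "(\<Sum>j<n. \<theta> j ^ 3 * (row_sum j S)\<^sup>2) = (\<Sum>j<n. \<theta> j ^ 3 * row_sq j S) + F5 S"
    unfolding F5_def by (rule sum_c_row_sum_sq)
  also have "(\<Sum>j<n. \<theta> j ^ 3 * row_sq j S) \<le> (\<Sum>j<n. 2 * q ^ 9 * \<theta> j ^ 3 + 2 * q ^ 16 * \<theta> j ^ 4)"
  proof (intro sum_mono)
    fix j assume "j \<in> {..<n}"
    then have j: "j < n" by simp
    have "row_sq j S \<le> q * (2 * q ^ 8) + 2 * (q ^ 16 * \<theta> j)"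
      by (intro order_trans[OF row_sq_le[OF j]] add_right_mono order_trans[OF row_sum_le[OF g j]] mult_left_mono \<rho>_le j) auto
    then have "\<theta> j ^ 3 * row_sq j S \<le> \<theta> j ^ 3 * (q * (2 * q ^ 8) + 2 * (q ^ 16 * \<theta> j))"
      by (intro mult_left_mono \<theta>_pow_nonneg j)
    then show "\<theta> j ^ 3 * row_sq j S \<le> 2 * q ^ 9 * \<theta> j ^ 3 + 2 * q ^ 16 * \<theta> j ^ 4"
      by (rule order_trans) (rule eq_refl, algebra)
  qed
  also have "(\<Sum>j<n. 2 * q ^ 9 * \<theta> j ^ 3 + 2 * q ^ 16 * \<theta> j ^ 4) = 2 * q ^ 9 * power_sum 3 + 2 * q ^ 16 * power_sum 4"
    by (simp add: sum.distrib sum_distrib_left power_sum_def)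
  also have "\<dots> \<le> 2 * q ^ 16 * s\<^sup>2 + 2 * q ^ 16 * s\<^sup>2"
    using q_pow_mono[of 9 16] by (intro add_mono mult_mono power_sum_le_s) auto
  finally have 1: "(\<Sum>j<n. \<theta> j ^ 3 * (x j S)\<^sup>2) \<le> 2 * (2 * q ^ 16 * s\<^sup>2 + 2 * q ^ 16 * s\<^sup>2 + F5 S) + 2 * power_sum 7" by simp
  have 2: "power_sum 7 \<le> q ^ 16 * s\<^sup>2" using power_sum_le_s[of 7] monomial_mono[of 0 2 2 16] by simp
  have "2 * (2 * q ^ 16 * s\<^sup>2 + 2 * q ^ 16 * s\<^sup>2 + F5 S) + 2 * power_sum 7 = 8 * (q ^ 16 * s\<^sup>2) + 2 * F5 S + 2 * power_sum 7" by algebra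
  then show ?thesis using 1 2 abs_ge_self[of "F5 S"] by linarith
qed

text \<open>
  The diagonal entry \<open>D j j\<close> is a sum of three terms. In each product with \<open>row_sq j\<close> one of the
  available bounds is proportional to a power of \<open>\<theta> j\<close> or to \<open>(x j)\<^sup>2\<close>, so that the sum over \<open>j\<close>
  does not produce a factor \<open>n\<close>.
\<close>
lemma X_le:
  assumes g: "good S"
  shows "X S \<le> 48 * (q ^ 48 * s ^ 0) * \<bar>F5 S\<bar> + 6000 * (q ^ 64 * s ^ 2)"
proof -
  have term_le: "row_sq j S * (D j j S)\<^sup>2 \<le> 108 * q ^ 50 * (\<theta> j)\<^sup>2 + 384 * q ^ 59 * (\<theta> j)\<^sup>2 + 24 * q ^ 48 * (\<theta> j ^ 3 * (x j S)\<^sup>2)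
      + 192 * q ^ 3 * (x j S)\<^sup>2 + 3072 * q ^ 53 * (\<theta> j)\<^sup>2" if j: "j < n" for j
  proof -
    let ?d = "row_sq j S" and ?t = "\<theta> j" and ?x = "x j S"
    note d0 = row_sq_nonneg[of j S]
    have t: "0 \<le> ?t" "?t \<le> 1" using \<theta>_nonneg \<theta>_le_1 j by auto
    have row_sum: "\<bar>row_sum j S\<bar> \<le> 2 * q ^ 9"
    proof -
      have "q * \<rho> j \<le> q * (2 * q ^ 8)" by (intro mult_left_mono \<rho>_le j) auto
      also have "\<dots> = 2 * q ^ 9" by algebra
      finally show ?thesis using row_sum_le[OF g j] by linarith
    qed
    have d1: "?d \<le> 4 * q ^ 16"
    proof -
      have "q ^ 16 * ?t \<le> q ^ 16 * 1" using t by (intro mult_left_mono) auto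
      moreover have "q ^ 9 \<le> q ^ 16" by (rule q_pow_mono) simp
      ultimately show ?thesis using row_sq_le[OF j, of S] row_sum by linarith
    qed
    have x2: "?x\<^sup>2 \<le> 16 * q ^ 18"
    proof -
      have "\<bar>?x\<bar>\<^sup>2 \<le> (4 * q ^ 9)\<^sup>2" by (intro power_mono x_le_const g j) auto
      then show ?thesis by (simp add: power_mult_distrib flip: power_mult)
    qed
    have v2: "(v S)\<^sup>2 \<le> 9 * q ^ 34"
    proof -
      have "\<bar>v S\<bar>\<^sup>2 \<le> (3 * q ^ 17)\<^sup>2" by (intro power_mono v_le g) auto
      then show ?thesis by (simp add: power_mult_distrib flip: power_mult)
    qed
    have t4: "(?t * ?t)\<^sup>2 \<le> ?t\<^sup>2"
      using t mult_mono[of "?t * ?t" ?t "?t * ?t" ?t] by (simp add: power2_eq_square mult_left_le)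
    have a: "?d * (v S * (?t * ?t))\<^sup>2 \<le> 36 * q ^ 50 * ?t\<^sup>2"
    proof -
      have "?d * (v S * (?t * ?t))\<^sup>2 = ?d * ((v S)\<^sup>2 * (?t * ?t)\<^sup>2)" by algebra
      also have "\<dots> \<le> 4 * q ^ 16 * (9 * q ^ 34 * ?t\<^sup>2)"
        by (intro mult_mono d1 v2 t4) auto
      also have "\<dots> = 36 * q ^ 50 * ?t\<^sup>2" by algebra
      finally show ?thesis .
    qed
    have b: "?d * (2 * (q ^ 16 * (?x * ?t)))\<^sup>2 \<le> 128 * q ^ 59 * ?t\<^sup>2 + 8 * q ^ 48 * (?t ^ 3 * ?x\<^sup>2)"
    proof -
      have "?d * (2 * (q ^ 16 * (?x * ?t)))\<^sup>2 \<le> (2 * q ^ 9 + 2 * (q ^ 16 * ?t)) * (2 * (q ^ 16 * (?x * ?t)))\<^sup>2"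
        using row_sq_le[OF j, of S] row_sum by (intro mult_right_mono) auto
      also have "\<dots> = 8 * q ^ 41 * ?t\<^sup>2 * ?x\<^sup>2 + 8 * q ^ 48 * (?t ^ 3 * ?x\<^sup>2)" by algebra
      also have "\<dots> \<le> 8 * q ^ 41 * ?t\<^sup>2 * (16 * q ^ 18) + 8 * q ^ 48 * (?t ^ 3 * ?x\<^sup>2)"
        by (intro add_right_mono mult_left_mono x2) auto
      also have "\<dots> = 128 * q ^ 59 * ?t\<^sup>2 + 8 * q ^ 48 * (?t ^ 3 * ?x\<^sup>2)" by algebra
      finally show ?thesis .
    qed
    have c: "?d * (?x * ?x)\<^sup>2 \<le> 64 * q ^ 3 * ?x\<^sup>2 + 1024 * q ^ 53 * ?t\<^sup>2"
    proof -
      (* up to constants \<open>r\<close> bounds \<open>(\<rho> j)\<^sup>2\<close>, and thereby both \<open>row_sq j / q\<close> and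
         \<open>(x j)\<^sup>2 / q\<^sup>2\<close> *)
      define r where "r = 1 + q ^ 16 * ?t"
      have r: "0 \<le> r" "q ^ 16 * ?t \<le> r" using t by (auto simp: r_def)
      have "\<rho> j \<le> (\<rho> j)\<^sup>2" using \<rho>_ge_1[OF j] by (simp add: self_le_power)
      then have rho: "\<rho> j \<le> 2 * r" using \<rho>_sq_le[OF j] by (simp add: r_def)
      have "?d \<le> q * (2 * r) + 2 * r"
        using mult_left_mono[OF rho, of q] r(2) by (intro order_trans[OF row_sq_le[OF j]] add_mono order_trans[OF row_sum_le[OF g j]]) auto
      also have "\<dots> \<le> q * (2 * r) + q * (2 * r)" using r mult_right_mono[of 1 q "2 * r"] by simp
      finally have d: "?d \<le> 4 * q * r" by simp
      have "\<bar>?x\<bar>\<^sup>2 \<le> (2 * (q * \<rho> j))\<^sup>2" by (intro power_mono x_le g j) auto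
      also have "\<dots> = 4 * q\<^sup>2 * (\<rho> j)\<^sup>2" by algebra
      also have "\<dots> \<le> 4 * q\<^sup>2 * (2 * r)" using \<rho>_sq_le[OF j] by (intro mult_left_mono) (auto simp: r_def)
      finally have xr: "?x\<^sup>2 \<le> 8 * q\<^sup>2 * r" by simp
      have "?d * (?x * ?x)\<^sup>2 = ?d * ?x\<^sup>2 * ?x\<^sup>2" by algebra
      also have "\<dots> \<le> 4 * q * r * (8 * q\<^sup>2 * r) * ?x\<^sup>2"
        using r d0 by (intro mult_right_mono mult_mono d xr) auto
      also have "\<dots> = 32 * q ^ 3 * (r\<^sup>2 * ?x\<^sup>2)" by algebra
      also have "\<dots> \<le> 32 * q ^ 3 * (2 * ?x\<^sup>2 + 2 * q ^ 32 * ?t\<^sup>2 * (16 * q ^ 18))"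
      proof (intro mult_left_mono)
        have "r\<^sup>2 \<le> 2 * (1 + (q ^ 16 * ?t)\<^sup>2)"
          unfolding r_def using sum_squares_bound[of 1 "q ^ 16 * ?t"] by (simp add: power2_sum)
        also have "\<dots> = 2 + 2 * q ^ 32 * ?t\<^sup>2" by algebra
        finally have "r\<^sup>2 * ?x\<^sup>2 \<le> (2 + 2 * q ^ 32 * ?t\<^sup>2) * ?x\<^sup>2" by (rule mult_right_mono) simp
        also have "\<dots> = 2 * ?x\<^sup>2 + 2 * q ^ 32 * ?t\<^sup>2 * ?x\<^sup>2" by algebra
        also have "\<dots> \<le> 2 * ?x\<^sup>2 + 2 * q ^ 32 * ?t\<^sup>2 * (16 * q ^ 18)"
          by (intro add_left_mono mult_left_mono x2) auto
        finally show "r\<^sup>2 * ?x\<^sup>2 \<le> 2 * ?x\<^sup>2 + 2 * q ^ 32 * ?t\<^sup>2 * (16 * q ^ 18)" .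
      qed auto
      also have "\<dots> = 64 * q ^ 3 * ?x\<^sup>2 + 1024 * q ^ 53 * ?t\<^sup>2" by algebra
      finally show ?thesis .
    qed
    have three: "(e - f - h)\<^sup>2 \<le> 3 * (e\<^sup>2 + f\<^sup>2 + h\<^sup>2)" for e f h :: real
    proof -
      have "3 * (e\<^sup>2 + f\<^sup>2 + h\<^sup>2) - (e - f - h)\<^sup>2 = (e + f)\<^sup>2 + (e + h)\<^sup>2 + (f - h)\<^sup>2" by algebra
      then show ?thesis by (smt (verit) zero_le_power2)
    qed
    have Djj: "D j j S = v S * (?t * ?t) - 2 * (q ^ 16 * (?x * ?t)) - ?x * ?x"
      by (simp add: D_eq[OF j j] algebra_simps)
    have "?d * (D j j S)\<^sup>2 \<le> ?d * (3 * ((v S * (?t * ?t))\<^sup>2 + (2 * (q ^ 16 * (?x * ?t)))\<^sup>2 + (?x * ?x)\<^sup>2))"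
      unfolding Djj by (intro mult_left_mono three d0)
    also have "\<dots> = 3 * (?d * (v S * (?t * ?t))\<^sup>2 + ?d * (2 * (q ^ 16 * (?x * ?t)))\<^sup>2 + ?d * (?x * ?x)\<^sup>2)" by algebra
    also have "\<dots> \<le> 3 * (36 * q ^ 50 * ?t\<^sup>2 + (128 * q ^ 59 * ?t\<^sup>2 + 8 * q ^ 48 * (?t ^ 3 * ?x\<^sup>2)) + (64 * q ^ 3 * ?x\<^sup>2 + 1024 * q ^ 53 * ?t\<^sup>2))"
      by (intro mult_left_mono add_mono a b c) auto
    also have "\<dots> = 108 * q ^ 50 * ?t\<^sup>2 + 384 * q ^ 59 * ?t\<^sup>2 + 24 * q ^ 48 * (?t ^ 3 * ?x\<^sup>2)
      + 192 * q ^ 3 * ?x\<^sup>2 + 3072 * q ^ 53 * ?t\<^sup>2" by algebra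
    finally show ?thesis .
  qed
  let ?Y = "\<Sum>j<n. \<theta> j ^ 3 * (x j S)\<^sup>2"
  have "X S \<le> (\<Sum>j<n. 108 * q ^ 50 * (\<theta> j)\<^sup>2 + 384 * q ^ 59 * (\<theta> j)\<^sup>2 + 24 * q ^ 48 * (\<theta> j ^ 3 * (x j S)\<^sup>2)
      + 192 * q ^ 3 * (x j S)\<^sup>2 + 3072 * q ^ 53 * (\<theta> j)\<^sup>2)"
    unfolding X_def by (intro sum_mono term_le) auto
  also have "\<dots> = 108 * q ^ 50 * s\<^sup>2 + 384 * q ^ 59 * s\<^sup>2 + 24 * q ^ 48 * ?Y + 192 * q ^ 3 * \<gamma> S + 3072 * q ^ 53 * s\<^sup>2"
    by (simp add: sum.distrib s_sq power_sum_def \<gamma>_def flip: sum_distrib_left)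
  also have "\<dots> \<le> 108 * q ^ 50 * s\<^sup>2 + 384 * q ^ 59 * s\<^sup>2 + 24 * q ^ 48 * (10 * (q ^ 16 * s\<^sup>2) + 2 * \<bar>F5 S\<bar>)
      + 192 * q ^ 3 * (11 * q ^ 34) + 3072 * q ^ 53 * s\<^sup>2"
    by (intro add_mono mult_left_mono Y_le \<gamma>_le g) auto
  also have "\<dots> = 48 * (q ^ 48 * s ^ 0) * \<bar>F5 S\<bar> + (108 * (q ^ 50 * s ^ 2) + 384 * (q ^ 59 * s ^ 2) + 240 * (q ^ 64 * s ^ 2) + 2112 * (q ^ 37 * s ^ 0) + 3072 * (q ^ 53 * s ^ 2))"
    by algebra
  also have "\<dots> \<le> 48 * (q ^ 48 * s ^ 0) * \<bar>F5 S\<bar> + (108 * (q ^ 64 * s ^ 2) + 384 * (q ^ 64 * s ^ 2) + 240 * (q ^ 64 * s ^ 2) + 2112 * (q ^ 64 * s ^ 2) + 3072 * (q ^ 64 * s ^ 2))"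
    by (intro add_mono mult_left_mono monomial_mono) auto
  also have "\<dots> \<le> 48 * (q ^ 48 * s ^ 0) * \<bar>F5 S\<bar> + 6000 * (q ^ 64 * s ^ 2)" by simp
  finally show ?thesis .
qed

lemma Q2_le:
  assumes g: "good S"
  shows "\<bar>sum3 (\<lambda>i j k. w i j S * D j k S * D k i S)\<bar> \<le>
    35 * (q ^ 64 * s ^ 0) * \<bar>B1 S\<bar> + 4 * (q ^ 33 * s ^ 2) * \<bar>F S\<bar>
    + 2 * (5 * (q ^ 48 * s ^ 2) * \<bar>\<beta> S\<bar> + 10 * (q ^ 32 * s ^ 2) * \<bar>F S\<bar> + 5 * (q ^ 32 * s ^ 4) * \<bar>v S\<bar>
     + 26 * (q ^ 50 * s ^ 0) * \<bar>F2 S\<bar> + 85 * (q ^ 64 * s ^ 2))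
    + (6 * (q ^ 32 * s ^ 0) * \<bar>F S\<bar> + 1 * (q ^ 32 * s ^ 2) * \<bar>F3 S\<bar> + 17 * (q ^ 34 * s ^ 0) * \<bar>F3 S\<bar> + 45 * (q ^ 64 * s ^ 2))
    + (48 * (q ^ 48 * s ^ 0) * \<bar>F5 S\<bar> + 6000 * (q ^ 64 * s ^ 2))
    + (200 * (q ^ 34 * s ^ 2) * \<bar>F S\<bar> + 700 * (q ^ 64 * s ^ 2))"
proof -
  have tri: "\<bar>a + 2 * b + c - d\<bar> \<le> a' + 2 * b' + c' + x' + d'"
    if "\<bar>a\<bar> \<le> a'" "\<bar>b\<bar> \<le> b'" "\<bar>c\<bar> \<le> c'" "\<bar>d\<bar> \<le> x + y" "x \<le> x'" "y \<le> d'" for a b c d x y a' b' c' x' d' :: real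
    using that by linarith
  have D_sq_sum: "D_sq_sum S \<le> 200 * (q ^ 34 * s ^ 2) * \<bar>F S\<bar> + 700 * (q ^ 64 * s ^ 2)" using D_sq_sum_le_F[OF g] by linarith
  show ?thesis unfolding Q2_eq
    by (rule tri[OF c1_le[OF g] c2_le[OF g] c3_le[OF g] sum2_wDD_le X_le[OF g] D_sq_sum])
qed

lemma Q3_le:
  assumes g: "good S"
  shows "\<bar>sum3 (\<lambda>i j k. D i j S * D j k S * D k i S)\<bar> \<le>
    6400 * (q ^ 68 * s ^ 0) * \<bar>F S\<bar> + 108 * (q ^ 57 * s ^ 3) * \<bar>F S\<bar> + 240 * (q ^ 66 * s ^ 2) * \<bar>F S\<bar>
    + 48 * (q ^ 64 * s ^ 4) * \<bar>v S\<bar> + 96 * (q ^ 80 * s ^ 2) * \<bar>\<beta> S\<bar> + 110000 * (q ^ 96 * s ^ 2)"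
proof -
  (* the trace of \<open>D\<close> is the difference of this and \<open>\<gamma> S\<close>, which dominates *)
  let ?u = "s\<^sup>2 * v S - 2 * q ^ 16 * \<beta> S"
  let ?t = "?u - \<gamma> S"
  let ?G = "s\<^sup>2 * \<gamma> S - (\<beta> S)\<^sup>2"
  note \<gamma>0 = \<gamma>_nonneg[of S]
  have u1: "\<bar>?u\<bar> \<le> s\<^sup>2 * \<bar>v S\<bar> + 2 * q ^ 16 * \<bar>\<beta> S\<bar>"
    using abs_triangle_ineq4[of "s\<^sup>2 * v S" "2 * q ^ 16 * \<beta> S"] by (simp add: abs_mult)
  also have "\<dots> \<le> s\<^sup>2 * (3 * q ^ 17) + 2 * q ^ 16 * (3 * (q ^ 9 * s))"
    by (intro add_mono mult_left_mono v_le \<beta>_le g) auto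
  also have "\<dots> = 3 * (q ^ 17 * s ^ 2) + 6 * (q ^ 25 * s ^ 1)" by algebra
  also have "\<dots> \<le> 3 * (q ^ 25 * s ^ 1) + 6 * (q ^ 25 * s ^ 1)"
    by (intro add_mono mult_left_mono monomial_mono) auto
  finally have u2: "\<bar>?u\<bar> \<le> 9 * (q ^ 25 * s)" unfolding power_one_right by linarith
  have cube: "\<bar>(a - b) ^ 3\<bar> \<le> 4 * (\<bar>a\<bar> ^ 3 + b ^ 3)" if "0 \<le> b" for a b :: real
  proof -
    have "\<bar>(a - b) ^ 3\<bar> \<le> (\<bar>a\<bar> + b) ^ 3"
      unfolding power_abs using that by (intro power_mono) auto
    also have "\<dots> \<le> 4 * (\<bar>a\<bar> ^ 3 + b ^ 3)"
    proof -
      have "4 * (\<bar>a\<bar> ^ 3 + b ^ 3) - (\<bar>a\<bar> + b) ^ 3 = 3 * ((\<bar>a\<bar> + b) * (\<bar>a\<bar> - b)\<^sup>2)" by algebra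
      moreover have "0 \<le> 3 * ((\<bar>a\<bar> + b) * (\<bar>a\<bar> - b)\<^sup>2)" using that by simp
      ultimately show ?thesis by linarith
    qed
    finally show ?thesis .
  qed
  have "\<bar>?t ^ 3\<bar> \<le> 4 * (\<bar>?u\<bar> ^ 3 + (\<gamma> S) ^ 3)" by (rule cube[OF \<gamma>0])
  also have "\<dots> \<le> 4 * ((9 * (q ^ 25 * s)) ^ 3 + (2048 * q ^ 96 + 1600 * q ^ 68 * \<bar>F S\<bar>))"
    by (intro mult_left_mono add_mono power_mono u2 \<gamma>_cube_le g) auto
  also have "\<dots> = 6400 * (q ^ 68 * s ^ 0) * \<bar>F S\<bar> + (2916 * (q ^ 75 * s ^ 3) + 8192 * (q ^ 96 * s ^ 0))" by algebra
  also have "\<dots> \<le> 6400 * (q ^ 68 * s ^ 0) * \<bar>F S\<bar> + (2916 * (q ^ 96 * s ^ 2) + 8192 * (q ^ 96 * s ^ 2))"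
    by (intro add_mono mult_left_mono monomial_mono) auto
  finally have 1: "\<bar>?t ^ 3\<bar> \<le> 6400 * (q ^ 68 * s ^ 0) * \<bar>F S\<bar> + 11108 * (q ^ 96 * s ^ 2)" by linarith
  have G: "\<bar>?G\<bar> \<le> s\<^sup>2 * \<gamma> S" using \<beta>_sq_le[of S] by simp
  have "\<bar>3 * ?t * V S * ?G\<bar> \<le> 3 * (\<bar>?u\<bar> + \<gamma> S) * (2 * q ^ 32) * (s\<^sup>2 * \<gamma> S)"
    using V_bounds[OF g] V_nonneg[of S] \<gamma>0 by (intro abs_mult_le G) auto
  also have "\<dots> = 6 * q ^ 32 * s\<^sup>2 * (\<bar>?u\<bar> * \<gamma> S + (\<gamma> S)\<^sup>2)" by algebra
  also have "\<dots> \<le> 6 * q ^ 32 * s\<^sup>2 * (\<bar>?u\<bar> * (8 * q ^ 32 + 2 * \<bar>F S\<bar>) + (128 * q ^ 64 + 40 * q ^ 34 * \<bar>F S\<bar>))"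
    by (intro mult_left_mono add_mono \<gamma>_le_F \<gamma>_sq_le g) auto
  also have "\<bar>?u\<bar> * (8 * q ^ 32 + 2 * \<bar>F S\<bar>) = 8 * q ^ 32 * \<bar>?u\<bar> + 2 * \<bar>F S\<bar> * \<bar>?u\<bar>" by algebra
  also have "6 * q ^ 32 * s\<^sup>2 * (8 * q ^ 32 * \<bar>?u\<bar> + 2 * \<bar>F S\<bar> * \<bar>?u\<bar> + (128 * q ^ 64 + 40 * q ^ 34 * \<bar>F S\<bar>)) \<le>
     6 * q ^ 32 * s\<^sup>2 * (8 * q ^ 32 * (s\<^sup>2 * \<bar>v S\<bar> + 2 * q ^ 16 * \<bar>\<beta> S\<bar>) + 2 * \<bar>F S\<bar> * (9 * (q ^ 25 * s)) + (128 * q ^ 64 + 40 * q ^ 34 * \<bar>F S\<bar>))"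
    by (intro mult_left_mono add_right_mono add_mono u1 u2) auto
  also have "\<dots> = 108 * (q ^ 57 * s ^ 3) * \<bar>F S\<bar> + 240 * (q ^ 66 * s ^ 2) * \<bar>F S\<bar>
    + 48 * (q ^ 64 * s ^ 4) * \<bar>v S\<bar> + 96 * (q ^ 80 * s ^ 2) * \<bar>\<beta> S\<bar> + 768 * (q ^ 96 * s ^ 2)" by algebra
  finally have 2: "\<bar>3 * ?t * V S * ?G\<bar> \<le> 108 * (q ^ 57 * s ^ 3) * \<bar>F S\<bar> + 240 * (q ^ 66 * s ^ 2) * \<bar>F S\<bar>
    + 48 * (q ^ 64 * s ^ 4) * \<bar>v S\<bar> + 96 * (q ^ 80 * s ^ 2) * \<bar>\<beta> S\<bar> + 768 * (q ^ 96 * s ^ 2)" .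
  have Dn0: "27 * q ^ 25 * D_sq_sum S \<le> 18900 * (q ^ 96 * s ^ 2)"
  proof -
    have "27 * q ^ 25 * D_sq_sum S \<le> 27 * q ^ 25 * (700 * (q ^ 68 * s\<^sup>2))" by (intro mult_left_mono D_sq_sum_le_const g) auto
    also have "\<dots> = 18900 * (q ^ 93 * s ^ 2)" by algebra
    also have "\<dots> \<le> 18900 * (q ^ 96 * s ^ 2)" by (intro mult_left_mono monomial_mono) auto
    finally show ?thesis .
  qed
  have 3: "\<bar>\<Sum>i<n. \<Sum>j<n. (D i j S)\<^sup>2 * D j j S\<bar> \<le> 27 * q ^ 25 * D_sq_sum S"
  proof -
    have "\<bar>\<Sum>i<n. \<Sum>j<n. (D i j S)\<^sup>2 * D j j S\<bar> \<le> (\<Sum>i<n. \<Sum>j<n. (D i j S)\<^sup>2 * (27 * q ^ 25))"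
    proof (rule order_trans[OF sum_abs], rule sum_mono, rule order_trans[OF sum_abs], rule sum_mono)
      fix i j assume "j \<in> {..<n}"
      then show "\<bar>(D i j S)\<^sup>2 * D j j S\<bar> \<le> (D i j S)\<^sup>2 * (27 * q ^ 25)"
        by (intro abs_mult_le Dii_le g) auto
    qed
    then show ?thesis by (simp add: D_sq_sum_def mult_ac flip: sum_distrib_right sum_distrib_left)
  qed
  have 4: "\<bar>\<Sum>i<n. (D i i S) ^ 3\<bar> \<le> 27 * q ^ 25 * D_sq_sum S"
  proof -
    have "\<bar>\<Sum>i<n. (D i i S) ^ 3\<bar> \<le> (\<Sum>i<n. (\<Sum>j<n. (D i j S)\<^sup>2) * (27 * q ^ 25))"
    proof (rule order_trans[OF sum_abs], rule sum_mono)
      fix i assume i: "i \<in> {..<n}"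
      have "(D i i S) ^ 3 = (D i i S)\<^sup>2 * D i i S" by algebra
      moreover have "(D i i S)\<^sup>2 \<le> (\<Sum>j<n. (D i j S)\<^sup>2)" using i by (intro member_le_sum) auto
      ultimately show "\<bar>(D i i S) ^ 3\<bar> \<le> (\<Sum>j<n. (D i j S)\<^sup>2) * (27 * q ^ 25)"
        using i by (simp only:) (intro abs_mult_le Dii_le g, auto)
    qed
    then show ?thesis by (simp add: D_sq_sum_def mult_ac flip: sum_distrib_right sum_distrib_left)
  qed
  have "\<bar>a + b - 3 * c + 2 * d\<bar> \<le> a' + b' + 3 * e + 2 * e"
    if "\<bar>a\<bar> \<le> a'" "\<bar>b\<bar> \<le> b'" "\<bar>c\<bar> \<le> e" "\<bar>d\<bar> \<le> e" for a b c d a' b' e :: real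
    using that by linarith
  from this[OF 1 2 order_trans[OF 3 Dn0] order_trans[OF 4 Dn0]]
  show ?thesis unfolding Q3_eq
  proof (rule order_trans)
    have "0 \<le> q ^ 96 * s ^ 2" by simp
    then show "6400 * (q ^ 68 * s ^ 0) * \<bar>F S\<bar> + 11108 * (q ^ 96 * s ^ 2) +
      (108 * (q ^ 57 * s ^ 3) * \<bar>F S\<bar> + 240 * (q ^ 66 * s ^ 2) * \<bar>F S\<bar> + 48 * (q ^ 64 * s ^ 4) * \<bar>v S\<bar> +
      96 * (q ^ 80 * s ^ 2) * \<bar>\<beta> S\<bar> + 768 * (q ^ 96 * s ^ 2)) + 3 * (18900 * (q ^ 96 * s ^ 2)) + 2 * (18900 * (q ^ 96 * s ^ 2))
      \<le> 6400 * (q ^ 68 * s ^ 0) * \<bar>F S\<bar> + 108 * (q ^ 57 * s ^ 3) * \<bar>F S\<bar> + 240 * (q ^ 66 * s ^ 2) * \<bar>F S\<bar>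
    + 48 * (q ^ 64 * s ^ 4) * \<bar>v S\<bar> + 96 * (q ^ 80 * s ^ 2) * \<bar>\<beta> S\<bar> + 110000 * (q ^ 96 * s ^ 2)" by simp
  qed
qed

end

section \<open>The remainder in mean square\<close>

context large_model
begin

lemma q_nz [simp]: "q \<noteq> 0" and s_nz [simp]: "s \<noteq> 0"
  using q_ge s_ge_1 by linarith+

lemma nrm_abs: "nrm (\<lambda>S. \<bar>f S\<bar>) = nrm f"
  by (simp add: nrm_eq)

text \<open>
  Turns a deterministic monomial times a random variable into the target order \<open>q ^ e * s\<^sup>2\<close>;
  the loss is a sum of exponents.
\<close>
lemma term_le:
  assumes "nrm f \<le> N * (q ^ c * s ^ d)" "a + c + 8 * (b + d - 2) \<le> e" "0 \<le> M" "0 \<le> N"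
  shows "nrm (\<lambda>S. M * (q ^ a * s ^ b) * \<bar>f S\<bar>) \<le> M * N * (q ^ e * s ^ 2)"
proof -
  have "nrm (\<lambda>S. M * (q ^ a * s ^ b) * \<bar>f S\<bar>) = M * (q ^ a * s ^ b) * nrm f"
    using assms by (simp add: nrm_scale nrm_abs)
  also have "\<dots> \<le> M * (q ^ a * s ^ b) * (N * (q ^ c * s ^ d))"
    using assms by (intro mult_left_mono) auto
  also have "\<dots> = M * N * (q ^ (a + c) * s ^ (b + d))" by (simp add: power_add)
  also have "\<dots> \<le> M * N * (q ^ e * s ^ 2)" using assms by (intro mult_left_mono monomial_mono) auto
  finally show ?thesis .
qed

lemma const_term: "nrm (\<lambda>S. M * (q ^ e * s ^ 2)) \<le> M * (q ^ e * s ^ 2)" if "0 \<le> M"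
  using that by simp

text \<open>
  The right-hand sides of the pointwise bounds \<open>Q1_le\<close>, \<open>Q2_le\<close> and \<open>Q3_le\<close>, as random
  variables.
\<close>
definition M1 :: "(nat \<times> nat) set \<Rightarrow> real" where "M1 S =
     3 * (q ^ 17 * s ^ 0) * \<bar>A1 S\<bar> + 2 * (q ^ 16 * s ^ 0) * \<bar>A2 S\<bar> + 2 * (q ^ 0 * s ^ 0) * \<bar>A32 S\<bar> + 1 * (q ^ 0 * s ^ 0) * \<bar>A34 S\<bar>
      + 2 * (q ^ 0 * s ^ 0) * \<bar>F S\<bar> + 14 * (q ^ 32 * s ^ 2)"

definition M2 :: "(nat \<times> nat) set \<Rightarrow> real" where "M2 S =
    35 * (q ^ 64 * s ^ 0) * \<bar>B1 S\<bar> + 4 * (q ^ 33 * s ^ 2) * \<bar>F S\<bar>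
    + 2 * (5 * (q ^ 48 * s ^ 2) * \<bar>\<beta> S\<bar> + 10 * (q ^ 32 * s ^ 2) * \<bar>F S\<bar> + 5 * (q ^ 32 * s ^ 4) * \<bar>v S\<bar>
     + 26 * (q ^ 50 * s ^ 0) * \<bar>F2 S\<bar> + 85 * (q ^ 64 * s ^ 2))
    + (6 * (q ^ 32 * s ^ 0) * \<bar>F S\<bar> + 1 * (q ^ 32 * s ^ 2) * \<bar>F3 S\<bar> + 17 * (q ^ 34 * s ^ 0) * \<bar>F3 S\<bar> + 45 * (q ^ 64 * s ^ 2))
    + (48 * (q ^ 48 * s ^ 0) * \<bar>F5 S\<bar> + 6000 * (q ^ 64 * s ^ 2))
    + (200 * (q ^ 34 * s ^ 2) * \<bar>F S\<bar> + 700 * (q ^ 64 * s ^ 2))"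

definition M3 :: "(nat \<times> nat) set \<Rightarrow> real" where "M3 S =
    6400 * (q ^ 68 * s ^ 0) * \<bar>F S\<bar> + 108 * (q ^ 57 * s ^ 3) * \<bar>F S\<bar> + 240 * (q ^ 66 * s ^ 2) * \<bar>F S\<bar>
    + 48 * (q ^ 64 * s ^ 4) * \<bar>v S\<bar> + 96 * (q ^ 80 * s ^ 2) * \<bar>\<beta> S\<bar> + 110000 * (q ^ 96 * s ^ 2)"

lemma nrm_M1: "nrm M1 \<le> 400 * (q ^ 32 * s ^ 2)"
proof -
  have "nrm M1 \<le> 3 * 6 * (q ^ 32 * s ^ 2) + 2 * 36 * (q ^ 32 * s ^ 2) + 2 * 42 * (q ^ 32 * s ^ 2) + 1 * 200 * (q ^ 32 * s ^ 2)
     + 2 * 6 * (q ^ 32 * s ^ 2) + 14 * (q ^ 32 * s ^ 2)"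
    unfolding M1_def
    by (rule nrm_add_le nrm_add_le[rotated] const_term term_le[OF nrm_A1] term_le[OF nrm_A2] term_le[OF nrm_A32] term_le[OF nrm_A34] term_le[OF nrm_F] | simp)+
  moreover have "0 \<le> q ^ 32 * s ^ 2" by simp
  ultimately show ?thesis by linarith
qed

lemma nrm_M2: "nrm M2 \<le> 11000 * (q ^ 64 * s ^ 2)"
proof -
  let ?m = "q ^ 64 * s ^ 2"
  have a: "nrm (\<lambda>S. 5 * (q ^ 48 * s ^ 2) * \<bar>\<beta> S\<bar> + 10 * (q ^ 32 * s ^ 2) * \<bar>F S\<bar> + 5 * (q ^ 32 * s ^ 4) * \<bar>v S\<bar>
     + 26 * (q ^ 50 * s ^ 0) * \<bar>F2 S\<bar> + 85 * (q ^ 64 * s ^ 2)) \<le> 5 * 3 * ?m + 10 * 6 * ?m + 5 * 3 * ?m + 26 * 8 * ?m + 85 * ?m"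
    by (rule nrm_add_le const_term term_le[OF nrm_\<beta>] term_le[OF nrm_F] term_le[OF nrm_v] term_le[OF nrm_F2] | simp)+
  have b: "nrm (\<lambda>S. 2 * (5 * (q ^ 48 * s ^ 2) * \<bar>\<beta> S\<bar> + 10 * (q ^ 32 * s ^ 2) * \<bar>F S\<bar> + 5 * (q ^ 32 * s ^ 4) * \<bar>v S\<bar>
     + 26 * (q ^ 50 * s ^ 0) * \<bar>F2 S\<bar> + 85 * (q ^ 64 * s ^ 2))) \<le> 2 * (5 * 3 * ?m + 10 * 6 * ?m + 5 * 3 * ?m + 26 * 8 * ?m + 85 * ?m)"
    using nrm_scale_le[OF a, of 2] unfolding abs_numeral .
  have "nrm M2 \<le> 35 * 2 * ?m + 4 * 6 * ?m + 2 * (5 * 3 * ?m + 10 * 6 * ?m + 5 * 3 * ?m + 26 * 8 * ?m + 85 * ?m)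
    + (6 * 6 * ?m + 1 * 58 * ?m + 17 * 58 * ?m + 45 * ?m) + (48 * 6 * ?m + 6000 * ?m) + (200 * 6 * ?m + 700 * ?m)"
    unfolding M2_def
    by (rule b nrm_add_le const_term term_le[OF nrm_B1] term_le[OF nrm_F] term_le[OF nrm_F3] term_le[OF nrm_F5] | simp)+
  also have "\<dots> = 10173 * ?m" by (simp add: algebra_simps)
  also have "\<dots> \<le> 11000 * ?m" by (intro mult_right_mono) auto
  finally show ?thesis .
qed

lemma nrm_M3: "nrm M3 \<le> 160000 * (q ^ 96 * s ^ 2)"
proof -
  let ?m = "q ^ 96 * s ^ 2"
  have "nrm M3 \<le> 6400 * 6 * ?m + 108 * 6 * ?m + 240 * 6 * ?m + 48 * 3 * ?m + 96 * 3 * ?m + 110000 * ?m"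
    unfolding M3_def
    by (rule nrm_add_le const_term term_le[OF nrm_F] term_le[OF nrm_v] term_le[OF nrm_\<beta>] | simp)+
  also have "\<dots> = 150920 * ?m" by (simp add: algebra_simps)
  also have "\<dots> \<le> 160000 * ?m" by (intro mult_right_mono) auto
  finally show ?thesis .
qed

lemma T_minus_U_good:
  assumes g: "good S"
  shows "\<bar>T S - U S\<bar> \<le> 6 / q ^ 32 * M1 S + 12 / q ^ 64 * M2 S + 8 / q ^ 96 * M3 S"
proof -
  have "0 < q ^ 32 / 2" by simp
  then have V: "0 < V S" using V_bounds(1)[OF g] by linarith
  define a where "a = 1 / V S"
  have "a \<le> 1 / (q ^ 32 / 2)" unfolding a_def using V V_bounds(1)[OF g] by (intro divide_left_mono) auto
  then have a2: "a \<le> 2 / q ^ 32" by simp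
  have a0: "0 \<le> a" using V by (simp add: a_def)
  have "a\<^sup>2 \<le> (2 / q ^ 32)\<^sup>2" by (rule power_mono[OF a2 a0])
  also have "\<dots> = 4 / q ^ 64" by (simp add: power_divide flip: power_mult)
  finally have "3 * a\<^sup>2 \<le> 12 / q ^ 64" by linarith
  then have 2: "\<bar>3 * a\<^sup>2\<bar> \<le> 12 / q ^ 64" by simp
  have "a ^ 3 \<le> (2 / q ^ 32) ^ 3" by (rule power_mono[OF a2 a0])
  also have "\<dots> = 8 / q ^ 96" by (simp add: power_divide flip: power_mult)
  finally have 3: "\<bar>a ^ 3\<bar> \<le> 8 / q ^ 96" using a0 by simp
  have 1: "\<bar>3 * a\<bar> \<le> 6 / q ^ 32" using a0 a2 by simp
  have "\<bar>y1 + y2 + y3\<bar> \<le> z1 + z2 + z3" if "\<bar>y1\<bar> \<le> z1" "\<bar>y2\<bar> \<le> z2" "\<bar>y3\<bar> \<le> z3" for y1 y2 y3 z1 z2 z3 :: real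
    using that by linarith
  from this[OF abs_mult_le[OF 1 Q1_le[OF g, folded M1_def]] abs_mult_le[OF 2 Q2_le[OF g, folded M2_def]] abs_mult_le[OF 3 Q3_le[OF g, folded M3_def]]]
  show ?thesis unfolding T_minus_U[OF V] a_def .
qed

lemma nrm_good: "nrm (\<lambda>S. of_bool (good S) * (T S - U S)) \<le> 2000000 * s\<^sup>2"
proof -
  have "nrm (\<lambda>S. of_bool (good S) * (T S - U S)) \<le> nrm (\<lambda>S. 6 / q ^ 32 * M1 S + 12 / q ^ 64 * M2 S + 8 / q ^ 96 * M3 S)"
  proof (rule nrm_mono)
    fix S
    show "\<bar>of_bool (good S) * (T S - U S)\<bar> \<le> \<bar>6 / q ^ 32 * M1 S + 12 / q ^ 64 * M2 S + 8 / q ^ 96 * M3 S\<bar>"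
      using T_minus_U_good[of S] by (cases "good S") auto
  qed
  also have "\<dots> \<le> \<bar>6 / q ^ 32\<bar> * (400 * (q ^ 32 * s ^ 2)) + \<bar>12 / q ^ 64\<bar> * (11000 * (q ^ 64 * s ^ 2)) + \<bar>8 / q ^ 96\<bar> * (160000 * (q ^ 96 * s ^ 2))"
    by (intro nrm_add_le nrm_scale_le nrm_M1 nrm_M2 nrm_M3)
  also have "\<dots> = 1414400 * s\<^sup>2" by (simp add: field_simps)
  also have "\<dots> \<le> 2000000 * s\<^sup>2" by simp
  finally show ?thesis .
qed

section \<open>The exceptional event\<close>

lemma sum2_w_edges: "sum2 (\<lambda>i j. c i j * w i j S) = (\<Sum>e\<in>edges. (c (fst e) (snd e) + c (snd e) (fst e)) * W e S)"
  unfolding sum2_edges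
proof (intro sum.cong refl)
  fix e assume "e \<in> edges"
  then obtain a b where e: "e = (a, b)" "a < b" by (auto simp: edges_def)
  then have "w a b S = W (a, b) S" "w b a S = W (a, b) S" by (auto simp: w_def edge_def)
  then show "(case e of (a, b) \<Rightarrow> c a b * w a b S + c b a * w b a S) = (c (fst e) (snd e) + c (snd e) (fst e)) * W e S"
    using e by (simp add: distrib_right)
qed

lemma row_sum_edges:
  assumes "i < n" shows "row_sum i S = (\<Sum>e\<in>edges. (of_bool (fst e = i) + of_bool (snd e = i)) * W e S)"
proof -
  have "row_sum i S = (\<Sum>i'<n. of_bool (i' = i) * row_sum i' S)"
    using assms by (simp add: of_bool_def if_distrib[of "\<lambda>z. z * _"] cong: if_cong)
  also have "\<dots> = sum2 (\<lambda>i' j. of_bool (i' = i) * w i' j S)" by (simp only: sum2_w)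
  finally show ?thesis by (simp only: sum2_w_edges)
qed

lemma edge_cases: "e \<in> edges \<Longrightarrow> (\<And>a b. e = (a, b) \<Longrightarrow> a < b \<Longrightarrow> a < n \<Longrightarrow> b < n \<Longrightarrow> P) \<Longrightarrow> P"
  by (auto simp: edges_def)

lemma exp_q: "2 < exp q"
  using exp_ge_add_one_self[of q] q_ge by linarith

lemma sum_edges_le:
  fixes f :: "nat \<Rightarrow> nat \<Rightarrow> real"
  assumes "\<And>a b. a < n \<Longrightarrow> b < n \<Longrightarrow> a < b \<Longrightarrow> g (a, b) \<le> f a b + f b a" "\<And>i j. i < n \<Longrightarrow> j < n \<Longrightarrow> 0 \<le> f i j"
  shows "(\<Sum>e\<in>edges. g e) \<le> (\<Sum>i<n. \<Sum>j<n. f i j)"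
proof -
  have "(\<Sum>e\<in>edges. g e) \<le> sum2 f"
    unfolding sum2_edges by (intro sum_mono) (use assms(1) in \<open>auto simp: edges_def\<close>)
  also have "\<dots> \<le> (\<Sum>i<n. \<Sum>j<n. f i j)"
    unfolding sum2_def using assms(2) by (intro sum_mono) auto
  finally show ?thesis .
qed

text \<open>
  In this and the next two lemmas the threshold is \<open>q\<close> times the square root of a bound on the
  variance.
\<close>
lemma tail_v: "expect (\<lambda>S. of_bool (q * (2 * q ^ 16) < \<bar>sum2 (\<lambda>i j. 1 * w i j S)\<bar>)) \<le> 4 / (exp q - 2)"
proof -
  have "(\<Sum>e\<in>edges. (1 + 1)\<^sup>2 * (case e of (i, j) \<Rightarrow> \<theta> i * \<theta> j)) \<le> (\<Sum>i<n. \<Sum>j<n. 4 * (\<theta> i * \<theta> j))"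
    by (rule sum_edges_le) (auto simp: \<theta>_nonneg)
  also have "\<dots> = (2 * q ^ 16)\<^sup>2"
  proof -
    have "(\<Sum>i<n. \<Sum>j<n. 4 * (\<theta> i * \<theta> j)) = 4 * (power_sum 1 * power_sum 1)"
      by (simp add: power_sum_def sum_sum_factor)
    then show ?thesis unfolding power_sum_1 by (simp add: power2_eq_square)
  qed
  finally have "expect (\<lambda>S. of_bool (q * (2 * q ^ 16) < \<bar>\<Sum>e\<in>edges. (1 + 1) * W e S\<bar>)) \<le> 4 * ((2 * q ^ 16)\<^sup>2 / (2 * q ^ 16)\<^sup>2) / (exp q - 2)"
    by (intro linear_tail) auto
  then show ?thesis unfolding sum2_w_edges by simp
qed

lemma tail_\<beta>: "expect (\<lambda>S. of_bool (q * (2 * (q ^ 8 * s)) < \<bar>sum2 (\<lambda>i j. \<theta> i * w i j S)\<bar>)) \<le> 4 / (exp q - 2)"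
proof -
  have "(\<Sum>e\<in>edges. (\<theta> (fst e) + \<theta> (snd e))\<^sup>2 * (case e of (i, j) \<Rightarrow> \<theta> i * \<theta> j)) \<le> (\<Sum>i<n. \<Sum>j<n. 4 * (\<theta> i ^ 3 * \<theta> j))"
  proof (rule sum_edges_le)
    fix a b assume "a < n" "b < n"
    then have t: "0 \<le> \<theta> a * \<theta> b" "0 \<le> \<theta> a" "0 \<le> \<theta> b" using \<theta>_nonneg by auto
    have "(\<theta> a + \<theta> b)\<^sup>2 \<le> 4 * ((\<theta> a)\<^sup>2 + (\<theta> b)\<^sup>2)"
      using sum_squares_bound[of "\<theta> a" "\<theta> b"] zero_le_power2[of "\<theta> a"] zero_le_power2[of "\<theta> b"] unfolding power2_sum distrib_left by linarith
    then have "(\<theta> a + \<theta> b)\<^sup>2 * (\<theta> a * \<theta> b) \<le> 4 * ((\<theta> a)\<^sup>2 + (\<theta> b)\<^sup>2) * (\<theta> a * \<theta> b)"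
      by (rule mult_right_mono) (rule t)
    also have "\<dots> = 4 * (\<theta> a ^ 3 * \<theta> b) + 4 * (\<theta> b ^ 3 * \<theta> a)" by algebra
    finally show "(\<theta> (fst (a, b)) + \<theta> (snd (a, b)))\<^sup>2 * (case (a, b) of (i, j) \<Rightarrow> \<theta> i * \<theta> j) \<le> 4 * (\<theta> a ^ 3 * \<theta> b) + 4 * (\<theta> b ^ 3 * \<theta> a)" by simp
  qed (auto simp: \<theta>_nonneg)
  also have "\<dots> = 4 * (power_sum 3 * power_sum 1)"
    by (simp add: power_sum_def sum_sum_factor)
  also have "\<dots> \<le> 4 * (s\<^sup>2 * q ^ 16)" unfolding power_sum_1 by (intro mult_left_mono mult_right_mono power_sum_le_s) auto
  also have "\<dots> = (2 * (q ^ 8 * s))\<^sup>2" by algebra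
  finally have "expect (\<lambda>S. of_bool (q * (2 * (q ^ 8 * s)) < \<bar>\<Sum>e\<in>edges. (\<theta> (fst e) + \<theta> (snd e)) * W e S\<bar>)) \<le> 4 * ((2 * (q ^ 8 * s))\<^sup>2 / (2 * (q ^ 8 * s))\<^sup>2) / (exp q - 2)"
  proof (intro linear_tail)
    fix e assume "e \<in> edges"
    then show "\<bar>\<theta> (fst e) + \<theta> (snd e)\<bar> \<le> 2 * (q ^ 8 * s)"
    proof (rule edge_cases)
      fix a b assume "e = (a, b)" "a < n" "b < n"
      moreover have "q ^ 0 * s ^ 0 \<le> q ^ 8 * s ^ 1" by (rule monomial_mono) simp
      ultimately show ?thesis using \<theta>_le_1[of a] \<theta>_le_1[of b] \<theta>_nonneg[of a] \<theta>_nonneg[of b] by simp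
    qed
  qed auto
  then show ?thesis unfolding sum2_w_edges by simp
qed

lemma tail_B1: "expect (\<lambda>S. of_bool (q * (2 * s ^ 2) < \<bar>B1 S\<bar>)) \<le> 4 / (exp q - 2)"
proof -
  have "(\<Sum>e\<in>edges. (\<theta> (fst e) * \<theta> (snd e) + \<theta> (snd e) * \<theta> (fst e))\<^sup>2 * (case e of (i, j) \<Rightarrow> \<theta> i * \<theta> j)) \<le> (\<Sum>i<n. \<Sum>j<n. 4 * (\<theta> i ^ 3 * \<theta> j ^ 3))"
  proof (rule sum_edges_le)
    fix a b assume "a < n" "b < n"
    then have t: "0 \<le> \<theta> a ^ 3 * \<theta> b ^ 3" using \<theta>_nonneg by auto
    have "(\<theta> a * \<theta> b + \<theta> b * \<theta> a)\<^sup>2 * (\<theta> a * \<theta> b) = 4 * (\<theta> a ^ 3 * \<theta> b ^ 3)" by algebra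
    then show "(\<theta> (fst (a, b)) * \<theta> (snd (a, b)) + \<theta> (snd (a, b)) * \<theta> (fst (a, b)))\<^sup>2 * (case (a, b) of (i, j) \<Rightarrow> \<theta> i * \<theta> j)
        \<le> 4 * (\<theta> a ^ 3 * \<theta> b ^ 3) + 4 * (\<theta> b ^ 3 * \<theta> a ^ 3)" using t by (simp add: mult.commute)
  qed (auto simp: \<theta>_nonneg)
  also have "\<dots> = 4 * (power_sum 3 * power_sum 3)"
    by (simp add: power_sum_def sum_sum_factor)
  also have "\<dots> \<le> 4 * (s\<^sup>2 * s\<^sup>2)" by (intro mult_left_mono mult_mono power_sum_le_s) auto
  also have "\<dots> = (2 * s ^ 2)\<^sup>2" by algebra
  finally have "expect (\<lambda>S. of_bool (q * (2 * s ^ 2) < \<bar>\<Sum>e\<in>edges. (\<theta> (fst e) * \<theta> (snd e) + \<theta> (snd e) * \<theta> (fst e)) * W e S\<bar>)) \<le> 4 * ((2 * s ^ 2)\<^sup>2 / (2 * s ^ 2)\<^sup>2) / (exp q - 2)"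
  proof (intro linear_tail)
    fix e assume "e \<in> edges"
    then show "\<bar>\<theta> (fst e) * \<theta> (snd e) + \<theta> (snd e) * \<theta> (fst e)\<bar> \<le> 2 * s ^ 2"
    proof (rule edge_cases)
      fix a b assume e: "e = (a, b)" "a < n" "b < n"
      have "1 \<le> s ^ 2" by (rule one_le_power) simp
      moreover have "0 \<le> \<theta> a * \<theta> b" "\<theta> a * \<theta> b \<le> 1" using e \<theta>_nonneg p_le_1 by auto
      ultimately show ?thesis
        unfolding e(1) fst_conv snd_conv abs_le_iff mult.commute[of "\<theta> b" "\<theta> a"] by linarith
    qed
  qed auto
  then show ?thesis unfolding B1_def sum2_w_edges by simp
qed

text \<open>
  The factor \<open>\<theta> i\<close> comes from the ratio of variance to squared threshold in \<open>linear_tail\<close>. It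
  makes the sum over all nodes equal to a power of \<open>q\<close>.
\<close>
lemma tail_row_sum:
  assumes i: "i < n"
  shows "expect (\<lambda>S. of_bool (q * \<rho> i < \<bar>row_sum i S\<bar>)) \<le> 4 * (q ^ 16 * \<theta> i) / (exp q - 2)"
proof -
  have "(\<Sum>e\<in>edges. (of_bool (fst e = i) + of_bool (snd e = i))\<^sup>2 * (case e of (i, j) \<Rightarrow> \<theta> i * \<theta> j)) \<le> (\<Sum>a<n. \<Sum>b<n. of_bool (a = i) * (\<theta> a * \<theta> b))"
    by (rule sum_edges_le) (auto simp: \<theta>_nonneg of_bool_def)
  also have "\<dots> = (\<Sum>a<n. of_bool (a = i) * (\<theta> a * power_sum 1))"
    by (simp add: power_sum_def sum_distrib_left)
  also have "\<dots> = q ^ 16 * \<theta> i"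
    unfolding power_sum_1 using i by (simp add: of_bool_def if_distrib[of "\<lambda>z. z * _"] cong: if_cong)
  finally have le: "(\<Sum>e\<in>edges. (of_bool (fst e = i) + of_bool (snd e = i))\<^sup>2 * (case e of (i, j) \<Rightarrow> \<theta> i * \<theta> j)) \<le> q ^ 16 * \<theta> i" .
  have r1: "1 \<le> \<rho> i" by (rule \<rho>_ge_1[OF i])
  have "q ^ 16 * \<theta> i = (q ^ 8 * sqrt (\<theta> i))\<^sup>2"
    using \<theta>_nonneg[OF i] by (simp add: power_mult_distrib flip: power_mult)
  also have "\<dots> \<le> (\<rho> i)\<^sup>2" using \<theta>_nonneg[OF i] by (intro power_mono) (auto simp: \<rho>_def)
  finally have vb: "q ^ 16 * \<theta> i \<le> (\<rho> i)\<^sup>2" .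
  have "expect (\<lambda>S. of_bool (q * \<rho> i < \<bar>row_sum i S\<bar>)) \<le> 4 * (q ^ 16 * \<theta> i / (\<rho> i)\<^sup>2) / (exp q - 2)"
    unfolding row_sum_edges[OF i]
  proof (rule linear_tail[OF _ _ le vb])
    fix e assume "e \<in> edges"
    then show "\<bar>of_bool (fst e = i) + of_bool (snd e = i)\<bar> \<le> \<rho> i"
    proof (rule edge_cases)
      fix a b assume "e = (a, b)" "a < b"
      then show ?thesis using r1 by (cases "a = i"; cases "b = i") auto
    qed
  qed (use r1 in auto)
  also have "\<dots> \<le> 4 * (q ^ 16 * \<theta> i / 1) / (exp q - 2)"
    using r1 \<theta>_nonneg[OF i] exp_q by (intro divide_right_mono mult_left_mono divide_left_mono) auto
  finally show ?thesis by simp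
qed

lemma bad_prob: "expect (\<lambda>S. of_bool (\<not> good S)) \<le> 32 * (q ^ 32 / exp q)"
proof -
  have "(expect (\<lambda>S. of_bool (\<not> good S)) :: real) \<le> expect (\<lambda>S. of_bool (q * (2 * q ^ 16) < \<bar>sum2 (\<lambda>i j. 1 * w i j S)\<bar>)
      + of_bool (q * (2 * (q ^ 8 * s)) < \<bar>sum2 (\<lambda>i j. \<theta> i * w i j S)\<bar>)
      + of_bool (q * (2 * s ^ 2) < \<bar>B1 S\<bar>) + (\<Sum>i<n. of_bool (q * \<rho> i < \<bar>row_sum i S\<bar>)))"
  proof (rule expect_mono)
    fix S
    let ?A = "q * (2 * q ^ 16) < \<bar>sum2 (\<lambda>i j. 1 * w i j S)\<bar>"
    let ?B = "q * (2 * (q ^ 8 * s)) < \<bar>sum2 (\<lambda>i j. \<theta> i * w i j S)\<bar>"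
    let ?C = "q * (2 * s ^ 2) < \<bar>B1 S\<bar>"
    let ?D = "\<Sum>i<n. of_bool (q * \<rho> i < \<bar>row_sum i S\<bar>) :: real"
    have D0: "0 \<le> ?D" by (intro sum_nonneg) auto
    have D1: "1 \<le> ?D" if "i < n" "q * \<rho> i < \<bar>row_sum i S\<bar>" for i
      using member_le_sum[of i "{..<n}" "\<lambda>i. of_bool (q * \<rho> i < \<bar>row_sum i S\<bar>) :: real"] that by auto
    have nn: "0 \<le> (of_bool ?A :: real)" "0 \<le> (of_bool ?B :: real)" "0 \<le> (of_bool ?C :: real)" by simp_all
    show "of_bool (\<not> good S) \<le> of_bool ?A + of_bool ?B + of_bool ?C + ?D"
    proof (cases "good S")
      case True
      then have "of_bool (\<not> good S) = (0 :: real)" by simp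
      then show ?thesis using nn D0 by linarith
    next
      case False
      then have "?A \<or> ?B \<or> ?C \<or> (\<exists>i<n. q * \<rho> i < \<bar>row_sum i S\<bar>)"
        unfolding good_def by (meson not_le)
      then have "of_bool ?A = (1 :: real) \<or> of_bool ?B = (1 :: real) \<or> of_bool ?C = (1 :: real) \<or> 1 \<le> ?D"
        using D1 unfolding of_bool_eq_1_iff by blast
      moreover have "of_bool (\<not> good S) = (1 :: real)" using False by simp
      ultimately show ?thesis using nn D0 by linarith
    qed
  qed
  also have "\<dots> \<le> 4 / (exp q - 2) + 4 / (exp q - 2) + 4 / (exp q - 2) + (\<Sum>i<n. 4 * (q ^ 16 * \<theta> i) / (exp q - 2))"
    unfolding expect_add expect_sum by (intro add_mono tail_v tail_\<beta> tail_B1 sum_mono tail_row_sum) auto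
  also have "(\<Sum>i<n. 4 * (q ^ 16 * \<theta> i) / (exp q - 2)) = 4 * (q ^ 16 * power_sum 1) / (exp q - 2)"
    by (simp add: power_sum_def sum_distrib_left sum_divide_distrib)
  also have "q ^ 16 * power_sum 1 = q ^ 32" unfolding power_sum_1 by (simp flip: power_add)
  also have "4 / (exp q - 2) + 4 / (exp q - 2) + 4 / (exp q - 2) + 4 * q ^ 32 / (exp q - 2) = (12 + 4 * q ^ 32) / (exp q - 2)"
    by (simp add: add_divide_distrib)
  also have "\<dots> \<le> (16 * q ^ 32) / (exp q / 2)"
  proof -
    have "4 \<le> exp q" using exp_ge_add_one_self[of q] q_ge by linarith
    moreover have "12 + 4 * q ^ 32 \<le> 16 * q ^ 32" using q_pow_ge_1[of 32] by linarith
    ultimately show ?thesis by (intro frac_le) auto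
  qed
  finally show ?thesis by simp
qed

text \<open>
  Two of the three factors are summed freely and the third is bounded by \<open>M\<close>.
\<close>
lemma tri_sum_le:
  assumes f: "\<And>i j. i < n \<Longrightarrow> j < n \<Longrightarrow> i \<noteq> j \<Longrightarrow> \<bar>f i j\<bar> \<le> b i j"
    and b: "\<And>i j. i < n \<Longrightarrow> j < n \<Longrightarrow> 0 \<le> b i j \<and> b i j \<le> M"
  shows "\<bar>sum3 (\<lambda>i j k. f i j * f j k * f k i)\<bar> \<le> M * (\<Sum>i<n. \<Sum>j<n. b i j)\<^sup>2"
proof (cases "n = 0")
  case True show ?thesis unfolding sum3_def by (simp add: True)
next
  case False
  then have M: "0 \<le> M" using b[of 0 0] by auto
  have row: "(\<Sum>k<n. b j k) \<le> (\<Sum>i<n. \<Sum>k<n. b i k)" if "j < n" for j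
    using that b by (intro member_le_sum[of j "{..<n}" "\<lambda>j. \<Sum>k<n. b j k"] sum_nonneg) auto
  have "\<bar>sum3 (\<lambda>i j k. f i j * f j k * f k i)\<bar> \<le> (\<Sum>i<n. \<Sum>j<n. \<Sum>k<n. b i j * b j k * M)"
    unfolding sum3_def
  proof (rule order_trans[OF sum_abs sum_mono], rule order_trans[OF sum_abs sum_mono], rule order_trans[OF sum_abs sum_mono])
    fix i j k assume "i \<in> {..<n}" "j \<in> {..<n}" "k \<in> {..<n}"
    then have ijk: "i < n" "j < n" "k < n" by auto
    have nn: "0 \<le> b i j * b j k * M" using b ijk M by auto
    show "\<bar>of_bool (distinct [i, j, k]) * (f i j * f j k * f k i)\<bar> \<le> b i j * b j k * M"
    proof (cases "distinct [i, j, k]")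
      case True
      then have "\<bar>f k i\<bar> \<le> M" using f[of k i] b[of k i] ijk by auto
      with True show ?thesis using ijk by (auto intro!: abs_mult_le f)
    next
      case False
      then have "of_bool (distinct [i, j, k]) = (0 :: real)" by simp
      then show ?thesis using nn by (simp only: mult_zero_left abs_zero)
    qed
  qed
  also have "\<dots> = M * (\<Sum>i<n. \<Sum>j<n. b i j * (\<Sum>k<n. b j k))"
    by (simp add: sum_distrib_left sum_distrib_right mult_ac)
  also have "\<dots> \<le> M * (\<Sum>i<n. \<Sum>j<n. b i j * (\<Sum>i<n. \<Sum>k<n. b i k))"
    using M b by (intro mult_left_mono sum_mono row) auto
  also have "\<dots> = M * (\<Sum>i<n. \<Sum>j<n. b i j)\<^sup>2"
    by (simp add: power2_eq_square sum_distrib_right)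
  finally show ?thesis .
qed

definition Z :: "(nat \<times> nat) set \<Rightarrow> real" where "Z S = 1 + q ^ 32 + V S"

lemma T_minus_U_crude: "\<bar>T S - U S\<bar> \<le> 6 * Z S ^ 3"
proof -
  have Z: "1 \<le> Z S" "V S \<le> Z S" "q ^ 32 + V S \<le> Z S" "1 + V S \<le> Z S" using V_nonneg[of S] by (auto simp: Z_def)
  have adj01: "0 \<le> adj S i j" "adj S i j \<le> 1" for i j by (auto simp: adj_def)
  have sum_adj: "(\<Sum>i<n. \<Sum>j<n. adj S i j) = V S" by (simp add: V_def node_degree_def)
  have U: "\<bar>U S\<bar> \<le> 2 * (V S + q ^ 32)\<^sup>2"
  proof -
    have "\<bar>U S\<bar> \<le> 2 * (\<Sum>i<n. \<Sum>j<n. adj S i j + \<theta> i * \<theta> j)\<^sup>2"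
      unfolding U_def
    proof (rule tri_sum_le)
      fix i j assume ij: "i < n" "j < n"
      have t: "0 \<le> \<theta> i * \<theta> j" "\<theta> i * \<theta> j \<le> 1" using ij \<theta>_nonneg p_le_1 by auto
      show "0 \<le> adj S i j + \<theta> i * \<theta> j \<and> adj S i j + \<theta> i * \<theta> j \<le> 2" using adj01[of i j] t by linarith
      show "i \<noteq> j \<Longrightarrow> \<bar>w i j S\<bar> \<le> adj S i j + \<theta> i * \<theta> j" using adj01[of i j] t adj_w[of i j S] unfolding abs_le_iff by linarith
    qed
    also have "(\<Sum>i<n. \<Sum>j<n. adj S i j + \<theta> i * \<theta> j) = V S + power_sum 1 * power_sum 1"
      by (simp add: sum.distrib sum_adj power_sum_def sum_product)
    also have "power_sum 1 * power_sum 1 = q ^ 32" unfolding power_sum_1 by (simp flip: power_add)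
    finally show ?thesis .
  qed
  have T: "\<bar>T S\<bar> \<le> (1 + V S) * (2 * V S)\<^sup>2"
  proof -
    have dgV: "node_degree i S \<le> V S" if "i < n" for i
      unfolding V_def using that node_degree_nonneg by (intro member_le_sum) auto
    have eta: "eta_hat n (adj S) i * eta_hat n (adj S) j = node_degree i S * node_degree j S / V S" for i j
    proof (cases "V S = 0")
      case True
      then have "total_degree n (adj S) = 0" using sum_adj by (simp add: total_degree_def)
      then show ?thesis using True by (simp add: eta_hat_def)
    next
      case False
      then show ?thesis using V_nonneg[of S] by (intro eta_hat_mult) simp
    qed
    have "\<bar>T S\<bar> \<le> (1 + V S) * (\<Sum>i<n. \<Sum>j<n. adj S i j + node_degree i S * node_degree j S / V S)\<^sup>2"
      unfolding T_def sgnT_sum3 eta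
    proof (rule tri_sum_le)
      fix i j assume ij: "i < n" "j < n"
      have t: "0 \<le> node_degree i S * node_degree j S / V S" using node_degree_nonneg V_nonneg by simp
      have "node_degree i S * node_degree j S / V S \<le> V S"
      proof (cases "V S = 0")
        case False
        then have "0 < V S" using V_nonneg[of S] by simp
        then show ?thesis using mult_mono[OF dgV[OF ij(1)] dgV[OF ij(2)]] node_degree_nonneg V_nonneg by (simp add: divide_le_eq)
      qed simp
      then show "0 \<le> adj S i j + node_degree i S * node_degree j S / V S \<and> adj S i j + node_degree i S * node_degree j S / V S \<le> 1 + V S"
        using adj01[of i j] t by linarith
      show "\<bar>adj S i j - node_degree i S * node_degree j S / V S\<bar> \<le> adj S i j + node_degree i S * node_degree j S / V S"
        using adj01[of i j] t unfolding abs_le_iff by linarith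
    qed
    also have "(\<Sum>i<n. \<Sum>j<n. adj S i j + node_degree i S * node_degree j S / V S) = V S + V S * V S / V S"
      by (simp add: sum.distrib sum_adj V_def sum_product sum_divide_distrib)
    also have "\<dots> = 2 * V S" by simp
    finally show ?thesis .
  qed
  have "2 * (V S + q ^ 32)\<^sup>2 \<le> 2 * Z S ^ 3"
  proof -
    have "(V S + q ^ 32)\<^sup>2 \<le> Z S ^ 2" using Z V_nonneg[of S] by (intro power_mono) auto
    also have "\<dots> \<le> Z S ^ 3" using Z by (intro power_increasing) auto
    finally show ?thesis by simp
  qed
  moreover have "(1 + V S) * (2 * V S)\<^sup>2 \<le> Z S * (2 * Z S)\<^sup>2"
    using Z V_nonneg[of S] by (intro mult_mono power_mono) auto
  moreover have "Z S * (2 * Z S)\<^sup>2 = 4 * Z S ^ 3" by algebra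
  ultimately show ?thesis using U T abs_triangle_ineq4[of "T S" "U S"] by linarith
qed

text \<open>
  The inequality \<open>y ^ 12 \<le> 12 ^ 12 * exp y\<close> reduces the moment to the moment generating function
  of the number of edges.
\<close>
lemma moment_Z: "expect (\<lambda>S. Z S ^ 12) \<le> 12 ^ 12 * exp 4 * q ^ 384"
proof -
  let ?l = "\<lambda>S. \<Sum>e\<in>edges. (2 / q ^ 32) * W e S"
  have "Z S ^ 12 \<le> 12 ^ 12 * q ^ 384 * exp 3 * exp (?l S)" for S
  proof -
    have Z0: "0 \<le> Z S" using V_nonneg[of S] by (simp add: Z_def)
    (* on the scale \<open>q ^ 32\<close> of the total degree the moment generating function is bounded *)
    define y where "y = Z S / q ^ 32"
    have y0: "0 \<le> y" using Z0 by (simp add: y_def)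
    have "Z S ^ 12 = q ^ 384 * 12 ^ 12 * (y / 12) ^ 12"
      by (simp add: y_def power_divide flip: power_mult)
    also have "\<dots> \<le> q ^ 384 * 12 ^ 12 * exp (y / 12) ^ 12"
    proof -
      have "y / 12 \<le> exp (y / 12)" using exp_ge_add_one_self[of "y / 12"] by linarith
      then have "(y / 12) ^ 12 \<le> exp (y / 12) ^ 12" using y0 by (intro power_mono) simp_all
      then show ?thesis by (rule mult_left_mono) simp
    qed
    also have "exp (y / 12) ^ 12 = exp y" by (simp flip: exp_of_nat_mult)
    also have "exp y \<le> exp (3 + ?l S)"
    proof -
      have "V S = q ^ 32 - s\<^sup>2 + sum2 (\<lambda>i j. 1 * w i j S)" unfolding V_eq v_eq by simp
      also have "sum2 (\<lambda>i j. 1 * w i j S) = q ^ 32 * ?l S"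
        unfolding sum2_w_edges by (simp add: sum_distrib_left)
      finally have "V S \<le> q ^ 32 + q ^ 32 * ?l S" using zero_le_power2[of s] by linarith
      then have "Z S \<le> q ^ 32 * (3 + ?l S)"
        using q_pow_ge_1[of 32] by (simp only: Z_def distrib_left)
      then have "y \<le> 3 + ?l S" by (simp add: y_def divide_le_eq mult.commute)
      then show ?thesis by simp
    qed
    finally show ?thesis by (simp add: exp_add mult_ac)
  qed
  then have "expect (\<lambda>S. Z S ^ 12) \<le> expect (\<lambda>S. 12 ^ 12 * q ^ 384 * exp 3 * exp (?l S))" by (intro expect_mono)
  also have "\<dots> = 12 ^ 12 * q ^ 384 * exp 3 * expect (\<lambda>S. exp (?l S))" by (rule expect_cmult)
  also have "expect (\<lambda>S. exp (?l S)) \<le> exp (\<Sum>e\<in>edges. (2 / q ^ 32)\<^sup>2 * (case e of (i, j) \<Rightarrow> \<theta> i * \<theta> j))"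
  proof (rule expect_exp_linear_le)
    have "100 * q ^ 0 \<le> q ^ 32" by (rule q_pow_ge) simp
    then show "\<bar>2 / q ^ 32\<bar> \<le> 1" by (simp add: field_simps)
  qed
  also have "\<dots> \<le> exp 1"
  proof -
    have "(\<Sum>e\<in>edges. (2 / q ^ 32)\<^sup>2 * (case e of (i, j) \<Rightarrow> \<theta> i * \<theta> j)) \<le> (\<Sum>i<n. \<Sum>j<n. (2 / q ^ 32)\<^sup>2 * (\<theta> i * \<theta> j))"
      by (rule sum_edges_le) (auto simp: \<theta>_nonneg)
    also have "\<dots> = (2 / q ^ 32)\<^sup>2 * (power_sum 1 * power_sum 1)"
      by (simp add: power_sum_def sum_sum_factor)
    also have "\<dots> = 4 / q ^ 32" unfolding power_sum_1 by (simp add: power_divide field_simps flip: power_mult power_add)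
    also have "\<dots> \<le> 1"
    proof -
      have "100 * q ^ 0 \<le> q ^ 32" by (rule q_pow_ge) simp
      then show ?thesis by (simp add: field_simps)
    qed
    finally show ?thesis by simp
  qed
  finally have "expect (\<lambda>S. Z S ^ 12) \<le> 12 ^ 12 * q ^ 384 * exp 3 * exp 1" by simp
  also have "\<dots> = 12 ^ 12 * exp 4 * q ^ 384" by (simp add: mult_ac flip: exp_add)
  finally show ?thesis .
qed

text \<open>
  By Cauchy--Schwarz the square of the cubic bound \<open>T_minus_U_crude\<close> is separated from the
  event; this needs the twelfth moment.
\<close>
lemma nrm_bad: "(nrm (\<lambda>S. of_bool (\<not> good S) * (T S - U S)))\<^sup>2 \<le> 36 * sqrt (32 * 12 ^ 12 * exp 4 * (q ^ 416 / exp q))"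
proof -
  have "(nrm (\<lambda>S. of_bool (\<not> good S) * (T S - U S)))\<^sup>2 \<le> expect (\<lambda>S. 36 * (\<bar>of_bool (\<not> good S)\<bar> * \<bar>Z S ^ 6\<bar>))"
    unfolding nrm_sq
  proof (rule expect_mono)
    fix S
    have "\<bar>T S - U S\<bar>\<^sup>2 \<le> (6 * Z S ^ 3)\<^sup>2" by (intro power_mono T_minus_U_crude) simp
    also have "\<dots> = 36 * \<bar>Z S ^ 6\<bar>" by (simp add: power_mult_distrib flip: power_mult)
    finally show "(of_bool (\<not> good S) * (T S - U S))\<^sup>2 \<le> 36 * (\<bar>of_bool (\<not> good S)\<bar> * \<bar>Z S ^ 6\<bar>)" by auto
  qed
  also have "\<dots> \<le> 36 * (nrm (\<lambda>S. of_bool (\<not> good S)) * nrm (\<lambda>S. Z S ^ 6))"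
    unfolding expect_cmult by (intro mult_left_mono expect_mult_le) auto
  also have "nrm (\<lambda>S. of_bool (\<not> good S)) * nrm (\<lambda>S. Z S ^ 6) = sqrt (expect (\<lambda>S. of_bool (\<not> good S)) * expect (\<lambda>S. Z S ^ 12))"
    unfolding nrm_eq real_sqrt_mult
    by (intro arg_cong2[where f = "(*)"] arg_cong[where f = sqrt] expect_cong) (auto simp flip: power_mult)
  also have "\<dots> \<le> sqrt (32 * (q ^ 32 / exp q) * (12 ^ 12 * exp 4 * q ^ 384))"
    by (intro real_sqrt_le_mono mult_mono bad_prob moment_Z expect_nonneg) auto
  also have "32 * (q ^ 32 / exp q) * (12 ^ 12 * exp 4 * q ^ 384) = 32 * 12 ^ 12 * exp 4 * (q ^ 416 / exp q)"
    by (simp add: mult_ac flip: power_add)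
  finally show ?thesis by simp
qed

theorem nrm_T_minus_U:
  assumes "q ^ 416 / exp q \<le> 1 / (36\<^sup>2 * (32 * 12 ^ 12 * exp 4))"
  shows "nrm (\<lambda>S. T S - U S) \<le> 2000001 * s\<^sup>2"
proof -
  have "32 * 12 ^ 12 * exp 4 * (q ^ 416 / exp q) \<le> 32 * 12 ^ 12 * exp 4 * (1 / (36\<^sup>2 * (32 * 12 ^ 12 * exp 4)))"
    using assms by (intro mult_left_mono) auto
  also have "\<dots> = (1 / 36)\<^sup>2" by (simp add: field_simps)
  finally have "sqrt (32 * 12 ^ 12 * exp 4 * (q ^ 416 / exp q)) \<le> 1 / 36"
    by (intro real_le_lsqrt) auto
  then have "(nrm (\<lambda>S. of_bool (\<not> good S) * (T S - U S)))\<^sup>2 \<le> 1\<^sup>2"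
    using nrm_bad by simp
  then have "nrm (\<lambda>S. of_bool (\<not> good S) * (T S - U S)) \<le> 1"
    by (rule power2_le_imp_le) simp
  moreover have "1 \<le> s\<^sup>2" by (rule one_le_power) simp
  moreover have "nrm (\<lambda>S. T S - U S) \<le> nrm (\<lambda>S. of_bool (good S) * (T S - U S)) + nrm (\<lambda>S. of_bool (\<not> good S) * (T S - U S))"
    by (rule nrm_le_add) auto
  ultimately show ?thesis using nrm_good by linarith
qed

end

section \<open>A Stein identity for one edge\<close>

context bernoulli_product
begin

lemma iexp_taylor_defect: "cmod (iexp y - 1 - \<i> * y * iexp y) \<le> y\<^sup>2 / 2"
proof -
  have "iexp y - 1 - \<i> * y * iexp y = - (iexp y * (iexp (- y) - (1 + \<i> * complex_of_real (- y))))"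
    by (simp add: algebra_simps flip: exp_add)
  then have "cmod (iexp y - 1 - \<i> * y * iexp y) = cmod (iexp (- y) - (1 + \<i> * complex_of_real (- y)))"
    by (simp add: norm_mult del: of_real_minus)
  also have "\<dots> \<le> \<bar>- y\<bar> ^ 2 / 2"
    using iexp_approx1[of "- y" 1] by (simp add: numeral_2_eq_2)
  finally show ?thesis by simp
qed

text \<open>
  With \<open>y = 6 * l * W e * h\<close> one has \<open>exp (\<i> l X) = exp (\<i> l R) * exp (\<i> y)\<close>. The expectation of
  \<open>W e * h * exp (\<i> l R)\<close> vanishes because \<open>W e\<close> is centred and independent of the other
  factors. What is left is \<open>exp (\<i> y) - 1 - \<i> y * exp (\<i> y)\<close>, of second order in \<open>y\<close>.
\<close>
lemma stein_edge:
  fixes h R :: "'e set \<Rightarrow> real" and l :: real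
  assumes e: "e \<in> E"
    and h: "\<And>S. S \<subseteq> E \<Longrightarrow> h (insert e S) = h S" "\<And>S. S \<subseteq> E \<Longrightarrow> h (S - {e}) = h S"
    and R: "\<And>S. S \<subseteq> E \<Longrightarrow> R (insert e S) = R S" "\<And>S. S \<subseteq> E \<Longrightarrow> R (S - {e}) = R S"
  defines "X \<equiv> \<lambda>S. R S + 6 * (W e S * h S)"
  shows "cmod (expect (\<lambda>S. complex_of_real (W e S * h S) * iexp (l * X S))
       - \<i> * l * expect (\<lambda>S. complex_of_real (6 * (W e S * h S)\<^sup>2) * iexp (l * X S))) \<le> 18 * l\<^sup>2 * (p e * expect (\<lambda>S. \<bar>h S\<bar> ^ 3))"
proof -
  define y where "y S = l * (6 * (W e S * h S))" for S
  note pe = p_bounds[OF e]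
  have zero: "expect (\<lambda>S. complex_of_real (W e S * h S) * iexp (l * R S)) = 0"
  proof -
    have "expect (\<lambda>S. complex_of_real (W e S * h S) * iexp (l * R S))
        = expect (\<lambda>S. (of_bool (e \<in> S) - p e) *\<^sub>R (complex_of_real (h S) * iexp (l * R S)))"
      by (simp add: W_def scaleR_conv_of_real mult.assoc)
    also have "\<dots> = (p e * (of_bool True - p e) + (1 - p e) * (of_bool False - p e)) *\<^sub>R expect (\<lambda>S. complex_of_real (h S) * iexp (l * R S))"
      by (rule expect_factor[OF e]) (simp_all add: h R)
    also have "\<dots> = 0" by (simp add: algebra_simps)
    finally show ?thesis .
  qed
  have "expect (\<lambda>S. complex_of_real (W e S * h S) * iexp (l * X S)) - \<i> * l * expect (\<lambda>S. complex_of_real (6 * (W e S * h S)\<^sup>2) * iexp (l * X S))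
      = expect (\<lambda>S. complex_of_real (W e S * h S) * iexp (l * X S)) - expect (\<lambda>S. complex_of_real (W e S * h S) * iexp (l * R S))
         - \<i> * l * expect (\<lambda>S. complex_of_real (6 * (W e S * h S)\<^sup>2) * iexp (l * X S))"
    using zero by simp
  also have "\<dots> = expect (\<lambda>S. complex_of_real (W e S * h S) * iexp (l * X S) - complex_of_real (W e S * h S) * iexp (l * R S)
         - \<i> * l * (complex_of_real (6 * (W e S * h S)\<^sup>2) * iexp (l * X S)))"
    by (simp only: expect_diff expect_cmult)
  also have "\<dots> = expect (\<lambda>S. complex_of_real (W e S * h S) * iexp (l * R S) * (iexp (y S) - 1 - \<i> * y S * iexp (y S)))"
  proof (rule expect_cong)
    fix S
    have "l * X S = l * R S + y S" by (simp add: X_def y_def algebra_simps)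
    then have "iexp (l * X S) = iexp (l * R S) * iexp (y S)"
      by (simp add: exp_add distrib_left)
    then show "complex_of_real (W e S * h S) * iexp (l * X S) - complex_of_real (W e S * h S) * iexp (l * R S)
         - \<i> * l * (complex_of_real (6 * (W e S * h S)\<^sup>2) * iexp (l * X S))
      = complex_of_real (W e S * h S) * iexp (l * R S) * (iexp (y S) - 1 - \<i> * y S * iexp (y S))"
      by (simp add: y_def algebra_simps power2_eq_square)
  qed
  finally have eq: "expect (\<lambda>S. complex_of_real (W e S * h S) * iexp (l * X S)) - \<i> * l * expect (\<lambda>S. complex_of_real (6 * (W e S * h S)\<^sup>2) * iexp (l * X S))
      = expect (\<lambda>S. complex_of_real (W e S * h S) * iexp (l * R S) * (iexp (y S) - 1 - \<i> * y S * iexp (y S)))" .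
  have "cmod (expect (\<lambda>S. complex_of_real (W e S * h S) * iexp (l * R S) * (iexp (y S) - 1 - \<i> * y S * iexp (y S))))
     \<le> expect (\<lambda>S. 18 * l\<^sup>2 * ((\<bar>of_bool (e \<in> S) - p e\<bar> ^ 3) *\<^sub>R \<bar>h S\<bar> ^ 3))"
  proof (rule order_trans[OF norm_expect_le], rule expect_mono)
    fix S
    have "cmod (complex_of_real (W e S * h S) * iexp (l * R S) * (iexp (y S) - 1 - \<i> * y S * iexp (y S)))
        = \<bar>W e S * h S\<bar> * cmod (iexp (y S) - 1 - \<i> * y S * iexp (y S))"
      by (simp only: norm_mult norm_of_real norm_exp_i_times mult_1_right)
    also have "\<dots> \<le> \<bar>W e S * h S\<bar> * ((y S)\<^sup>2 / 2)"
      by (intro mult_left_mono iexp_taylor_defect) auto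
    also have "(y S)\<^sup>2 = 36 * l\<^sup>2 * \<bar>W e S * h S\<bar>\<^sup>2" by (simp add: y_def power_mult_distrib)
    also have "\<bar>W e S * h S\<bar> * (36 * l\<^sup>2 * \<bar>W e S * h S\<bar>\<^sup>2 / 2) = 18 * l\<^sup>2 * \<bar>W e S * h S\<bar> ^ 3" by algebra
    also have "\<dots> = 18 * l\<^sup>2 * ((\<bar>of_bool (e \<in> S) - p e\<bar> ^ 3) *\<^sub>R \<bar>h S\<bar> ^ 3)"
      by (simp add: W_def abs_mult power_mult_distrib)
    finally show "cmod (complex_of_real (W e S * h S) * iexp (l * R S) * (iexp (y S) - 1 - \<i> * y S * iexp (y S)))
        \<le> 18 * l\<^sup>2 * ((\<bar>of_bool (e \<in> S) - p e\<bar> ^ 3) *\<^sub>R \<bar>h S\<bar> ^ 3)" .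
  qed
  also have "\<dots> = 18 * l\<^sup>2 * ((p e * \<bar>of_bool True - p e\<bar> ^ 3 + (1 - p e) * \<bar>of_bool False - p e\<bar> ^ 3) *\<^sub>R expect (\<lambda>S. \<bar>h S\<bar> ^ 3))"
    unfolding expect_cmult by (subst expect_factor[OF e]) (simp_all add: h)
  also have "\<dots> \<le> 18 * l\<^sup>2 * (p e * expect (\<lambda>S. \<bar>h S\<bar> ^ 3))"
  proof -
    have "p e * (1 - p e) ^ 3 + (1 - p e) * p e ^ 3 \<le> p e * (1 - p e) + p e * p e"
    proof (intro add_mono mult_left_mono)
      show "(1 - p e) ^ 3 \<le> 1 - p e" using pe power_decreasing[of 1 3 "1 - p e"] by simp
      have "(1 - p e) * p e ^ 3 \<le> 1 * p e ^ 2" using pe by (intro mult_mono power_decreasing) auto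
      then show "(1 - p e) * p e ^ 3 \<le> p e * p e" by (simp add: power2_eq_square)
    qed (use pe in auto)
    also have "\<dots> = p e" by (simp add: algebra_simps)
    finally have "p e * \<bar>of_bool True - p e\<bar> ^ 3 + (1 - p e) * \<bar>of_bool False - p e\<bar> ^ 3 \<le> p e"
      using pe by simp
    then show ?thesis unfolding real_scaleR_def by (intro mult_left_mono mult_right_mono expect_nonneg) auto
  qed
  finally show ?thesis unfolding eq .
qed

lemma expect_W_factor:
  assumes e: "e \<in> E" and h: "\<And>S. S \<subseteq> E \<Longrightarrow> h (insert e S) = h S" "\<And>S. S \<subseteq> E \<Longrightarrow> h (S - {e}) = h S"
  shows "expect (\<lambda>S. W e S * h S) = (0 :: real)"
  using expect_factor[OF e h, of "\<lambda>b. of_bool b - p e"] by (simp add: W_def algebra_simps)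

end

context null_model
begin

text \<open>
  Six times \<open>h i j\<close> is the derivative of \<open>U\<close> with respect to the edge \<open>i, j\<close>, see \<open>U_diff\<close>.
\<close>
definition h :: "nat \<Rightarrow> nat \<Rightarrow> (nat \<times> nat) set \<Rightarrow> real" where
  "h i j S = (\<Sum>k<n. of_bool (distinct [i, j, k]) * (w j k S * w k i S))"

lemma U_h: "U S = sum2 (\<lambda>i j. w i j S * h i j S)"
  unfolding U_def sum3_sum2 h_def by (simp add: sum_distrib_left mult_ac)

lemma h_sym: "h i j S = h j i S"
  unfolding h_def by (intro sum.cong refl) (auto simp: w_sym mult.commute)

lemma w_indep:
  assumes "edge i j \<noteq> e" shows "w i j (insert e S) = w i j S" "w i j (S - {e}) = w i j S"
  using assms by (auto simp: w_def W_def)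

lemma h_indep: "h i j (insert (edge i j) S) = h i j S" "h i j (S - {edge i j}) = h i j S"
proof -
  have ne: "edge j k \<noteq> edge i j" "edge k i \<noteq> edge i j" if "distinct [i, j, k]" for k
    using that by (auto simp: edge_eq_iff doubleton_eq_iff)
  have "of_bool (distinct [i, j, k]) * (w j k (insert (edge i j) S) * w k i (insert (edge i j) S)) = of_bool (distinct [i, j, k]) * (w j k S * w k i S)"
    "of_bool (distinct [i, j, k]) * (w j k (S - {edge i j}) * w k i (S - {edge i j})) = of_bool (distinct [i, j, k]) * (w j k S * w k i S)" for k
    by (cases "distinct [i, j, k]"; simp add: w_indep ne)+
  then show "h i j (insert (edge i j) S) = h i j S" "h i j (S - {edge i j}) = h i j S"
    unfolding h_def by (simp_all only:)
qed

text \<open>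
  Changing one edge changes only the ordered triples that contain it. Two different factors of a
  triple cannot both change, so the difference is linear, and each triangle is counted six
  times.
\<close>
lemma U_diff:
  assumes ij: "i < n" "j < n" "i \<noteq> j"
    and agree: "\<And>a b. edge a b \<noteq> edge i j \<Longrightarrow> w a b S' = w a b S"
  shows "U S' - U S = 6 * ((w i j S' - w i j S) * h i j S)"
proof -
  define d where "d a b = w a b S' - w a b S" for a b
  have d0: "d a b = 0" if "edge a b \<noteq> edge i j" for a b using agree[OF that] by (simp add: d_def)
  (* consecutive sides of a triangle are different edges, and only one edge changes *)
  have dd: "d a b * d b c = 0" if "distinct [a, b, c]" for a b c
  proof (cases "edge a b = edge i j")
    case True
    have "edge b c \<noteq> edge a b" using that by (auto simp: edge_eq_iff doubleton_eq_iff)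
    with True show ?thesis using d0[of b c] by simp
  next
    case False then show ?thesis using d0 by simp
  qed
  have w': "w a b S' = w a b S + d a b" for a b by (simp add: d_def)
  have "U S' - U S = sum3 (\<lambda>a b c. d a b * (w b c S * w c a S) + d b c * (w c a S * w a b S) + d c a * (w a b S * w b c S))"
    unfolding U_def sum3_diff[symmetric]
  proof (rule sum3_cong)
    fix a b c :: nat assume "distinct [a, b, c]"
    then have z: "d a b * d b c = 0" "d b c * d c a = 0" "d c a * d a b = 0" using dd by auto
    have "(w a b S + d a b) * (w b c S + d b c) * (w c a S + d c a) - w a b S * w b c S * w c a S
      = d a b * (w b c S * w c a S) + d b c * (w c a S * w a b S) + d c a * (w a b S * w b c S)
        + (d a b * d b c) * (w c a S + d c a) + (d b c * d c a) * w a b S + (d c a * d a b) * w b c S" by algebra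
    then show "w a b S' * w b c S' * w c a S' - w a b S * w b c S * w c a S
      = d a b * (w b c S * w c a S) + d b c * (w c a S * w a b S) + d c a * (w a b S * w b c S)"
      unfolding w' z by simp
  qed
  also have "\<dots> = sum3 (\<lambda>a b c. d a b * (w b c S * w c a S)) + sum3 (\<lambda>a b c. d b c * (w c a S * w a b S)) + sum3 (\<lambda>a b c. d c a * (w a b S * w b c S))"
    by (simp only: sum3_add)
  also have "sum3 (\<lambda>a b c. d b c * (w c a S * w a b S)) = sum3 (\<lambda>a b c. d a b * (w b c S * w c a S))"
    by (subst (2) sum3_rot) simp
  also have "sum3 (\<lambda>a b c. d c a * (w a b S * w b c S)) = sum3 (\<lambda>a b c. d a b * (w b c S * w c a S))"
    by (subst sum3_rot) simp
  also have "sum3 (\<lambda>a b c. d a b * (w b c S * w c a S)) = sum2 (\<lambda>a b. d a b * h a b S)"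
    unfolding sum3_sum2 h_def by (simp add: sum_distrib_left mult_ac)
  also have "\<dots> = 2 * (d i j * h i j S)"
  proof -
    define X where "X = d i j * h i j S"
    have "d a b * h a b S = (if a = i then if b = j then X else 0 else 0) + (if a = j then if b = i then X else 0 else 0)" for a b
    proof (cases "edge a b = edge i j")
      case True
      then have "a = i \<and> b = j \<or> a = j \<and> b = i" by (auto simp: edge_eq_iff doubleton_eq_iff)
      moreover have "d j i * h j i S = X" unfolding X_def d_def w_sym[of j i] h_sym[of j i] ..
      ultimately show ?thesis using ij(3) by (auto simp: X_def)
    next
      case False
      then have "\<not> (a = i \<and> b = j)" "\<not> (a = j \<and> b = i)" by (auto simp: edge_eq_iff)
      then show ?thesis using d0[OF False] by auto
    qed
    then have "sum2 (\<lambda>a b. d a b * h a b S) = (\<Sum>a<n. \<Sum>b<n. (if a = i then if b = j then X else 0 else 0) + (if a = j then if b = i then X else 0 else 0))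
         - (\<Sum>a<n. (if a = i then if a = j then X else 0 else 0) + (if a = j then if a = i then X else 0 else 0))"
      unfolding sum2_full by (simp only:)
    also have "\<dots> = (\<Sum>a<n. \<Sum>b<n. (if a = i then if b = j then X else 0 else 0) + (if a = j then if b = i then X else 0 else 0))"
      using ij(3) by (simp add: sum.neutral)
    also have "\<dots> = (\<Sum>a<n. (if a = i then X else 0) + (if a = j then X else 0))"
    proof (rule sum.cong[OF refl])
      fix a
      show "(\<Sum>b<n. (if a = i then if b = j then X else 0 else 0) + (if a = j then if b = i then X else 0 else 0)) = (if a = i then X else 0) + (if a = j then X else 0)"
        using ij by (cases "a = i"; cases "a = j"; simp add: sum.distrib)
    qed
    also have "\<dots> = 2 * (d i j * h i j S)"
      using ij by (simp add: sum.distrib X_def)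
    finally show ?thesis .
  qed
  finally show ?thesis by (simp add: d_def)
qed

lemma U_rest_indep:
  assumes ij: "i < n" "j < n" "i \<noteq> j" and S': "S' = insert (edge i j) S \<or> S' = S - {edge i j}"
  shows "U S' - 6 * (w i j S' * h i j S') = U S - 6 * (w i j S * h i j S)"
proof -
  have "U S' - U S = 6 * ((w i j S' - w i j S) * h i j S)"
    using S' by (intro U_diff ij) (auto simp: w_indep)
  moreover have "h i j S' = h i j S" using S' h_indep by auto
  ultimately show ?thesis by (simp add: algebra_simps)
qed

context
  fixes i j assumes ij: "i < n" "j < n" "i \<noteq> j"
begin

text \<open>
  The possible middle nodes of a path from \<open>i\<close> to \<open>j\<close>.
\<close>
definition Ks :: "nat set" where "Ks = {k. k < n \<and> k \<noteq> i \<and> k \<noteq> j}"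

lemma finite_Ks [simp]: "finite Ks" by (simp add: Ks_def)

lemma sum_Ks: "(\<Sum>k<n. of_bool (distinct [i, j, k]) * f k) = (\<Sum>k\<in>Ks. f k)" for f :: "nat \<Rightarrow> real"
  unfolding Ks_def using ij by (intro sum.mono_neutral_cong_right) auto

lemma KsD: "k \<in> Ks \<Longrightarrow> k < n \<and> k \<noteq> i \<and> k \<noteq> j" by (simp add: Ks_def)

lemma p_Ks: "k \<in> Ks \<Longrightarrow> 0 \<le> \<theta> j * \<theta> k \<and> \<theta> j * \<theta> k \<le> 1 \<and> 0 \<le> \<theta> k * \<theta> i \<and> \<theta> k * \<theta> i \<le> 1"
  using KsD[of k] ij \<theta>_nonneg p_le_1 by auto

text \<open>
  The norms of the multilinear parts of \<open>(h i j)\<^sup>2\<close>. As the end points are fixed, an edge or a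
  path determines its middle node, and a pair of paths determines its unordered pair of middle
  nodes; this bounds the fibres in \<open>nrm_multilinear_le\<close>.
\<close>
lemma nrm_h_edges:
  assumes c: "\<And>k. k \<in> Ks \<Longrightarrow> \<bar>c k\<bar> \<le> \<theta> a * \<theta> k" and ab: "(a = i \<and> b = j) \<or> (a = j \<and> b = i)"
  shows "(nrm (\<lambda>S. \<Sum>k\<in>Ks. c k * w k b S))\<^sup>2 \<le> \<theta> i * \<theta> j * power_sum 2"
proof -
  have ab': "a < n" "b < n" "a \<noteq> b" using ab ij by blast+
  have ab'_prod: "\<theta> i * \<theta> j = \<theta> a * \<theta> b" using ab by (metis mult.commute)
  have ab'_Ks: "k < n \<and> k \<noteq> a \<and> k \<noteq> b" if "k \<in> Ks" for k using ab KsD[OF that] by blast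
  have "(nrm (\<lambda>S. \<Sum>k\<in>Ks. c k * (\<Prod>e\<in>{edge k b}. W e S)))\<^sup>2 \<le> 1 * (\<Sum>k\<in>Ks. (c k)\<^sup>2 * (\<Prod>e\<in>{edge k b}. case e of (i, j) \<Rightarrow> \<theta> i * \<theta> j))"
  proof (rule nrm_multilinear_le)
    fix k assume k: "k \<in> Ks"
    show "{edge k b} \<subseteq> edges" using ab'(2) ab'_Ks[OF k] by (simp add: edge_in)
    have "{k' \<in> Ks. {edge k' b} = {edge k b}} \<subseteq> {k}"
    proof clarify
      fix k' assume k': "k' \<in> Ks" "edge k' b = edge k b"
      then show "k' = k" using ab'_Ks[OF k'(1)] ab'_Ks[OF k] by (simp add: edge_eq_iff doubleton_eq_iff)
    qed
    then have "card {k' \<in> Ks. {edge k' b} = {edge k b}} \<le> card {k}" by (intro card_mono) auto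
    then show "real (card {k' \<in> Ks. {edge k' b} = {edge k b}}) \<le> 1" by simp
  qed simp
  also have "(\<lambda>S. \<Sum>k\<in>Ks. c k * (\<Prod>e\<in>{edge k b}. W e S)) = (\<lambda>S. \<Sum>k\<in>Ks. c k * w k b S)"
  proof (intro ext sum.cong refl)
    fix S k assume "k \<in> Ks"
    then show "c k * (\<Prod>e\<in>{edge k b}. W e S) = c k * w k b S" using ab'_Ks[of k] by (simp add: w_def)
  qed
  also have "1 * (\<Sum>k\<in>Ks. (c k)\<^sup>2 * (\<Prod>e\<in>{edge k b}. case e of (i, j) \<Rightarrow> \<theta> i * \<theta> j)) \<le> (\<Sum>k\<in>Ks. \<theta> a * \<theta> b * (\<theta> k)\<^sup>2)"
    unfolding mult_1
  proof (rule sum_mono)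
    fix k assume k: "k \<in> Ks"
    have t: "0 \<le> \<theta> a * \<theta> k" "\<theta> a * \<theta> k \<le> 1" "0 \<le> \<theta> k * \<theta> b" using ab' ab'_Ks[OF k] \<theta>_nonneg p_le_1 by auto
    have "\<bar>c k\<bar>\<^sup>2 \<le> (\<theta> a * \<theta> k)\<^sup>2" using c[OF k] by (intro power_mono) auto
    also have "\<dots> \<le> \<theta> a * \<theta> k" using t by (simp add: power2_eq_square mult_left_le)
    finally have "(c k)\<^sup>2 * (\<theta> k * \<theta> b) \<le> \<theta> a * \<theta> k * (\<theta> k * \<theta> b)" using t by (intro mult_right_mono) auto
    then show "(c k)\<^sup>2 * (\<Prod>e\<in>{edge k b}. case e of (i, j) \<Rightarrow> \<theta> i * \<theta> j) \<le> \<theta> a * \<theta> b * (\<theta> k)\<^sup>2"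
      by (simp add: p_edge power2_eq_square mult_ac)
  qed
  also have "\<dots> \<le> (\<Sum>k<n. \<theta> a * \<theta> b * (\<theta> k)\<^sup>2)"
    using ab' \<theta>_nonneg by (intro sum_mono2) (auto simp: Ks_def)
  also have "\<dots> = \<theta> i * \<theta> j * power_sum 2" by (simp add: ab'_prod power_sum_def sum_distrib_left)
  finally show ?thesis .
qed

lemma nrm_h_paths:
  assumes c: "\<And>k. k \<in> Ks \<Longrightarrow> \<bar>c k\<bar> \<le> 1"
  shows "(nrm (\<lambda>S. \<Sum>k\<in>Ks. c k * (w j k S * w k i S)))\<^sup>2 \<le> \<theta> i * \<theta> j * power_sum 2"
proof -
  define F where "F k = {edge j k, edge k i}" for k
  have ne: "edge j k \<noteq> edge k i" if "k \<in> Ks" for k using KsD[OF that] ij by (auto simp: edge_eq_iff doubleton_eq_iff)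
  have "(nrm (\<lambda>S. \<Sum>k\<in>Ks. c k * (\<Prod>e\<in>F k. W e S)))\<^sup>2 \<le> 1 * (\<Sum>k\<in>Ks. (c k)\<^sup>2 * (\<Prod>e\<in>F k. case e of (i, j) \<Rightarrow> \<theta> i * \<theta> j))"
  proof (rule nrm_multilinear_le)
    fix k assume k: "k \<in> Ks"
    show "F k \<subseteq> edges" using ij KsD[OF k] by (simp add: F_def edge_in)
    have "{k' \<in> Ks. F k' = F k} \<subseteq> {k}"
    proof clarify
      fix k' assume k': "k' \<in> Ks" "F k' = F k"
      then have "edge j k' \<in> F k" by (auto simp: F_def)
      then show "k' = k" using KsD[OF k] KsD[OF k'(1)] ij by (auto simp: F_def edge_eq_iff doubleton_eq_iff)
    qed
    then have "card {k' \<in> Ks. F k' = F k} \<le> card {k}" by (intro card_mono) auto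
    then show "real (card {k' \<in> Ks. F k' = F k}) \<le> 1" by simp
  qed simp
  also have "(\<lambda>S. \<Sum>k\<in>Ks. c k * (\<Prod>e\<in>F k. W e S)) = (\<lambda>S. \<Sum>k\<in>Ks. c k * (w j k S * w k i S))"
  proof (intro ext sum.cong refl)
    fix S k assume k: "k \<in> Ks"
    have "(\<Prod>e\<in>F k. W e S) = W (edge j k) S * W (edge k i) S" using ne[OF k] by (simp add: F_def)
    then show "c k * (\<Prod>e\<in>F k. W e S) = c k * (w j k S * w k i S)" using KsD[OF k] by (simp add: w_def)
  qed
  also have "1 * (\<Sum>k\<in>Ks. (c k)\<^sup>2 * (\<Prod>e\<in>F k. case e of (i, j) \<Rightarrow> \<theta> i * \<theta> j)) \<le> (\<Sum>k\<in>Ks. \<theta> i * \<theta> j * (\<theta> k)\<^sup>2)"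
    unfolding mult_1
  proof (rule sum_mono)
    fix k assume k: "k \<in> Ks"
    have "(c k)\<^sup>2 \<le> 1" using c[OF k] by (simp add: abs_square_le_1)
    moreover have "0 \<le> \<theta> j * \<theta> k * (\<theta> k * \<theta> i)" using p_Ks[OF k] by simp
    ultimately have "(c k)\<^sup>2 * (\<theta> j * \<theta> k * (\<theta> k * \<theta> i)) \<le> 1 * (\<theta> j * \<theta> k * (\<theta> k * \<theta> i))" by (rule mult_right_mono)
    then show "(c k)\<^sup>2 * (\<Prod>e\<in>F k. case e of (i, j) \<Rightarrow> \<theta> i * \<theta> j) \<le> \<theta> i * \<theta> j * (\<theta> k)\<^sup>2"
      using ne[OF k] by (simp add: F_def p_edge power2_eq_square mult_ac)
  qed
  also have "\<dots> \<le> (\<Sum>k<n. \<theta> i * \<theta> j * (\<theta> k)\<^sup>2)"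
    using ij \<theta>_nonneg by (intro sum_mono2) (auto simp: Ks_def)
  also have "\<dots> = \<theta> i * \<theta> j * power_sum 2" by (simp add: power_sum_def sum_distrib_left)
  finally show ?thesis .
qed

lemma nrm_h_pairs:
  "(nrm (\<lambda>S. \<Sum>(k, l)\<in>{(k, l). k \<in> Ks \<and> l \<in> Ks \<and> k \<noteq> l}. 1 * (w j k S * w k i S * (w j l S * w l i S))))\<^sup>2 \<le> 4 * (\<theta> i * \<theta> j * power_sum 2)\<^sup>2"
proof -
  define I where "I = {(k, l). k \<in> Ks \<and> l \<in> Ks \<and> k \<noteq> l}"
  have I: "I \<subseteq> Ks \<times> Ks" by (auto simp: I_def)
  have fI: "finite I" by (rule finite_subset[OF I]) simp
  define F where "F x = (case x of (k, l) \<Rightarrow> {edge j k, edge k i, edge j l, edge l i})" for x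
  have card_F: "(\<Prod>e\<in>F (k, l). g e) = g (edge j k) * g (edge k i) * (g (edge j l) * g (edge l i))"
    if "(k, l) \<in> I" for k l and g :: "nat \<times> nat \<Rightarrow> real"
  proof -
    have "edge j k \<noteq> edge k i" "edge j k \<noteq> edge j l" "edge j k \<noteq> edge l i" "edge k i \<noteq> edge j l" "edge k i \<noteq> edge l i" "edge j l \<noteq> edge l i"
      using that KsD[of k] KsD[of l] ij by (auto simp: I_def edge_eq_iff doubleton_eq_iff)
    then show ?thesis by (simp add: F_def)
  qed
  have "(nrm (\<lambda>S. \<Sum>x\<in>I. 1 * (\<Prod>e\<in>F x. W e S)))\<^sup>2 \<le> 4 * (\<Sum>x\<in>I. 1\<^sup>2 * (\<Prod>e\<in>F x. case e of (i, j) \<Rightarrow> \<theta> i * \<theta> j))"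
  proof (rule nrm_multilinear_le[OF fI])
    fix x assume x: "x \<in> I"
    obtain k l where kl: "x = (k, l)" "k \<in> Ks" "l \<in> Ks" using x by (auto simp: I_def)
    show "F x \<subseteq> edges" using ij KsD[OF kl(2)] KsD[OF kl(3)] kl(1) by (simp add: F_def edge_in)
    have mem: "a \<in> {k, l}" if "a \<in> Ks" "edge j a \<in> F x" for a
      using that kl KsD[of a] KsD[of k] KsD[of l] ij by (auto simp: F_def edge_eq_iff doubleton_eq_iff)
    have "{y \<in> I. F y = F x} \<subseteq> {k, l} \<times> {k, l}"
    proof clarify
      fix a b assume ab: "(a, b) \<in> I" "F (a, b) = F x"
      then have "edge j a \<in> F x" "edge j b \<in> F x" "a \<in> Ks" "b \<in> Ks" by (auto simp: F_def I_def)
      then show "a \<in> {k, l} \<and> b \<in> {k, l}" using mem by blast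
    qed
    then have "card {y \<in> I. F y = F x} \<le> card ({k, l} \<times> {k, l})" by (intro card_mono) auto
    also have "\<dots> \<le> 2 * 2"
    proof -
      have "card {k, l} \<le> 2" by (cases "k = l") auto
      then show ?thesis unfolding card_cartesian_product by (intro mult_le_mono)
    qed
    finally show "real (card {y \<in> I. F y = F x}) \<le> 4" by simp
  qed
  also have "(\<lambda>S. \<Sum>x\<in>I. 1 * (\<Prod>e\<in>F x. W e S)) = (\<lambda>S. \<Sum>(k, l)\<in>I. 1 * (w j k S * w k i S * (w j l S * w l i S)))"
  proof (intro ext sum.cong refl, clarify)
    fix S k l assume kl: "(k, l) \<in> I"
    then have "k \<noteq> i" "k \<noteq> j" "l \<noteq> i" "l \<noteq> j" using KsD[of k] KsD[of l] by (auto simp: I_def)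
    then show "1 * (\<Prod>e\<in>F (k, l). W e S) = 1 * (w j k S * w k i S * (w j l S * w l i S))"
      unfolding card_F[OF kl] by (simp add: w_def)
  qed
  also have "4 * (\<Sum>x\<in>I. 1\<^sup>2 * (\<Prod>e\<in>F x. case e of (i, j) \<Rightarrow> \<theta> i * \<theta> j)) = 4 * (\<Sum>(k, l)\<in>I. (\<theta> i * \<theta> j * (\<theta> k)\<^sup>2) * (\<theta> i * \<theta> j * (\<theta> l)\<^sup>2))"
  proof (intro arg_cong[where f = "(*) 4"] sum.cong refl, clarify)
    fix k l assume kl: "(k, l) \<in> I"
    show "1\<^sup>2 * (\<Prod>e\<in>F (k, l). case e of (i, j) \<Rightarrow> \<theta> i * \<theta> j) = (\<theta> i * \<theta> j * (\<theta> k)\<^sup>2) * (\<theta> i * \<theta> j * (\<theta> l)\<^sup>2)"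
      unfolding card_F[OF kl] p_edge by (simp add: power2_eq_square)
  qed
  also have "\<dots> \<le> 4 * (\<Sum>(k, l)\<in>{..<n} \<times> {..<n}. (\<theta> i * \<theta> j * (\<theta> k)\<^sup>2) * (\<theta> i * \<theta> j * (\<theta> l)\<^sup>2))"
    using ij \<theta>_nonneg I by (intro mult_left_mono sum_mono2) (auto simp: Ks_def)
  also have "(\<Sum>(k, l)\<in>{..<n} \<times> {..<n}. (\<theta> i * \<theta> j * (\<theta> k)\<^sup>2) * (\<theta> i * \<theta> j * (\<theta> l)\<^sup>2)) = (\<theta> i * \<theta> j * power_sum 2)\<^sup>2"
  proof -
    have "\<theta> i * \<theta> j * power_sum 2 = (\<Sum>k<n. \<theta> i * \<theta> j * (\<theta> k)\<^sup>2)" by (simp add: power_sum_def sum_distrib_left)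
    then show ?thesis unfolding power2_eq_square[of "\<theta> i * \<theta> j * power_sum 2"] by (simp only: sum_product sum.cartesian_product)
  qed
  finally show ?thesis by (simp add: I_def)
qed

lemma h_eq: "h i j S = (\<Sum>k\<in>Ks. 1 * (w j k S * w k i S))"
  unfolding h_def sum_Ks by simp

lemma expect_h2: "expect (\<lambda>S. (h i j S)\<^sup>2) \<le> \<theta> i * \<theta> j * power_sum 2"
  using nrm_h_paths[of "\<lambda>_. 1"] by (simp add: nrm_sq flip: h_eq[simplified])

lemma expect_h4: "expect (\<lambda>S. (h i j S) ^ 4) \<le> 18 * (\<theta> i * \<theta> j * power_sum 2)\<^sup>2 + 18 * (\<theta> i * \<theta> j * power_sum 2)"
proof -
  define z where "z = \<theta> i * \<theta> j * power_sum 2"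
  have z0: "0 \<le> z" using ij \<theta>_nonneg by (simp add: z_def)
  have sq: "(h i j S)\<^sup>2 = (\<Sum>k\<in>Ks. sg j k * sg k i) + (\<Sum>k\<in>Ks. (sg j k * kp k i) * w k i S) + (\<Sum>k\<in>Ks. (kp j k * sg k i) * w k j S)
       + (\<Sum>k\<in>Ks. (kp j k * kp k i) * (w j k S * w k i S))
       + (\<Sum>(k, l)\<in>{(k, l). k \<in> Ks \<and> l \<in> Ks \<and> k \<noteq> l}. 1 * (w j k S * w k i S * (w j l S * w l i S)))" for S
  proof -
    let ?Y = "\<lambda>k. w j k S * w k i S"
    have "(h i j S)\<^sup>2 = (\<Sum>k\<in>Ks. \<Sum>l\<in>Ks. ?Y k * ?Y l)"
      by (simp add: h_eq power2_eq_square sum_product)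
    also have "\<dots> = (\<Sum>k\<in>Ks. \<Sum>l\<in>Ks. (if l = k then (?Y k)\<^sup>2 else 0) + of_bool (k \<noteq> l) * (?Y k * ?Y l))"
      by (intro sum.cong refl) (auto simp: power2_eq_square)
    also have "\<dots> = (\<Sum>k\<in>Ks. (?Y k)\<^sup>2) + (\<Sum>k\<in>Ks. \<Sum>l\<in>Ks. of_bool (k \<noteq> l) * (?Y k * ?Y l))"
      by (simp add: sum.distrib)
    also have "(\<Sum>k\<in>Ks. \<Sum>l\<in>Ks. of_bool (k \<noteq> l) * (?Y k * ?Y l)) = (\<Sum>(k, l)\<in>Ks \<times> Ks. of_bool (k \<noteq> l) * (?Y k * ?Y l))"
      by (simp add: sum.cartesian_product)
    also have "\<dots> = (\<Sum>(k, l)\<in>{(k, l). k \<in> Ks \<and> l \<in> Ks \<and> k \<noteq> l}. 1 * (w j k S * w k i S * (w j l S * w l i S)))"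
      by (intro sum.mono_neutral_cong_right) auto
    also have "(\<Sum>k\<in>Ks. (?Y k)\<^sup>2) = (\<Sum>k\<in>Ks. sg j k * sg k i + (sg j k * kp k i) * w k i S + (kp j k * sg k i) * w k j S + (kp j k * kp k i) * (w j k S * w k i S))"
    proof (intro sum.cong refl)
      fix k assume "k \<in> Ks"
      then have "w j k S ^ 2 = sg j k + kp j k * w j k S" "w k i S ^ 2 = sg k i + kp k i * w k i S"
        using KsD[of k] by (auto intro!: w_square)
      then show "(?Y k)\<^sup>2 = sg j k * sg k i + (sg j k * kp k i) * w k i S + (kp j k * sg k i) * w k j S + (kp j k * kp k i) * (w j k S * w k i S)"
        unfolding power_mult_distrib w_sym[of k j] by algebra
    qed
    finally show ?thesis by (simp add: sum.distrib)
  qed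
  have b: "nrm f \<le> sqrt z" if "(nrm f)\<^sup>2 \<le> z" for f using that by (rule real_le_rsqrt)
  have 1: "nrm (\<lambda>S. \<Sum>k\<in>Ks. sg j k * sg k i) \<le> z"
  proof -
    have "\<bar>\<Sum>k\<in>Ks. sg j k * sg k i\<bar> \<le> (\<Sum>k\<in>Ks. \<theta> i * \<theta> j * (\<theta> k)\<^sup>2)"
    proof (rule order_trans[OF sum_abs], rule sum_mono)
      fix k assume k: "k \<in> Ks"
      then have "0 \<le> sg j k" "sg j k \<le> \<theta> j * \<theta> k" "0 \<le> sg k i" "sg k i \<le> \<theta> k * \<theta> i" using KsD[OF k] ij sg_bounds by auto
      then have "\<bar>sg j k * sg k i\<bar> \<le> \<theta> j * \<theta> k * (\<theta> k * \<theta> i)" by (simp add: mult_mono)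
      then show "\<bar>sg j k * sg k i\<bar> \<le> \<theta> i * \<theta> j * (\<theta> k)\<^sup>2" by (simp add: power2_eq_square mult_ac)
    qed
    also have "\<dots> \<le> (\<Sum>k<n. \<theta> i * \<theta> j * (\<theta> k)\<^sup>2)"
      using ij \<theta>_nonneg by (intro sum_mono2) (auto simp: Ks_def)
    also have "\<dots> = z" by (simp add: z_def power_sum_def sum_distrib_left)
    finally show ?thesis by simp
  qed
  have 2: "nrm (\<lambda>S. \<Sum>k\<in>Ks. (sg j k * kp k i) * w k i S) \<le> sqrt z"
  proof (rule b, unfold z_def, rule nrm_h_edges)
    fix k assume k: "k \<in> Ks"
    then have "\<bar>sg j k\<bar> \<le> \<theta> j * \<theta> k" "\<bar>kp k i\<bar> \<le> 1" using KsD[OF k] ij sg_bounds[of j k] kp_le[of k i] by auto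
    then have "\<bar>sg j k * kp k i\<bar> \<le> \<theta> j * \<theta> k * 1" unfolding abs_mult by (intro mult_mono) auto
    then show "\<bar>sg j k * kp k i\<bar> \<le> \<theta> j * \<theta> k" by simp
  qed auto
  have 3: "nrm (\<lambda>S. \<Sum>k\<in>Ks. (kp j k * sg k i) * w k j S) \<le> sqrt z"
  proof (rule b, unfold z_def, rule nrm_h_edges)
    fix k assume k: "k \<in> Ks"
    then have "\<bar>sg k i\<bar> \<le> \<theta> i * \<theta> k" "\<bar>kp j k\<bar> \<le> 1" using KsD[OF k] ij sg_bounds[of k i] kp_le[of j k] by (auto simp: mult.commute)
    then have "\<bar>kp j k * sg k i\<bar> \<le> 1 * (\<theta> i * \<theta> k)" unfolding abs_mult by (intro mult_mono) auto
    then show "\<bar>kp j k * sg k i\<bar> \<le> \<theta> i * \<theta> k" by simp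
  qed auto
  have 4: "nrm (\<lambda>S. \<Sum>k\<in>Ks. (kp j k * kp k i) * (w j k S * w k i S)) \<le> sqrt z"
  proof (rule b, unfold z_def, rule nrm_h_paths)
    fix k assume k: "k \<in> Ks"
    then have "\<bar>kp j k\<bar> \<le> 1" "\<bar>kp k i\<bar> \<le> 1" using KsD[OF k] ij kp_le by auto
    then show "\<bar>kp j k * kp k i\<bar> \<le> 1" unfolding abs_mult by (intro mult_le_one) auto
  qed
  have 5: "nrm (\<lambda>S. \<Sum>(k, l)\<in>{(k, l). k \<in> Ks \<and> l \<in> Ks \<and> k \<noteq> l}. 1 * (w j k S * w k i S * (w j l S * w l i S))) \<le> 2 * z"
  proof (rule power2_le_imp_le)
    show "(nrm (\<lambda>S. \<Sum>(k, l)\<in>{(k, l). k \<in> Ks \<and> l \<in> Ks \<and> k \<noteq> l}. 1 * (w j k S * w k i S * (w j l S * w l i S))))\<^sup>2 \<le> (2 * z)\<^sup>2"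
      using nrm_h_pairs by (simp add: z_def power_mult_distrib)
  qed (use z0 in simp)
  have "nrm (\<lambda>S. (h i j S)\<^sup>2) \<le> 3 * z + 3 * sqrt z"
    unfolding sq using nrm_add_le[OF nrm_add_le[OF nrm_add_le[OF nrm_add_le[OF 1 2] 3] 4] 5] by simp
  then have "(nrm (\<lambda>S. (h i j S)\<^sup>2))\<^sup>2 \<le> (3 * z + 3 * sqrt z)\<^sup>2" by (intro power_mono) auto
  also have "\<dots> \<le> 2 * ((3 * z)\<^sup>2 + (3 * sqrt z)\<^sup>2)"
    using sum_squares_bound[of "3 * z" "3 * sqrt z"] by (simp add: power2_sum)
  also have "\<dots> = 18 * z\<^sup>2 + 18 * z" using z0 by (simp add: power_mult_distrib)
  finally show ?thesis by (simp add: nrm_sq z_def flip: power_mult)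
qed

end

end

section \<open>The central limit theorem for the centred triangle count\<close>

context bernoulli_product
begin

lemma expect_iexp_le:
  "cmod (expect (\<lambda>S. complex_of_real (f S) * iexp (g S))) \<le> nrm f"
proof -
  have "cmod (expect (\<lambda>S. complex_of_real (f S) * iexp (g S))) \<le> expect (\<lambda>S. \<bar>f S\<bar>)"
    by (rule order_trans[OF norm_expect_le]) (simp add: norm_mult)
  then show ?thesis using expect_abs_le_nrm[of f] by linarith
qed

text \<open>
  If \<open>U\<close> satisfies a Stein identity with a nearly constant factor \<open>\<Gamma>\<close>, then its characteristic
  function satisfies \<open>\<phi>' y = - v * y * \<phi> y\<close> up to a small error. Along the segment from \<open>0\<close> to
  \<open>l\<close> the product of \<open>\<phi>\<close> with the inverse of the Gaussian characteristic function therefore has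
  a small derivative.
\<close>
lemma char_fun_gaussian:
  fixes U \<Gamma> :: "'e set \<Rightarrow> real" and v c l :: real
  assumes stein: "\<And>y. cmod (expect (\<lambda>S. complex_of_real (U S) * iexp (y * U S)) - \<i> * y * expect (\<lambda>S. complex_of_real (\<Gamma> S) * iexp (y * U S))) \<le> c * y\<^sup>2"
    and v: "0 \<le> v" and c: "0 \<le> c"
  shows "cmod (expect (\<lambda>S. iexp (l * U S)) - exp (- (v * l\<^sup>2 / 2))) \<le> l\<^sup>2 * nrm (\<lambda>S. \<Gamma> S - v) + c * \<bar>l\<bar> ^ 3"
proof -
  define \<delta> where "\<delta> = nrm (\<lambda>S. \<Gamma> S - v)"
  have \<delta>0: "0 \<le> \<delta>" by (simp add: \<delta>_def)
  define \<phi> where "\<phi> y = expect (\<lambda>S. iexp (y * U S))" for y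
  define \<phi>' where "\<phi>' y = expect (\<lambda>S. \<i> * U S * iexp (y * U S))" for y
  define g where "g u = complex_of_real (exp (v * l\<^sup>2 * u\<^sup>2 / 2))" for u
  (* the quotient of the two characteristic functions along the segment *)
  define f where "f u = \<phi> (l * u) * g u" for u :: real
  define f' where "f' u = (l *\<^sub>R \<phi>' (l * u)) * g u + \<phi> (l * u) * (of_real (v * l\<^sup>2 * u) * g u)" for u
  have d\<phi>: "((\<lambda>u. \<phi> (l * u)) has_vector_derivative l *\<^sub>R \<phi>' (l * u)) (at u)" for u
  proof -
    have "((\<lambda>u. \<Sum>S\<in>Pow E. weight S *\<^sub>R iexp (l * u * U S)) has_vector_derivative
        (\<Sum>S\<in>Pow E. weight S *\<^sub>R (\<i> * (l * U S) * iexp (l * u * U S)))) (at u)"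
    proof (intro has_vector_derivative_sum has_vector_derivative_scaleR[THEN has_vector_derivative_eq_rhs])
      fix S
      have "((\<lambda>u. exp (\<i> * of_real (l * U S) * of_real u)) has_vector_derivative (\<i> * of_real (l * U S)) * exp (\<i> * of_real (l * U S) * of_real u)) (at u)"
        by (rule has_vector_derivative_real_field) (auto intro!: derivative_eq_intros)
      then show "((\<lambda>u. iexp (l * u * U S)) has_vector_derivative \<i> * (l * U S) * iexp (l * u * U S)) (at u)"
        by (simp add: mult_ac)
      show "((\<lambda>u. weight S) has_real_derivative 0) (at u)" by simp
    qed simp
    moreover have "(\<Sum>S\<in>Pow E. weight S *\<^sub>R (\<i> * (l * U S) * iexp (l * u * U S))) = l *\<^sub>R \<phi>' (l * u)"
      unfolding \<phi>'_def expect_def scaleR_sum_right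
      by (intro sum.cong refl) (simp add: scaleR_conv_of_real mult_ac)
    ultimately show ?thesis by (simp add: \<phi>_def expect_def)
  qed
  have dg: "(g has_vector_derivative of_real (v * l\<^sup>2 * u) * g u) (at u)" for u
  proof -
    have "((\<lambda>u. exp (v * l\<^sup>2 * u\<^sup>2 / 2)) has_real_derivative v * l\<^sup>2 * u * exp (v * l\<^sup>2 * u\<^sup>2 / 2)) (at u)"
      by (auto intro!: derivative_eq_intros simp: power2_eq_square)
    from has_vector_derivative_of_real[OF this] show ?thesis
      by (simp add: g_def[abs_def])
  qed
  have df: "(f has_vector_derivative f' u) (at u)" for u
    unfolding f_def[abs_def] f'_def
    using has_vector_derivative_mult[OF d\<phi>[of u] dg[of u]] by (simp add: add.commute)
  have bound: "cmod (f' u) \<le> (l\<^sup>2 * \<delta> + c * \<bar>l\<bar> ^ 3) * exp (v * l\<^sup>2 / 2)" if u: "0 \<le> u" "u \<le> 1" for u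
  proof -
    let ?y = "l * u"
    let ?A = "expect (\<lambda>S. complex_of_real (U S) * iexp (?y * U S))"
    let ?G = "expect (\<lambda>S. complex_of_real (\<Gamma> S) * iexp (?y * U S))"
    let ?D = "expect (\<lambda>S. complex_of_real (\<Gamma> S - v) * iexp (?y * U S))"
    have 1: "\<phi>' ?y = \<i> * ?A" unfolding \<phi>'_def by (simp only: mult.assoc expect_cmult)
    have 2: "?D = ?G - v * \<phi> ?y"
      unfolding \<phi>_def by (simp only: of_real_diff left_diff_distrib expect_diff expect_cmult)
    have "f' u = l * g u * (\<phi>' ?y + v * ?y * \<phi> ?y)"
      by (simp add: f'_def scaleR_conv_of_real algebra_simps power2_eq_square)
    also have "\<phi>' ?y + v * ?y * \<phi> ?y = \<i> * (?A - \<i> * ?y * ?G) - ?y * ?D"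
      unfolding 1 2 by (simp add: algebra_simps)
    finally have "f' u = l * g u * (\<i> * (?A - \<i> * ?y * ?G) - ?y * ?D)" .
    then have "cmod (f' u) = \<bar>l\<bar> * \<bar>exp (v * l\<^sup>2 * u\<^sup>2 / 2)\<bar> * cmod (\<i> * (?A - \<i> * ?y * ?G) - ?y * ?D)"
      by (simp only: norm_mult norm_of_real g_def)
    also have "\<dots> \<le> \<bar>l\<bar> * exp (v * l\<^sup>2 / 2) * (c * ?y\<^sup>2 + \<bar>?y\<bar> * \<delta>)"
    proof (intro mult_mono)
      have "v * l\<^sup>2 * u\<^sup>2 \<le> v * l\<^sup>2 * 1"
        using u v by (intro mult_left_mono) (auto simp: power_le_one)
      then show "\<bar>exp (v * l\<^sup>2 * u\<^sup>2 / 2)\<bar> \<le> exp (v * l\<^sup>2 / 2)" by simp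
      have "cmod (\<i> * (?A - \<i> * ?y * ?G)) \<le> c * ?y\<^sup>2" using stein[of ?y] by (simp add: norm_mult)
      moreover have "cmod (?y * ?D) \<le> \<bar>?y\<bar> * \<delta>"
        unfolding norm_mult norm_of_real \<delta>_def by (intro mult_left_mono expect_iexp_le) auto
      ultimately show "cmod (\<i> * (?A - \<i> * ?y * ?G) - ?y * ?D) \<le> c * ?y\<^sup>2 + \<bar>?y\<bar> * \<delta>"
        by (intro norm_triangle_le_diff) linarith
    qed auto
    also have "\<dots> \<le> \<bar>l\<bar> * exp (v * l\<^sup>2 / 2) * (c * l\<^sup>2 + \<bar>l\<bar> * \<delta>)"
    proof (intro mult_left_mono add_mono mult_right_mono)
      have "\<bar>?y\<bar> \<le> \<bar>l\<bar> * 1" unfolding abs_mult using u by (intro mult_left_mono) auto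
      then show y: "\<bar>?y\<bar> \<le> \<bar>l\<bar>" by simp
      then show "?y\<^sup>2 \<le> l\<^sup>2" by (simp add: abs_le_square_iff)
    qed (use c \<delta>0 in auto)
    also have "\<dots> = (\<bar>l\<bar>\<^sup>2 * \<delta> + c * (\<bar>l\<bar> * l\<^sup>2)) * exp (v * l\<^sup>2 / 2)" by algebra
    also have "\<bar>l\<bar> * l\<^sup>2 = \<bar>l\<bar> ^ 3" by (simp add: power3_eq_cube power2_eq_square)
    finally show ?thesis by simp
  qed
  have "\<exists>u\<in>{0<..<1}. norm (f 1 - f 0) \<le> norm ((1 - 0) *\<^sub>R f' u)"
  proof (rule mvt_general)
    show "continuous_on {0..1} f"
      using df by (intro continuous_at_imp_continuous_on ballI has_vector_derivative_continuous)
    show "(f has_derivative (\<lambda>x. x *\<^sub>R f' u)) (at u)" for u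
      using df by (simp add: has_vector_derivative_def)
  qed simp
  then obtain u where "0 \<le> u" "u \<le> 1" "cmod (f 1 - f 0) \<le> cmod (f' u)"
    by (metis diff_zero greaterThanLessThan_iff less_imp_le scaleR_one)
  with bound have le: "cmod (f 1 - f 0) \<le> (l\<^sup>2 * \<delta> + c * \<bar>l\<bar> ^ 3) * exp (v * l\<^sup>2 / 2)" by fastforce
  have "f 1 - f 0 = (\<phi> l - exp (- (v * l\<^sup>2 / 2))) * exp (v * l\<^sup>2 / 2)"
  proof -
    have "complex_of_real (exp (- (v * l\<^sup>2 / 2))) * complex_of_real (exp (v * l\<^sup>2 / 2)) = 1"
      by (simp flip: of_real_mult exp_add)
    moreover have "f 0 = 1" by (simp add: f_def g_def \<phi>_def)
    ultimately show ?thesis by (simp add: f_def g_def left_diff_distrib)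
  qed
  then have "cmod (\<phi> l - exp (- (v * l\<^sup>2 / 2))) * exp (v * l\<^sup>2 / 2) \<le> (l\<^sup>2 * \<delta> + c * \<bar>l\<bar> ^ 3) * exp (v * l\<^sup>2 / 2)"
    using le by (simp only: norm_mult norm_of_real abs_exp_cancel)
  then show ?thesis by (simp add: \<phi>_def \<delta>_def)
qed

end

text \<open>
  The bound \<open>m\<close> on \<open>\<theta>\<close> measures how far the network is from having dominant nodes; the normal
  approximation is good when \<open>m\<close> is small and \<open>s\<close> is large.
\<close>
locale spread_model = null_model +
  fixes m s :: real
  assumes m_nonneg: "0 \<le> m" and m_le_1: "m \<le> 1" and \<theta>_le_m: "\<And>i. i < n \<Longrightarrow> \<theta> i \<le> m"
    and s_ge_1: "1 \<le> s" and s_sq: "s\<^sup>2 = power_sum 2"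
begin

lemma power_sum_2_plus: "power_sum (2 + r) \<le> m ^ r * s\<^sup>2"
proof -
  have "power_sum (2 + r) \<le> (\<Sum>i<n. m ^ r * (\<theta> i)\<^sup>2)"
    unfolding power_sum_def power_add mult.commute[of "_\<^sup>2"]
    by (intro sum_mono mult_right_mono power_mono \<theta>_le_m \<theta>_nonneg) auto
  then show ?thesis by (simp add: s_sq power_sum_def flip: sum_distrib_left)
qed

lemma rp2: "rp 2 = s"
  unfolding rp_def using s_ge_1 by (simp flip: s_sq)

lemma rp3_sq: "rp 3 * rp 3 \<le> m * s\<^sup>2" and rp4_sq: "rp 4 * rp 4 \<le> m * s\<^sup>2"
proof -
  show "rp 3 * rp 3 \<le> m * s\<^sup>2" using power_sum_2_plus[of 1] by (simp add: rp_def)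
  have "m ^ 2 * s\<^sup>2 \<le> m * s\<^sup>2" using m_nonneg m_le_1 by (intro mult_right_mono) (auto simp: power2_eq_square mult_left_le)
  then show "rp 4 * rp 4 \<le> m * s\<^sup>2" using power_sum_2_plus[of 2] by (simp add: rp_def)
qed

text \<open>
  The Stein factor of \<open>U\<close>; its expectation is the variance of \<open>U\<close>, see \<open>expect_U_sq\<close>.
\<close>
definition \<Gamma> :: "(nat \<times> nat) set \<Rightarrow> real" where
  "\<Gamma> S = 6 * sum2 (\<lambda>i j. (w i j S)\<^sup>2 * (h i j S)\<^sup>2)"

text \<open>
  Squaring \<open>h\<close> gives triangles with squared edges, which carry the mean of \<open>\<Gamma>\<close>, and pairs of
  triangles sharing an edge.
\<close>
lemma \<Gamma>_split:
  "sum2 (\<lambda>i j. (w i j S)\<^sup>2 * (h i j S)\<^sup>2) =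
     sum3 (\<lambda>i j k. (w i j S)\<^sup>2 * (w j k S)\<^sup>2 * (w k i S)\<^sup>2)
   + sum4 (\<lambda>i j k l. (w i j S)\<^sup>2 * (w j k S * (w i k S * (w j l S * w i l S))))"
proof -
  have "sum2 (\<lambda>i j. (w i j S)\<^sup>2 * (h i j S)\<^sup>2) = sum2 (\<lambda>i j.
      (\<Sum>k<n. of_bool (distinct [i, j, k]) * ((w i j S)\<^sup>2 * (w j k S)\<^sup>2 * (w k i S)\<^sup>2))
    + (\<Sum>k<n. \<Sum>l<n. of_bool (distinct [i, j, k, l]) * ((w i j S)\<^sup>2 * (w j k S * (w i k S * (w j l S * w i l S))))))"
  proof (rule sum2_cong)
    fix i j
    show "(w i j S)\<^sup>2 * (h i j S)\<^sup>2 = (\<Sum>k<n. of_bool (distinct [i, j, k]) * ((w i j S)\<^sup>2 * (w j k S)\<^sup>2 * (w k i S)\<^sup>2))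
      + (\<Sum>k<n. \<Sum>l<n. of_bool (distinct [i, j, k, l]) * ((w i j S)\<^sup>2 * (w j k S * (w i k S * (w j l S * w i l S)))))"
    proof -
      have "(h i j S)\<^sup>2 = (\<Sum>k<n. of_bool (distinct [i, j, k]) * ((w j k S * w k i S) * (w j k S * w k i S)))
        + (\<Sum>k<n. \<Sum>l<n. of_bool (distinct [i, j, k, l]) * ((w j k S * w k i S) * (w j l S * w l i S)))"
        unfolding h_def power2_eq_square by (rule sum_pair_split2)
      then have "(w i j S)\<^sup>2 * (h i j S)\<^sup>2 = (\<Sum>k<n. (w i j S)\<^sup>2 * (of_bool (distinct [i, j, k]) * ((w j k S * w k i S) * (w j k S * w k i S))))
        + (\<Sum>k<n. \<Sum>l<n. (w i j S)\<^sup>2 * (of_bool (distinct [i, j, k, l]) * ((w j k S * w k i S) * (w j l S * w l i S))))"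
        by (simp only: distrib_left sum_distrib_left)
      moreover have "(w i j S)\<^sup>2 * (of_bool (distinct [i, j, k]) * ((w j k S * w k i S) * (w j k S * w k i S))) =
          of_bool (distinct [i, j, k]) * ((w i j S)\<^sup>2 * (w j k S)\<^sup>2 * (w k i S)\<^sup>2)" for k by algebra
      moreover have "(w i j S)\<^sup>2 * (of_bool (distinct [i, j, k, l]) * ((w j k S * w k i S) * (w j l S * w l i S))) =
          of_bool (distinct [i, j, k, l]) * ((w i j S)\<^sup>2 * (w j k S * (w i k S * (w j l S * w i l S))))" for k l
        unfolding w_sym[of k i] w_sym[of l i] by algebra
      ultimately show ?thesis by presburger
    qed
  qed
  then show ?thesis by (simp only: sum2_add sum3_sum2 sum4_sum2)
qed

text \<open>
  The mean of the first part of \<open>\<Gamma>_split\<close>: the sum of the variances of the signed triangles.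
\<close>
definition v0 :: real where "v0 = sum3 (\<lambda>i j k. sg i j * sg j k * sg k i)"

lemma \<Gamma>_triangles:
  "sum3 (\<lambda>i j k. (w i j S)\<^sup>2 * (w j k S)\<^sup>2 * (w k i S)\<^sup>2) = v0
   + 3 * sum2 (\<lambda>i j. (\<Sum>k<n. of_bool (distinct [i, j, k]) * (kp i j * (sg j k * sg k i))) * w i j S)
   + 3 * sum3 (\<lambda>i j k. (kp i j * kp j k * sg k i) * (w i j S * w j k S))
   + sum3 (\<lambda>i j k. (kp i j * kp j k * kp k i) * (w i j S * (w j k S * w i k S)))"
proof -
  let ?f1 = "\<lambda>i j k. (kp i j * (sg j k * sg k i)) * w i j S"
  let ?f2 = "\<lambda>i j k. (kp i j * kp j k * sg k i) * (w i j S * w j k S)"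
  have "sum3 (\<lambda>i j k. (w i j S)\<^sup>2 * (w j k S)\<^sup>2 * (w k i S)\<^sup>2) = sum3 (\<lambda>i j k. sg i j * sg j k * sg k i
      + ?f1 i j k + ?f1 j k i + ?f1 k i j + ?f2 i j k + ?f2 j k i + ?f2 k i j
      + (kp i j * kp j k * kp k i) * (w i j S * (w j k S * w i k S)))"
  proof (rule sum3_cong)
    fix i j k :: nat assume "distinct [i, j, k]"
    then have sq: "(w i j S)\<^sup>2 = sg i j + kp i j * w i j S" "(w j k S)\<^sup>2 = sg j k + kp j k * w j k S" "(w k i S)\<^sup>2 = sg k i + kp k i * w k i S"
      by (auto intro!: w_square)
    show "(w i j S)\<^sup>2 * (w j k S)\<^sup>2 * (w k i S)\<^sup>2 = sg i j * sg j k * sg k i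
      + ?f1 i j k + ?f1 j k i + ?f1 k i j + ?f2 i j k + ?f2 j k i + ?f2 k i j
      + (kp i j * kp j k * kp k i) * (w i j S * (w j k S * w i k S))"
      unfolding sq w_sym[of i k] by algebra
  qed
  also have "\<dots> = v0 + sum3 ?f1 + sum3 (\<lambda>i j k. ?f1 j k i) + sum3 (\<lambda>i j k. ?f1 k i j)
      + sum3 ?f2 + sum3 (\<lambda>i j k. ?f2 j k i) + sum3 (\<lambda>i j k. ?f2 k i j)
      + sum3 (\<lambda>i j k. (kp i j * kp j k * kp k i) * (w i j S * (w j k S * w i k S)))"
    by (simp only: sum3_add v0_def)
  also have "sum3 (\<lambda>i j k. ?f1 j k i) = sum3 ?f1" by (rule sum3_rot[symmetric])
  also have "sum3 (\<lambda>i j k. ?f2 j k i) = sum3 ?f2" by (rule sum3_rot[symmetric])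
  also have "sum3 (\<lambda>i j k. ?f1 k i j) = sum3 ?f1" by (subst sum3_rot) (rule refl)
  also have "sum3 (\<lambda>i j k. ?f2 k i j) = sum3 ?f2" by (subst sum3_rot) (rule refl)
  also have "sum3 ?f1 = sum2 (\<lambda>i j. (\<Sum>k<n. of_bool (distinct [i, j, k]) * (kp i j * (sg j k * sg k i))) * w i j S)"
    unfolding sum3_sum2 sum_distrib_right by (simp only: mult.assoc)
  finally show ?thesis by simp
qed

lemma diamonds:
  "sum4 (\<lambda>i j k l. (w i j S)\<^sup>2 * (w j k S * (w i k S * (w j l S * w i l S)))) =
     sum4 (\<lambda>i j k l. sg i j * (w j k S * (w i k S * (w j l S * w i l S))))
   + sum4 (\<lambda>i j k l. kp i j * (w i j S * (w j k S * (w i k S * (w j l S * w i l S)))))"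
proof -
  have "of_bool (distinct [i, j, k, l]) * ((w i j S)\<^sup>2 * (w j k S * (w i k S * (w j l S * w i l S)))) =
      of_bool (distinct [i, j, k, l]) * (sg i j * (w j k S * (w i k S * (w j l S * w i l S))))
    + of_bool (distinct [i, j, k, l]) * (kp i j * (w i j S * (w j k S * (w i k S * (w j l S * w i l S)))))" for i j k l
    using w_square[of i j S] by (cases "i = j") (simp_all add: algebra_simps)
  then show ?thesis unfolding sum4_def by (simp add: sum.distrib)
qed

text \<open>
  Each variance \<open>sg\<close> is \<open>\<theta> i * \<theta> j\<close> up to a relative error \<open>m\<close>, and triples with coinciding
  indices contribute at most \<open>m\<close> times the full sum \<open>s ^ 6\<close>.
\<close>
lemma v0_bounds: "\<bar>v0 - s ^ 6\<bar> \<le> 6 * (m * s ^ 6)"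
proof -
  let ?t = "\<lambda>i j k. (\<theta> i)\<^sup>2 * (\<theta> j)\<^sup>2 * (\<theta> k)\<^sup>2"
  have m2: "m\<^sup>2 \<le> m" using m_nonneg m_le_1 by (simp add: power2_eq_square mult_left_le)
  have s6: "(\<Sum>i<n. \<Sum>j<n. \<Sum>k<n. ?t i j k) = s ^ 6"
  proof -
    have "(\<Sum>i<n. \<Sum>j<n. \<Sum>k<n. ?t i j k) = power_sum 2 * power_sum 2 * power_sum 2"
      unfolding power_sum_def by (simp only: sum_distrib_left[symmetric] sum_distrib_right[symmetric])
    also have "\<dots> = s ^ 6" unfolding s_sq[symmetric] by algebra
    finally show ?thesis .
  qed
  have diag: "(\<Sum>i<n. \<Sum>j<n. \<Sum>k<n. of_bool (i = j) * ?t i j k) = power_sum 4 * power_sum 2"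
  proof -
    have "(\<Sum>j<n. \<Sum>k<n. of_bool (i = j) * ?t i j k) = \<theta> i ^ 4 * power_sum 2" if "i < n" for i
    proof -
      have "(\<Sum>j<n. \<Sum>k<n. of_bool (i = j) * ?t i j k) = (\<Sum>j<n. if j = i then (\<theta> i)\<^sup>2 * (\<theta> i)\<^sup>2 * power_sum 2 else 0)"
        by (intro sum.cong refl) (auto simp: power_sum_def sum_distrib_left)
      also have "\<dots> = \<theta> i ^ 4 * power_sum 2" using that by (simp flip: power_add)
      finally show ?thesis .
    qed
    then have "(\<Sum>i<n. \<Sum>j<n. \<Sum>k<n. of_bool (i = j) * ?t i j k) = (\<Sum>i<n. \<theta> i ^ 4 * power_sum 2)" by (intro sum.cong) auto
    then show ?thesis by (simp add: power_sum_def[of 4] sum_distrib_right)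
  qed
  have diag': "(\<Sum>i<n. \<Sum>j<n. \<Sum>k<n. of_bool (j = k) * ?t i j k) = power_sum 4 * power_sum 2"
  proof -
    have "(\<Sum>i<n. \<Sum>j<n. \<Sum>k<n. of_bool (j = k) * ?t i j k) = (\<Sum>j<n. \<Sum>i<n. \<Sum>k<n. of_bool (j = k) * ?t i j k)" by (rule sum.swap)
    also have "\<dots> = (\<Sum>j<n. \<Sum>k<n. \<Sum>i<n. of_bool (j = k) * ?t j k i)" by (intro sum.cong refl sum.swap[THEN trans]) (simp add: mult_ac)
    finally show ?thesis using diag by simp
  qed
  have diag'': "(\<Sum>i<n. \<Sum>j<n. \<Sum>k<n. of_bool (k = i) * ?t i j k) = power_sum 4 * power_sum 2"
  proof -
    have "(\<Sum>i<n. \<Sum>j<n. \<Sum>k<n. of_bool (k = i) * ?t i j k) = (\<Sum>i<n. \<Sum>k<n. \<Sum>j<n. of_bool (i = k) * ?t i k j)"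
      by (intro sum.cong refl sum.swap[THEN trans]) (auto simp: mult_ac)
    then show ?thesis using diag by simp
  qed
  have lo: "?t i j k - of_bool (distinct [i, j, k]) * (sg i j * sg j k * sg k i) \<le> 3 * m * ?t i j k
       + of_bool (i = j) * ?t i j k + of_bool (j = k) * ?t i j k + of_bool (k = i) * ?t i j k" (is ?lo)
    and hi: "0 \<le> ?t i j k - of_bool (distinct [i, j, k]) * (sg i j * sg j k * sg k i)" (is ?hi)
    if ijk: "i < n" "j < n" "k < n" for i j k
  proof -
    have t0: "0 \<le> ?t i j k" by simp
    define a b c where "a = \<theta> i * \<theta> j" and "b = \<theta> j * \<theta> k" and "c = \<theta> k * \<theta> i"
    have pm: "\<theta> x * \<theta> y \<le> m" if "x < n" "y < n" for x y
      using mult_mono[OF \<theta>_le_m[OF that(1)] \<theta>_le_1[OF that(2)]] \<theta>_nonneg that m_nonneg by simp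
    have abc: "0 \<le> a" "0 \<le> b" "0 \<le> c" "a \<le> 1" "b \<le> 1" "c \<le> 1" "a \<le> m" "b \<le> m" "c \<le> m"
      using ijk \<theta>_nonneg p_le_1 pm by (auto simp: a_def b_def c_def)
    have prod: "sg i j * sg j k * sg k i = ?t i j k * ((1 - a) * (1 - b) * (1 - c))"
      by (simp add: sg_def a_def b_def c_def power2_eq_square mult_ac)
    have low: "1 - 3 * m \<le> (1 - a) * (1 - b) * (1 - c)"
    proof -
      have "1 - a - b \<le> (1 - a) * (1 - b)" using abc by (simp add: algebra_simps)
      then have "(1 - a - b) * (1 - c) \<le> (1 - a) * (1 - b) * (1 - c)" using abc by (intro mult_right_mono) auto
      moreover have "1 - a - b - c \<le> (1 - a - b) * (1 - c)" using abc mult_nonneg_nonneg[of a c] mult_nonneg_nonneg[of b c] by (simp add: algebra_simps)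
      ultimately show ?thesis using abc by linarith
    qed
    have up: "(1 - a) * (1 - b) * (1 - c) \<le> 1"
      using abc by (intro mult_le_one) auto
    show ?lo
    proof (cases "distinct [i, j, k]")
      case True
      have "?t i j k * (1 - 3 * m) \<le> ?t i j k * ((1 - a) * (1 - b) * (1 - c))" by (intro mult_left_mono low t0)
      then show ?thesis using True unfolding prod by (simp add: algebra_simps)
    next
      case False
      then have "i = j \<or> j = k \<or> k = i" by auto
      then have "(1 :: real) \<le> of_bool (i = j) + of_bool (j = k) + of_bool (k = i)" by (auto simp: of_bool_def)
      then have "1 * ?t i j k \<le> (of_bool (i = j) + of_bool (j = k) + of_bool (k = i)) * ?t i j k" by (intro mult_right_mono t0)
      moreover have "0 \<le> 3 * m * ?t i j k" using m_nonneg t0 by simp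
      moreover have "of_bool (distinct [i, j, k]) = (0 :: real)" using False by simp
      ultimately show ?thesis by (simp only: distrib_right mult_zero_left diff_zero mult_1)
    qed
    show ?hi
    proof (cases "distinct [i, j, k]")
      case True
      have "?t i j k * ((1 - a) * (1 - b) * (1 - c)) \<le> ?t i j k * 1" by (intro mult_left_mono up t0)
      then show ?thesis using True unfolding prod by simp
    next
      case False
      then have "of_bool (distinct [i, j, k]) = (0 :: real)" by simp
      then show ?thesis using t0 by (simp only: mult_zero_left diff_zero)
    qed
  qed
  have diff: "s ^ 6 - v0 = (\<Sum>i<n. \<Sum>j<n. \<Sum>k<n. ?t i j k - of_bool (distinct [i, j, k]) * (sg i j * sg j k * sg k i))"
    unfolding v0_def sum3_def s6[symmetric] by (simp only: sum_subtractf)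
  have "0 \<le> s ^ 6 - v0"
    unfolding diff by (intro sum_nonneg hi) auto
  moreover have "s ^ 6 - v0 \<le> 3 * m * s ^ 6 + 3 * (power_sum 4 * power_sum 2)"
  proof -
    have "s ^ 6 - v0 \<le> (\<Sum>i<n. \<Sum>j<n. \<Sum>k<n. 3 * m * ?t i j k
       + of_bool (i = j) * ?t i j k + of_bool (j = k) * ?t i j k + of_bool (k = i) * ?t i j k)"
      unfolding diff by (intro sum_mono lo) auto
    also have "\<dots> = 3 * m * s ^ 6 + power_sum 4 * power_sum 2 + power_sum 4 * power_sum 2 + power_sum 4 * power_sum 2"
    proof -
      have "(\<Sum>i<n. \<Sum>j<n. \<Sum>k<n. 3 * m * ?t i j k) = 3 * m * s ^ 6"
        unfolding s6[symmetric] by (simp only: sum_distrib_left)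
      then show ?thesis unfolding sum.distrib diag diag' diag'' by simp
    qed
    finally show ?thesis by linarith
  qed
  moreover have "power_sum 4 * power_sum 2 \<le> m * s ^ 6"
  proof -
    have "power_sum 4 * power_sum 2 \<le> m\<^sup>2 * s\<^sup>2 * s\<^sup>2" unfolding s_sq[symmetric] using power_sum_2_plus[of 2] by (intro mult_right_mono) auto
    also have "\<dots> = m\<^sup>2 * s ^ 4" by algebra
    also have "\<dots> \<le> m * s ^ 6" using m2 s_ge_1 m_nonneg by (intro mult_mono power_increasing) auto
    finally show ?thesis .
  qed
  ultimately show ?thesis unfolding abs_le_iff by simp
qed

lemma sg_abs: "i < n \<Longrightarrow> j < n \<Longrightarrow> \<bar>sg i j\<bar> \<le> \<theta> i * \<theta> j" using sg_bounds by auto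

text \<open>
  In the fluctuating parts of \<open>\<Gamma>\<close> some node carries an exponent above two, which yields the
  factor \<open>m\<close>. The only exception is the signed triangle, whose norm is of order \<open>s ^ 3\<close>.
\<close>
lemma nrm_\<Gamma>: "nrm (\<lambda>S. \<Gamma> S - 6 * s ^ 6) \<le> 372 * (m * s ^ 6) + 36 * s ^ 3"
proof -
  have s46: "s ^ 4 \<le> s ^ 6" "s ^ 3 \<le> s ^ 6" using s_ge_1 by (auto intro: power_increasing)
  have mm: "m * s ^ 4 \<le> m * s ^ 6" "m * s ^ 3 \<le> m * s ^ 6" using m_nonneg s46 by (auto intro: mult_left_mono)
  have 1: "nrm (\<lambda>S. sum2 (\<lambda>i j. (\<Sum>k<n. of_bool (distinct [i, j, k]) * (kp i j * (sg j k * sg k i))) * w i j S)) \<le> 2 * (m * s ^ 6)"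
  proof -
    have "nrm (\<lambda>S. sum2 (\<lambda>i j. (\<Sum>k<n. of_bool (distinct [i, j, k]) * (kp i j * (sg j k * sg k i))) * w i j S)) \<le> 2 * (s\<^sup>2 * (rp (2 * 1 + 1) * rp (2 * 1 + 1)))"
    proof (rule edge2)
      fix i j assume ij: "i < n" "j < n"
      have "\<bar>\<Sum>k<n. of_bool (distinct [i, j, k]) * (kp i j * (sg j k * sg k i))\<bar> \<le> (\<Sum>k<n. \<theta> i * \<theta> j * (\<theta> k)\<^sup>2)"
      proof (rule order_trans[OF sum_abs], rule sum_mono)
        fix k assume "k \<in> {..<n}"
        then have k: "k < n" by simp
        have "\<bar>kp i j * (sg j k * sg k i)\<bar> \<le> 1 * (\<theta> j * \<theta> k * (\<theta> k * \<theta> i))"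
          unfolding abs_mult using kp_le sg_abs ij k \<theta>_nonneg by (intro mult_mono mult_nonneg_nonneg) auto
        then have "\<bar>kp i j * (sg j k * sg k i)\<bar> \<le> \<theta> i * \<theta> j * (\<theta> k)\<^sup>2" by (simp add: power2_eq_square mult_ac)
        moreover have "0 \<le> \<theta> i * \<theta> j * (\<theta> k)\<^sup>2" using ij \<theta>_nonneg by simp
        ultimately show "\<bar>of_bool (distinct [i, j, k]) * (kp i j * (sg j k * sg k i))\<bar> \<le> \<theta> i * \<theta> j * (\<theta> k)\<^sup>2"
          by (cases "distinct [i, j, k]") (simp_all del: distinct.simps)
      qed
      also have "\<dots> = s\<^sup>2 * (\<theta> i ^ 1 * \<theta> j ^ 1)" by (simp add: s_sq power_sum_def sum_distrib_left sum_distrib_right mult_ac)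
      finally show "\<bar>\<Sum>k<n. of_bool (distinct [i, j, k]) * (kp i j * (sg j k * sg k i))\<bar> \<le> s\<^sup>2 * (\<theta> i ^ 1 * \<theta> j ^ 1)" .
    qed simp
    also have "\<dots> \<le> 2 * (s\<^sup>2 * (m * s\<^sup>2))" using rp3_sq by (intro mult_left_mono) auto
    also have "\<dots> = 2 * (m * s ^ 4)" by algebra
    finally show ?thesis using mm by linarith
  qed
  have 2: "nrm (\<lambda>S. sum3 (\<lambda>i j k. (kp i j * kp j k * sg k i) * (w i j S * w j k S))) \<le> 6 * (m * s ^ 6)"
  proof -
    have "nrm (\<lambda>S. sum3 (\<lambda>i j k. (kp i j * kp j k * sg k i) * (w i j S * w j k S))) \<le> 6 * (1 * (rp (2 * 1 + 1) * rp (2 * 0 + 2) * rp (2 * 1 + 1)))"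
    proof (rule path3)
      fix i j k assume ijk: "i < n" "j < n" "k < n"
      have "\<bar>kp i j * kp j k * sg k i\<bar> \<le> 1 * 1 * (\<theta> k * \<theta> i)"
        unfolding abs_mult using kp_le sg_abs ijk by (intro mult_mono) auto
      then show "\<bar>kp i j * kp j k * sg k i\<bar> \<le> 1 * (\<theta> i ^ 1 * \<theta> j ^ 0 * \<theta> k ^ 1)" by (simp add: mult.commute)
    qed simp
    also have "\<dots> = 6 * (s * (rp 3 * rp 3))" by (simp add: rp2 flip: numeral_2_eq_2)
    also have "\<dots> \<le> 6 * (s * (m * s\<^sup>2))" using rp3_sq s_ge_1 by (intro mult_left_mono) auto
    also have "\<dots> = 6 * (m * s ^ 3)" by algebra
    finally show ?thesis using mm by linarith
  qed
  have 3: "nrm (\<lambda>S. sum3 (\<lambda>i j k. (kp i j * kp j k * kp k i) * (w i j S * (w j k S * w i k S)))) \<le> 6 * s ^ 3"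
  proof -
    have "nrm (\<lambda>S. sum3 (\<lambda>i j k. (kp i j * kp j k * kp k i) * (w i j S * (w j k S * w i k S)))) \<le> 6 * (1 * (rp (2 * 0 + 2) * rp (2 * 0 + 2) * rp (2 * 0 + 2)))"
    proof (rule triangle)
      fix i j k assume ijk: "i < n" "j < n" "k < n"
      have "\<bar>kp i j * kp j k * kp k i\<bar> \<le> 1 * 1 * 1"
        unfolding abs_mult using kp_le ijk by (intro mult_mono) auto
      then show "\<bar>kp i j * kp j k * kp k i\<bar> \<le> 1 * (\<theta> i ^ 0 * \<theta> j ^ 0 * \<theta> k ^ 0)" by simp
    qed simp
    then show ?thesis by (simp add: rp2 power3_eq_cube mult.assoc flip: numeral_2_eq_2)
  qed
  have 4: "nrm (\<lambda>S. sum4 (\<lambda>i j k l. sg i j * (w j k S * (w i k S * (w j l S * w i l S))))) \<le> 16 * (m * s ^ 6)"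
  proof -
    have "nrm (\<lambda>S. sum4 (\<lambda>i j k l. sg i j * (w j k S * (w i k S * (w j l S * w i l S))))) \<le> 16 * (1 * (rp (2 * 1 + 2) * rp (2 * 1 + 2) * rp (2 * 0 + 2) * rp (2 * 0 + 2)))"
      using nrm_graph4[of "[(1, 2), (0, 2), (1, 3), (0, 3)]" "\<lambda>i j k l. sg i j" 1 1 1 0 0] sg_abs
      by (simp add: sum4_def pattern_degree_def less_Suc_eq numeral_3_eq_3 numeral_2_eq_2 eval_nat_numeral)
    also have "\<dots> = 16 * ((rp 4 * rp 4) * s\<^sup>2)" by (simp add: rp2 power2_eq_square mult_ac flip: numeral_2_eq_2)
    also have "\<dots> \<le> 16 * ((m * s\<^sup>2) * s\<^sup>2)" using rp4_sq by (intro mult_left_mono mult_right_mono) auto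
    also have "\<dots> = 16 * (m * s ^ 4)" by algebra
    finally show ?thesis using mm by linarith
  qed
  have 5: "nrm (\<lambda>S. sum4 (\<lambda>i j k l. kp i j * (w i j S * (w j k S * (w i k S * (w j l S * w i l S)))))) \<le> 16 * (m * s ^ 6)"
  proof -
    have "nrm (\<lambda>S. sum4 (\<lambda>i j k l. kp i j * (w i j S * (w j k S * (w i k S * (w j l S * w i l S)))))) \<le> 16 * (1 * (rp (2 * 0 + 3) * rp (2 * 0 + 3) * rp (2 * 0 + 2) * rp (2 * 0 + 2)))"
      using nrm_graph4[of "[(0, 1), (1, 2), (0, 2), (1, 3), (0, 3)]" "\<lambda>i j k l. kp i j" 1 0 0 0 0] kp_le
      by (simp add: sum4_def pattern_degree_def less_Suc_eq numeral_3_eq_3 numeral_2_eq_2 eval_nat_numeral)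
    also have "\<dots> = 16 * ((rp 3 * rp 3) * s\<^sup>2)" by (simp add: rp2 power2_eq_square mult_ac flip: numeral_2_eq_2)
    also have "\<dots> \<le> 16 * ((m * s\<^sup>2) * s\<^sup>2)" using rp3_sq by (intro mult_left_mono mult_right_mono) auto
    also have "\<dots> = 16 * (m * s ^ 4)" by algebra
    finally show ?thesis using mm by linarith
  qed
  have 0: "nrm (\<lambda>S. v0 - s ^ 6) \<le> 6 * (m * s ^ 6)" using v0_bounds by simp
  have eq: "\<Gamma> S - 6 * s ^ 6 = 6 * ((v0 - s ^ 6)
    + 3 * sum2 (\<lambda>i j. (\<Sum>k<n. of_bool (distinct [i, j, k]) * (kp i j * (sg j k * sg k i))) * w i j S)
   + 3 * sum3 (\<lambda>i j k. (kp i j * kp j k * sg k i) * (w i j S * w j k S))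
   + sum3 (\<lambda>i j k. (kp i j * kp j k * kp k i) * (w i j S * (w j k S * w i k S)))
   + sum4 (\<lambda>i j k l. sg i j * (w j k S * (w i k S * (w j l S * w i l S))))
   + sum4 (\<lambda>i j k l. kp i j * (w i j S * (w j k S * (w i k S * (w j l S * w i l S))))))" for S
    unfolding \<Gamma>_def \<Gamma>_split \<Gamma>_triangles diamonds by simp
  have "nrm (\<lambda>S. \<Gamma> S - 6 * s ^ 6) \<le> \<bar>6\<bar> * (6 * (m * s ^ 6) + \<bar>3\<bar> * (2 * (m * s ^ 6)) + \<bar>3\<bar> * (6 * (m * s ^ 6)) + 6 * s ^ 3 + 16 * (m * s ^ 6) + 16 * (m * s ^ 6))"
    unfolding eq by (intro nrm_scale_le nrm_add_le 0 1 2 3 4 5)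
  then show ?thesis by (simp add: algebra_simps)
qed

lemma edge_fst_snd: "e \<in> edges \<Longrightarrow> fst e < n \<and> snd e < n \<and> fst e \<noteq> snd e \<and> edge (fst e) (snd e) = e"
  by (auto simp: edges_def edge_def)

lemma w_W: "e \<in> edges \<Longrightarrow> w (fst e) (snd e) S = W e S"
  using edge_fst_snd[of e] by (simp add: w_def)

definition h_edge :: "nat \<times> nat \<Rightarrow> (nat \<times> nat) set \<Rightarrow> real" where "h_edge e S = h (fst e) (snd e) S"

lemma sum2_edges_sym:
  assumes "\<And>i j. f i j = f j i" shows "sum2 f = (\<Sum>e\<in>edges. 2 * f (fst e) (snd e))"
  unfolding sum2_edges by (intro sum.cong refl) (use assms in \<open>auto split: prod.splits\<close>)

lemma U_edges: "U S = (\<Sum>e\<in>edges. 2 * (W e S * h_edge e S))"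
  unfolding U_h by (subst sum2_edges_sym) (simp_all add: w_sym h_sym h_edge_def w_W)

lemma \<Gamma>_edges: "\<Gamma> S = (\<Sum>e\<in>edges. 12 * (W e S * h_edge e S)\<^sup>2)"
  unfolding \<Gamma>_def by (subst sum2_edges_sym) (simp_all add: w_sym h_sym h_edge_def w_W power_mult_distrib sum_distrib_left)

lemma h_edge_indep: "e \<in> edges \<Longrightarrow> h_edge e (insert e S) = h_edge e S" "e \<in> edges \<Longrightarrow> h_edge e (S - {e}) = h_edge e S"
  using h_indep[of "fst e" "snd e" S] edge_fst_snd[of e] by (simp_all add: h_edge_def)

definition rest :: "nat \<times> nat \<Rightarrow> (nat \<times> nat) set \<Rightarrow> real" where "rest e S = U S - 6 * (W e S * h_edge e S)"

lemma rest_indep: "e \<in> edges \<Longrightarrow> rest e (insert e S) = rest e S" "e \<in> edges \<Longrightarrow> rest e (S - {e}) = rest e S"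
  using U_rest_indep[of "fst e" "snd e" "insert e S" S] U_rest_indep[of "fst e" "snd e" "S - {e}" S] edge_fst_snd[of e] w_W[of e]
  by (simp_all add: rest_def h_edge_def)

definition third_moments :: real where "third_moments = (\<Sum>e\<in>edges. (case e of (i, j) \<Rightarrow> \<theta> i * \<theta> j) * expect (\<lambda>S. \<bar>h_edge e S\<bar> ^ 3))"

text \<open>
  The one-edge identity is summed over all edges, each of which occurs in two ordered pairs.
\<close>
lemma stein_U:
  "cmod (expect (\<lambda>S. complex_of_real (U S) * iexp (y * U S)) - \<i> * y * expect (\<lambda>S. complex_of_real (\<Gamma> S) * iexp (y * U S))) \<le> 36 * third_moments * y\<^sup>2"
proof -
  let ?A = "\<lambda>e. expect (\<lambda>S. complex_of_real (W e S * h_edge e S) * iexp (y * U S))"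
  let ?B = "\<lambda>e. expect (\<lambda>S. complex_of_real (6 * (W e S * h_edge e S)\<^sup>2) * iexp (y * U S))"
  have A: "expect (\<lambda>S. complex_of_real (U S) * iexp (y * U S)) = (\<Sum>e\<in>edges. 2 * ?A e)"
  proof -
    have "complex_of_real (U S) * z = (\<Sum>e\<in>edges. 2 * (complex_of_real (W e S * h_edge e S) * z))" for S z
      by (simp add: U_edges sum_distrib_left sum_distrib_right mult_ac)
    then show ?thesis by (simp only: expect_sum expect_cmult)
  qed
  have B: "expect (\<lambda>S. complex_of_real (\<Gamma> S) * iexp (y * U S)) = (\<Sum>e\<in>edges. 2 * ?B e)"
  proof -
    have "complex_of_real (\<Gamma> S) * z = (\<Sum>e\<in>edges. 2 * (complex_of_real (6 * (W e S * h_edge e S)\<^sup>2) * z))" for S z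
      by (simp add: \<Gamma>_edges sum_distrib_left sum_distrib_right mult_ac)
    then show ?thesis by (simp only: expect_sum expect_cmult)
  qed
  have "cmod ((\<Sum>e\<in>edges. 2 * ?A e) - \<i> * y * (\<Sum>e\<in>edges. 2 * ?B e)) = cmod (\<Sum>e\<in>edges. 2 * (?A e - \<i> * y * ?B e))"
    by (simp add: sum_distrib_left right_diff_distrib sum_subtractf mult_ac)
  also have "\<dots> \<le> (\<Sum>e\<in>edges. 2 * (18 * y\<^sup>2 * ((case e of (i, j) \<Rightarrow> \<theta> i * \<theta> j) * expect (\<lambda>S. \<bar>h_edge e S\<bar> ^ 3))))"
  proof (rule sum_norm_le)
    fix e assume e: "e \<in> edges"
    have eq: "rest e S + 6 * (W e S * h_edge e S) = U S" for S by (simp add: rest_def)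
    have "cmod (?A e - \<i> * y * ?B e) \<le> 18 * y\<^sup>2 * ((case e of (i, j) \<Rightarrow> \<theta> i * \<theta> j) * expect (\<lambda>S. \<bar>h_edge e S\<bar> ^ 3))"
      using stein_edge[OF e, of "h_edge e" "rest e" y] h_edge_indep[OF e] rest_indep[OF e] unfolding eq by blast
    moreover have "cmod (2 * (?A e - \<i> * y * ?B e)) = 2 * cmod (?A e - \<i> * y * ?B e)" by (simp only: norm_mult norm_numeral)
    ultimately show "cmod (2 * (?A e - \<i> * y * ?B e)) \<le> 2 * (18 * y\<^sup>2 * ((case e of (i, j) \<Rightarrow> \<theta> i * \<theta> j) * expect (\<lambda>S. \<bar>h_edge e S\<bar> ^ 3)))"
      by linarith
  qed
  also have "\<dots> = 36 * third_moments * y\<^sup>2" by (simp add: third_moments_def sum_distrib_left sum_distrib_right mult_ac)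
  finally show ?thesis unfolding A B .
qed

lemma expect_U: "expect U = 0"
proof -
  have "expect U = expect (\<lambda>S. \<Sum>e\<in>edges. 2 * (W e S * h_edge e S))" by (rule expect_cong) (rule U_edges)
  also have "\<dots> = (\<Sum>e\<in>edges. 2 * expect (\<lambda>S. W e S * h_edge e S))" by (simp only: expect_sum expect_cmult)
  also have "\<dots> = 0" using h_edge_indep by (intro sum.neutral ballI) (simp add: expect_W_factor)
  finally show ?thesis .
qed

lemma expect_U_sq: "expect (\<lambda>S. (U S)\<^sup>2) = expect \<Gamma>"
proof -
  have "expect (\<lambda>S. (U S)\<^sup>2) = expect (\<lambda>S. \<Sum>e\<in>edges. 2 * (W e S * (h_edge e S * rest e S)) + 12 * (W e S * h_edge e S)\<^sup>2)"
  proof (rule expect_cong)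
    fix S
    have "(U S)\<^sup>2 = (\<Sum>e\<in>edges. 2 * (W e S * h_edge e S)) * U S" by (simp add: power2_eq_square U_edges[symmetric])
    also have "\<dots> = (\<Sum>e\<in>edges. 2 * (W e S * h_edge e S) * (rest e S + 6 * (W e S * h_edge e S)))"
      by (simp add: sum_distrib_right rest_def)
    also have "\<dots> = (\<Sum>e\<in>edges. 2 * (W e S * (h_edge e S * rest e S)) + 12 * (W e S * h_edge e S)\<^sup>2)"
      by (intro sum.cong refl) algebra
    finally show "(U S)\<^sup>2 = (\<Sum>e\<in>edges. 2 * (W e S * (h_edge e S * rest e S)) + 12 * (W e S * h_edge e S)\<^sup>2)" .
  qed
  also have "\<dots> = (\<Sum>e\<in>edges. 2 * expect (\<lambda>S. W e S * (h_edge e S * rest e S)) + expect (\<lambda>S. 12 * (W e S * h_edge e S)\<^sup>2))"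
    by (simp only: expect_sum expect_add expect_cmult)
  also have "\<dots> = (\<Sum>e\<in>edges. expect (\<lambda>S. 12 * (W e S * h_edge e S)\<^sup>2))"
    using h_edge_indep rest_indep by (intro sum.cong refl) (simp add: expect_W_factor)
  also have "\<dots> = expect \<Gamma>"
    unfolding expect_sum[symmetric] by (rule expect_cong) (simp add: \<Gamma>_edges)
  finally show ?thesis .
qed

lemma third_moments_nonneg: "0 \<le> third_moments"
  unfolding third_moments_def using \<theta>_nonneg by (intro sum_nonneg mult_nonneg_nonneg expect_nonneg) (auto simp: edges_def)

text \<open>
  The third moment is interpolated between the second and the fourth by
  \<open>2 * \<bar>h\<bar> ^ 3 \<le> \<kappa> * h\<^sup>2 + h ^ 4 / \<kappa>\<close>. The choice \<open>\<kappa> = m * s + 1\<close> balances the two sums over all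
  edges.
\<close>
lemma third_moments_le: "third_moments \<le> 10 * (m * s + 1) * s ^ 6"
proof -
  define \<kappa> where "\<kappa> = m * s + 1"
  have \<kappa>: "1 \<le> \<kappa>" using m_nonneg s_ge_1 by (simp add: \<kappa>_def)
  have "(case e of (i, j) \<Rightarrow> \<theta> i * \<theta> j) * expect (\<lambda>S. \<bar>h_edge e S\<bar> ^ 3) \<le>
      \<theta> (fst e) * \<theta> (snd e) * ((\<kappa> * (\<theta> (fst e) * \<theta> (snd e) * s\<^sup>2) + (18 * (\<theta> (fst e) * \<theta> (snd e) * s\<^sup>2)\<^sup>2 + 18 * (\<theta> (fst e) * \<theta> (snd e) * s\<^sup>2)) / \<kappa>) / 2)"
    if e: "e \<in> edges" for e
  proof -
    have ij: "fst e < n" "snd e < n" "fst e \<noteq> snd e" using edge_fst_snd[OF e] by auto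
    have "expect (\<lambda>S. \<bar>h_edge e S\<bar> ^ 3) \<le> expect (\<lambda>S. (\<kappa> / 2) * (h_edge e S)\<^sup>2 + (1 / (2 * \<kappa>)) * (h_edge e S) ^ 4)"
    proof (rule expect_mono)
      fix S
      define a where "a = \<bar>h_edge e S\<bar>"
      have "2 * \<kappa> * a ^ 3 \<le> \<kappa>\<^sup>2 * a\<^sup>2 + a ^ 4"
      proof -
        have "\<kappa>\<^sup>2 * a\<^sup>2 + a ^ 4 - 2 * \<kappa> * a ^ 3 = (a * (\<kappa> - a))\<^sup>2" by algebra
        then show ?thesis using zero_le_power2[of "a * (\<kappa> - a)"] by linarith
      qed
      then have "2 * \<kappa> * a ^ 3 / (2 * \<kappa>) \<le> (\<kappa>\<^sup>2 * a\<^sup>2 + a ^ 4) / (2 * \<kappa>)" using \<kappa> by (intro divide_right_mono) auto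
      also have "2 * \<kappa> * a ^ 3 / (2 * \<kappa>) = a ^ 3" using \<kappa> by simp
      also have "(\<kappa>\<^sup>2 * a\<^sup>2 + a ^ 4) / (2 * \<kappa>) = (\<kappa> / 2) * a\<^sup>2 + (1 / (2 * \<kappa>)) * a ^ 4"
        using \<kappa> by (simp add: add_divide_distrib power2_eq_square)
      finally show "\<bar>h_edge e S\<bar> ^ 3 \<le> (\<kappa> / 2) * (h_edge e S)\<^sup>2 + (1 / (2 * \<kappa>)) * (h_edge e S) ^ 4"
        by (simp add: a_def)
    qed
    also have "\<dots> = (\<kappa> / 2) * expect (\<lambda>S. (h_edge e S)\<^sup>2) + (1 / (2 * \<kappa>)) * expect (\<lambda>S. (h_edge e S) ^ 4)"
      by (simp only: expect_add expect_cmult)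
    also have "\<dots> \<le> (\<kappa> / 2) * (\<theta> (fst e) * \<theta> (snd e) * s\<^sup>2) + (1 / (2 * \<kappa>)) * (18 * (\<theta> (fst e) * \<theta> (snd e) * s\<^sup>2)\<^sup>2 + 18 * (\<theta> (fst e) * \<theta> (snd e) * s\<^sup>2))"
      using \<kappa> expect_h2[OF ij] expect_h4[OF ij] unfolding h_edge_def s_sq by (intro add_mono mult_left_mono) auto
    also have "\<dots> = (\<kappa> * (\<theta> (fst e) * \<theta> (snd e) * s\<^sup>2) + (18 * (\<theta> (fst e) * \<theta> (snd e) * s\<^sup>2)\<^sup>2 + 18 * (\<theta> (fst e) * \<theta> (snd e) * s\<^sup>2)) / \<kappa>) / 2"
      by (simp add: add_divide_distrib)
    finally show ?thesis using ij \<theta>_nonneg by (simp only: case_prod_unfold) (intro mult_left_mono, auto)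
  qed
  then have "third_moments \<le> (\<Sum>e\<in>edges. \<theta> (fst e) * \<theta> (snd e) * ((\<kappa> * (\<theta> (fst e) * \<theta> (snd e) * s\<^sup>2) + (18 * (\<theta> (fst e) * \<theta> (snd e) * s\<^sup>2)\<^sup>2 + 18 * (\<theta> (fst e) * \<theta> (snd e) * s\<^sup>2)) / \<kappa>) / 2))"
    unfolding third_moments_def by (rule sum_mono)
  also have "\<dots> \<le> (\<Sum>(i, j)\<in>{..<n} \<times> {..<n}. \<theta> i * \<theta> j * ((\<kappa> * (\<theta> i * \<theta> j * s\<^sup>2) + (18 * (\<theta> i * \<theta> j * s\<^sup>2)\<^sup>2 + 18 * (\<theta> i * \<theta> j * s\<^sup>2)) / \<kappa>) / 2))"
    unfolding case_prod_unfold using \<theta>_nonneg \<kappa> by (intro sum_mono2) (auto simp: edges_def intro!: mult_nonneg_nonneg add_nonneg_nonneg divide_nonneg_nonneg)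
  also have "\<dots> = (\<Sum>i<n. \<Sum>j<n. (\<kappa> * s\<^sup>2 / 2 + 9 * s\<^sup>2 / \<kappa>) * ((\<theta> i)\<^sup>2 * (\<theta> j)\<^sup>2) + (9 * s ^ 4 / \<kappa>) * (\<theta> i ^ 3 * \<theta> j ^ 3))"
    unfolding sum.cartesian_product[symmetric]
  proof (intro sum.cong refl)
    fix i j
    show "\<theta> i * \<theta> j * ((\<kappa> * (\<theta> i * \<theta> j * s\<^sup>2) + (18 * (\<theta> i * \<theta> j * s\<^sup>2)\<^sup>2 + 18 * (\<theta> i * \<theta> j * s\<^sup>2)) / \<kappa>) / 2)
      = (\<kappa> * s\<^sup>2 / 2 + 9 * s\<^sup>2 / \<kappa>) * ((\<theta> i)\<^sup>2 * (\<theta> j)\<^sup>2) + (9 * s ^ 4 / \<kappa>) * (\<theta> i ^ 3 * \<theta> j ^ 3)"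
      using \<kappa> by (simp add: field_simps power2_eq_square power3_eq_cube power4_eq_xxxx)
  qed
  also have "\<dots> = (\<kappa> * s\<^sup>2 / 2 + 9 * s\<^sup>2 / \<kappa>) * (s\<^sup>2 * s\<^sup>2) + (9 * s ^ 4 / \<kappa>) * (power_sum 3 * power_sum 3)"
    unfolding sum.distrib sum_sum_factor s_sq power_sum_def ..
  also have "\<dots> \<le> (\<kappa> * s\<^sup>2 / 2 + 9 * s\<^sup>2 / \<kappa>) * (s\<^sup>2 * s\<^sup>2) + (9 * s ^ 4 / \<kappa>) * ((m * s\<^sup>2) * (m * s\<^sup>2))"
    using power_sum_2_plus[of 1] \<kappa> m_nonneg by (intro add_left_mono mult_left_mono mult_mono) auto
  also have "\<dots> = (\<kappa> / 2 + 9 * (1 + (m * s)\<^sup>2) / \<kappa>) * s ^ 6"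
    using \<kappa> by (simp add: field_simps power2_eq_square eval_nat_numeral)
  also have "\<dots> \<le> (\<kappa> / 2 + 9 * \<kappa>) * s ^ 6"
  proof (intro mult_right_mono add_left_mono)
    have "1 + (m * s)\<^sup>2 \<le> \<kappa> * \<kappa>" using m_nonneg s_ge_1 by (simp add: \<kappa>_def power2_eq_square algebra_simps)
    then show "9 * (1 + (m * s)\<^sup>2) / \<kappa> \<le> 9 * \<kappa>" using \<kappa> by (simp add: divide_le_eq)
  qed (use s_ge_1 in auto)
  also have "\<dots> \<le> 10 * \<kappa> * s ^ 6" using \<kappa> s_ge_1 by (intro mult_right_mono) auto
  finally show ?thesis by (simp add: \<kappa>_def)
qed

theorem char_U:
  "cmod (expect (\<lambda>S. iexp (l * U S)) - exp (- (6 * s ^ 6 * l\<^sup>2 / 2))) \<le>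
     l\<^sup>2 * (372 * (m * s ^ 6) + 36 * s ^ 3) + 360 * (m * s + 1) * s ^ 6 * \<bar>l\<bar> ^ 3"
proof -
  have "cmod (expect (\<lambda>S. iexp (l * U S)) - exp (- (6 * s ^ 6 * l\<^sup>2 / 2))) \<le> l\<^sup>2 * nrm (\<lambda>S. \<Gamma> S - 6 * s ^ 6) + 36 * third_moments * \<bar>l\<bar> ^ 3"
    using s_ge_1 third_moments_nonneg by (intro char_fun_gaussian stein_U) auto
  also have "\<dots> \<le> l\<^sup>2 * (372 * (m * s ^ 6) + 36 * s ^ 3) + 36 * (10 * (m * s + 1) * s ^ 6) * \<bar>l\<bar> ^ 3"
    by (intro add_mono mult_left_mono mult_right_mono nrm_\<Gamma> third_moments_le) auto
  also have "36 * (10 * (m * s + 1) * s ^ 6) * \<bar>l\<bar> ^ 3 = 360 * (m * s + 1) * s ^ 6 * \<bar>l\<bar> ^ 3" by algebra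
  finally show ?thesis .
qed

theorem variance_U: "\<bar>expect (\<lambda>S. (U S)\<^sup>2) - 6 * s ^ 6\<bar> \<le> 372 * (m * s ^ 6) + 36 * s ^ 3"
proof -
  have "expect (\<lambda>S. (U S)\<^sup>2) - 6 * s ^ 6 = expect (\<lambda>S. \<Gamma> S - 6 * s ^ 6)" by (simp add: expect_U_sq expect_diff)
  then show ?thesis using abs_expect_le_nrm[of "\<lambda>S. \<Gamma> S - 6 * s ^ 6"] nrm_\<Gamma> by linarith
qed

end

section \<open>From the network to the finite model\<close>

definition graph_of :: "nat \<Rightarrow> (nat \<Rightarrow> nat \<Rightarrow> real) \<Rightarrow> (nat \<times> nat) set" where
  "graph_of n a = {(i, j). i < j \<and> j < n \<and> a i j = 1}"

lemma sgnT_cong: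
  assumes "\<And>i j. i < n \<Longrightarrow> j < n \<Longrightarrow> a i j = b i j"
  shows "sgnT n a = sgnT n b"
proof -
  have td: "total_degree n a = total_degree n b"
    unfolding total_degree_def using assms by (intro sum.cong) auto
  have eta: "eta_hat n a i = eta_hat n b i" if "i < n" for i
    unfolding eta_hat_def td using assms that by (intro if_cong refl arg_cong2[where f = "(*)"] sum.cong) auto
  show ?thesis
    unfolding sgnT_def using assms eta by (intro sum.cong) auto
qed

lemma null_network_measurable:
  assumes "null_network M n \<theta> A" "i < n" "j < n"
  shows "(\<lambda>\<omega>. A \<omega> i j) \<in> borel_measurable M"
proof -
  interpret prob_space M using assms by (simp add: null_network_def)
  have meas: "(\<lambda>\<omega>. A \<omega> i j) \<in> borel_measurable M" if "i < j" "j < n" for i j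
    using assms that unfolding null_network_def indep_vars_def2 by auto
  consider "i < j" | "i = j" | "j < i" by linarith
  then show ?thesis
  proof cases
    case 1 then show ?thesis using meas assms by simp
  next
    case 2
    then have "(\<lambda>\<omega>. A \<omega> i j) \<in> borel_measurable M \<longleftrightarrow> (\<lambda>\<omega>. 0 :: real) \<in> borel_measurable M"
      using assms by (intro measurable_cong) (simp add: null_network_def)
    then show ?thesis by simp
  next
    case 3
    then have "(\<lambda>\<omega>. A \<omega> i j) \<in> borel_measurable M \<longleftrightarrow> (\<lambda>\<omega>. A \<omega> j i) \<in> borel_measurable M"
      using assms by (intro measurable_cong) (simp add: null_network_def)
    then show ?thesis using 3 meas assms by simp
  qed
qed

text \<open>
  Measurability holds for every \<open>n\<close>, including those for which some \<open>\<theta> i\<close> exceeds one and the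
  finite model is unavailable; the continuity theorem needs all terms of the sequence to be
  distributions.
\<close>
lemma sgnT_measurable:
  assumes "null_network M n \<theta> A"
  shows "(\<lambda>\<omega>. sgnT n (A \<omega>)) \<in> borel_measurable M"
proof -
  note [measurable] = null_network_measurable[OF assms]
  have td [measurable]: "(\<lambda>\<omega>. total_degree n (A \<omega>)) \<in> borel_measurable M"
    unfolding total_degree_def by (intro borel_measurable_sum) auto
  have [measurable]: "(\<lambda>\<omega>. eta_hat n (A \<omega>) i) \<in> borel_measurable M" if "i < n" for i
  proof -
    have [measurable]: "(\<lambda>\<omega>. \<Sum>j<n. A \<omega> i j) \<in> borel_measurable M"
      using that by (intro borel_measurable_sum) auto
    show ?thesis unfolding eta_hat_def by measurable
  qed
  show ?thesis
    unfolding sgnT_def case_prod_unfold by (intro borel_measurable_sum) auto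
qed

context null_model
begin

text \<open>
  That the network has a given set of edges is an intersection of one event for each pair of
  nodes, and these events are independent.
\<close>
lemma prob_graph:
  assumes net: "null_network M n \<theta> A" and S: "S \<subseteq> edges"
  shows "{\<omega> \<in> space M. graph_of n (A \<omega>) = S} \<in> sets M" (is ?m)
    and "measure M {\<omega> \<in> space M. graph_of n (A \<omega>) = S} = weight S" (is ?p)
proof -
  interpret prob_space M using net by (simp add: null_network_def)
  define X where "X = (\<lambda>(i, j) \<omega>. A \<omega> i j)"
  define a :: "nat \<times> nat \<Rightarrow> real set" where "a e = (if e \<in> S then {1} else {0})" for e
  define Y where "Y e = X e -` a e \<inter> space M" for e
  have val: "X e \<omega> \<in> {0, 1}" if e: "e \<in> edges" and w: "\<omega> \<in> space M" for e \<omega>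
  proof -
    obtain i j where "e = (i, j)" "i < n" "j < n" using e by (auto simp: edges_def)
    moreover have "\<forall>\<omega>\<in>space M. \<forall>i<n. \<forall>j<n. A \<omega> i j \<in> {0, 1}" using net unfolding null_network_def by blast
    ultimately show ?thesis using w by (simp add: X_def)
  qed
  have ind: "indep_vars (\<lambda>_. borel) X edges"
    using net unfolding null_network_def X_def edges_def by blast
  have Xm: "X e \<in> borel_measurable M" if "e \<in> edges" for e
    using ind that by (simp add: indep_vars_def2)
  have a: "a e \<in> sets borel" for e by (simp add: a_def)
  have Y: "Y e \<in> sets M" if "e \<in> edges" for e
    unfolding Y_def using measurable_sets[OF Xm[OF that] a] .
  have eq: "{\<omega> \<in> space M. graph_of n (A \<omega>) = S} = space M \<inter> (\<Inter>e\<in>edges. Y e)"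
  proof (intro set_eqI iffI)
    fix \<omega> assume "\<omega> \<in> {\<omega> \<in> space M. graph_of n (A \<omega>) = S}"
    then have w: "\<omega> \<in> space M" and g: "graph_of n (A \<omega>) = S" by auto
    have "\<omega> \<in> Y e" if e: "e \<in> edges" for e
      using val[OF e w] e g w by (auto simp: Y_def a_def X_def graph_of_def edges_def)
    then show "\<omega> \<in> space M \<inter> (\<Inter>e\<in>edges. Y e)" using w by auto
  next
    fix \<omega> assume "\<omega> \<in> space M \<inter> (\<Inter>e\<in>edges. Y e)"
    then have w: "\<omega> \<in> space M" and Y: "\<And>e. e \<in> edges \<Longrightarrow> X e \<omega> \<in> a e" unfolding Y_def by blast+
    have "e \<in> graph_of n (A \<omega>) \<longleftrightarrow> e \<in> S" if "e \<in> edges" for e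
      using Y[OF that] that by (cases e) (auto simp: a_def X_def graph_of_def edges_def split: if_splits)
    moreover have "graph_of n (A \<omega>) \<subseteq> edges" by (auto simp: graph_of_def edges_def)
    ultimately show "\<omega> \<in> {\<omega> \<in> space M. graph_of n (A \<omega>) = S}" using w S by blast
  qed
  show ?m unfolding eq using Y finite_edges by (cases "edges = {}") auto
  have pY: "prob (Y e) = (if e \<in> S then case e of (i, j) \<Rightarrow> \<theta> i * \<theta> j else 1 - (case e of (i, j) \<Rightarrow> \<theta> i * \<theta> j))"
    if e: "e \<in> edges" for e
  proof -
    obtain i j where ij: "e = (i, j)" "i < j" "j < n" using e by (auto simp: edges_def)
    have one: "prob {\<omega> \<in> space M. A \<omega> i j = 1} = \<theta> i * \<theta> j" using net ij by (simp add: null_network_def)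
    have ev: "{\<omega> \<in> space M. A \<omega> i j = 1} \<in> sets M"
      using measurable_sets[OF Xm[OF e], of "{1}"] ij by (auto simp: X_def vimage_def Int_def conj_commute)
    have "Y e = (if e \<in> S then {\<omega> \<in> space M. A \<omega> i j = 1} else space M - {\<omega> \<in> space M. A \<omega> i j = 1})"
      using val[OF e] by (auto simp: Y_def a_def X_def ij)
    then show ?thesis using one prob_compl[OF ev] by (simp add: ij)
  qed
  have "prob (space M \<inter> (\<Inter>e\<in>edges. Y e)) = (\<Prod>e\<in>edges. prob (Y e))"
  proof (cases "edges = {}")
    case True then show ?thesis by (simp add: prob_space)
  next
    case False
    have "space M \<inter> (\<Inter>e\<in>edges. Y e) = (\<Inter>e\<in>edges. Y e)" using False by (auto simp: Y_def)
    then show ?thesis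
      using indep_varsD_finite[OF ind False finite_edges, of a] a by (simp add: Y_def)
  qed
  also have "\<dots> = (\<Prod>e\<in>edges. if e \<in> S then case e of (i, j) \<Rightarrow> \<theta> i * \<theta> j else 1 - (case e of (i, j) \<Rightarrow> \<theta> i * \<theta> j))"
    by (intro prod.cong refl pY)
  also have "\<dots> = weight S"
    using S finite_edges unfolding weight_def by (simp add: prod.If_cases Int_absorb1 Diff_eq flip: Collect_neg_eq)
  finally show ?p unfolding eq .
qed

lemma integral_graph:
  fixes f :: "(nat \<times> nat) set \<Rightarrow> 'b::{banach, second_countable_topology}"
  assumes net: "null_network M n \<theta> A"
  shows "(\<integral>\<omega>. f (graph_of n (A \<omega>)) \<partial>M) = expect f"
proof -
  interpret prob_space M using net by (simp add: null_network_def)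
  let ?B = "\<lambda>S. {\<omega> \<in> space M. graph_of n (A \<omega>) = S}"
  have g: "graph_of n (A \<omega>) \<in> Pow edges" for \<omega> by (auto simp: graph_of_def edges_def)
  have B: "?B S \<in> sets M" if "S \<in> Pow edges" for S using prob_graph(1)[OF net] that by auto
  have "(\<integral>\<omega>. f (graph_of n (A \<omega>)) \<partial>M) = (\<integral>\<omega>. (\<Sum>S\<in>Pow edges. indicator (?B S) \<omega> *\<^sub>R f S) \<partial>M)"
  proof (rule Bochner_Integration.integral_cong[OF refl])
    fix \<omega> assume "\<omega> \<in> space M"
    then have "(\<Sum>S\<in>Pow edges. indicator (?B S) \<omega> *\<^sub>R f S) = (\<Sum>S\<in>Pow edges. if S = graph_of n (A \<omega>) then f S else 0)"
      by (intro sum.cong refl) (auto simp: indicator_def)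
    also have "\<dots> = f (graph_of n (A \<omega>))" using g finite_edges by (subst sum.delta) auto
    finally show "f (graph_of n (A \<omega>)) = (\<Sum>S\<in>Pow edges. indicator (?B S) \<omega> *\<^sub>R f S)" by simp
  qed
  also have "\<dots> = (\<Sum>S\<in>Pow edges. \<integral>\<omega>. indicator (?B S) \<omega> *\<^sub>R f S \<partial>M)"
    using B by (intro Bochner_Integration.integral_sum integrable_scaleR_left impI integrable_real_indicator)
      (auto simp: less_top[symmetric])
  also have "\<dots> = (\<Sum>S\<in>Pow edges. weight S *\<^sub>R f S)"
  proof (intro sum.cong refl)
    fix S assume S: "S \<in> Pow edges"
    have "(\<integral>\<omega>. indicator (?B S) \<omega> *\<^sub>R f S \<partial>M) = measure M (?B S) *\<^sub>R f S"
      using B[OF S] by (subst integral_scaleR_left) (auto simp: less_top[symmetric])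
    then show "(\<integral>\<omega>. indicator (?B S) \<omega> *\<^sub>R f S \<partial>M) = weight S *\<^sub>R f S"
      using prob_graph(2)[OF net, of S] S by simp
  qed
  finally show ?thesis by (simp add: expect_def)
qed

lemma sgnT_graph:
  assumes net: "null_network M n \<theta> A" and "\<omega> \<in> space M"
  shows "sgnT n (A \<omega>) = T (graph_of n (A \<omega>))"
  unfolding T_def
proof (rule sgnT_cong)
  fix i j assume ij: "i < n" "j < n"
  have diag: "A \<omega> i i = 0" and sym: "A \<omega> i j = A \<omega> j i" and "A \<omega> i j \<in> {0, 1}"
    using assms ij unfolding null_network_def by blast+
  then show "A \<omega> i j = adj (graph_of n (A \<omega>)) i j"
    using ij by (cases i j rule: linorder_cases) (auto simp: adj_def edge_def graph_of_def)
qed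

lemma expectation_sgnT:
  fixes f :: "real \<Rightarrow> 'b::{banach, second_countable_topology}"
  assumes "null_network M n \<theta> A"
  shows "(\<integral>\<omega>. f (sgnT n (A \<omega>)) \<partial>M) = expect (\<lambda>S. f (T S))"
proof -
  have "(\<integral>\<omega>. f (sgnT n (A \<omega>)) \<partial>M) = (\<integral>\<omega>. f (T (graph_of n (A \<omega>))) \<partial>M)"
    by (rule Bochner_Integration.integral_cong) (simp_all add: sgnT_graph[OF assms])
  then show ?thesis by (simp add: integral_graph[OF assms, of "\<lambda>S. f (T S)"])
qed

end

context bernoulli_product
begin

text \<open>
  Characteristic functions are Lipschitz with respect to the \<open>L\<^sup>2\<close> distance.
\<close>
lemma expect_iexp_diff_le:
  "cmod (expect (\<lambda>S. iexp (l * f S)) - expect (\<lambda>S. iexp (l * g S))) \<le> \<bar>l\<bar> * nrm (\<lambda>S. f S - g S)"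
proof -
  have "cmod (iexp x - iexp y) \<le> \<bar>x - y\<bar>" for x y
  proof -
    have "iexp x - iexp y = iexp y * (iexp (x - y) - 1)"
      by (simp add: right_diff_distrib of_real_diff flip: exp_add)
    moreover have "cmod (iexp (x - y) - 1) \<le> \<bar>x - y\<bar>" using iexp_approx1[of "x - y" 0] by simp
    ultimately show ?thesis by (simp add: norm_mult)
  qed
  then have "expect (\<lambda>S. cmod (iexp (l * f S) - iexp (l * g S))) \<le> expect (\<lambda>S. \<bar>l * f S - l * g S\<bar>)"
    by (intro expect_mono)
  also have "\<dots> \<le> nrm (\<lambda>S. l * f S - l * g S)" by (rule expect_abs_le_nrm)
  also have "\<dots> = \<bar>l\<bar> * nrm (\<lambda>S. f S - g S)" by (simp only: nrm_scale flip: right_diff_distrib)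
  finally show ?thesis
    using norm_expect_le[of "\<lambda>S. iexp (l * f S) - iexp (l * g S)"] by (simp add: expect_diff)
qed

end

text \<open>
  The two estimates for a fixed number of nodes, transferred to the network. The deviation of
  \<open>T\<close> from its mean differs from \<open>U\<close> by at most twice the bound on \<open>T - U\<close>, as the mean of \<open>T\<close>
  is the mean of \<open>T - U\<close>.
\<close>
lemma sgnT_estimates:
  fixes M :: "'a measure" and \<theta> :: "nat \<Rightarrow> real" and m s q :: real
  assumes net: "null_network M n \<theta> A"
    and pos: "\<And>i. i < n \<Longrightarrow> 0 < \<theta> i" and le_m: "\<And>i. i < n \<Longrightarrow> \<theta> i \<le> m" and m: "0 \<le> m" "m \<le> 1"
    and s: "1 \<le> s" "s\<^sup>2 = (\<Sum>i<n. (\<theta> i)\<^sup>2)" and q: "100 \<le> q" "(\<Sum>i<n. \<theta> i) = q ^ 16"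
    and q_large: "q ^ 416 / exp q \<le> 1 / (36\<^sup>2 * (32 * 12 ^ 12 * exp 4))"
  defines "\<mu> \<equiv> \<integral>\<omega>. sgnT n (A \<omega>) \<partial>M" and "v \<equiv> \<integral>\<omega>. (sgnT n (A \<omega>) - (\<integral>\<omega>. sgnT n (A \<omega>) \<partial>M))\<^sup>2 \<partial>M"
  shows "\<bar>\<mu>\<bar> \<le> 2000001 * s\<^sup>2"
    and "\<exists>u\<ge>0. \<bar>u\<^sup>2 - 6 * s ^ 6\<bar> \<le> 372 * (m * s ^ 6) + 36 * s ^ 3 \<and> \<bar>sqrt v - u\<bar> \<le> 4000002 * s\<^sup>2"
    and "cmod ((\<integral>\<omega>. iexp (l * (sgnT n (A \<omega>) - \<mu>)) \<partial>M) - exp (- (6 * s ^ 6 * l\<^sup>2 / 2))) \<le>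
      \<bar>l\<bar> * (4000002 * s\<^sup>2) + (l\<^sup>2 * (372 * (m * s ^ 6) + 36 * s ^ 3) + 360 * (m * s + 1) * s ^ 6 * \<bar>l\<bar> ^ 3)"
proof -
  interpret null_model n \<theta>
    using pos le_m m by unfold_locales (auto intro: order_trans)
  interpret L: large_model n \<theta> q s
    using s q by unfold_locales (simp_all add: power_sum_def)
  interpret R: spread_model n \<theta> m s
    using s m le_m by unfold_locales (simp_all add: power_sum_def)
  note ex = expectation_sgnT[OF net]
  have mu: "\<mu> = expect T" unfolding \<mu>_def using ex[of "\<lambda>x. x"] by simp
  have v: "v = expect (\<lambda>S. (T S - \<mu>)\<^sup>2)" unfolding v_def \<mu>_def[symmetric] using ex[of "\<lambda>x. (x - \<mu>)\<^sup>2"] by simp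
  have TU: "nrm (\<lambda>S. T S - U S) \<le> 2000001 * s\<^sup>2" by (rule L.nrm_T_minus_U[OF q_large])
  have "\<mu> = expect (\<lambda>S. T S - U S)" by (simp add: mu expect_diff R.expect_U)
  then show mu_le: "\<bar>\<mu>\<bar> \<le> 2000001 * s\<^sup>2" using abs_expect_le_nrm[of "\<lambda>S. T S - U S"] TU by simp
  have diff: "nrm (\<lambda>S. (T S - \<mu>) - U S) \<le> 4000002 * s\<^sup>2"
    using nrm_diff[of "\<lambda>S. T S - U S" "\<lambda>_. \<mu>"] TU mu_le by (simp add: algebra_simps)
  have "sqrt v = nrm (\<lambda>S. T S - \<mu>)" by (simp add: v nrm_eq)
  moreover have "nrm (\<lambda>S. T S - \<mu>) \<le> nrm U + nrm (\<lambda>S. (T S - \<mu>) - U S)"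
    using nrm_add[of U "\<lambda>S. (T S - \<mu>) - U S"] by simp
  moreover have "nrm U \<le> nrm (\<lambda>S. T S - \<mu>) + nrm (\<lambda>S. (T S - \<mu>) - U S)"
    using nrm_diff[of "\<lambda>S. T S - \<mu>" "\<lambda>S. (T S - \<mu>) - U S"] by simp
  ultimately have "\<bar>sqrt v - nrm U\<bar> \<le> 4000002 * s\<^sup>2" using diff by linarith
  then show "\<exists>u\<ge>0. \<bar>u\<^sup>2 - 6 * s ^ 6\<bar> \<le> 372 * (m * s ^ 6) + 36 * s ^ 3 \<and> \<bar>sqrt v - u\<bar> \<le> 4000002 * s\<^sup>2"
    using R.variance_U by (intro exI[of _ "nrm U"]) (simp add: nrm_sq)
  have "(\<integral>\<omega>. iexp (l * (sgnT n (A \<omega>) - \<mu>)) \<partial>M) = expect (\<lambda>S. iexp (l * (T S - \<mu>)))"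
    by (rule ex[of "\<lambda>x. iexp (l * (x - \<mu>))"])
  moreover have "cmod (expect (\<lambda>S. iexp (l * (T S - \<mu>))) - expect (\<lambda>S. iexp (l * U S))) \<le> \<bar>l\<bar> * (4000002 * s\<^sup>2)"
    by (rule order_trans[OF expect_iexp_diff_le mult_left_mono[OF diff]]) simp
  moreover have "cmod (a - c) \<le> x + y" if "a = b" "cmod (b - d) \<le> x" "cmod (d - c) \<le> y" for a b c d x y
    using norm_triangle_ineq[of "b - d" "d - c"] that by simp
  ultimately show "cmod ((\<integral>\<omega>. iexp (l * (sgnT n (A \<omega>) - \<mu>)) \<partial>M) - exp (- (6 * s ^ 6 * l\<^sup>2 / 2))) \<le>
      \<bar>l\<bar> * (4000002 * s\<^sup>2) + (l\<^sup>2 * (372 * (m * s ^ 6) + 36 * s ^ 3) + 360 * (m * s + 1) * s ^ 6 * \<bar>l\<bar> ^ 3)"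
    using R.char_U[of l] by blast
qed

section \<open>The limit\<close>

text \<open>
  The number \<open>u\<close> stands for the standard deviation of \<open>U\<close>: it is \<open>sqrt 6 * s ^ 3\<close> to first
  order, and differs from that of \<open>T\<close> by a multiple of \<open>s\<^sup>2\<close>.
\<close>
lemma variance_ratio_limit:
  fixes s m v :: "nat \<Rightarrow> real"
  assumes s: "filterlim s at_top sequentially" and m: "m \<longlonglongrightarrow> 0"
    and near: "\<forall>\<^sub>F n in sequentially. \<exists>u\<ge>0. \<bar>u\<^sup>2 - 6 * s n ^ 6\<bar> \<le> a * (m n * s n ^ 6) + b * s n ^ 3
      \<and> \<bar>sqrt (v n) - u\<bar> \<le> c * (s n)\<^sup>2"
  shows "(\<lambda>n. sqrt (v n) / s n ^ 3) \<longlonglongrightarrow> sqrt 6"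
proof -
  obtain u where u: "\<forall>\<^sub>F n in sequentially. 0 \<le> u n \<and> \<bar>(u n)\<^sup>2 - 6 * s n ^ 6\<bar> \<le> a * (m n * s n ^ 6) + b * s n ^ 3
      \<and> \<bar>sqrt (v n) - u n\<bar> \<le> c * (s n)\<^sup>2"
    using near[unfolded eventually_ex] by auto
  have s0: "\<forall>\<^sub>F n in sequentially. 0 < s n" using s by (simp add: filterlim_at_top_dense)
  have inv: "(\<lambda>n. inverse (s n)) \<longlonglongrightarrow> 0" using s by (rule tendsto_inverse_0_at_top)
  have "(\<lambda>n. (u n)\<^sup>2 / s n ^ 6 - 6) \<longlonglongrightarrow> 0"
  proof (rule Lim_null_comparison)
    show "\<forall>\<^sub>F n in sequentially. norm ((u n)\<^sup>2 / s n ^ 6 - 6) \<le> a * m n + b * inverse (s n) ^ 3"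
      using u s0
    proof eventually_elim
      fix n assume u: "0 \<le> u n \<and> \<bar>(u n)\<^sup>2 - 6 * s n ^ 6\<bar> \<le> a * (m n * s n ^ 6) + b * s n ^ 3
        \<and> \<bar>sqrt (v n) - u n\<bar> \<le> c * (s n)\<^sup>2" and s: "0 < s n"
      have "(u n)\<^sup>2 / s n ^ 6 - 6 = ((u n)\<^sup>2 - 6 * s n ^ 6) / s n ^ 6"
        using s by (simp add: field_simps)
      then have "norm ((u n)\<^sup>2 / s n ^ 6 - 6) = \<bar>(u n)\<^sup>2 - 6 * s n ^ 6\<bar> / s n ^ 6"
        using s by simp
      also have "\<dots> \<le> (a * (m n * s n ^ 6) + b * s n ^ 3) / s n ^ 6"
        using u s by (intro divide_right_mono) auto
      also have "\<dots> = a * m n + b * inverse (s n) ^ 3"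
        using s by (simp add: field_simps eval_nat_numeral)
      finally show "norm ((u n)\<^sup>2 / s n ^ 6 - 6) \<le> a * m n + b * inverse (s n) ^ 3" .
    qed
    show "(\<lambda>n. a * m n + b * inverse (s n) ^ 3) \<longlonglongrightarrow> 0"
    proof -
      have "(\<lambda>n. a * m n + b * r n ^ 3) \<longlonglongrightarrow> a * 0 + b * 0 ^ 3" if "r \<longlonglongrightarrow> 0" for r
        using that m by (intro tendsto_intros)
      from this[OF inv] show ?thesis by simp
    qed
  qed
  then have "(\<lambda>n. sqrt ((u n)\<^sup>2 / s n ^ 6)) \<longlonglongrightarrow> sqrt 6"
    by (intro tendsto_real_sqrt) (simp add: LIM_zero_iff)
  moreover have "\<forall>\<^sub>F n in sequentially. sqrt ((u n)\<^sup>2 / s n ^ 6) = u n / s n ^ 3"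
    using u s0
  proof eventually_elim
    fix n assume "0 \<le> u n \<and> \<bar>(u n)\<^sup>2 - 6 * s n ^ 6\<bar> \<le> a * (m n * s n ^ 6) + b * s n ^ 3
        \<and> \<bar>sqrt (v n) - u n\<bar> \<le> c * (s n)\<^sup>2" and "0 < s n"
    then have "(u n)\<^sup>2 / s n ^ 6 = (u n / s n ^ 3)\<^sup>2" "0 \<le> u n / s n ^ 3"
      by (simp_all add: power_divide flip: power_mult)
    then show "sqrt ((u n)\<^sup>2 / s n ^ 6) = u n / s n ^ 3" by (simp only: real_sqrt_abs abs_of_nonneg)
  qed
  ultimately have ulim: "(\<lambda>n. u n / s n ^ 3) \<longlonglongrightarrow> sqrt 6"
    by (rule Lim_transform_eventually)
  have "(\<lambda>n. sqrt (v n) / s n ^ 3 - u n / s n ^ 3) \<longlonglongrightarrow> 0"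
  proof (rule Lim_null_comparison)
    show "\<forall>\<^sub>F n in sequentially. norm (sqrt (v n) / s n ^ 3 - u n / s n ^ 3) \<le> c * inverse (s n)"
      using u s0
    proof eventually_elim
      fix n assume u: "0 \<le> u n \<and> \<bar>(u n)\<^sup>2 - 6 * s n ^ 6\<bar> \<le> a * (m n * s n ^ 6) + b * s n ^ 3
        \<and> \<bar>sqrt (v n) - u n\<bar> \<le> c * (s n)\<^sup>2" and s: "0 < s n"
      have "norm (sqrt (v n) / s n ^ 3 - u n / s n ^ 3) = \<bar>sqrt (v n) - u n\<bar> / s n ^ 3"
        using s by (simp flip: diff_divide_distrib)
      also have "\<dots> \<le> c * (s n)\<^sup>2 / s n ^ 3" using u s by (intro divide_right_mono) auto
      also have "\<dots> = c * inverse (s n)" using s by (simp add: field_simps eval_nat_numeral)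
      finally show "norm (sqrt (v n) / s n ^ 3 - u n / s n ^ 3) \<le> c * inverse (s n)" .
    qed
    show "(\<lambda>n. c * inverse (s n)) \<longlonglongrightarrow> 0" using tendsto_mult_left[OF inv, of c] by simp
  qed
  from tendsto_add[OF this ulim] show ?thesis by simp
qed

text \<open>
  After rescaling by \<open>\<sigma>\<close>, which is of order \<open>s ^ 3\<close>, every error term contains a factor \<open>1 / s\<close>
  or \<open>m\<close>.
\<close>
lemma characteristic_function_limit:
  fixes s m \<sigma> :: "nat \<Rightarrow> real" and \<phi> :: "nat \<Rightarrow> real \<Rightarrow> complex"
  assumes s: "filterlim s at_top sequentially" and m: "m \<longlonglongrightarrow> 0"
    and ratio: "(\<lambda>n. \<sigma> n / s n ^ 3) \<longlonglongrightarrow> sqrt 6"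
    and near: "\<forall>\<^sub>F n in sequentially. \<forall>l. cmod (\<phi> n l - exp (- (6 * s n ^ 6 * l\<^sup>2 / 2))) \<le>
      \<bar>l\<bar> * (c * (s n)\<^sup>2) + (l\<^sup>2 * (a * (m n * s n ^ 6) + b * s n ^ 3) + d * (m n * s n + 1) * s n ^ 6 * \<bar>l\<bar> ^ 3)"
  shows "(\<lambda>n. \<phi> n (t / \<sigma> n)) \<longlonglongrightarrow> complex_of_real (exp (- t\<^sup>2 / 2))"
proof -
  (* the argument \<open>t / \<sigma> n\<close> in units of \<open>1 / s n ^ 3\<close>; it converges to \<open>t / sqrt 6\<close> *)
  define z where "z n = t * (s n ^ 3 / \<sigma> n)" for n
  have "(\<lambda>n. inverse (\<sigma> n / s n ^ 3)) \<longlonglongrightarrow> inverse (sqrt 6)" using ratio by (rule tendsto_inverse) simp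
  then have z: "z \<longlonglongrightarrow> t * inverse (sqrt 6)" unfolding z_def[abs_def] by (intro tendsto_mult tendsto_const) simp
  have s0: "\<forall>\<^sub>F n in sequentially. 0 < s n" using s by (simp add: filterlim_at_top_dense)
  have inv: "(\<lambda>n. inverse (s n)) \<longlonglongrightarrow> 0" using s by (rule tendsto_inverse_0_at_top)
  let ?g = "\<lambda>n. complex_of_real (exp (- (3 * (z n)\<^sup>2)))"
  have "(\<lambda>n. \<phi> n (t / \<sigma> n) - ?g n) \<longlonglongrightarrow> 0"
  proof (rule Lim_null_comparison)
    let ?b = "\<lambda>n. \<bar>z n\<bar> * (c * inverse (s n)) + ((z n)\<^sup>2 * (a * m n + b * inverse (s n) ^ 3)
        + d * (m n * inverse (s n) ^ 2 + inverse (s n) ^ 3) * \<bar>z n\<bar> ^ 3)"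
    show "\<forall>\<^sub>F n in sequentially. norm (\<phi> n (t / \<sigma> n) - ?g n) \<le> ?b n"
      using near s0
    proof eventually_elim
      fix n assume near: "\<forall>l. cmod (\<phi> n l - exp (- (6 * s n ^ 6 * l\<^sup>2 / 2))) \<le>
          \<bar>l\<bar> * (c * (s n)\<^sup>2) + (l\<^sup>2 * (a * (m n * s n ^ 6) + b * s n ^ 3) + d * (m n * s n + 1) * s n ^ 6 * \<bar>l\<bar> ^ 3)"
        and s: "0 < s n"
      have l: "t / \<sigma> n = z n / s n ^ 3" using s by (simp add: z_def)
      have al: "\<bar>z n / s n ^ 3\<bar> = \<bar>z n\<bar> / s n ^ 3" using s by simp
      have 1: "6 * s n ^ 6 * (z n / s n ^ 3)\<^sup>2 / 2 = 3 * (z n)\<^sup>2"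
        using s by (simp add: power_divide flip: power_mult)
      have 2: "\<bar>z n\<bar> / s n ^ 3 * (c * (s n)\<^sup>2) = \<bar>z n\<bar> * (c * inverse (s n))"
        using s by (simp add: field_simps eval_nat_numeral)
      have 3: "(z n / s n ^ 3)\<^sup>2 * (a * (m n * s n ^ 6) + b * s n ^ 3) = (z n)\<^sup>2 * (a * m n + b * inverse (s n) ^ 3)"
        using s by (simp add: field_simps eval_nat_numeral)
      have 4: "d * (m n * s n + 1) * s n ^ 6 * (\<bar>z n\<bar> / s n ^ 3) ^ 3 = d * (m n * inverse (s n) ^ 2 + inverse (s n) ^ 3) * \<bar>z n\<bar> ^ 3"
        using s by (simp add: field_simps eval_nat_numeral)
      show "norm (\<phi> n (t / \<sigma> n) - ?g n) \<le> ?b n"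
        using near[rule_format, of "z n / s n ^ 3"] unfolding l al 1 2 3 4 .
    qed
    show "?b \<longlonglongrightarrow> 0"
    proof -
      define y where "y = t * inverse (sqrt 6)"
      have "(\<lambda>n. \<bar>z n\<bar> * (c * r n) + ((z n)\<^sup>2 * (a * m n + b * r n ^ 3) + d * (m n * r n ^ 2 + r n ^ 3) * \<bar>z n\<bar> ^ 3))
        \<longlonglongrightarrow> \<bar>y\<bar> * (c * 0) + (y\<^sup>2 * (a * 0 + b * 0 ^ 3) + d * (0 * 0 ^ 2 + 0 ^ 3) * \<bar>y\<bar> ^ 3)" if "r \<longlonglongrightarrow> 0" for r
        using that m z[folded y_def] by (intro tendsto_intros)
      from this[OF inv] show ?thesis by simp
    qed
  qed
  moreover have "?g \<longlonglongrightarrow> complex_of_real (exp (- (3 * (t * inverse (sqrt 6))\<^sup>2)))"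
    using z by (intro tendsto_intros)
  moreover have "3 * (t * inverse (sqrt 6))\<^sup>2 = t\<^sup>2 / 2" by (simp add: power_mult_distrib power_inverse)
  ultimately show ?thesis using tendsto_add[of "\<lambda>n. \<phi> n (t / \<sigma> n) - ?g n" 0 sequentially ?g] by simp
qed

theorem theorem2p1:
  fixes M :: "nat \<Rightarrow> 'a measure"
    and \<theta> :: "nat \<Rightarrow> nat \<Rightarrow> real"
    and A :: "nat \<Rightarrow> 'a \<Rightarrow> nat \<Rightarrow> nat \<Rightarrow> real"
    and T :: "nat \<Rightarrow> 'a \<Rightarrow> real"
    and norm1 norm2 :: "nat \<Rightarrow> real"
  defines "T \<equiv> \<lambda>n \<omega>. sgnT n (A n \<omega>)"
    and "norm1 \<equiv> \<lambda>n. \<Sum>i<n. \<bar>\<theta> n i\<bar>"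
    and "norm2 \<equiv> \<lambda>n. L2_set (\<theta> n) {..<n}"
  assumes theta_pos: "\<And>n i. i < n \<Longrightarrow> 0 < \<theta> n i"
    and network: "\<And>n. null_network (M n) n (\<theta> n) (A n)"
    and norm2_infinity: "filterlim norm2 at_top sequentially"
    and theta_max: "(\<lambda>n. Max (\<theta> n ` {..<n})) \<longlonglongrightarrow> 0"
    and sparsity: "(\<lambda>n. (norm2 n)\<^sup>2 / norm1 n * sqrt (ln (norm1 n))) \<longlonglongrightarrow> 0"
  shows "(\<lambda>n. prob_space.expectation (M n) (T n)) \<in> o(\<lambda>n. norm2 n ^ 3) \<and>
    (\<lambda>n. prob_space.variance (M n) (T n)) \<sim>[sequentially] (\<lambda>n. 6 * norm2 n ^ 6) \<and>
    weak_conv_m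
      (\<lambda>n. distr (M n) borel (\<lambda>\<omega>.
         (T n \<omega> - prob_space.expectation (M n) (T n)) / sqrt (prob_space.variance (M n) (T n))))
      std_normal_distribution"
proof -
  define m where "m n = Max (\<theta> n ` {..<n})" for n
  (* with this choice \<open>q n ^ 16\<close> is the sum of the \<open>\<theta> n i\<close>, as the finite model requires *)
  define q where "q n = root 16 (norm1 n)" for n
  define \<mu> where "\<mu> n = (\<integral>\<omega>. T n \<omega> \<partial>M n)" for n
  define v where "v n = (\<integral>\<omega>. (T n \<omega> - \<mu> n)\<^sup>2 \<partial>M n)" for n
  define \<phi> where "\<phi> n l = (\<integral>\<omega>. iexp (l * (T n \<omega> - \<mu> n)) \<partial>M n)" for n l
  have sq: "(norm2 n)\<^sup>2 = (\<Sum>i<n. (\<theta> n i)\<^sup>2)" for n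
    by (simp add: norm2_def L2_set_def sum_nonneg)
  have m_lim: "m \<longlonglongrightarrow> 0" using theta_max unfolding m_def .
  have le_m: "\<theta> n i \<le> m n" if "i < n" for n i using that by (simp add: m_def)
  have m_nonneg: "0 \<le> m n" if "0 < n" for n
    using le_m[OF that] theta_pos[OF that] by linarith
  have ev_m: "\<forall>\<^sub>F n in sequentially. m n \<le> 1"
    using order_tendstoD(2)[OF m_lim, of 1] by (auto elim: eventually_mono)
  (* for \<open>\<theta> \<le> 1\<close> the sum of the entries dominates the sum of their squares *)
  have norm1_infinity: "filterlim norm1 at_top sequentially"
  proof (rule filterlim_at_top_mono)
    show "filterlim (\<lambda>n. (norm2 n)\<^sup>2) at_top sequentially"
      using norm2_infinity by (intro filterlim_pow_at_top) auto
    show "\<forall>\<^sub>F n in sequentially. (norm2 n)\<^sup>2 \<le> norm1 n"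
      using ev_m
    proof eventually_elim
      fix n assume m: "m n \<le> 1"
      have "(\<theta> n i)\<^sup>2 \<le> \<bar>\<theta> n i\<bar>" if "i < n" for i
        using theta_pos[OF that] le_m[OF that] m by (simp add: power2_eq_square mult_left_le)
      then show "(norm2 n)\<^sup>2 \<le> norm1 n" unfolding sq norm1_def by (intro sum_mono) auto
    qed
  qed
  have q_infinity: "filterlim q at_top sequentially"
    unfolding q_def by (rule filterlim_compose[OF _ norm1_infinity]) real_asymp
  have "(\<lambda>n. q n ^ 416 / exp (q n)) \<longlonglongrightarrow> 0"
    by (rule filterlim_compose[OF tendsto_power_div_exp_0 q_infinity])
  then have ev_exp: "\<forall>\<^sub>F n in sequentially. q n ^ 416 / exp (q n) < 1 / (36\<^sup>2 * (32 * 12 ^ 12 * exp 4))"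
    by (rule order_tendstoD) simp
  have estimates: "\<forall>\<^sub>F n in sequentially. \<bar>\<mu> n\<bar> \<le> 2000001 * (norm2 n)\<^sup>2
    \<and> (\<exists>u\<ge>0. \<bar>u\<^sup>2 - 6 * norm2 n ^ 6\<bar> \<le> 372 * (m n * norm2 n ^ 6) + 36 * norm2 n ^ 3 \<and> \<bar>sqrt (v n) - u\<bar> \<le> 4000002 * (norm2 n)\<^sup>2)
    \<and> (\<forall>l. cmod (\<phi> n l - exp (- (6 * norm2 n ^ 6 * l\<^sup>2 / 2))) \<le> \<bar>l\<bar> * (4000002 * (norm2 n)\<^sup>2)
        + (l\<^sup>2 * (372 * (m n * norm2 n ^ 6) + 36 * norm2 n ^ 3) + 360 * (m n * norm2 n + 1) * norm2 n ^ 6 * \<bar>l\<bar> ^ 3))"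
    using ev_m ev_exp filterlim_at_top[THEN iffD1, OF norm2_infinity, rule_format, of 1]
      filterlim_at_top[THEN iffD1, OF q_infinity, rule_format, of 100] eventually_gt_at_top[of 0]
  proof eventually_elim
    fix n
    assume ass: "m n \<le> 1" "q n ^ 416 / exp (q n) < 1 / (36\<^sup>2 * (32 * 12 ^ 12 * exp 4))"
      "1 \<le> norm2 n" "100 \<le> q n" "0 < n"
    have abs: "\<bar>\<theta> n i\<bar> = \<theta> n i" if "i < n" for i using theta_pos[OF that] by simp
    have q16: "(\<Sum>i<n. \<theta> n i) = q n ^ 16"
    proof -
      have "norm1 n = (\<Sum>i<n. \<theta> n i)" unfolding norm1_def by (intro sum.cong) (auto simp: abs)
      moreover have "0 \<le> norm1 n" unfolding norm1_def by (intro sum_nonneg) simp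
      ultimately show ?thesis by (simp add: q_def)
    qed
    note est = sgnT_estimates[OF network theta_pos le_m m_nonneg[OF ass(5)] ass(1) ass(3) sq ass(4) q16 less_imp_le[OF ass(2)]]
    show "\<bar>\<mu> n\<bar> \<le> 2000001 * (norm2 n)\<^sup>2
    \<and> (\<exists>u\<ge>0. \<bar>u\<^sup>2 - 6 * norm2 n ^ 6\<bar> \<le> 372 * (m n * norm2 n ^ 6) + 36 * norm2 n ^ 3 \<and> \<bar>sqrt (v n) - u\<bar> \<le> 4000002 * (norm2 n)\<^sup>2)
    \<and> (\<forall>l. cmod (\<phi> n l - exp (- (6 * norm2 n ^ 6 * l\<^sup>2 / 2))) \<le> \<bar>l\<bar> * (4000002 * (norm2 n)\<^sup>2)
        + (l\<^sup>2 * (372 * (m n * norm2 n ^ 6) + 36 * norm2 n ^ 3) + 360 * (m n * norm2 n + 1) * norm2 n ^ 6 * \<bar>l\<bar> ^ 3))"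
      unfolding \<mu>_def v_def \<phi>_def T_def by (intro conjI allI est)
  qed
  have ratio: "(\<lambda>n. sqrt (v n) / norm2 n ^ 3) \<longlonglongrightarrow> sqrt 6"
    by (rule variance_ratio_limit[OF norm2_infinity m_lim]) (use estimates in \<open>auto elim: eventually_mono\<close>)
  have "\<mu> \<in> O(\<lambda>n. (norm2 n)\<^sup>2)"
    by (rule bigoI[of _ 2000001]) (use estimates in \<open>auto elim: eventually_mono\<close>)
  moreover have "(\<lambda>n. (norm2 n)\<^sup>2) \<in> o(\<lambda>n. norm2 n ^ 3)"
  proof -
    have "(\<lambda>x :: real. x\<^sup>2) \<in> o(\<lambda>x. x ^ 3)" by real_asymp
    from landau_o.small.compose[OF this norm2_infinity] show ?thesis .
  qed
  ultimately have mean: "\<mu> \<in> o(\<lambda>n. norm2 n ^ 3)" by (rule landau_o.big_small_trans)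
  have v_nonneg: "0 \<le> v n" for n unfolding v_def by simp
  have "(\<lambda>n. (sqrt (v n) / norm2 n ^ 3)\<^sup>2 / 6) \<longlonglongrightarrow> (sqrt 6)\<^sup>2 / 6"
    using ratio by (intro tendsto_intros) auto
  then have "(\<lambda>n. v n / (6 * norm2 n ^ 6)) \<longlonglongrightarrow> 1"
    using v_nonneg by (simp add: power_divide mult.commute flip: power_mult)
  then have var: "v \<sim>[sequentially] (\<lambda>n. 6 * norm2 n ^ 6)" by (rule asymp_equivI')
  have "weak_conv_m (\<lambda>n. distr (M n) borel (\<lambda>\<omega>. (T n \<omega> - \<mu> n) / sqrt (v n))) std_normal_distribution"
  proof (rule levy_continuity)
    fix n
    interpret prob_space "M n" using network[of n] by (simp add: null_network_def)
    have [measurable]: "T n \<in> borel_measurable (M n)"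
      unfolding T_def by (rule sgnT_measurable[OF network])
    show "real_distribution (distr (M n) borel (\<lambda>\<omega>. (T n \<omega> - \<mu> n) / sqrt (v n)))"
      by (rule real_distribution_distr) measurable
  next
    show "real_distribution std_normal_distribution" by (rule real_dist_normal_dist)
  next
    fix t
    have "char (distr (M n) borel (\<lambda>\<omega>. (T n \<omega> - \<mu> n) / sqrt (v n))) t = \<phi> n (t / sqrt (v n))" for n
    proof -
      have [measurable]: "T n \<in> borel_measurable (M n)"
        unfolding T_def by (rule sgnT_measurable[OF network])
      have "(\<lambda>\<omega>. (T n \<omega> - \<mu> n) / sqrt (v n)) \<in> borel_measurable (M n)" by measurable
      moreover have "(\<lambda>x. iexp (t * x)) \<in> borel_measurable borel" by measurable
      ultimately show ?thesis unfolding char_def \<phi>_def by (simp add: integral_distr)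
    qed
    moreover have "(\<lambda>n. \<phi> n (t / sqrt (v n))) \<longlonglongrightarrow> complex_of_real (exp (- t\<^sup>2 / 2))"
      by (rule characteristic_function_limit[OF norm2_infinity m_lim ratio
            estimates[unfolded eventually_conj_iff, THEN conjunct2, THEN conjunct2]])
    ultimately show "(\<lambda>n. char (distr (M n) borel (\<lambda>\<omega>. (T n \<omega> - \<mu> n) / sqrt (v n))) t) \<longlonglongrightarrow> char std_normal_distribution t"
      by (simp add: char_std_normal_distribution)
  qed
  then show ?thesis using mean var by (simp add: \<mu>_def[abs_def] v_def[abs_def])
qed

end
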